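(* Let $\mathcal{I}$ and $\mathcal{I}'$ be intervals in a topos $\mathcal{E}$ and let $\mathcal{W}_{\mathcal{I}}$, respectively $\mathcal{W}_{\mathcal{I}'}$, be the classes of weak equivalences in the induced model structures on $\mathcal{E}$. Suppose $\iota:\mathcal{I}\to\mathcal{I}'$ is a morphism of intervals. Then $$\mathcal{W}_{\mathcal{I}'}\subseteq\mathcal{W}_{\mathcal{I}}$$ if $\iota$ is a section-wise $\mathcal{I}$-weak equivalence, and $$\mathcal{W}_{\mathcal{I}}\subseteq\mathcal{W}_{\mathcal{I}'}$$ if $\iota$ is a section-wise $\mathcal{I}'$-weak equivalence.
   Context: $\mathcal{E}$ is a (Grothendieck) topos, and $\mathfrak{M}$ is a fixed cellular model of it: a set of monos such that $\mathfrak{M}\text{-cof}$ is the class of all monos. Here, for a class $M$ of morphisms, $M\text{-inj}$ is the class of morphisms with the right lifting property with respect to $M$, and $M\text{-cof}$ is the class of morphisms with the left lifting property with respect to $M\text{-inj}$. A cylinder $\mathcal{I}=(I,\partial^0,\partial^1,\sigma)$ on $\mathcal{E}$ consists of an endofunctor $I:\mathcal{E}\to\mathcal{E}$ and natural transformations $\partial^0,\partial^1:\mathrm{id}\Rightarrow I$, $\sigma:I\Rightarrow\mathrm{id}$ with $\sigma\circ\partial^0=\sigma\circ\partial^1=\mathrm{id}$. It is cartesian if for every mono $j:A\to B$ and $e\in\{0,1\}$ the naturality square $\partial^e_B\circ j=I(j)\circ\partial^e_A$ is a pullback. An interval is a cartesian cylinder such that $I$ preserves monos and colimits and $[\partial^0_C,\partial^1_C]:C+C\to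 I(C)$ is mono for every object $C$. A morphism of intervals $\iota:\mathcal{I}\to\mathcal{I}'$ is a natural transformation $\iota:I\to I'$ with $\iota\circ\partial^e_{\mathcal{I}}=\partial^e_{\mathcal{I}'}$ ($e\in\{0,1\}$) and $\sigma_{\mathcal{I}}=\sigma_{\mathcal{I}'}\circ\iota$. Morphisms $f_0,f_1:X\to Y$ are $\mathcal{I}$-homotopic if there is $h:I(X)\to Y$ with $h\circ\partial^e_X=f_e$ for $e\in\{0,1\}$. Write $\vee$ for the union of subobjects, and for a set $S$ of monos put $\mathrm{sat}(S)=\{I(l)\vee[\partial^0_{\mathrm{cod}(l)},\partial^1_{\mathrm{cod}(l)}]\mid l\in S\}$. Set $\Lambda^0_{\mathcal{I}}=\{I(m)\vee\partial^e_{\mathrm{cod}(m)}\mid m\in\mathfrak{M},e\in\{0,1\}\}$, $\Lambda^{n+1}_{\mathcal{I}}=\mathrm{sat}(\Lambda^n_{\mathcal{I}})$, $\Lambda_{\mathcal{I}}=\bigcup_{n\ge0}\Lambda^n_{\mathcal{I}}$. An object $T$ is $\mathcal{I}$-naively fibrant if $T\to 1$ lies in $\Lambda_{\mathcal{I}}\text{-inj}$; for such $T$, $\mathcal{I}$-homotopy is an equivalence relation on $\mathcal{E}(X,T)$ (Cisinski). The $\mathcal{I}$-model structure on $\mathcal{E}$ (Cisinski) is the cofibrantly generated model structure whose cofibrations are the monos and whose weak equivalences (the $\mathcal{I}$-weak equivalences, forming the class $\mathcal{W}_{\mathcal{I}}$) are the morphisms $f:X\to Y$ inducing a bijection $f^*:\mathcal{E}(Y,T)/_{\sim}\to\mathcal{E}(X,T)/_{\sim}$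 on $\mathcal{I}$-homotopy classes for all $\mathcal{I}$-naively fibrant $T$. A morphism of intervals is a section-wise $\mathcal{I}$-weak (resp. $\mathcal{I}'$-weak) equivalence if each component $\iota_X:I(X)\to I'(X)$ is in $\mathcal{W}_{\mathcal{I}}$ (resp. $\mathcal{W}_{\mathcal{I}'}$). *)

theory Defs
  imports "HOL-Library.FuncSet" "HOL-Library.Equipollence"
begin

section \<open>Universes and smallness\<close>

text \<open>
  The type \<open>'u\<close> plays the role of a Grothendieck universe: a set is small if it has strictly
  fewer elements than \<open>'u\<close>, and the cardinal of \<open>'u\<close> is required to be an infinite
  regular strong limit.  Large categories (such as toposes) live on arbitrary types.
  Uncountability is not imposed, so a countable \<open>'u\<close> (small = finite) is also admitted; for
  uncountable \<open>'u\<close> this is the usual notion based on a strongly inaccessible cardinal.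
\<close>

definition small :: "'u itself \<Rightarrow> 'b set \<Rightarrow> bool" where
  "small U A \<longleftrightarrow> A \<prec> (UNIV :: 'u set)"

definition universe :: "'u itself \<Rightarrow> bool" where
  "universe U \<longleftrightarrow>
     infinite (UNIV :: 'u set) \<and>
     (\<forall>A :: 'u set. small U A \<longrightarrow> small U (Pow A)) \<and>
     (\<forall>(A :: 'u set) (F :: 'u \<Rightarrow> 'u set).
        small U A \<longrightarrow> (\<forall>a\<in>A. small U (F a)) \<longrightarrow> small U (\<Union>a\<in>A. F a))"


section \<open>Categories, functors, natural transformations\<close>

record ('o, 'a) cat =
  Obj :: "'o set"
  Arr :: "'a set"
  Dom :: "'a \<Rightarrow> 'o"
  Cod :: "'a \<Rightarrow> 'o"
  Ide :: "'o \<Rightarrow> 'a"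
  Comp :: "'a \<Rightarrow> 'a \<Rightarrow> 'a"  (infixl "\<cdot>\<index>" 70)

definition Hom :: "('o, 'a) cat \<Rightarrow> 'o \<Rightarrow> 'o \<Rightarrow> 'a set" where
  "Hom C X Y = {f \<in> Arr C. Dom C f = X \<and> Cod C f = Y}"

locale category =
  fixes C :: "('o, 'a) cat" (structure)
  assumes Dom_in_Obj: "f \<in> Arr C \<Longrightarrow> Dom C f \<in> Obj C"
    and Cod_in_Obj: "f \<in> Arr C \<Longrightarrow> Cod C f \<in> Obj C"
    and Ide_in_Hom: "X \<in> Obj C \<Longrightarrow> Ide C X \<in> Hom C X X"
    and Comp_in_Hom: "\<lbrakk>f \<in> Hom C X Y; g \<in> Hom C Y Z\<rbrakk> \<Longrightarrow> g \<cdot> f \<in> Hom C X Z"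
    and Comp_Ide: "f \<in> Hom C X Y \<Longrightarrow> f \<cdot> Ide C X = f"
    and Ide_Comp: "f \<in> Hom C X Y \<Longrightarrow> Ide C Y \<cdot> f = f"
    and Comp_assoc: "\<lbrakk>f \<in> Hom C X Y; g \<in> Hom C Y Z; h \<in> Hom C Z W\<rbrakk> \<Longrightarrow>
          h \<cdot> (g \<cdot> f) = (h \<cdot> g) \<cdot> f"

definition small_category :: "'u itself \<Rightarrow> ('o, 'a) cat \<Rightarrow> bool" where
  "small_category U C \<longleftrightarrow> category C \<and> small U (Obj C) \<and> small U (Arr C)"

definition op_cat :: "('o, 'a) cat \<Rightarrow> ('o, 'a) cat" where
  "op_cat C = \<lparr>Obj = Obj C, Arr = Arr C, Dom = Cod C, Cod = Dom C, Ide = Ide C,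
     Comp = (\<lambda>g f. f \<cdot>\<^bsub>C\<^esub> g)\<rparr>"

definition full_subcat :: "('o, 'a) cat \<Rightarrow> 'o set \<Rightarrow> ('o, 'a) cat" where
  "full_subcat C S = C\<lparr>Obj := Obj C \<inter> S, Arr := {f \<in> Arr C. Dom C f \<in> S \<and> Cod C f \<in> S}\<rparr>"

record ('o, 'a, 'p, 'b) fctr =
  OMap :: "'o \<Rightarrow> 'p"
  AMap :: "'a \<Rightarrow> 'b"

definition is_functor :: "('o, 'a) cat \<Rightarrow> ('p, 'b) cat \<Rightarrow> ('o, 'a, 'p, 'b) fctr \<Rightarrow> bool" where
  "is_functor C D F \<longleftrightarrow>
     (\<forall>X \<in> Obj C. OMap F X \<in> Obj D) \<and>
     (\<forall>f \<in> Arr C. AMap F f \<in> Hom D (OMap F (Dom C f)) (OMap F (Cod C f))) \<and>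
     (\<forall>X \<in> Obj C. AMap F (Ide C X) = Ide D (OMap F X)) \<and>
     (\<forall>f \<in> Arr C. \<forall>g \<in> Arr C. Cod C f = Dom C g \<longrightarrow>
        AMap F (g \<cdot>\<^bsub>C\<^esub> f) = AMap F g \<cdot>\<^bsub>D\<^esub> AMap F f)"

definition id_fctr :: "('o, 'a, 'o, 'a) fctr" where
  "id_fctr = \<lparr>OMap = (\<lambda>X. X), AMap = (\<lambda>f. f)\<rparr>"

definition comp_fctr ::
  "('p, 'b, 'q, 'c) fctr \<Rightarrow> ('o, 'a, 'p, 'b) fctr \<Rightarrow> ('o, 'a, 'q, 'c) fctr" where
  "comp_fctr G F = \<lparr>OMap = OMap G \<circ> OMap F, AMap = AMap G \<circ> AMap F\<rparr>"

definition nat_trans ::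
  "('o, 'a) cat \<Rightarrow> ('p, 'b) cat \<Rightarrow> ('o, 'a, 'p, 'b) fctr \<Rightarrow> ('o, 'a, 'p, 'b) fctr \<Rightarrow>
   ('o \<Rightarrow> 'b) \<Rightarrow> bool" where
  "nat_trans C D F G t \<longleftrightarrow>
     (\<forall>X \<in> Obj C. t X \<in> Hom D (OMap F X) (OMap G X)) \<and>
     (\<forall>f \<in> Arr C. t (Cod C f) \<cdot>\<^bsub>D\<^esub> AMap F f = AMap G f \<cdot>\<^bsub>D\<^esub> t (Dom C f))"

definition is_iso :: "('o, 'a) cat \<Rightarrow> 'a \<Rightarrow> bool" where
  "is_iso C f \<longleftrightarrow> f \<in> Arr C \<and>
     (\<exists>g \<in> Hom C (Cod C f) (Dom C f).
        g \<cdot>\<^bsub>C\<^esub> f = Ide C (Dom C f) \<and> f \<cdot>\<^bsub>C\<^esub> g = Ide C (Cod C f))"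

definition nat_iso ::
  "('o, 'a) cat \<Rightarrow> ('p, 'b) cat \<Rightarrow> ('o, 'a, 'p, 'b) fctr \<Rightarrow> ('o, 'a, 'p, 'b) fctr \<Rightarrow>
   ('o \<Rightarrow> 'b) \<Rightarrow> bool" where
  "nat_iso C D F G t \<longleftrightarrow> nat_trans C D F G t \<and> (\<forall>X \<in> Obj C. is_iso D (t X))"

definition equivalent_categories :: "('o, 'a) cat \<Rightarrow> ('p, 'b) cat \<Rightarrow> bool" where
  "equivalent_categories C D \<longleftrightarrow>
     (\<exists>F G \<eta> \<epsilon>. is_functor C D F \<and> is_functor D C G \<and>
        nat_iso C C id_fctr (comp_fctr G F) \<eta> \<and>
        nat_iso D D (comp_fctr F G) id_fctr \<epsilon>)"

text \<open>
  The data of a functor and of a natural transformation are taken to be extensional here, so that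
  equality of objects and of arrows of the functor category is the intended one.
\<close>

definition fun_cat ::
  "('o, 'a) cat \<Rightarrow> ('p, 'b) cat \<Rightarrow>
   (('o, 'a, 'p, 'b) fctr,
    ('o, 'a, 'p, 'b) fctr \<times> ('o, 'a, 'p, 'b) fctr \<times> ('o \<Rightarrow> 'b)) cat" where
  "fun_cat C D =
     (let Fs = {F. is_functor C D F \<and> OMap F \<in> extensional (Obj C) \<and> AMap F \<in> extensional (Arr C)}
      in \<lparr>Obj = Fs,
          Arr = {(F, G, t). F \<in> Fs \<and> G \<in> Fs \<and> nat_trans C D F G t \<and> t \<in> extensional (Obj C)},
          Dom = (\<lambda>(F, G, t). F),
          Cod = (\<lambda>(F, G, t). G),
          Ide = (\<lambda>F. (F, F, restrict (\<lambda>X. Ide D (OMap F X)) (Obj C))),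
          Comp = (\<lambda>(G', H, s) (F, G, t). (F, H, restrict (\<lambda>X. s X \<cdot>\<^bsub>D\<^esub> t X) (Obj C)))\<rparr>)"

text \<open>The category of small sets (represented by small subsets of \<open>'u\<close>) and functions.\<close>

definition set_cat :: "'u itself \<Rightarrow> ('u set, 'u set \<times> 'u set \<times> ('u \<Rightarrow> 'u)) cat" where
  "set_cat U =
     \<lparr>Obj = {A. small U A},
      Arr = {(A, B, f). small U A \<and> small U B \<and> f \<in> A \<rightarrow>\<^sub>E B},
      Dom = (\<lambda>(A, B, f). A),
      Cod = (\<lambda>(A, B, f). B),
      Ide = (\<lambda>A. (A, A, restrict (\<lambda>x. x) A)),
      Comp = (\<lambda>(B', D, g) (A, B, f). (A, D, compose A g f))\<rparr>"


section \<open>Sites, sheaves, Grothendieck toposes\<close>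

definition is_sieve :: "('o, 'a) cat \<Rightarrow> 'o \<Rightarrow> 'a set \<Rightarrow> bool" where
  "is_sieve C c S \<longleftrightarrow>
     (\<forall>f \<in> S. f \<in> Arr C \<and> Cod C f = c) \<and>
     (\<forall>f \<in> S. \<forall>g \<in> Arr C. Cod C g = Dom C f \<longrightarrow> f \<cdot>\<^bsub>C\<^esub> g \<in> S)"

definition pullback_sieve :: "('o, 'a) cat \<Rightarrow> 'a \<Rightarrow> 'a set \<Rightarrow> 'a set" where
  "pullback_sieve C f S = {g \<in> Arr C. Cod C g = Dom C f \<and> f \<cdot>\<^bsub>C\<^esub> g \<in> S}"

definition grothendieck_topology :: "('o, 'a) cat \<Rightarrow> ('o \<Rightarrow> 'a set set) \<Rightarrow> bool" where
  "grothendieck_topology C J \<longleftrightarrow>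
     (\<forall>c \<in> Obj C. \<forall>S \<in> J c. is_sieve C c S) \<and>
     (\<forall>c \<in> Obj C. {f \<in> Arr C. Cod C f = c} \<in> J c) \<and>
     (\<forall>f \<in> Arr C. \<forall>S \<in> J (Cod C f). pullback_sieve C f S \<in> J (Dom C f)) \<and>
     (\<forall>c \<in> Obj C. \<forall>S \<in> J c. \<forall>R. is_sieve C c R \<longrightarrow>
        (\<forall>f \<in> S. pullback_sieve C f R \<in> J (Dom C f)) \<longrightarrow> R \<in> J c)"

definition presheaf_cat ::
  "'u itself \<Rightarrow> ('o, 'a) cat \<Rightarrow>
   (('o, 'a, 'u set, 'u set \<times> 'u set \<times> ('u \<Rightarrow> 'u)) fctr,
    ('o, 'a, 'u set, 'u set \<times> 'u set \<times> ('u \<Rightarrow> 'u)) fctr \<times>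
    ('o, 'a, 'u set, 'u set \<times> 'u set \<times> ('u \<Rightarrow> 'u)) fctr \<times>
    ('o \<Rightarrow> 'u set \<times> 'u set \<times> ('u \<Rightarrow> 'u))) cat" where
  "presheaf_cat U C = fun_cat (op_cat C) (set_cat U)"

definition restr ::
  "('o, 'a, 'u set, 'u set \<times> 'u set \<times> ('u \<Rightarrow> 'u)) fctr \<Rightarrow> 'a \<Rightarrow> 'u \<Rightarrow> 'u" where
  "restr F f = snd (snd (AMap F f))"

definition matching_family ::
  "('o, 'a) cat \<Rightarrow> ('o, 'a, 'u set, 'u set \<times> 'u set \<times> ('u \<Rightarrow> 'u)) fctr \<Rightarrow> 'a set \<Rightarrow>
   ('a \<Rightarrow> 'u) \<Rightarrow> bool" where
  "matching_family C F S x \<longleftrightarrow>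
     (\<forall>f \<in> S. x f \<in> OMap F (Dom C f)) \<and>
     (\<forall>f \<in> S. \<forall>g \<in> Arr C. Cod C g = Dom C f \<longrightarrow> x (f \<cdot>\<^bsub>C\<^esub> g) = restr F g (x f))"

definition is_sheaf ::
  "('o, 'a) cat \<Rightarrow> ('o \<Rightarrow> 'a set set) \<Rightarrow>
   ('o, 'a, 'u set, 'u set \<times> 'u set \<times> ('u \<Rightarrow> 'u)) fctr \<Rightarrow> bool" where
  "is_sheaf C J F \<longleftrightarrow>
     (\<forall>c \<in> Obj C. \<forall>S \<in> J c. \<forall>x. matching_family C F S x \<longrightarrow>
        (\<exists>!y. y \<in> OMap F c \<and> (\<forall>f \<in> S. restr F f y = x f)))"

definition sheaf_cat ::
  "'u itself \<Rightarrow> ('o, 'a) cat \<Rightarrow> ('o \<Rightarrow> 'a set set) \<Rightarrow>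
   (('o, 'a, 'u set, 'u set \<times> 'u set \<times> ('u \<Rightarrow> 'u)) fctr,
    ('o, 'a, 'u set, 'u set \<times> 'u set \<times> ('u \<Rightarrow> 'u)) fctr \<times>
    ('o, 'a, 'u set, 'u set \<times> 'u set \<times> ('u \<Rightarrow> 'u)) fctr \<times>
    ('o \<Rightarrow> 'u set \<times> 'u set \<times> ('u \<Rightarrow> 'u))) cat" where
  "sheaf_cat U C J = full_subcat (presheaf_cat U C) {F. is_sheaf C J F}"

text \<open>
  Taking the objects and arrows of the site in \<open>'u\<close> is no restriction: every small set is in
  bijection with a subset of \<open>'u\<close>.
\<close>

definition grothendieck_topos :: "'u itself \<Rightarrow> ('o, 'a) cat \<Rightarrow> bool" where
  "grothendieck_topos U E \<longleftrightarrow>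
     category E \<and>
     (\<exists>(C :: ('u, 'u) cat) J. small_category U C \<and> grothendieck_topology C J \<and>
        equivalent_categories E (sheaf_cat U C J))"


section \<open>Universal constructions\<close>

definition is_mono :: "('o, 'a) cat \<Rightarrow> 'a \<Rightarrow> bool" where
  "is_mono C m \<longleftrightarrow> m \<in> Arr C \<and>
     (\<forall>f \<in> Arr C. \<forall>g \<in> Arr C. Dom C f = Dom C g \<longrightarrow> Cod C f = Dom C m \<longrightarrow> Cod C g = Dom C m \<longrightarrow>
        m \<cdot>\<^bsub>C\<^esub> f = m \<cdot>\<^bsub>C\<^esub> g \<longrightarrow> f = g)"

definition is_terminal :: "('o, 'a) cat \<Rightarrow> 'o \<Rightarrow> bool" where
  "is_terminal C T \<longleftrightarrow> T \<in> Obj C \<and> (\<forall>X \<in> Obj C. \<exists>!f. f \<in> Hom C X T)"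

text \<open>\<open>p\<close>, \<open>q\<close> are the projections of a pullback of the cospan \<open>f\<close>, \<open>g\<close>.\<close>

definition is_pullback :: "('o, 'a) cat \<Rightarrow> 'a \<Rightarrow> 'a \<Rightarrow> 'a \<Rightarrow> 'a \<Rightarrow> bool" where
  "is_pullback C f g p q \<longleftrightarrow>
     f \<in> Arr C \<and> g \<in> Arr C \<and> Cod C f = Cod C g \<and>
     p \<in> Arr C \<and> q \<in> Arr C \<and> Dom C p = Dom C q \<and>
     Cod C p = Dom C f \<and> Cod C q = Dom C g \<and> f \<cdot>\<^bsub>C\<^esub> p = g \<cdot>\<^bsub>C\<^esub> q \<and>
     (\<forall>u \<in> Arr C. \<forall>v \<in> Arr C.
        Dom C u = Dom C v \<longrightarrow> Cod C u = Dom C f \<longrightarrow> Cod C v = Dom C g \<longrightarrow>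
        f \<cdot>\<^bsub>C\<^esub> u = g \<cdot>\<^bsub>C\<^esub> v \<longrightarrow>
        (\<exists>!w. w \<in> Hom C (Dom C u) (Dom C p) \<and> p \<cdot>\<^bsub>C\<^esub> w = u \<and> q \<cdot>\<^bsub>C\<^esub> w = v))"

definition is_cocone ::
  "('o, 'a) cat \<Rightarrow> ('j, 'k) cat \<Rightarrow> ('j, 'k, 'o, 'a) fctr \<Rightarrow> 'o \<Rightarrow> ('j \<Rightarrow> 'a) \<Rightarrow> bool" where
  "is_cocone C J D X k \<longleftrightarrow>
     X \<in> Obj C \<and>
     (\<forall>j \<in> Obj J. k j \<in> Hom C (OMap D j) X) \<and>
     (\<forall>f \<in> Arr J. k (Cod J f) \<cdot>\<^bsub>C\<^esub> AMap D f = k (Dom J f))"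

definition is_colimit ::
  "('o, 'a) cat \<Rightarrow> ('j, 'k) cat \<Rightarrow> ('j, 'k, 'o, 'a) fctr \<Rightarrow> 'o \<Rightarrow> ('j \<Rightarrow> 'a) \<Rightarrow> bool" where
  "is_colimit C J D X k \<longleftrightarrow>
     is_cocone C J D X k \<and>
     (\<forall>Y l. is_cocone C J D Y l \<longrightarrow>
        (\<exists>!w. w \<in> Hom C X Y \<and> (\<forall>j \<in> Obj J. w \<cdot>\<^bsub>C\<^esub> k j = l j)))"

definition preserves_colimits ::
  "'u itself \<Rightarrow> ('o, 'a) cat \<Rightarrow> ('p, 'b) cat \<Rightarrow> ('o, 'a, 'p, 'b) fctr \<Rightarrow> bool" where
  "preserves_colimits U C C' F \<longleftrightarrow>
     (\<forall>(J :: ('u, 'u) cat) D X k.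
        small_category U J \<longrightarrow> is_functor J C D \<longrightarrow> is_colimit C J D X k \<longrightarrow>
        is_colimit C' J (comp_fctr F D) (OMap F X) (\<lambda>j. AMap F (k j)))"

definition preserves_monos ::
  "('o, 'a) cat \<Rightarrow> ('p, 'b) cat \<Rightarrow> ('o, 'a, 'p, 'b) fctr \<Rightarrow> bool" where
  "preserves_monos C D F \<longleftrightarrow> (\<forall>m. is_mono C m \<longrightarrow> is_mono D (AMap F m))"

definition is_coproduct :: "('o, 'a) cat \<Rightarrow> 'a \<Rightarrow> 'a \<Rightarrow> bool" where
  "is_coproduct C i j \<longleftrightarrow>
     i \<in> Arr C \<and> j \<in> Arr C \<and> Cod C i = Cod C j \<and>
     (\<forall>f \<in> Arr C. \<forall>g \<in> Arr C.
        Dom C f = Dom C i \<longrightarrow> Dom C g = Dom C j \<longrightarrow> Cod C f = Cod C g \<longrightarrow>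
        (\<exists>!w. w \<in> Hom C (Cod C i) (Cod C f) \<and> w \<cdot>\<^bsub>C\<^esub> i = f \<and> w \<cdot>\<^bsub>C\<^esub> j = g))"

text \<open>
  Copairings and unions are determined only up to isomorphism (of the chosen coproduct,
  respectively of the representing mono), so they are rendered as relations that hold of every
  representative: \<open>k\<close> is a copairing \<open>[f, g]\<close>, and \<open>u\<close> represents the
  union \<open>f \<or> g\<close> in the preorder of subobjects of the common codomain of the monos
  \<open>f\<close> and \<open>g\<close>.
\<close>

definition is_copairing :: "('o, 'a) cat \<Rightarrow> 'a \<Rightarrow> 'a \<Rightarrow> 'a \<Rightarrow> bool" where
  "is_copairing C f g k \<longleftrightarrow>
     k \<in> Arr C \<and>
     (\<exists>i j. is_coproduct C i j \<and> Dom C k = Cod C i \<and> Dom C i = Dom C f \<and> Dom C j = Dom C g \<and>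
        k \<cdot>\<^bsub>C\<^esub> i = f \<and> k \<cdot>\<^bsub>C\<^esub> j = g)"

definition subobj_le :: "('o, 'a) cat \<Rightarrow> 'a \<Rightarrow> 'a \<Rightarrow> bool" where
  "subobj_le C m n \<longleftrightarrow> Cod C m = Cod C n \<and> (\<exists>w \<in> Hom C (Dom C m) (Dom C n). n \<cdot>\<^bsub>C\<^esub> w = m)"

definition is_union :: "('o, 'a) cat \<Rightarrow> 'a \<Rightarrow> 'a \<Rightarrow> 'a \<Rightarrow> bool" where
  "is_union C f g u \<longleftrightarrow>
     is_mono C f \<and> is_mono C g \<and> is_mono C u \<and>
     subobj_le C f u \<and> subobj_le C g u \<and>
     (\<forall>v. is_mono C v \<longrightarrow> subobj_le C f v \<longrightarrow> subobj_le C g v \<longrightarrow> subobj_le C u v)"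


section \<open>Lifting properties and cellular models\<close>

definition has_lifting :: "('o, 'a) cat \<Rightarrow> 'a \<Rightarrow> 'a \<Rightarrow> bool" where
  "has_lifting C i p \<longleftrightarrow>
     (\<forall>u \<in> Hom C (Dom C i) (Dom C p). \<forall>v \<in> Hom C (Cod C i) (Cod C p).
        p \<cdot>\<^bsub>C\<^esub> u = v \<cdot>\<^bsub>C\<^esub> i \<longrightarrow>
        (\<exists>w \<in> Hom C (Cod C i) (Dom C p). w \<cdot>\<^bsub>C\<^esub> i = u \<and> p \<cdot>\<^bsub>C\<^esub> w = v))"

definition inj_class :: "('o, 'a) cat \<Rightarrow> 'a set \<Rightarrow> 'a set" where
  "inj_class C M = {p \<in> Arr C. \<forall>i \<in> M. has_lifting C i p}"

definition cof_class :: "('o, 'a) cat \<Rightarrow> 'a set \<Rightarrow> 'a set" where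
  "cof_class C M = {i \<in> Arr C. \<forall>p \<in> inj_class C M. has_lifting C i p}"

definition cellular_model :: "'u itself \<Rightarrow> ('o, 'a) cat \<Rightarrow> 'a set \<Rightarrow> bool" where
  "cellular_model U E M \<longleftrightarrow>
     small U M \<and> M \<subseteq> {m. is_mono E m} \<and> cof_class E M = {m. is_mono E m}"


section \<open>Cylinders and intervals\<close>

text \<open>\<open>bd I e\<close> is the natural transformation \<open>\<partial>\<^sup>e\<close>; only \<open>e \<in> {0, 1}\<close> is meaningful.\<close>

record ('o, 'a) cyl =
  Cyl :: "('o, 'a, 'o, 'a) fctr"
  bd :: "nat \<Rightarrow> 'o \<Rightarrow> 'a"
  proj :: "'o \<Rightarrow> 'a"

definition cylinder :: "('o, 'a) cat \<Rightarrow> ('o, 'a) cyl \<Rightarrow> bool" where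
  "cylinder E I \<longleftrightarrow>
     is_functor E E (Cyl I) \<and>
     (\<forall>e \<in> {0, 1}. nat_trans E E id_fctr (Cyl I) (bd I e)) \<and>
     nat_trans E E (Cyl I) id_fctr (proj I) \<and>
     (\<forall>e \<in> {0, 1}. \<forall>X \<in> Obj E. proj I X \<cdot>\<^bsub>E\<^esub> bd I e X = Ide E X)"

definition cartesian_cylinder :: "('o, 'a) cat \<Rightarrow> ('o, 'a) cyl \<Rightarrow> bool" where
  "cartesian_cylinder E I \<longleftrightarrow>
     cylinder E I \<and>
     (\<forall>j. is_mono E j \<longrightarrow> (\<forall>e \<in> {0, 1}.
        is_pullback E (bd I e (Cod E j)) (AMap (Cyl I) j) j (bd I e (Dom E j))))"

definition interval :: "'u itself \<Rightarrow> ('o, 'a) cat \<Rightarrow> ('o, 'a) cyl \<Rightarrow> bool" where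
  "interval U E I \<longleftrightarrow>
     cartesian_cylinder E I \<and>
     preserves_monos E E (Cyl I) \<and>
     preserves_colimits U E E (Cyl I) \<and>
     (\<forall>X \<in> Obj E. \<forall>k. is_copairing E (bd I 0 X) (bd I 1 X) k \<longrightarrow> is_mono E k)"

definition interval_morphism ::
  "('o, 'a) cat \<Rightarrow> ('o, 'a) cyl \<Rightarrow> ('o, 'a) cyl \<Rightarrow> ('o \<Rightarrow> 'a) \<Rightarrow> bool" where
  "interval_morphism E I I' \<iota> \<longleftrightarrow>
     nat_trans E E (Cyl I) (Cyl I') \<iota> \<and>
     (\<forall>e \<in> {0, 1}. \<forall>X \<in> Obj E. \<iota> X \<cdot>\<^bsub>E\<^esub> bd I e X = bd I' e X) \<and>
     (\<forall>X \<in> Obj E. proj I X = proj I' X \<cdot>\<^bsub>E\<^esub> \<iota> X)"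


section \<open>Homotopy, naively fibrant objects and weak equivalences\<close>

definition homotopy_rel ::
  "('o, 'a) cat \<Rightarrow> ('o, 'a) cyl \<Rightarrow> 'o \<Rightarrow> 'o \<Rightarrow> ('a \<times> 'a) set" where
  "homotopy_rel E I X Y =
     {(f0, f1). f0 \<in> Hom E X Y \<and> f1 \<in> Hom E X Y \<and>
        (\<exists>h \<in> Hom E (OMap (Cyl I) X) Y.
           h \<cdot>\<^bsub>E\<^esub> bd I 0 X = f0 \<and> h \<cdot>\<^bsub>E\<^esub> bd I 1 X = f1)}"

definition sat :: "('o, 'a) cat \<Rightarrow> ('o, 'a) cyl \<Rightarrow> 'a set \<Rightarrow> 'a set" where
  "sat E I S =
     {u. \<exists>l \<in> S. \<exists>k. is_copairing E (bd I 0 (Cod E l)) (bd I 1 (Cod E l)) k \<and>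
        is_union E (AMap (Cyl I) l) k u}"

primrec Lambda_stage :: "('o, 'a) cat \<Rightarrow> 'a set \<Rightarrow> ('o, 'a) cyl \<Rightarrow> nat \<Rightarrow> 'a set" where
  "Lambda_stage E M I 0 =
     {u. \<exists>m \<in> M. \<exists>e \<in> {0, 1}. is_union E (AMap (Cyl I) m) (bd I e (Cod E m)) u}"
| "Lambda_stage E M I (Suc n) = sat E I (Lambda_stage E M I n)"

definition Lambda :: "('o, 'a) cat \<Rightarrow> 'a set \<Rightarrow> ('o, 'a) cyl \<Rightarrow> 'a set" where
  "Lambda E M I = (\<Union>n. Lambda_stage E M I n)"

definition naively_fibrant :: "('o, 'a) cat \<Rightarrow> 'a set \<Rightarrow> ('o, 'a) cyl \<Rightarrow> 'o \<Rightarrow> bool" where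
  "naively_fibrant E M I T \<longleftrightarrow>
     T \<in> Obj E \<and> (\<exists>t \<in> inj_class E (Lambda E M I). Dom E t = T \<and> is_terminal E (Cod E t))"

definition homotopy_classes ::
  "('o, 'a) cat \<Rightarrow> ('o, 'a) cyl \<Rightarrow> 'o \<Rightarrow> 'o \<Rightarrow> 'a set set" where
  "homotopy_classes E I X T = Hom E X T // homotopy_rel E I X T"

text \<open>\<open>f\<^sup>*\<close>: the class of \<open>g\<close> is sent to the class of \<open>g \<cdot> f\<close>.\<close>

definition precomp_classes ::
  "('o, 'a) cat \<Rightarrow> ('o, 'a) cyl \<Rightarrow> 'a \<Rightarrow> 'o \<Rightarrow> 'a set \<Rightarrow> 'a set" where
  "precomp_classes E I f T c = homotopy_rel E I (Dom E f) T `` ((\<lambda>g. g \<cdot>\<^bsub>E\<^esub> f) ` c)"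

definition weak_equivalences :: "('o, 'a) cat \<Rightarrow> 'a set \<Rightarrow> ('o, 'a) cyl \<Rightarrow> 'a set" where
  "weak_equivalences E M I =
     {f \<in> Arr E. \<forall>T. naively_fibrant E M I T \<longrightarrow>
        bij_betw (precomp_classes E I f T)
          (homotopy_classes E I (Cod E f) T) (homotopy_classes E I (Dom E f) T)}"

definition sectionwise :: "('o, 'a) cat \<Rightarrow> 'a set \<Rightarrow> ('o \<Rightarrow> 'a) \<Rightarrow> bool" where
  "sectionwise E W \<iota> \<longleftrightarrow> (\<forall>X \<in> Obj E. \<iota> X \<in> W)"

end

theory Submission
  imports Defs
begin

text \<open>
  Fix the interval \<open>J\<close> for which \<open>\<iota>\<close> consists of weak equivalences, and let \<open>T\<close> be \<open>J\<close>-naively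
  fibrant.  It suffices that \<open>T\<close> is naively fibrant for the other interval \<open>K\<close>, and that the two
  homotopy relations on maps to \<open>T\<close> agree: then both weak equivalence conditions at \<open>T\<close> coincide.
  A \<open>J\<close>-homotopy lifting argument along the mono \<open>[\<partial>\<^sup>0, \<partial>\<^sup>1]\<close> gives the agreement of homotopies.

  For the fibrancy, consider the monos lifting against all maps \<open>p \<in> \<Lambda>\<^sub>J-inj\<close> with naively fibrant
  codomain.  The ends \<open>\<partial>\<^sup>e\<close> of \<open>K\<close> are among them, being split monos and \<open>J\<close>-weak equivalences by
  two-out-of-three: the splitting turns homotopies into homotopies relative to the source.  This class
  is closed under composition and pushout, and under cancellation (\<open>j\<close> and \<open>u \<cdot> j\<close> in the class
  imply \<open>u\<close> in the class), so it contains \<open>\<Lambda>\<^sub>K\<close>.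

  Lifting of arbitrary monos, respectively of \<open>\<Lambda>\<close>-cofibrations, in box shaped squares follows from the
  cases of \<open>M\<close> and \<open>\<Lambda>\<close>, because the functor of an interval has a right adjoint; the value of the
  adjoint at \<open>Y\<close> is the sheaf \<open>c \<mapsto> E(I(G\<^sub>c), Y)\<close>, where \<open>G\<^sub>c\<close> is the sheafified representable.
\<close>

section \<open>Small sets\<close>

text \<open>The codomain of the fibrations has to be naively fibrant: a lift is moved along a
  homotopy in the codomain that is constant on the source of the mono, and such a homotopy is made
  by filling boxes in the codomain. The map from \<open>T\<close> to the terminal object is a
  fibration of this kind, so the restriction costs nothing when asking whether \<open>T\<close> is
  \<open>K\<close>-naively fibrant. Being defined by lifting, the class is stable under pushouts by
  inspection, and the proof gets by without factorizations, small object argument or transfinite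
  composition. The fact about the ends of \<open>K\<close> that drives everything is injectivity:
  two maps from \<open>K(X)\<close> to \<open>T\<close> that agree after one end are
  \<open>J\<close>-homotopic. It does not mention \<iota>, so one locale serves both inclusions,
  although \<iota> points into \<open>K\<close> in one of them and out of \<open>K\<close> in the
  other. A topos is given as a category equivalent to sheaves on a site. A presentation by sections,
  \<open>sheaf_rep\<close>, is extracted once; from it come the exactness properties collected in
  \<open>topos_like\<close>, after which sheaves do not reappear.\<close>

lemma small_lepoll: "A \<lesssim> B \<Longrightarrow> small U B \<Longrightarrow> small U A"
  unfolding small_def using lesspoll_trans1 by blast

lemma small_subset: "A \<subseteq> B \<Longrightarrow> small U B \<Longrightarrow> small U A"
  by (meson small_lepoll subset_imp_lepoll)

lemma small_image: "small U A \<Longrightarrow> small U (f ` A)"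
  by (meson image_lepoll small_lepoll)

lemma small_inj_on: "inj_on f A \<Longrightarrow> f ` A \<subseteq> B \<Longrightarrow> small U B \<Longrightarrow> small U A"
  by (meson lepoll_def small_lepoll)

lemma small_embed:
  assumes "small (U :: 'u itself) A"
  shows "\<exists>e :: _ \<Rightarrow> 'u. inj_on e A"
  using assms unfolding small_def lesspoll_def lepoll_def by blast

locale universe_type =
  fixes U :: "'u itself"
  assumes universe: "universe U"
begin

lemma infinite_UNIV: "infinite (UNIV :: 'u set)"
  using universe by (simp add: universe_def)

text \<open>An infinite set is in bijection with its square, so pairs of elements of the universe
  can be coded in it again. The codes serve for dependent sums here and for categories of elements
  later.\<close>

definition pr :: "'u \<times> 'u \<Rightarrow> 'u" where
  "pr = (SOME f. inj f)"

lemma inj_pr: "inj pr"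
proof -
  have "(card_of ((UNIV :: 'u set) \<times> (UNIV :: 'u set)), card_of (UNIV :: 'u set)) \<in> ordIso"
    using card_of_Times_same_infinite infinite_UNIV by blast
  then have "(UNIV :: ('u \<times> 'u) set) \<approx> (UNIV :: 'u set)"
    by (simp add: eqpoll_iff_card_of_ordIso)
  then have "\<exists>f :: 'u \<times> 'u \<Rightarrow> 'u. inj f"
    unfolding eqpoll_def bij_betw_def by blast
  then show ?thesis unfolding pr_def by (rule someI_ex)
qed

lemma small_finite: "finite A \<Longrightarrow> small U A"
  unfolding small_def by (rule finite_lesspoll_infinite[OF infinite_UNIV])

text \<open>The universe axioms speak of subsets of \<open>'u\<close>; a small set over another type
  is first carried there by an injection.\<close>

lemma small_Pow:
  assumes "small U (A :: 'b set)"
  shows "small U (Pow A)"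
proof -
  obtain e :: "'b \<Rightarrow> 'u" where e: "inj_on e A"
    using small_embed[OF assms] by blast
  have "small U (Pow (e ` A))"
    using universe small_image[OF assms] by (auto simp: universe_def)
  moreover have "inj_on ((`) e) (Pow A)"
    using e by (rule inj_on_image_Pow)
  ultimately show ?thesis
    by (elim small_inj_on[rotated 2]) auto
qed

text \<open>The union axiom wants a family indexed by a subset of \<open>'u\<close>. The index is
  therefore replaced by its code, and each fibre \<open>G x\<close> carries that code as first
  component, which keeps the fibres apart.\<close>

lemma small_Sigma:
  assumes "small U (A :: 'b set)" and "\<And>a. a \<in> A \<Longrightarrow> small U (F a :: 'c set)"
  shows "small U (Sigma A F)"
proof -
  obtain e :: "'b \<Rightarrow> 'u" where e: "inj_on e A"
    using small_embed[OF assms(1)] by blast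
  have "\<forall>a\<in>A. \<exists>d :: 'c \<Rightarrow> 'u. inj_on d (F a)"
    using small_embed assms(2) by blast
  then obtain d :: "'b \<Rightarrow> 'c \<Rightarrow> 'u" where d: "\<And>a. a \<in> A \<Longrightarrow> inj_on (d a) (F a)"
    by metis
  define G where "G x = (\<lambda>y. pr (x, d (inv_into A e x) y)) ` F (inv_into A e x)" for x
  define k where "k = (\<lambda>(a, y). pr (e a, d a y))"
  have "small U (\<Union>x\<in>e ` A. G x)"
  proof -
    have "\<forall>x\<in>e ` A. small U (G x)"
      unfolding G_def using e by (auto intro!: small_image assms(2))
    then show ?thesis
      using universe small_image[OF assms(1), of e] unfolding universe_def by blast
  qed
  moreover have "k ` Sigma A F \<subseteq> (\<Union>x\<in>e ` A. G x)"
    using e unfolding k_def G_def by fastforce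
  moreover have "inj_on k (Sigma A F)"
  proof (rule inj_onI)
    fix p q assume pq: "p \<in> Sigma A F" "q \<in> Sigma A F" "k p = k q"
    obtain a b a' b' where [simp]: "p = (a, b)" "q = (a', b')" by fastforce
    have "e a = e a'" "d a b = d a' b'"
      using pq(3) injD[OF inj_pr] unfolding k_def by auto
    moreover from this have "a = a'" using e pq by (auto dest: inj_onD)
    ultimately show "p = q" using pq d[of a] by (auto dest: inj_onD)
  qed
  ultimately show ?thesis using small_inj_on by blast
qed

lemma small_Times: "small U A \<Longrightarrow> small U B \<Longrightarrow> small U (A \<times> B)"
  by (rule small_Sigma)

end

section \<open>Categories\<close>

context category
begin

lemma Comp_Arr: "f \<in> Arr C \<Longrightarrow> g \<in> Arr C \<Longrightarrow> Cod C f = Dom C g \<Longrightarrow> g \<cdot> f \<in> Arr C"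
  and Dom_Comp: "f \<in> Arr C \<Longrightarrow> g \<in> Arr C \<Longrightarrow> Cod C f = Dom C g \<Longrightarrow> Dom C (g \<cdot> f) = Dom C f"
  and Cod_Comp: "f \<in> Arr C \<Longrightarrow> g \<in> Arr C \<Longrightarrow> Cod C f = Dom C g \<Longrightarrow> Cod C (g \<cdot> f) = Cod C g"
  using Comp_in_Hom[of f "Dom C f" "Cod C f" g "Cod C g"] by (auto simp: Hom_def)

lemma Ide_Arr: "X \<in> Obj C \<Longrightarrow> Ide C X \<in> Arr C"
  and Dom_Ide: "X \<in> Obj C \<Longrightarrow> Dom C (Ide C X) = X"
  and Cod_Ide: "X \<in> Obj C \<Longrightarrow> Cod C (Ide C X) = X"
  using Ide_in_Hom[of X] by (auto simp: Hom_def)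

lemma assoc:
  "f \<in> Arr C \<Longrightarrow> g \<in> Arr C \<Longrightarrow> h \<in> Arr C \<Longrightarrow> Cod C f = Dom C g \<Longrightarrow> Cod C g = Dom C h \<Longrightarrow>
   (h \<cdot> g) \<cdot> f = h \<cdot> (g \<cdot> f)"
  using Comp_assoc[of f "Dom C f" "Cod C f" g "Cod C g" h "Cod C h"] by (simp add: Hom_def)

lemma Comp_Ide': "f \<in> Arr C \<Longrightarrow> Dom C f = X \<Longrightarrow> f \<cdot> Ide C X = f"
  and Ide_Comp': "f \<in> Arr C \<Longrightarrow> Cod C f = X \<Longrightarrow> Ide C X \<cdot> f = f"
  using Comp_Ide Ide_Comp by (auto simp: Hom_def)

lemmas cat_simps = Comp_Arr Dom_Comp Cod_Comp Ide_Arr Dom_Ide Cod_Ide assoc Comp_Ide' Ide_Comp'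
  Dom_in_Obj Cod_in_Obj

text \<open>\<open>cat_simps\<close> nests composites to the right, so an equation for
  \<open>a \<cdot> b\<close> no longer matches inside a longer composite; this form does.\<close>

lemma post:
  "a \<cdot> b = c \<Longrightarrow> a \<in> Arr C \<Longrightarrow> b \<in> Arr C \<Longrightarrow> Dom C a = Cod C b \<Longrightarrow> x \<in> Arr C \<Longrightarrow>
   Cod C x = Dom C b \<Longrightarrow> a \<cdot> (b \<cdot> x) = c \<cdot> x"
  by (metis assoc)

end

section \<open>Sheaf categories and equivalences\<close>

lemma set_cat_simps [simp]:
  "Obj (set_cat U) = {A. small U A}"
  "Arr (set_cat U) = {(A, B, f). small U A \<and> small U B \<and> f \<in> A \<rightarrow>\<^sub>E B}"
  "Dom (set_cat U) (A, B, f) = A"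
  "Cod (set_cat U) (A, B, f) = B"
  "Ide (set_cat U) A = (A, A, restrict (\<lambda>x. x) A)"
  "Comp (set_cat U) (B', D, g) (A, B, f) = (A, D, compose A g f)"
  by (simp_all add: set_cat_def)

lemma category_set_cat: "category (set_cat U)"
proof
  fix X assume "X \<in> Obj (set_cat U)"
  then show "Ide (set_cat U) X \<in> Hom (set_cat U) X X"
    by (auto simp: Hom_def)
next
  fix f X Y g Z
  assume "f \<in> Hom (set_cat U) X Y" "g \<in> Hom (set_cat U) Y Z"
  then show "g \<cdot>\<^bsub>set_cat U\<^esub> f \<in> Hom (set_cat U) X Z"
    by (auto simp: Hom_def compose_def PiE_def Pi_def)
next
  fix f X Y assume "f \<in> Hom (set_cat U) X Y"
  then show "f \<cdot>\<^bsub>set_cat U\<^esub> Ide (set_cat U) X = f"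
    by (auto simp: Hom_def compose_def fun_eq_iff PiE_def extensional_def)
next
  fix f X Y assume "f \<in> Hom (set_cat U) X Y"
  then show "Ide (set_cat U) Y \<cdot>\<^bsub>set_cat U\<^esub> f = f"
    by (auto simp: Hom_def compose_def fun_eq_iff PiE_def Pi_def extensional_def) metis
next
  fix f X Y g Z h W
  assume "f \<in> Hom (set_cat U) X Y" "g \<in> Hom (set_cat U) Y Z" "h \<in> Hom (set_cat U) Z W"
  then show "h \<cdot>\<^bsub>set_cat U\<^esub> (g \<cdot>\<^bsub>set_cat U\<^esub> f) = h \<cdot>\<^bsub>set_cat U\<^esub> g \<cdot>\<^bsub>set_cat U\<^esub> f"
    by (auto simp: Hom_def compose_def fun_eq_iff PiE_def Pi_def extensional_def)
qed (auto simp: set_cat_def)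

lemma category_op_cat:
  assumes "category C" shows "category (op_cat C)"
proof -
  interpret category C by fact
  show ?thesis
    by unfold_locales (auto simp: op_cat_def Hom_def cat_simps)
qed

lemma fun_cat_Obj:
  "F \<in> Obj (fun_cat C D) \<longleftrightarrow>
     is_functor C D F \<and> OMap F \<in> extensional (Obj C) \<and> AMap F \<in> extensional (Arr C)"
  by (simp add: fun_cat_def)

lemma fun_cat_simps:
  "Arr (fun_cat C D) = {(F, G, t). F \<in> Obj (fun_cat C D) \<and> G \<in> Obj (fun_cat C D) \<and>
      nat_trans C D F G t \<and> t \<in> extensional (Obj C)}"
  "Dom (fun_cat C D) (F, G, t) = F"
  "Cod (fun_cat C D) (F, G, t) = G"
  "Ide (fun_cat C D) F = (F, F, restrict (\<lambda>X. Ide D (OMap F X)) (Obj C))"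
  "Comp (fun_cat C D) (G', H, s) (F, G, t) = (F, H, restrict (\<lambda>X. s X \<cdot>\<^bsub>D\<^esub> t X) (Obj C))"
  by (simp_all add: fun_cat_def Let_def)

lemma nat_trans_comp:
  assumes "category C" "category D" "is_functor C D F" "is_functor C D G" "is_functor C D H"
    "nat_trans C D F G t" "nat_trans C D G H s"
  shows "nat_trans C D F H (restrict (\<lambda>X. s X \<cdot>\<^bsub>D\<^esub> t X) (Obj C))"
proof -
  interpret C: category C by fact
  interpret D: category D by fact
  show ?thesis
    unfolding nat_trans_def
  proof (intro conjI ballI)
    fix X assume "X \<in> Obj C"
    then show "restrict (\<lambda>X. s X \<cdot>\<^bsub>D\<^esub> t X) (Obj C) X \<in> Hom D (OMap F X) (OMap H X)"
      using assms(6,7) D.Comp_in_Hom unfolding nat_trans_def by auto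
  next
    fix f assume f: "f \<in> Arr C"
    have [simp]: "Dom C f \<in> Obj C" "Cod C f \<in> Obj C"
      using f C.Dom_in_Obj C.Cod_in_Obj by auto
    have t: "t (Dom C f) \<in> Hom D (OMap F (Dom C f)) (OMap G (Dom C f))"
        "t (Cod C f) \<in> Hom D (OMap F (Cod C f)) (OMap G (Cod C f))"
        "t (Cod C f) \<cdot>\<^bsub>D\<^esub> AMap F f = AMap G f \<cdot>\<^bsub>D\<^esub> t (Dom C f)"
      using assms(6) f unfolding nat_trans_def by auto
    have s: "s (Dom C f) \<in> Hom D (OMap G (Dom C f)) (OMap H (Dom C f))"
        "s (Cod C f) \<in> Hom D (OMap G (Cod C f)) (OMap H (Cod C f))"
        "s (Cod C f) \<cdot>\<^bsub>D\<^esub> AMap G f = AMap H f \<cdot>\<^bsub>D\<^esub> s (Dom C f)"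
      using assms(7) f unfolding nat_trans_def by auto
    have F: "AMap F f \<in> Hom D (OMap F (Dom C f)) (OMap F (Cod C f))"
        "AMap G f \<in> Hom D (OMap G (Dom C f)) (OMap G (Cod C f))"
        "AMap H f \<in> Hom D (OMap H (Dom C f)) (OMap H (Cod C f))"
      using assms(3-5) f unfolding is_functor_def by auto
    have "s (Cod C f) \<cdot>\<^bsub>D\<^esub> t (Cod C f) \<cdot>\<^bsub>D\<^esub> AMap F f = s (Cod C f) \<cdot>\<^bsub>D\<^esub> (t (Cod C f) \<cdot>\<^bsub>D\<^esub> AMap F f)"
      using D.Comp_assoc[OF F(1) t(2) s(2)] by simp
    also have "\<dots> = s (Cod C f) \<cdot>\<^bsub>D\<^esub> AMap G f \<cdot>\<^bsub>D\<^esub> t (Dom C f)"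
      using D.Comp_assoc[OF t(1) F(2) s(2)] t(3) by simp
    also have "\<dots> = AMap H f \<cdot>\<^bsub>D\<^esub> (s (Dom C f) \<cdot>\<^bsub>D\<^esub> t (Dom C f))"
      using D.Comp_assoc[OF t(1) s(1) F(3)] s(3) by simp
    finally show "restrict (\<lambda>X. s X \<cdot>\<^bsub>D\<^esub> t X) (Obj C) (Cod C f) \<cdot>\<^bsub>D\<^esub> AMap F f =
        AMap H f \<cdot>\<^bsub>D\<^esub> restrict (\<lambda>X. s X \<cdot>\<^bsub>D\<^esub> t X) (Obj C) (Dom C f)" by simp
  qed
qed

lemma category_fun_cat:
  assumes C: "category C" and D: "category D"
  shows "category (fun_cat C D)"
proof -
  interpret C: category C by fact
  interpret D: category D by fact
  let ?F = "fun_cat C D"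
  have nt: "t X \<in> Hom D (OMap F X) (OMap G X)" if "nat_trans C D F G t" "X \<in> Obj C" for F G t X
    using that unfolding nat_trans_def by auto
  show ?thesis
  proof
    fix X assume "X \<in> Obj ?F"
    then show "Ide ?F X \<in> Hom ?F X X"
      by (auto simp: Hom_def fun_cat_simps nat_trans_def is_functor_def fun_cat_Obj C.cat_simps
          D.cat_simps)
  next
    fix f X Y g Z
    assume "f \<in> Hom ?F X Y" "g \<in> Hom ?F Y Z"
    then show "g \<cdot>\<^bsub>?F\<^esub> f \<in> Hom ?F X Z"
      using nat_trans_comp[OF C D] by (auto simp: Hom_def fun_cat_simps fun_cat_Obj)
  next
    fix f X Y assume "f \<in> Hom ?F X Y"
    then show "f \<cdot>\<^bsub>?F\<^esub> Ide ?F X = f" "Ide ?F Y \<cdot>\<^bsub>?F\<^esub> f = f"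
      using D.Comp_Ide[OF nt] D.Ide_Comp[OF nt]
      by (auto simp: Hom_def fun_cat_simps fun_eq_iff extensional_def)
  next
    fix f X Y g Z h W
    assume "f \<in> Hom ?F X Y" "g \<in> Hom ?F Y Z" "h \<in> Hom ?F Z W"
    then show "h \<cdot>\<^bsub>?F\<^esub> (g \<cdot>\<^bsub>?F\<^esub> f) = h \<cdot>\<^bsub>?F\<^esub> g \<cdot>\<^bsub>?F\<^esub> f"
      using D.Comp_assoc[OF nt nt nt]
      by (auto simp: Hom_def fun_cat_simps fun_eq_iff extensional_def)
  qed (auto simp: fun_cat_simps)
qed

lemma category_full_subcat:
  assumes "category C" shows "category (full_subcat C A)"
proof -
  interpret category C by fact
  show ?thesis
    by unfold_locales (auto simp: full_subcat_def Hom_def cat_simps)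
qed

lemma full_subcat_simps:
  "Obj (full_subcat C A) = Obj C \<inter> A"
  "Arr (full_subcat C A) = {f \<in> Arr C. Dom C f \<in> A \<and> Cod C f \<in> A}"
  "Dom (full_subcat C A) = Dom C" "Cod (full_subcat C A) = Cod C"
  "Ide (full_subcat C A) = Ide C" "Comp (full_subcat C A) = Comp C"
  by (simp_all add: full_subcat_def)

section \<open>Equivalences are faithful, full and essentially surjective\<close>

definition faithful :: "('o, 'a) cat \<Rightarrow> ('p, 'b) cat \<Rightarrow> ('o, 'a, 'p, 'b) fctr \<Rightarrow> bool" where
  "faithful C D F \<longleftrightarrow> (\<forall>X\<in>Obj C. \<forall>Y\<in>Obj C. inj_on (AMap F) (Hom C X Y))"

definition full :: "('o, 'a) cat \<Rightarrow> ('p, 'b) cat \<Rightarrow> ('o, 'a, 'p, 'b) fctr \<Rightarrow> bool" where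
  "full C D F \<longleftrightarrow> (\<forall>X\<in>Obj C. \<forall>Y\<in>Obj C. Hom D (OMap F X) (OMap F Y) \<subseteq> AMap F ` Hom C X Y)"

lemma faithful_if_retract:
  assumes "category C" "is_functor C D F" "is_functor D C G"
    and iso: "nat_iso C C id_fctr (comp_fctr G F) \<eta>"
  shows "faithful C D F"
  unfolding faithful_def
proof (intro ballI inj_onI)
  interpret C: category C by fact
  fix X Y f g assume XY: "X \<in> Obj C" "Y \<in> Obj C"
    and f: "f \<in> Hom C X Y" and g: "g \<in> Hom C X Y" and eq: "AMap F f = AMap F g"
  have nat: "\<eta> Y \<cdot>\<^bsub>C\<^esub> h = AMap G (AMap F h) \<cdot>\<^bsub>C\<^esub> \<eta> X" if "h \<in> Hom C X Y" for h
    using iso that unfolding nat_iso_def nat_trans_def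
    by (auto simp: id_fctr_def comp_fctr_def Hom_def)
  have e: "\<eta> Y \<in> Hom C Y (OMap G (OMap F Y))"
    using iso XY unfolding nat_iso_def nat_trans_def by (auto simp: id_fctr_def comp_fctr_def)
  have "is_iso C (\<eta> Y)" using iso XY unfolding nat_iso_def by blast
  then obtain k where k: "k \<in> Hom C (OMap G (OMap F Y)) Y" "k \<cdot>\<^bsub>C\<^esub> \<eta> Y = Ide C Y"
    using e unfolding is_iso_def Hom_def by auto
  have "k \<cdot>\<^bsub>C\<^esub> (\<eta> Y \<cdot>\<^bsub>C\<^esub> f) = k \<cdot>\<^bsub>C\<^esub> (\<eta> Y \<cdot>\<^bsub>C\<^esub> g)"
    using nat f g eq by simp
  then show "f = g"
    using C.Comp_assoc[OF f e k(1)] C.Comp_assoc[OF g e k(1)] k(2) C.Ide_Comp f g by simp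
qed

text \<open>The mirror image, for an isomorphism out of the composite: the counit of an equivalence
  is oriented this way, and through it the inverse functor is seen to be faithful.\<close>

lemma faithful_if_retract':
  assumes "category C" "is_functor C D F" "is_functor D C G"
    and iso: "nat_iso C C (comp_fctr G F) id_fctr \<eta>"
  shows "faithful C D F"
  unfolding faithful_def
proof (intro ballI inj_onI)
  interpret C: category C by fact
  fix X Y f g assume XY: "X \<in> Obj C" "Y \<in> Obj C"
    and f: "f \<in> Hom C X Y" and g: "g \<in> Hom C X Y" and eq: "AMap F f = AMap F g"
  have nat: "h \<cdot>\<^bsub>C\<^esub> \<eta> X = \<eta> Y \<cdot>\<^bsub>C\<^esub> AMap G (AMap F h)" if "h \<in> Hom C X Y" for h
    using iso that unfolding nat_iso_def nat_trans_def
    by (auto simp: id_fctr_def comp_fctr_def Hom_def)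
  have e: "\<eta> X \<in> Hom C (OMap G (OMap F X)) X"
    using iso XY unfolding nat_iso_def nat_trans_def by (auto simp: id_fctr_def comp_fctr_def)
  have "is_iso C (\<eta> X)" using iso XY unfolding nat_iso_def by blast
  then obtain k where k: "k \<in> Hom C X (OMap G (OMap F X))" "\<eta> X \<cdot>\<^bsub>C\<^esub> k = Ide C X"
    using e unfolding is_iso_def Hom_def by auto
  have "(f \<cdot>\<^bsub>C\<^esub> \<eta> X) \<cdot>\<^bsub>C\<^esub> k = (g \<cdot>\<^bsub>C\<^esub> \<eta> X) \<cdot>\<^bsub>C\<^esub> k"
    using nat f g eq by simp
  then show "f = g"
    using C.Comp_assoc[OF k(1) e f] C.Comp_assoc[OF k(1) e g] k(2) C.Comp_Ide f g by simp
qed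

text \<open>The candidate preimage is \<open>AMap G t\<close> conjugated by \<open>\<eta>\<close>.
  Naturality and cancellation of \<open>\<eta>\<close> show that \<open>G\<close> sends its image to
  \<open>AMap G t\<close>, and faithfulness of \<open>G\<close> concludes.\<close>

lemma equivalence_full:
  assumes C: "category C" and F: "is_functor C D F" and G: "is_functor D C G"
    and iso: "nat_iso C C id_fctr (comp_fctr G F) \<eta>" and Gf: "faithful D C G"
  shows "full C D F"
  unfolding full_def
proof (intro ballI subsetI)
  interpret C: category C by fact
  fix X Y t assume XY: "X \<in> Obj C" "Y \<in> Obj C" and t: "t \<in> Hom D (OMap F X) (OMap F Y)"
  have e: "\<eta> Z \<in> Hom C Z (OMap G (OMap F Z))" if "Z \<in> Obj C" for Z
    using iso that unfolding nat_iso_def nat_trans_def by (auto simp: id_fctr_def comp_fctr_def)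
  have inv: "\<exists>k\<in>Hom C (OMap G (OMap F Z)) Z. k \<cdot>\<^bsub>C\<^esub> \<eta> Z = Ide C Z \<and>
      \<eta> Z \<cdot>\<^bsub>C\<^esub> k = Ide C (OMap G (OMap F Z))" if "Z \<in> Obj C" for Z
  proof -
    have "is_iso C (\<eta> Z)" using iso that unfolding nat_iso_def by blast
    then show ?thesis using e[OF that] unfolding is_iso_def Hom_def by auto
  qed
  obtain k where k: "k \<in> Hom C (OMap G (OMap F Y)) Y"
      "\<eta> Y \<cdot>\<^bsub>C\<^esub> k = Ide C (OMap G (OMap F Y))"
    using inv[OF XY(2)] by blast
  obtain k' where k': "k' \<in> Hom C (OMap G (OMap F X)) X"
      "\<eta> X \<cdot>\<^bsub>C\<^esub> k' = Ide C (OMap G (OMap F X))"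
    using inv[OF XY(1)] by blast
  have Gt: "AMap G t \<in> Hom C (OMap G (OMap F X)) (OMap G (OMap F Y))"
    using G t unfolding is_functor_def Hom_def by auto
  define f where "f = k \<cdot>\<^bsub>C\<^esub> (AMap G t \<cdot>\<^bsub>C\<^esub> \<eta> X)"
  have f: "f \<in> Hom C X Y"
    unfolding f_def using C.Comp_in_Hom e[OF XY(1)] Gt k(1) by blast
  have Ff: "AMap F f \<in> Hom D (OMap F X) (OMap F Y)"
    using F f unfolding is_functor_def Hom_def by auto
  have GFf: "AMap G (AMap F f) \<in> Hom C (OMap G (OMap F X)) (OMap G (OMap F Y))"
    using G Ff unfolding is_functor_def Hom_def by auto
  have "AMap G (AMap F f) \<cdot>\<^bsub>C\<^esub> \<eta> X = \<eta> Y \<cdot>\<^bsub>C\<^esub> f"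
    using iso f unfolding nat_iso_def nat_trans_def
    by (auto simp: id_fctr_def comp_fctr_def Hom_def)
  also have "\<dots> = AMap G t \<cdot>\<^bsub>C\<^esub> \<eta> X"
    unfolding f_def
    using C.Comp_assoc[OF C.Comp_in_Hom[OF e[OF XY(1)] Gt] k(1) e[OF XY(2)]] k(2)
      C.Ide_Comp[OF C.Comp_in_Hom[OF e[OF XY(1)] Gt]] by simp
  finally have "(AMap G (AMap F f) \<cdot>\<^bsub>C\<^esub> \<eta> X) \<cdot>\<^bsub>C\<^esub> k' = (AMap G t \<cdot>\<^bsub>C\<^esub> \<eta> X) \<cdot>\<^bsub>C\<^esub> k'" by simp
  then have "AMap G (AMap F f) = AMap G t"
    using C.Comp_assoc[OF k'(1) e[OF XY(1)]] GFf Gt k'(2) C.Comp_Ide by metis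
  moreover have "OMap F X \<in> Obj D" "OMap F Y \<in> Obj D"
    using F XY unfolding is_functor_def by auto
  ultimately have "AMap F f = t"
    using Gf Ff t unfolding faithful_def by (meson inj_onD)
  then show "t \<in> AMap F ` Hom C X Y" using f by blast
qed

lemma equivalent_categoriesE:
  assumes "equivalent_categories C D" and C: "category C" and D: "category D"
  obtains F where "is_functor C D F" "faithful C D F" "full C D F"
    "\<And>Y. Y \<in> Obj D \<Longrightarrow> \<exists>X\<in>Obj C. \<exists>f\<in>Hom D (OMap F X) Y. is_iso D f"
proof -
  obtain F G \<eta> \<epsilon> where F: "is_functor C D F" and G: "is_functor D C G"
    and \<eta>: "nat_iso C C id_fctr (comp_fctr G F) \<eta>"
    and \<epsilon>: "nat_iso D D (comp_fctr F G) id_fctr \<epsilon>"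
    using assms(1) unfolding equivalent_categories_def by blast
  show ?thesis
  proof
    show "is_functor C D F" by fact
    show "faithful C D F" using faithful_if_retract[OF C F G \<eta>] .
    show "full C D F" using equivalence_full[OF C F G \<eta> faithful_if_retract'[OF D G F \<epsilon>]] .
    fix Y assume Y: "Y \<in> Obj D"
    then have "OMap G Y \<in> Obj C" using G unfolding is_functor_def by blast
    moreover have "\<epsilon> Y \<in> Hom D (OMap F (OMap G Y)) Y" "is_iso D (\<epsilon> Y)"
      using \<epsilon> Y unfolding nat_iso_def nat_trans_def by (auto simp: id_fctr_def comp_fctr_def)
    ultimately show "\<exists>X\<in>Obj C. \<exists>f\<in>Hom D (OMap F X) Y. is_iso D f" by blast
  qed
qed

section \<open>Sheaves on a site\<close>

locale site = universe_type U + category C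
  for U :: "'u itself" and C :: "('u, 'u) cat" (structure) +
  fixes J :: "'u \<Rightarrow> 'u set set"
  assumes small_site: "small_category U C"
    and topology: "grothendieck_topology C J"
begin

text \<open>Presheaves as bare families of sections and restriction maps, over an arbitrary type of
  elements and without extensionality: the constructions below produce sections that are sets of
  pairs, pairs, or arrows of \<open>E\<close>.\<close>

definition psh :: "('u \<Rightarrow> 'p set) \<Rightarrow> ('u \<Rightarrow> 'p \<Rightarrow> 'p) \<Rightarrow> bool" where
  "psh P r \<longleftrightarrow>
     (\<forall>g\<in>Arr C. \<forall>x\<in>P (Cod C g). r g x \<in> P (Dom C g)) \<and>
     (\<forall>c\<in>Obj C. \<forall>x\<in>P c. r (Ide C c) x = x) \<and>
     (\<forall>f\<in>Arr C. \<forall>g\<in>Arr C. Cod C g = Dom C f \<longrightarrow> (\<forall>x\<in>P (Cod C f). r (f \<cdot> g) x = r g (r f x)))"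

definition ntr :: "('u \<Rightarrow> 'p set) \<Rightarrow> ('u \<Rightarrow> 'p \<Rightarrow> 'p) \<Rightarrow> ('u \<Rightarrow> 'q set) \<Rightarrow> ('u \<Rightarrow> 'q \<Rightarrow> 'q) \<Rightarrow>
    ('u \<Rightarrow> 'p \<Rightarrow> 'q) \<Rightarrow> bool" where
  "ntr P r Q q t \<longleftrightarrow>
     (\<forall>c\<in>Obj C. \<forall>x\<in>P c. t c x \<in> Q c) \<and>
     (\<forall>g\<in>Arr C. \<forall>x\<in>P (Cod C g). t (Dom C g) (r g x) = q g (t (Cod C g) x))"

definition matching :: "('u \<Rightarrow> 'p set) \<Rightarrow> ('u \<Rightarrow> 'p \<Rightarrow> 'p) \<Rightarrow> 'u set \<Rightarrow> ('u \<Rightarrow> 'p) \<Rightarrow> bool" where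
  "matching P r S x \<longleftrightarrow>
     (\<forall>f\<in>S. x f \<in> P (Dom C f)) \<and>
     (\<forall>f\<in>S. \<forall>g\<in>Arr C. Cod C g = Dom C f \<longrightarrow> x (f \<cdot> g) = r g (x f))"

definition shf :: "('u \<Rightarrow> 'p set) \<Rightarrow> ('u \<Rightarrow> 'p \<Rightarrow> 'p) \<Rightarrow> bool" where
  "shf P r \<longleftrightarrow> psh P r \<and>
     (\<forall>c\<in>Obj C. \<forall>S\<in>J c. \<forall>x. matching P r S x \<longrightarrow> (\<exists>!y. y \<in> P c \<and> (\<forall>f\<in>S. r f y = x f)))"

lemma psh_mem: "psh P r \<Longrightarrow> g \<in> Arr C \<Longrightarrow> Cod C g = c \<Longrightarrow> x \<in> P c \<Longrightarrow> Dom C g = d \<Longrightarrow> r g x \<in> P d"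
  and psh_Ide: "psh P r \<Longrightarrow> c \<in> Obj C \<Longrightarrow> x \<in> P c \<Longrightarrow> r (Ide C c) x = x"
  and psh_Comp: "psh P r \<Longrightarrow> f \<in> Arr C \<Longrightarrow> g \<in> Arr C \<Longrightarrow> Cod C g = Dom C f \<Longrightarrow> x \<in> P (Cod C f) \<Longrightarrow>
    r (f \<cdot> g) x = r g (r f x)"
  unfolding psh_def by auto

lemma ntr_mem: "ntr P r Q q t \<Longrightarrow> c \<in> Obj C \<Longrightarrow> x \<in> P c \<Longrightarrow> t c x \<in> Q c"
  and ntr_nat: "ntr P r Q q t \<Longrightarrow> g \<in> Arr C \<Longrightarrow> Cod C g = c \<Longrightarrow> Dom C g = d \<Longrightarrow> x \<in> P c \<Longrightarrow>
    t d (r g x) = q g (t c x)"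
  unfolding ntr_def by auto

lemma shf_psh: "shf P r \<Longrightarrow> psh P r"
  unfolding shf_def by blast

section \<open>Calculus of covering sieves\<close>

lemma cov_sieve: "S \<in> J c \<Longrightarrow> c \<in> Obj C \<Longrightarrow> is_sieve C c S"
  using topology by (simp add: grothendieck_topology_def)

lemma cov_Arr: "S \<in> J c \<Longrightarrow> c \<in> Obj C \<Longrightarrow> f \<in> S \<Longrightarrow> f \<in> Arr C"
  and cov_Cod: "S \<in> J c \<Longrightarrow> c \<in> Obj C \<Longrightarrow> f \<in> S \<Longrightarrow> Cod C f = c"
  and cov_Comp: "S \<in> J c \<Longrightarrow> c \<in> Obj C \<Longrightarrow> f \<in> S \<Longrightarrow> g \<in> Arr C \<Longrightarrow> Cod C g = Dom C f \<Longrightarrow> f \<cdot> g \<in> S"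
  using cov_sieve[of S c] by (simp_all add: is_sieve_def)

lemma cov_max: "c \<in> Obj C \<Longrightarrow> {f \<in> Arr C. Cod C f = c} \<in> J c"
  using topology by (simp add: grothendieck_topology_def)

lemma cov_pullback:
  assumes "f \<in> Arr C" "Cod C f = c" "Dom C f = d" "S \<in> J c"
  shows "pullback_sieve C f S \<in> J d"
proof -
  have "\<forall>f\<in>Arr C. \<forall>S\<in>J (Cod C f). pullback_sieve C f S \<in> J (Dom C f)"
    using topology unfolding grothendieck_topology_def by (elim conjE)
  then show ?thesis using assms by blast
qed

lemma cov_trans:
  assumes "c \<in> Obj C" "S \<in> J c" "is_sieve C c R"
    and "\<And>f. f \<in> S \<Longrightarrow> pullback_sieve C f R \<in> J (Dom C f)"
  shows "R \<in> J c"
proof -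
  have "\<forall>c\<in>Obj C. \<forall>S\<in>J c. \<forall>R. is_sieve C c R \<longrightarrow>
      (\<forall>f\<in>S. pullback_sieve C f R \<in> J (Dom C f)) \<longrightarrow> R \<in> J c"
    using topology unfolding grothendieck_topology_def by (elim conjE)
  then show ?thesis using assms by blast
qed

lemma sieve_pullback:
  assumes S: "is_sieve C c S" and f: "f \<in> Arr C"
  shows "is_sieve C (Dom C f) (pullback_sieve C f S)"
  unfolding is_sieve_def
proof (intro conjI ballI impI)
  fix g assume "g \<in> pullback_sieve C f S"
  then show "g \<in> Arr C" "Cod C g = Dom C f" by (auto simp: pullback_sieve_def)
next
  fix g h assume g: "g \<in> pullback_sieve C f S" and h: "h \<in> Arr C" "Cod C h = Dom C g"
  then have g': "g \<in> Arr C" "Cod C g = Dom C f" "f \<cdot> g \<in> S" by (auto simp: pullback_sieve_def)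
  have "(f \<cdot> g) \<cdot> h \<in> S"
    using S g' h f unfolding is_sieve_def by (simp add: Dom_Comp)
  then show "g \<cdot> h \<in> pullback_sieve C f S"
    using g' h f by (simp add: pullback_sieve_def cat_simps)
qed

lemma cov_superset:
  assumes "S \<in> J c" "c \<in> Obj C" "is_sieve C c R" "S \<subseteq> R"
  shows "R \<in> J c"
proof (rule cov_trans[OF assms(2,1,3)])
  fix f assume f: "f \<in> S"
  then have fA: "f \<in> Arr C" using cov_Arr assms by blast
  have "pullback_sieve C f R = {g \<in> Arr C. Cod C g = Dom C f}"
    using cov_Comp[OF assms(1,2) f] assms(4) unfolding pullback_sieve_def by auto
  then show "pullback_sieve C f R \<in> J (Dom C f)"
    using cov_max[of "Dom C f"] fA Dom_in_Obj by simp
qed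

lemma cov_inter:
  assumes "S \<in> J c" "R \<in> J c" "c \<in> Obj C"
  shows "S \<inter> R \<in> J c"
proof (rule cov_trans[OF assms(3,1)])
  show "is_sieve C c (S \<inter> R)"
    using cov_sieve assms unfolding is_sieve_def by blast
  fix f assume f: "f \<in> S"
  then have fA: "f \<in> Arr C" "Cod C f = c" using cov_Arr cov_Cod assms by blast+
  have "pullback_sieve C f (S \<inter> R) = pullback_sieve C f R"
    using cov_Comp[OF assms(1,3) f] unfolding pullback_sieve_def by auto
  then show "pullback_sieve C f (S \<inter> R) \<in> J (Dom C f)"
    using cov_pullback[OF fA refl assms(2)] by simp
qed

text \<open>Transitivity of covers phrased for a predicate: the sieve of all arrows satisfying
  \<open>P\<close> pulls back along each \<open>f\<close> in \<open>S\<close> to a sieve that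
  contains the cover \<open>R\<close>.\<close>

lemma cov_locI:
  assumes c: "c \<in> Obj C" and S: "S \<in> J c"
    and stable: "\<And>f g. f \<in> Arr C \<Longrightarrow> Cod C f = c \<Longrightarrow> P f \<Longrightarrow> g \<in> Arr C \<Longrightarrow> Cod C g = Dom C f \<Longrightarrow> P (f \<cdot> g)"
    and loc: "\<And>f. f \<in> S \<Longrightarrow> \<exists>R\<in>J (Dom C f). \<forall>g\<in>R. P (f \<cdot> g)"
  shows "{f \<in> Arr C. Cod C f = c \<and> P f} \<in> J c"
proof (rule cov_trans[OF c S])
  show sv: "is_sieve C c {f \<in> Arr C. Cod C f = c \<and> P f}"
    unfolding is_sieve_def using stable by (auto simp: cat_simps)
  fix f assume f: "f \<in> S"
  have fA: "f \<in> Arr C" "Cod C f = c" using cov_Arr cov_Cod S c f by blast+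
  obtain R where R: "R \<in> J (Dom C f)" "\<forall>g\<in>R. P (f \<cdot> g)" using loc[OF f] by blast
  have d: "Dom C f \<in> Obj C" using fA Dom_in_Obj by blast
  show "pullback_sieve C f {f \<in> Arr C. Cod C f = c \<and> P f} \<in> J (Dom C f)"
  proof (rule cov_superset[OF R(1) d sieve_pullback[OF sv fA(1)]])
    show "R \<subseteq> pullback_sieve C f {f \<in> Arr C. Cod C f = c \<and> P f}"
      using R(2) cov_Arr[OF R(1) d] cov_Cod[OF R(1) d] fA unfolding pullback_sieve_def
      by (auto simp: cat_simps)
  qed
qed

lemma cov_pullbackI:
  assumes f: "f \<in> Arr C" and S: "{g \<in> Arr C. Cod C g = Cod C f \<and> P g} \<in> J (Cod C f)"
  shows "{g \<in> Arr C. Cod C g = Dom C f \<and> P (f \<cdot> g)} \<in> J (Dom C f)"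
proof -
  have "pullback_sieve C f {g \<in> Arr C. Cod C g = Cod C f \<and> P g} =
      {g \<in> Arr C. Cod C g = Dom C f \<and> P (f \<cdot> g)}"
    using f unfolding pullback_sieve_def by (auto simp: cat_simps)
  then show ?thesis using cov_pullback[OF f refl refl S] by simp
qed

lemma shf_sep:
  assumes "shf P r" "c \<in> Obj C" "S \<in> J c" "x \<in> P c" "y \<in> P c"
    "\<And>f. f \<in> S \<Longrightarrow> r f x = r f y"
  shows "x = y"
proof -
  have p: "psh P r" using assms shf_psh by blast
  have "matching P r S (\<lambda>f. r f x)"
    unfolding matching_def
    using cov_Arr[OF assms(3,2)] cov_Cod[OF assms(3,2)] psh_mem[OF p _ _ assms(4)]
      psh_Comp[OF p] assms(4) by auto
  then have "\<exists>!y. y \<in> P c \<and> (\<forall>f\<in>S. r f y = r f x)"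
    using assms unfolding shf_def by blast
  then show ?thesis using assms by metis
qed

lemma shf_glue:
  assumes "shf P r" "c \<in> Obj C" "S \<in> J c" "matching P r S x"
  shows "\<exists>y\<in>P c. \<forall>f\<in>S. r f y = x f"
  using assms unfolding shf_def by blast

end

text \<open>What is kept of an equivalence between \<open>E\<close> and a category of sheaves: the
  sections of each object and a faithful, full, essentially surjective action of arrows on them.
  From here on, equalities of arrows are checked on sections and arrows are built from natural
  families.\<close>

locale sheaf_rep = site U C J + E: category E
  for U :: "'u itself" and C :: "('u, 'u) cat" (structure) and J and E :: "('o, 'a) cat" +
  fixes sec :: "'o \<Rightarrow> 'u \<Rightarrow> 'u set" and ap :: "'a \<Rightarrow> 'u \<Rightarrow> 'u \<Rightarrow> 'u"
    and rs :: "'o \<Rightarrow> 'u \<Rightarrow> 'u \<Rightarrow> 'u"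
  assumes sec_shf: "X \<in> Obj E \<Longrightarrow> shf (sec X) (rs X)"
    and sec_small: "X \<in> Obj E \<Longrightarrow> c \<in> Obj C \<Longrightarrow> small U (sec X c)"
    and ap_ntr: "f \<in> Hom E X Y \<Longrightarrow> ntr (sec X) (rs X) (sec Y) (rs Y) (ap f)"
    and ap_Ide: "X \<in> Obj E \<Longrightarrow> c \<in> Obj C \<Longrightarrow> x \<in> sec X c \<Longrightarrow> ap (Ide E X) c x = x"
    and ap_Comp: "f \<in> Hom E X Y \<Longrightarrow> g \<in> Hom E Y Z \<Longrightarrow> c \<in> Obj C \<Longrightarrow> x \<in> sec X c \<Longrightarrow>
      ap (g \<cdot>\<^bsub>E\<^esub> f) c x = ap g c (ap f c x)"
    and ap_faithful: "f \<in> Hom E X Y \<Longrightarrow> g \<in> Hom E X Y \<Longrightarrow>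
      (\<And>c x. c \<in> Obj C \<Longrightarrow> x \<in> sec X c \<Longrightarrow> ap f c x = ap g c x) \<Longrightarrow> f = g"
    and ap_full: "X \<in> Obj E \<Longrightarrow> Y \<in> Obj E \<Longrightarrow> ntr (sec X) (rs X) (sec Y) (rs Y) t \<Longrightarrow>
      \<exists>f\<in>Hom E X Y. \<forall>c\<in>Obj C. \<forall>x\<in>sec X c. ap f c x = t c x"
    and ap_ess: "shf (Q :: 'u \<Rightarrow> 'u set) q \<Longrightarrow> (\<And>c. c \<in> Obj C \<Longrightarrow> small U (Q c)) \<Longrightarrow>
      \<exists>X\<in>Obj E. \<exists>\<phi>. ntr Q q (sec X) (rs X) \<phi> \<and> (\<forall>c\<in>Obj C. bij_betw (\<phi> c) (Q c) (sec X c))"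

section \<open>Sections of a Grothendieck topos\<close>

context site
begin

abbreviation "Sh \<equiv> sheaf_cat U C J"

lemma op_simps [simp]: "Obj (op_cat C) = Obj C" "Arr (op_cat C) = Arr C" "Dom (op_cat C) = Cod C"
  "Cod (op_cat C) = Dom C" "Ide (op_cat C) = Ide C" "Comp (op_cat C) g f = f \<cdot> g"
  by (simp_all add: op_cat_def)

lemma category_Sh: "category Sh"
  unfolding sheaf_cat_def presheaf_cat_def
  by (intro category_full_subcat category_fun_cat category_op_cat category_set_cat category_axioms)

lemma psh_functor:
  assumes F: "is_functor (op_cat C) (set_cat U) F"
  shows "psh (OMap F) (restr F)"
    and "g \<in> Arr C \<Longrightarrow> AMap F g = (OMap F (Cod C g), OMap F (Dom C g), restr F g)"
    and "g \<in> Arr C \<Longrightarrow> restr F g \<in> OMap F (Cod C g) \<rightarrow>\<^sub>E OMap F (Dom C g)"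
proof -
  have A: "AMap F g = (OMap F (Cod C g), OMap F (Dom C g), restr F g) \<and>
      restr F g \<in> OMap F (Cod C g) \<rightarrow>\<^sub>E OMap F (Dom C g)" if "g \<in> Arr C" for g
  proof -
    have "AMap F g \<in> Hom (set_cat U) (OMap F (Cod C g)) (OMap F (Dom C g))"
      using F that unfolding is_functor_def by auto
    then show ?thesis by (cases "AMap F g") (auto simp: Hom_def restr_def)
  qed
  then show "g \<in> Arr C \<Longrightarrow> AMap F g = (OMap F (Cod C g), OMap F (Dom C g), restr F g)"
    and "g \<in> Arr C \<Longrightarrow> restr F g \<in> OMap F (Cod C g) \<rightarrow>\<^sub>E OMap F (Dom C g)" by blast+
  show "psh (OMap F) (restr F)"
    unfolding psh_def
  proof (intro conjI ballI impI)
    fix g x assume "g \<in> Arr C" "x \<in> OMap F (Cod C g)"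
    then show "restr F g x \<in> OMap F (Dom C g)" using A by (auto simp: PiE_def Pi_def)
  next
    fix c x assume "c \<in> Obj C" "x \<in> OMap F c"
    moreover from this have "AMap F (Ide C c) = Ide (set_cat U) (OMap F c)"
      using F unfolding is_functor_def by auto
    ultimately show "restr F (Ide C c) x = x" by (simp add: restr_def)
  next
    fix f g x assume fg: "f \<in> Arr C" "g \<in> Arr C" "Cod C g = Dom C f" "x \<in> OMap F (Cod C f)"
    then have "AMap F (f \<cdot> g) = Comp (set_cat U) (AMap F g) (AMap F f)"
      using F unfolding is_functor_def by auto
    then show "restr F (f \<cdot> g) x = restr F g (restr F f x)"
      using A[OF fg(1)] A[OF fg(2)] A[of "f \<cdot> g"] fg by (auto simp: cat_simps compose_def)
  qed
qed

lemma Sh_Obj: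
  "F \<in> Obj Sh \<longleftrightarrow> is_functor (op_cat C) (set_cat U) F \<and> OMap F \<in> extensional (Obj C) \<and>
     AMap F \<in> extensional (Arr C) \<and> is_sheaf C J F"
  by (simp add: sheaf_cat_def presheaf_cat_def full_subcat_simps fun_cat_Obj)

lemma Sh_shf: "F \<in> Obj Sh \<Longrightarrow> shf (OMap F) (restr F)"
  using psh_functor(1)[of F]
  by (simp add: Sh_Obj is_sheaf_def shf_def matching_family_def matching_def)

lemma Sh_simps:
  "Hom Sh F G = {(F', G', t). F' = F \<and> G' = G \<and> F \<in> Obj Sh \<and> G \<in> Obj Sh \<and>
     nat_trans (op_cat C) (set_cat U) F G t \<and> t \<in> extensional (Obj C)}"
  "Comp Sh (G', H, s) (F, G, t) = (F, H, restrict (\<lambda>X. Comp (set_cat U) (s X) (t X)) (Obj C))"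
  "Ide Sh F = (F, F, restrict (\<lambda>X. Ide (set_cat U) (OMap F X)) (Obj C))"
  by (auto simp: Hom_def sheaf_cat_def presheaf_cat_def full_subcat_simps fun_cat_simps)

text \<open>An arrow of the sheaf category is a triple \<open>(F, G, t)\<close>, and each component
  \<open>t c\<close> is again a triple of source, target and function; the innermost function acts
  on sections.\<close>

definition Sap where "Sap f c x = snd (snd (snd (snd f) c)) x"

lemma nat_trans_Sh:
  assumes "nat_trans (op_cat C) (set_cat U) F G t" "c \<in> Obj C"
  shows "t c = (OMap F c, OMap G c, snd (snd (t c)))" "snd (snd (t c)) \<in> OMap F c \<rightarrow>\<^sub>E OMap G c"
proof -
  have "t c \<in> Hom (set_cat U) (OMap F c) (OMap G c)"
    using assms unfolding nat_trans_def by auto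
  then show "t c = (OMap F c, OMap G c, snd (snd (t c)))"
    "snd (snd (t c)) \<in> OMap F c \<rightarrow>\<^sub>E OMap G c"
    by (cases "t c"; auto simp: Hom_def)+
qed

lemma Sap_ntr:
  assumes f: "f \<in> Hom Sh F G"
  shows "ntr (OMap F) (restr F) (OMap G) (restr G) (Sap f)"
proof -
  obtain t where t: "f = (F, G, t)" "nat_trans (op_cat C) (set_cat U) F G t"
      and FG: "F \<in> Obj Sh" "G \<in> Obj Sh"
    using f by (auto simp: Sh_simps)
  note n = nat_trans_Sh[OF t(2)]
  show ?thesis
    unfolding ntr_def
  proof (intro conjI ballI)
    fix c x assume "c \<in> Obj C" "x \<in> OMap F c"
    then show "Sap f c x \<in> OMap G c" using n(2) by (auto simp: Sap_def t(1) PiE_def Pi_def)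
  next
    fix g x assume g: "g \<in> Arr C" and x: "x \<in> OMap F (Cod C g)"
    have FF: "is_functor (op_cat C) (set_cat U) F" "is_functor (op_cat C) (set_cat U) G"
      using FG by (auto simp: Sh_Obj)
    define \<tau> where "\<tau> c = snd (snd (t c))" for c
    have e: "t (Dom C g) = (OMap F (Dom C g), OMap G (Dom C g), \<tau> (Dom C g))"
      "t (Cod C g) = (OMap F (Cod C g), OMap G (Cod C g), \<tau> (Cod C g))"
      unfolding \<tau>_def by (rule n(1)[OF Dom_in_Obj[OF g]], rule n(1)[OF Cod_in_Obj[OF g]])
    have "Comp (set_cat U) (t (Cod (op_cat C) g)) (AMap F g) =
        Comp (set_cat U) (AMap G g) (t (Dom (op_cat C) g))"
      using t(2) g unfolding nat_trans_def by simp
    then have "compose (OMap F (Cod C g)) (\<tau> (Dom C g)) (restr F g) =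
        compose (OMap F (Cod C g)) (restr G g) (\<tau> (Cod C g))"
      unfolding op_simps e psh_functor(2)[OF FF(1) g] psh_functor(2)[OF FF(2) g] set_cat_simps(6)
      by simp
    from fun_cong[OF this, of x]
    show "Sap f (Dom C g) (restr F g x) = restr G g (Sap f (Cod C g) x)"
      using x by (simp add: Sap_def t(1) compose_def \<tau>_def)
  qed
qed

lemma Sap_full:
  assumes FG: "F \<in> Obj Sh" "G \<in> Obj Sh" and n: "ntr (OMap F) (restr F) (OMap G) (restr G) n"
  shows "\<exists>f\<in>Hom Sh F G. \<forall>c\<in>Obj C. \<forall>x\<in>OMap F c. Sap f c x = n c x"
proof -
  define t where "t = restrict (\<lambda>c. (OMap F c, OMap G c, restrict (n c) (OMap F c))) (Obj C)"
  have F: "is_functor (op_cat C) (set_cat U) F" and G: "is_functor (op_cat C) (set_cat U) G"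
    using FG by (auto simp: Sh_Obj)
  have sm: "small U (OMap F c)" "small U (OMap G c)" if "c \<in> Obj C" for c
    using F G that unfolding is_functor_def by auto
  have "nat_trans (op_cat C) (set_cat U) F G t"
    unfolding nat_trans_def
  proof (intro conjI ballI)
    fix c assume "c \<in> Obj (op_cat C)"
    then show "t c \<in> Hom (set_cat U) (OMap F c) (OMap G c)"
      using sm ntr_mem[OF n] by (auto simp: t_def Hom_def)
  next
    fix g assume "g \<in> Arr (op_cat C)"
    then have g: "g \<in> Arr C" by simp
    note g' = Dom_in_Obj[OF g] Cod_in_Obj[OF g]
    have "compose (OMap F (Cod C g)) (restrict (n (Dom C g)) (OMap F (Dom C g))) (restr F g) =
        compose (OMap F (Cod C g)) (restr G g) (restrict (n (Cod C g)) (OMap F (Cod C g)))"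
      using ntr_nat[OF n g refl refl] psh_mem[OF psh_functor(1)[OF F] g refl _ refl]
      by (auto simp: compose_def fun_eq_iff)
    then have "Comp (set_cat U) (t (Dom C g)) (AMap F g) = Comp (set_cat U) (AMap G g) (t (Cod C g))"
      using g' by (simp add: t_def psh_functor(2)[OF F g] psh_functor(2)[OF G g])
    then show "Comp (set_cat U) (t (Cod (op_cat C) g)) (AMap F g) =
        Comp (set_cat U) (AMap G g) (t (Dom (op_cat C) g))" by simp
  qed
  then have "(F, G, t) \<in> Hom Sh F G"
    using FG by (simp add: Sh_simps t_def)
  moreover have "\<forall>c\<in>Obj C. \<forall>x\<in>OMap F c. Sap (F, G, t) c x = n c x"
    by (simp add: Sap_def t_def)
  ultimately show ?thesis by blast
qed

lemma Sap_faithful: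
  assumes f: "f \<in> Hom Sh F G" and g: "g \<in> Hom Sh F G"
    and eq: "\<And>c x. c \<in> Obj C \<Longrightarrow> x \<in> OMap F c \<Longrightarrow> Sap f c x = Sap g c x"
  shows "f = g"
proof -
  obtain t s where t: "f = (F, G, t)" "nat_trans (op_cat C) (set_cat U) F G t" "t \<in> extensional (Obj C)"
    and s: "g = (F, G, s)" "nat_trans (op_cat C) (set_cat U) F G s" "s \<in> extensional (Obj C)"
    using f g by (auto simp: Sh_simps)
  have "t c = s c" if c: "c \<in> Obj C" for c
  proof -
    have "snd (snd (t c)) = snd (snd (s c))"
      using nat_trans_Sh(2)[OF t(2) c] nat_trans_Sh(2)[OF s(2) c] eq[OF c]
      by (intro PiE_ext) (auto simp: Sap_def t s)
    then show ?thesis using nat_trans_Sh(1)[OF t(2) c] nat_trans_Sh(1)[OF s(2) c] by simp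
  qed
  then have "t = s" using t(3) s(3) by (meson extensionalityI)
  then show ?thesis using t s by simp
qed

lemma Sap_Comp:
  assumes f: "f \<in> Hom Sh F G" and g: "g \<in> Hom Sh G H" and c: "c \<in> Obj C" "x \<in> OMap F c"
  shows "Sap (Comp Sh g f) c x = Sap g c (Sap f c x)"
proof -
  obtain t s where t: "f = (F, G, t)" "nat_trans (op_cat C) (set_cat U) F G t"
    and s: "g = (G, H, s)" "nat_trans (op_cat C) (set_cat U) G H s"
    using f g by (auto simp: Sh_simps)
  have "Comp (set_cat U) (s c) (t c) = (OMap F c, OMap H c, compose (OMap F c) (snd (snd (s c))) (snd (snd (t c))))"
    using nat_trans_Sh(1)[OF t(2) c(1)] nat_trans_Sh(1)[OF s(2) c(1)] set_cat_simps(6) by metis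
  then show ?thesis using c by (simp add: t(1) s(1) Sh_simps Sap_def compose_def)
qed

lemma Sap_Ide: "c \<in> Obj C \<Longrightarrow> x \<in> OMap F c \<Longrightarrow> Sap (Ide Sh F) c x = x"
  by (simp add: Sh_simps Sap_def)

text \<open>Objects of the sheaf category carry extensional data, so the given sheaf is cut down to
  the objects and arrows of the site, and each restriction map to its set of sections.\<close>

lemma Sh_make:
  assumes Q: "shf Q q" and sm: "\<And>c. c \<in> Obj C \<Longrightarrow> small U (Q c)"
  obtains F where "F \<in> Obj Sh" "\<And>c. c \<in> Obj C \<Longrightarrow> OMap F c = Q c"
    "\<And>g x. g \<in> Arr C \<Longrightarrow> x \<in> Q (Cod C g) \<Longrightarrow> restr F g x = q g x"
proof
  define F where "F = \<lparr>OMap = restrict Q (Obj C),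
    AMap = restrict (\<lambda>g. (Q (Cod C g), Q (Dom C g), restrict (q g) (Q (Cod C g)))) (Arr C)\<rparr>"
  have p: "psh Q q" using Q shf_psh by blast
  show O: "OMap F c = Q c" if "c \<in> Obj C" for c using that by (simp add: F_def)
  show R: "restr F g x = q g x" if "g \<in> Arr C" "x \<in> Q (Cod C g)" for g x
    using that by (simp add: F_def restr_def)
  have "is_functor (op_cat C) (set_cat U) F"
    unfolding is_functor_def
  proof (intro conjI ballI impI)
    fix c assume "c \<in> Obj (op_cat C)"
    then show "OMap F c \<in> Obj (set_cat U)" using O sm by simp
  next
    fix g assume "g \<in> Arr (op_cat C)"
    then show "AMap F g \<in> Hom (set_cat U) (OMap F (Dom (op_cat C) g)) (OMap F (Cod (op_cat C) g))"
      using psh_mem[OF p _ refl _ refl] sm O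
      by (auto simp: F_def Hom_def Dom_in_Obj Cod_in_Obj)
  next
    fix c assume "c \<in> Obj (op_cat C)"
    then have c: "c \<in> Obj C" by simp
    have "restrict (q (Ide C c)) (Q c) = restrict (\<lambda>x. x) (Q c)"
      using psh_Ide[OF p c] by (rule restrict_ext)
    then show "AMap F (Ide (op_cat C) c) = Ide (set_cat U) (OMap F c)"
      using c by (simp add: F_def cat_simps)
  next
    fix f g assume "f \<in> Arr (op_cat C)" "g \<in> Arr (op_cat C)" "Cod (op_cat C) f = Dom (op_cat C) g"
    then have fg: "f \<in> Arr C" "g \<in> Arr C" "Cod C g = Dom C f" by auto
    have "restrict (q (f \<cdot> g)) (Q (Cod C f)) =
        compose (Q (Cod C f)) (restrict (q g) (Q (Cod C g))) (restrict (q f) (Q (Cod C f)))"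
      using psh_Comp[OF p fg(1,2,3)] psh_mem[OF p fg(1) refl _ refl] fg(3)
      by (auto simp: compose_def fun_eq_iff)
    then show "AMap F (Comp (op_cat C) g f) = Comp (set_cat U) (AMap F g) (AMap F f)"
      using fg by (simp add: F_def cat_simps)
  qed
  moreover have "is_sheaf C J F"
    unfolding is_sheaf_def
  proof (intro ballI allI impI)
    fix c S x assume c: "c \<in> Obj C" and S: "S \<in> J c" and m: "matching_family C F S x"
    have "matching Q q S x"
      using m c S O R cov_Arr[OF S c] unfolding matching_family_def matching_def
      by (simp add: Dom_in_Obj)
    then have "\<exists>!y. y \<in> Q c \<and> (\<forall>f\<in>S. q f y = x f)"
      using Q c S unfolding shf_def by blast
    moreover have "(y \<in> Q c \<and> (\<forall>f\<in>S. q f y = x f)) \<longleftrightarrow> (y \<in> OMap F c \<and> (\<forall>f\<in>S. restr F f y = x f))" for y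
      using O[OF c] R cov_Arr[OF S c] cov_Cod[OF S c] by auto
    ultimately show "\<exists>!y. y \<in> OMap F c \<and> (\<forall>f\<in>S. restr F f y = x f)" by simp
  qed
  ultimately show "F \<in> Obj Sh"
    by (simp add: Sh_Obj) (simp add: F_def)
qed

end

theorem sheaf_rep_exists:
  assumes U: "universe (U :: 'u itself)" and E: "grothendieck_topos U E"
  obtains C :: "('u, 'u) cat" and J sec ap rs where "sheaf_rep U C J E sec ap rs"
proof -
  obtain C :: "('u, 'u) cat" and J where CJ: "small_category U C" "grothendieck_topology C J"
      "equivalent_categories E (sheaf_cat U C J)"
    using E unfolding grothendieck_topos_def by blast
  interpret E: category E using E unfolding grothendieck_topos_def by blast
  interpret site U C J
    using U CJ
    by (auto simp: site_def site_axioms_def universe_type_def small_category_def)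
  interpret Sh: category Sh by (rule category_Sh)
  obtain F where F: "is_functor E Sh F" "faithful E Sh F" "full E Sh F"
    and ess: "\<And>Y. Y \<in> Obj Sh \<Longrightarrow> \<exists>X\<in>Obj E. \<exists>f\<in>Hom Sh (OMap F X) Y. is_iso Sh f"
    using equivalent_categoriesE[OF CJ(3) E.category_axioms category_Sh] by blast
  have FO: "OMap F X \<in> Obj Sh" if "X \<in> Obj E" for X
    using F that unfolding is_functor_def by blast
  have FA: "AMap F f \<in> Hom Sh (OMap F X) (OMap F Y)" if "f \<in> Hom E X Y" for f X Y
    using F that unfolding is_functor_def Hom_def by blast
  have HO: "X \<in> Obj E" "Y \<in> Obj E" if "f \<in> Hom E X Y" for f X Y
    using that E.Dom_in_Obj E.Cod_in_Obj unfolding Hom_def by blast+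
  have "sheaf_rep U C J E (\<lambda>X. OMap (OMap F X)) (\<lambda>f. Sap (AMap F f)) (\<lambda>X. restr (OMap F X))"
  proof
    fix X assume "X \<in> Obj E"
    then show "shf (OMap (OMap F X)) (restr (OMap F X))" using FO Sh_shf by blast
  next
    fix X c assume "X \<in> Obj E" "c \<in> Obj C"
    then show "small U (OMap (OMap F X) c)"
      using FO by (auto simp: Sh_Obj is_functor_def)
  next
    fix f X Y assume "f \<in> Hom E X Y"
    then show "ntr (OMap (OMap F X)) (restr (OMap F X)) (OMap (OMap F Y)) (restr (OMap F Y))
        (Sap (AMap F f))"
      using FA Sap_ntr by blast
  next
    fix X c x assume "X \<in> Obj E" "c \<in> Obj C" "x \<in> OMap (OMap F X) c"
    then show "Sap (AMap F (Ide E X)) c x = x"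
      using F Sap_Ide unfolding is_functor_def by simp
  next
    fix f X Y g Z c x
    assume a: "f \<in> Hom E X Y" "g \<in> Hom E Y Z" "c \<in> Obj C" "x \<in> OMap (OMap F X) c"
    then have "AMap F (g \<cdot>\<^bsub>E\<^esub> f) = Comp Sh (AMap F g) (AMap F f)"
      using F(1) unfolding is_functor_def Hom_def by auto
    then show "Sap (AMap F (g \<cdot>\<^bsub>E\<^esub> f)) c x = Sap (AMap F g) c (Sap (AMap F f) c x)"
      using Sap_Comp[OF FA[OF a(1)] FA[OF a(2)] a(3,4)] by simp
  next
    fix f X Y g
    assume a: "f \<in> Hom E X Y" "g \<in> Hom E X Y"
      "\<And>c x. c \<in> Obj C \<Longrightarrow> x \<in> OMap (OMap F X) c \<Longrightarrow> Sap (AMap F f) c x = Sap (AMap F g) c x"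
    then have "AMap F f = AMap F g" using Sap_faithful[OF FA[OF a(1)] FA[OF a(2)]] by blast
    then show "f = g" using F(2) a HO[OF a(1)] unfolding faithful_def by (meson inj_onD)
  next
    fix X Y t
    assume a: "X \<in> Obj E" "Y \<in> Obj E"
      "ntr (OMap (OMap F X)) (restr (OMap F X)) (OMap (OMap F Y)) (restr (OMap F Y)) t"
    obtain f' where f': "f' \<in> Hom Sh (OMap F X) (OMap F Y)"
        "\<forall>c\<in>Obj C. \<forall>x\<in>OMap (OMap F X) c. Sap f' c x = t c x"
      using Sap_full[OF FO[OF a(1)] FO[OF a(2)] a(3)] by blast
    obtain f where "f \<in> Hom E X Y" "f' = AMap F f"
      using F(3) a f'(1) unfolding full_def by blast
    then show "\<exists>f\<in>Hom E X Y. \<forall>c\<in>Obj C. \<forall>x\<in>OMap (OMap F X) c. Sap (AMap F f) c x = t c x"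
      using f'(2) by blast
  next
    fix Q :: "'u \<Rightarrow> 'u set" and q
    assume Q: "shf Q q" "\<And>c. c \<in> Obj C \<Longrightarrow> small U (Q c)"
    obtain G where G: "G \<in> Obj Sh" "\<And>c. c \<in> Obj C \<Longrightarrow> OMap G c = Q c"
        "\<And>g x. g \<in> Arr C \<Longrightarrow> x \<in> Q (Cod C g) \<Longrightarrow> restr G g x = q g x"
      using Sh_make[OF Q] by blast
    \<comment> \<open>The given sheaf is only isomorphic to the image of an object; the bijection on
      sections is the inverse \<open>k\<close> of that isomorphism.\<close>
    obtain X f where X: "X \<in> Obj E" and f: "f \<in> Hom Sh (OMap F X) G" "is_iso Sh f"
      using ess[OF G(1)] by blast
    obtain k where k: "k \<in> Hom Sh G (OMap F X)" "Comp Sh k f = Ide Sh (OMap F X)"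
        "Comp Sh f k = Ide Sh G"
      using f unfolding is_iso_def Hom_def by auto
    have kn: "ntr (OMap G) (restr G) (OMap (OMap F X)) (restr (OMap F X)) (Sap k)"
      using Sap_ntr[OF k(1)] .
    have fn: "ntr (OMap (OMap F X)) (restr (OMap F X)) (OMap G) (restr G) (Sap f)"
      using Sap_ntr[OF f(1)] .
    have "ntr Q q (OMap (OMap F X)) (restr (OMap F X)) (Sap k)"
      using kn G(2,3) unfolding ntr_def by (auto simp: Dom_in_Obj Cod_in_Obj)
    moreover have "bij_betw (Sap k c) (Q c) (OMap (OMap F X) c)" if c: "c \<in> Obj C" for c
    proof (rule bij_betw_byWitness[where f' = "Sap f c"])
      show "\<forall>x\<in>Q c. Sap f c (Sap k c x) = x"
        using Sap_Comp[OF k(1) f(1) c] Sap_Ide[OF c, of _ G] k(3) G(2)[OF c] by simp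
      show "\<forall>x\<in>OMap (OMap F X) c. Sap k c (Sap f c x) = x"
        using Sap_Comp[OF f(1) k(1) c] Sap_Ide[OF c, of _ "OMap F X"] k(2) by simp
      show "Sap k c ` Q c \<subseteq> OMap (OMap F X) c" "Sap f c ` OMap (OMap F X) c \<subseteq> Q c"
        using ntr_mem[OF kn c] ntr_mem[OF fn c] G(2)[OF c] by auto
    qed
    ultimately show "\<exists>X\<in>Obj E. \<exists>\<phi>. ntr Q q (OMap (OMap F X)) (restr (OMap F X)) \<phi> \<and>
        (\<forall>c\<in>Obj C. bij_betw (\<phi> c) (Q c) (OMap (OMap F X) c))"
      using X by blast
  qed
  then show ?thesis using that by blast
qed

section \<open>Constructing objects from sheaves\<close>

context site
begin

lemma ntr_inv:
  assumes P: "psh P r" and t: "ntr P r Q q t" and bij: "\<And>c. c \<in> Obj C \<Longrightarrow> bij_betw (t c) (P c) (Q c)"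
  shows "ntr Q q P r (\<lambda>c. inv_into (P c) (t c))"
  unfolding ntr_def
proof (intro conjI ballI)
  fix c x assume "c \<in> Obj C" "x \<in> Q c"
  then show "inv_into (P c) (t c) x \<in> P c" using bij by (metis bij_betw_def inv_into_into)
next
  fix g x assume g: "g \<in> Arr C" and x: "x \<in> Q (Cod C g)"
  have c: "Cod C g \<in> Obj C" "Dom C g \<in> Obj C" using g Cod_in_Obj Dom_in_Obj by auto
  obtain y where y: "y \<in> P (Cod C g)" "x = t (Cod C g) y"
    using bij[OF c(1)] x unfolding bij_betw_def by blast
  have "inv_into (P (Cod C g)) (t (Cod C g)) x = y"
    using y bij[OF c(1)] by (simp add: bij_betw_def)
  moreover have "q g x = t (Dom C g) (r g y)" using ntr_nat[OF t g refl refl y(1)] y by simp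
  ultimately show "inv_into (P (Dom C g)) (t (Dom C g)) (q g x) = r g (inv_into (P (Cod C g)) (t (Cod C g)) x)"
    using bij[OF c(2)] psh_mem[OF P g refl y(1) refl] by (simp add: bij_betw_def)
qed

lemma ntr_comp: "ntr P r Q q t \<Longrightarrow> ntr Q q R w s \<Longrightarrow> ntr P r R w (\<lambda>c x. s c (t c x))"
  unfolding ntr_def by (simp add: Cod_in_Obj)

text \<open>A matching family is moved to \<open>P\<close> by the inverse transformation, glued
  there and moved back.\<close>

lemma shf_transfer:
  assumes P: "shf P r" and t: "ntr P r Q q t" and bij: "\<And>c. c \<in> Obj C \<Longrightarrow> bij_betw (t c) (P c) (Q c)"
    and Q: "psh Q q"
  shows "shf Q q"
  unfolding shf_def
proof (intro conjI ballI allI impI Q)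
  fix c S x assume c: "c \<in> Obj C" and S: "S \<in> J c" and m: "matching Q q S x"
  have p: "psh P r" using P shf_psh by blast
  let ?i = "\<lambda>c. inv_into (P c) (t c)"
  note i = ntr_inv[OF p t bij]
  have SA: "f \<in> Arr C" "Cod C f = c" "Dom C f \<in> Obj C" if "f \<in> S" for f
    using cov_Arr[OF S c that] cov_Cod[OF S c that] Dom_in_Obj by auto
  have ti: "t d (?i d y) = y" if "d \<in> Obj C" "y \<in> Q d" for d y
    using bij[OF that(1)] that(2) by (simp add: bij_betw_def f_inv_into_f)
  have "matching P r S (\<lambda>f. ?i (Dom C f) (x f))"
    unfolding matching_def
  proof (intro conjI ballI impI)
    fix f assume f: "f \<in> S"
    then have xf: "x f \<in> Q (Dom C f)" using m unfolding matching_def by blast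
    then show "?i (Dom C f) (x f) \<in> P (Dom C f)" using ntr_mem[OF i] SA f by blast
    fix g assume g: "g \<in> Arr C" "Cod C g = Dom C f"
    then have "x (f \<cdot> g) = q g (x f)" using m f unfolding matching_def by blast
    then show "?i (Dom C (f \<cdot> g)) (x (f \<cdot> g)) = r g (?i (Dom C f) (x f))"
      using ntr_nat[OF i g refl xf] g SA f by (simp add: cat_simps)
  qed
  then obtain y where y: "y \<in> P c" "\<forall>f\<in>S. r f y = ?i (Dom C f) (x f)"
    using shf_glue[OF P c S] by blast
  have "t c y \<in> Q c \<and> (\<forall>f\<in>S. q f (t c y) = x f)"
  proof (intro conjI ballI)
    show "t c y \<in> Q c" using ntr_mem[OF t c y(1)] .
    fix f assume f: "f \<in> S"
    have "q f (t c y) = t (Dom C f) (r f y)" using ntr_nat[OF t SA(1,2)[OF f] refl y(1)] by simp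
    also have "\<dots> = x f" using y(2) f ti SA m unfolding matching_def by simp
    finally show "q f (t c y) = x f" .
  qed
  moreover have "z = z'" if z: "z \<in> Q c \<and> (\<forall>f\<in>S. q f z = x f)" and z': "z' \<in> Q c \<and> (\<forall>f\<in>S. q f z' = x f)" for z z'
  proof -
    have "?i c z = ?i c z'"
    proof (rule shf_sep[OF P c S])
      show "?i c z \<in> P c" "?i c z' \<in> P c" using ntr_mem[OF i c] z z' by auto
      fix f assume f: "f \<in> S"
      show "r f (?i c z) = r f (?i c z')"
        using ntr_nat[OF i SA(1,2)[OF f] refl, of z] ntr_nat[OF i SA(1,2)[OF f] refl, of z'] z z' f
        by simp
    qed
    then show ?thesis using ti[OF c] z z' by metis
  qed
  ultimately show "\<exists>!y. y \<in> Q c \<and> (\<forall>f\<in>S. q f y = x f)" by blast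
qed

end

context sheaf_rep
begin

text \<open>\<open>ap_ess\<close> is about sheaves with elements in \<open>'u\<close>. A sheaf of
  small sets over another type is recoded fibre by fibre, with restriction maps conjugated by the
  codes.\<close>

lemma make_obj:
  fixes Q :: "'u \<Rightarrow> 'p set"
  assumes Q: "shf Q q" and sm: "\<And>c. c \<in> Obj C \<Longrightarrow> small U (Q c)"
  shows "\<exists>X\<in>Obj E. \<exists>\<phi>. ntr Q q (sec X) (rs X) \<phi> \<and> (\<forall>c\<in>Obj C. bij_betw (\<phi> c) (Q c) (sec X c))"
proof -
  have "\<forall>c. \<exists>e :: 'p \<Rightarrow> 'u. c \<in> Obj C \<longrightarrow> inj_on e (Q c)"
    using small_embed sm by blast
  then obtain e :: "'u \<Rightarrow> 'p \<Rightarrow> 'u" where e: "\<And>c. c \<in> Obj C \<Longrightarrow> inj_on (e c) (Q c)" by metis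
  define Q' where "Q' c = e c ` Q c" for c
  define q' where "q' g y = e (Dom C g) (q g (inv_into (Q (Cod C g)) (e (Cod C g)) y))" for g y
  have p: "psh Q q" using Q shf_psh by blast
  have q': "q' g (e c x) = e (Dom C g) (q g x)" if "g \<in> Arr C" "Cod C g = c" "x \<in> Q c" for g x c
    using that e[OF Cod_in_Obj[OF that(1)]] unfolding q'_def by simp
  have n: "ntr Q q Q' q' e"
    unfolding ntr_def using q' by (auto simp: Q'_def)
  have b: "bij_betw (e c) (Q c) (Q' c)" if "c \<in> Obj C" for c
    using e[OF that] by (simp add: Q'_def bij_betw_def)
  have "psh Q' q'"
    unfolding psh_def Q'_def
    using q' psh_mem[OF p _ refl _ refl] psh_Ide[OF p] psh_Comp[OF p]
    by (auto simp: cat_simps)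
  then have "shf Q' q'" using shf_transfer[OF Q n b] by blast
  moreover have "small U (Q' c)" if "c \<in> Obj C" for c
    unfolding Q'_def using small_image sm[OF that] by blast
  ultimately obtain X \<phi> where X: "X \<in> Obj E" "ntr Q' q' (sec X) (rs X) \<phi>"
      "\<And>c. c \<in> Obj C \<Longrightarrow> bij_betw (\<phi> c) (Q' c) (sec X c)"
    using ap_ess by metis
  have "ntr Q q (sec X) (rs X) (\<lambda>c x. \<phi> c (e c x))" using ntr_comp[OF n X(2)] .
  moreover have "bij_betw (\<lambda>x. \<phi> c (e c x)) (Q c) (sec X c)" if "c \<in> Obj C" for c
    using bij_betw_trans[OF b X(3)] that by (simp add: comp_def)
  ultimately show ?thesis using X(1) by blast
qed

lemma sec_psh: "X \<in> Obj E \<Longrightarrow> psh (sec X) (rs X)"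
  using sec_shf shf_psh by blast

lemma Hom_Obj: "f \<in> Hom E X Y \<Longrightarrow> X \<in> Obj E" "f \<in> Hom E X Y \<Longrightarrow> Y \<in> Obj E"
  using E.Dom_in_Obj E.Cod_in_Obj unfolding Hom_def by auto

lemma ap_mem: "f \<in> Hom E X Y \<Longrightarrow> c \<in> Obj C \<Longrightarrow> x \<in> sec X c \<Longrightarrow> ap f c x \<in> sec Y c"
  using ntr_mem[OF ap_ntr] .

lemma ap_nat: "f \<in> Hom E X Y \<Longrightarrow> g \<in> Arr C \<Longrightarrow> Cod C g = c \<Longrightarrow> Dom C g = d \<Longrightarrow> x \<in> sec X c \<Longrightarrow>
    ap f d (rs X g x) = rs Y g (ap f c x)"
  using ntr_nat[OF ap_ntr] .

lemma mono_if_inj: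
  assumes m: "m \<in> Hom E X Y" and inj: "\<And>c. c \<in> Obj C \<Longrightarrow> inj_on (ap m c) (sec X c)"
  shows "is_mono E m"
  unfolding is_mono_def
proof (intro conjI ballI impI)
  show "m \<in> Arr E" using m by (simp add: Hom_def)
  fix f g assume "f \<in> Arr E" "g \<in> Arr E" "Dom E f = Dom E g" "Cod E f = Dom E m" "Cod E g = Dom E m"
    and eq: "m \<cdot>\<^bsub>E\<^esub> f = m \<cdot>\<^bsub>E\<^esub> g"
  then have fg: "f \<in> Hom E (Dom E f) X" "g \<in> Hom E (Dom E f) X" using m by (auto simp: Hom_def)
  show "f = g"
  proof (rule ap_faithful[OF fg])
    fix c x assume cx: "c \<in> Obj C" "x \<in> sec (Dom E f) c"
    have "ap m c (ap f c x) = ap m c (ap g c x)"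
      using ap_Comp[OF fg(1) m cx] ap_Comp[OF fg(2) m cx] eq by simp
    then show "ap f c x = ap g c x" using inj[OF cx(1)] ap_mem fg cx by (meson inj_onD)
  qed
qed

text \<open>Families in \<open>A\<close> are glued in the ambient sheaf; the locality assumption
  \<open>loc\<close> keeps the result inside \<open>A\<close>, so \<open>A\<close> is a sheaf and
  hence comes from an object.\<close>

lemma subobject:
  assumes X: "X \<in> Obj E" and A: "\<And>c. c \<in> Obj C \<Longrightarrow> A c \<subseteq> sec X c"
    and st: "\<And>g x. g \<in> Arr C \<Longrightarrow> x \<in> A (Cod C g) \<Longrightarrow> rs X g x \<in> A (Dom C g)"
    and loc: "\<And>c S x. c \<in> Obj C \<Longrightarrow> S \<in> J c \<Longrightarrow> x \<in> sec X c \<Longrightarrow> (\<And>f. f \<in> S \<Longrightarrow> rs X f x \<in> A (Dom C f)) \<Longrightarrow>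
      x \<in> A c"
  shows "\<exists>Y m. m \<in> Hom E Y X \<and> is_mono E m \<and> (\<forall>c\<in>Obj C. bij_betw (ap m c) (sec Y c) (A c))"
proof -
  note sh = sec_shf[OF X] and p = sec_psh[OF X]
  have pA: "psh A (rs X)"
    unfolding psh_def
  proof (intro conjI ballI impI)
    fix g x assume "g \<in> Arr C" "x \<in> A (Cod C g)"
    then show "rs X g x \<in> A (Dom C g)" using st by blast
  next
    fix c x assume "c \<in> Obj C" "x \<in> A c"
    then show "rs X (Ide C c) x = x" using psh_Ide[OF p] A by blast
  next
    fix f g x assume "f \<in> Arr C" "g \<in> Arr C" "Cod C g = Dom C f" "x \<in> A (Cod C f)"
    then show "rs X (f \<cdot> g) x = rs X g (rs X f x)" using psh_Comp[OF p] A Cod_in_Obj by blast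
  qed
  have "shf A (rs X)"
    unfolding shf_def
  proof (intro conjI ballI allI impI pA)
    fix c S x assume c: "c \<in> Obj C" and S: "S \<in> J c" and m: "matching A (rs X) S x"
    have SA: "f \<in> Arr C" "Cod C f = c" "Dom C f \<in> Obj C" if "f \<in> S" for f
      using cov_Arr[OF S c that] cov_Cod[OF S c that] Dom_in_Obj by auto
    have m': "matching (sec X) (rs X) S x"
      using m A SA unfolding matching_def by blast
    obtain y where y: "y \<in> sec X c" "\<forall>f\<in>S. rs X f y = x f"
      using shf_glue[OF sh c S m'] by blast
    have "y \<in> A c" using loc[OF c S y(1)] y(2) m unfolding matching_def by auto
    moreover have "z = y" if "z \<in> A c \<and> (\<forall>f\<in>S. rs X f z = x f)" for z
      using shf_sep[OF sh c S, of z y] that y A[OF c] by auto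
    ultimately show "\<exists>!y. y \<in> A c \<and> (\<forall>f\<in>S. rs X f y = x f)" using y(2) by blast
  qed
  moreover have "small U (A c)" if "c \<in> Obj C" for c
    using small_subset[OF A sec_small] X that by blast
  ultimately obtain Y \<phi> where Y: "Y \<in> Obj E" and \<phi>: "ntr A (rs X) (sec Y) (rs Y) \<phi>"
    and b: "\<And>c. c \<in> Obj C \<Longrightarrow> bij_betw (\<phi> c) (A c) (sec Y c)"
    using make_obj by metis
  note i = ntr_inv[OF pA \<phi> b]
  have "ntr A (rs X) (sec X) (rs X) (\<lambda>c x. x)"
    using A unfolding ntr_def by blast
  from ap_full[OF Y X ntr_comp[OF i this]] obtain m where m: "m \<in> Hom E Y X"
      "\<And>c x. c \<in> Obj C \<Longrightarrow> x \<in> sec Y c \<Longrightarrow> ap m c x = inv_into (A c) (\<phi> c) x" by blast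
  have bm: "bij_betw (ap m c) (sec Y c) (A c)" if "c \<in> Obj C" for c
    using bij_betw_inv_into[OF b[OF that]] m(2)[OF that] bij_betw_cong[of "sec Y c"] by metis
  then have "is_mono E m" using mono_if_inj[OF m(1)] by (meson bij_betw_def)
  then show ?thesis using m(1) bm by blast
qed

text \<open>Preimages under the injective maps \<open>ap m c\<close> are unique, and uniqueness
  makes their choice natural.\<close>

lemma factor:
  assumes m: "m \<in> Hom E Y X" and inj: "\<And>c. c \<in> Obj C \<Longrightarrow> inj_on (ap m c) (sec Y c)"
    and f: "f \<in> Hom E Z X"
    and im: "\<And>c z. c \<in> Obj C \<Longrightarrow> z \<in> sec Z c \<Longrightarrow> ap f c z \<in> ap m c ` sec Y c"
  shows "\<exists>w\<in>Hom E Z Y. m \<cdot>\<^bsub>E\<^esub> w = f"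
proof -
  define t where "t c z = inv_into (sec Y c) (ap m c) (ap f c z)" for c z
  have t: "t c z \<in> sec Y c" "ap m c (t c z) = ap f c z" if "c \<in> Obj C" "z \<in> sec Z c" for c z
    using im[OF that] unfolding t_def by (auto simp: inv_into_into f_inv_into_f)
  have "ntr (sec Z) (rs Z) (sec Y) (rs Y) t"
    unfolding ntr_def
  proof (intro conjI ballI)
    fix g z assume g: "g \<in> Arr C" and z: "z \<in> sec Z (Cod C g)"
    have c: "Cod C g \<in> Obj C" "Dom C g \<in> Obj C" using g Cod_in_Obj Dom_in_Obj by auto
    have z': "rs Z g z \<in> sec Z (Dom C g)" using psh_mem[OF sec_psh] Hom_Obj f g z by blast
    have "ap m (Dom C g) (t (Dom C g) (rs Z g z)) = ap m (Dom C g) (rs Y g (t (Cod C g) z))"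
      using t(2)[OF c(2) z'] t[OF c(1) z] ap_nat[OF f g refl refl z]
        ap_nat[OF m g refl refl t(1)[OF c(1) z]] by simp
    moreover have "rs Y g (t (Cod C g) z) \<in> sec Y (Dom C g)"
      using psh_mem[OF sec_psh] Hom_Obj m g t(1)[OF c(1) z] by blast
    ultimately show "t (Dom C g) (rs Z g z) = rs Y g (t (Cod C g) z)"
      using inj[OF c(2)] t(1)[OF c(2) z'] by (meson inj_onD)
  qed (use t in blast)
  from ap_full[OF Hom_Obj(1)[OF f] Hom_Obj(1)[OF m] this]
  obtain w where w: "w \<in> Hom E Z Y" "\<forall>c\<in>Obj C. \<forall>x\<in>sec Z c. ap w c x = t c x" by blast
  have "m \<cdot>\<^bsub>E\<^esub> w = f"
    by (rule ap_faithful[OF E.Comp_in_Hom[OF w(1) m] f]) (simp add: ap_Comp[OF w(1) m] w(2) t)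
  then show ?thesis using w(1) by blast
qed

text \<open>\<open>X\<close> is the sheaf associated with \<open>P\<close> and \<open>\<eta>\<close>
  the unit, described by the universal property alone. Besides sheafifications, the relation covers
  a sheaf presenting itself and a covering sieve presenting the sheafified representable.\<close>

definition presents :: "('u \<Rightarrow> 'p set) \<Rightarrow> ('u \<Rightarrow> 'p \<Rightarrow> 'p) \<Rightarrow> 'o \<Rightarrow> ('u \<Rightarrow> 'p \<Rightarrow> 'u) \<Rightarrow> bool" where
  "presents P r X \<eta> \<longleftrightarrow> X \<in> Obj E \<and> ntr P r (sec X) (rs X) \<eta> \<and>
     (\<forall>Y\<in>Obj E. \<forall>t. ntr P r (sec Y) (rs Y) t \<longrightarrow>
        (\<exists>!f. f \<in> Hom E X Y \<and> (\<forall>c\<in>Obj C. \<forall>x\<in>P c. ap f c (\<eta> c x) = t c x)))"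

end

section \<open>Sheafification\<close>

text \<open>
  A section of the sheaf associated with a presheaf \<open>P\<close> over \<open>c\<close> is recorded by all the
  pairs \<open>(g, x)\<close> such that \<open>x\<close> represents its restriction along \<open>g\<close>.
\<close>

locale sheafification = sheaf_rep U C J E sec ap rs
  for U :: "'u itself" and C :: "('u, 'u) cat" (structure) and J and E :: "('o, 'a) cat"
    and sec ap rs +
  fixes P :: "'u \<Rightarrow> 'p set" and r :: "'u \<Rightarrow> 'p \<Rightarrow> 'p"
  assumes P: "psh P r" and P_small: "c \<in> Obj C \<Longrightarrow> small U (P c)"
begin

definition loc_eq :: "'u \<Rightarrow> 'p \<Rightarrow> 'p \<Rightarrow> bool" where
  "loc_eq d x y \<longleftrightarrow> (\<exists>R\<in>J d. \<forall>h\<in>R. r h x = r h y)"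

text \<open>The third clause makes the set contain every pair that represents the section locally.
  Equal sections are then equal sets, which takes the place of a quotient by local equality and of a
  second pass of the plus construction.\<close>

definition asec :: "'u \<Rightarrow> ('u \<times> 'p) set set" where
  "asec c = {s. (\<forall>g x. (g, x) \<in> s \<longrightarrow> g \<in> Arr C \<and> Cod C g = c \<and> x \<in> P (Dom C g)) \<and>
     (\<forall>g x h. (g, x) \<in> s \<longrightarrow> h \<in> Arr C \<longrightarrow> Cod C h = Dom C g \<longrightarrow> (g \<cdot> h, r h x) \<in> s) \<and>
     (\<forall>g x. \<forall>R\<in>J (Dom C g). g \<in> Arr C \<longrightarrow> Cod C g = c \<longrightarrow> x \<in> P (Dom C g) \<longrightarrow>
        (\<forall>h\<in>R. (g \<cdot> h, r h x) \<in> s) \<longrightarrow> (g, x) \<in> s) \<and>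
     (\<forall>g x y. (g, x) \<in> s \<longrightarrow> (g, y) \<in> s \<longrightarrow> loc_eq (Dom C g) x y) \<and>
     (\<exists>S\<in>J c. \<forall>g\<in>S. \<exists>x. (g, x) \<in> s)}"

definition ares :: "'u \<Rightarrow> ('u \<times> 'p) set \<Rightarrow> ('u \<times> 'p) set" where
  "ares f s = {(g, x). g \<in> Arr C \<and> Cod C g = Dom C f \<and> (f \<cdot> g, x) \<in> s}"

lemma asec_mem:
  assumes "s \<in> asec c" "(g, x) \<in> s"
  shows "g \<in> Arr C \<and> Cod C g = c \<and> x \<in> P (Dom C g)"
proof -
  have "\<forall>g x. (g, x) \<in> s \<longrightarrow> g \<in> Arr C \<and> Cod C g = c \<and> x \<in> P (Dom C g)"
    using assms(1) unfolding asec_def mem_Collect_eq by (elim conjE)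
  then show ?thesis using assms by blast
qed

lemma asec_res:
  assumes "s \<in> asec c" "(g, x) \<in> s" "h \<in> Arr C" "Cod C h = Dom C g"
  shows "(g \<cdot> h, r h x) \<in> s"
proof -
  have "\<forall>g x h. (g, x) \<in> s \<longrightarrow> h \<in> Arr C \<longrightarrow> Cod C h = Dom C g \<longrightarrow> (g \<cdot> h, r h x) \<in> s"
    using assms(1) unfolding asec_def mem_Collect_eq by (elim conjE)
  then show ?thesis using assms by blast
qed

lemma asec_loc:
  assumes "s \<in> asec c" "g \<in> Arr C" "Cod C g = c" "x \<in> P (Dom C g)" "R \<in> J (Dom C g)"
    "\<forall>h\<in>R. (g \<cdot> h, r h x) \<in> s"
  shows "(g, x) \<in> s"
proof -
  have "\<forall>g x. \<forall>R\<in>J (Dom C g). g \<in> Arr C \<longrightarrow> Cod C g = c \<longrightarrow> x \<in> P (Dom C g) \<longrightarrow>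
        (\<forall>h\<in>R. (g \<cdot> h, r h x) \<in> s) \<longrightarrow> (g, x) \<in> s"
    using assms(1) unfolding asec_def mem_Collect_eq by (elim conjE)
  then show ?thesis using assms by blast
qed

lemma asec_eq:
  assumes "s \<in> asec c" "(g, x) \<in> s" "(g, y) \<in> s"
  shows "loc_eq (Dom C g) x y"
proof -
  have "\<forall>g x y. (g, x) \<in> s \<longrightarrow> (g, y) \<in> s \<longrightarrow> loc_eq (Dom C g) x y"
    using assms(1) unfolding asec_def mem_Collect_eq by (elim conjE)
  then show ?thesis using assms by blast
qed

lemma asec_cov: "s \<in> asec c \<Longrightarrow> \<exists>S\<in>J c. \<forall>g\<in>S. \<exists>x. (g, x) \<in> s"
  unfolding asec_def mem_Collect_eq by (elim conjE)

lemma asecI: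
  assumes "\<And>g x. (g, x) \<in> s \<Longrightarrow> g \<in> Arr C \<and> Cod C g = c \<and> x \<in> P (Dom C g)"
    and "\<And>g x h. (g, x) \<in> s \<Longrightarrow> h \<in> Arr C \<Longrightarrow> Cod C h = Dom C g \<Longrightarrow> (g \<cdot> h, r h x) \<in> s"
    and "\<And>g x R. R \<in> J (Dom C g) \<Longrightarrow> g \<in> Arr C \<Longrightarrow> Cod C g = c \<Longrightarrow> x \<in> P (Dom C g) \<Longrightarrow>
        (\<And>h. h \<in> R \<Longrightarrow> (g \<cdot> h, r h x) \<in> s) \<Longrightarrow> (g, x) \<in> s"
    and "\<And>g x y. (g, x) \<in> s \<Longrightarrow> (g, y) \<in> s \<Longrightarrow> loc_eq (Dom C g) x y"
    and "\<exists>S\<in>J c. \<forall>g\<in>S. \<exists>x. (g, x) \<in> s"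
  shows "s \<in> asec c"
  unfolding asec_def mem_Collect_eq
proof (intro conjI)
  show "\<forall>g x. (g, x) \<in> s \<longrightarrow> g \<in> Arr C \<and> Cod C g = c \<and> x \<in> P (Dom C g)" using assms(1) by blast
  show "\<forall>g x h. (g, x) \<in> s \<longrightarrow> h \<in> Arr C \<longrightarrow> Cod C h = Dom C g \<longrightarrow> (g \<cdot> h, r h x) \<in> s"
    using assms(2) by blast
  show "\<forall>g x. \<forall>R\<in>J (Dom C g). g \<in> Arr C \<longrightarrow> Cod C g = c \<longrightarrow> x \<in> P (Dom C g) \<longrightarrow>
        (\<forall>h\<in>R. (g \<cdot> h, r h x) \<in> s) \<longrightarrow> (g, x) \<in> s"
    using assms(3) by blast
  show "\<forall>g x y. (g, x) \<in> s \<longrightarrow> (g, y) \<in> s \<longrightarrow> loc_eq (Dom C g) x y" using assms(4) by blast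
qed (fact assms(5))

lemma loc_eqI:
  assumes d: "d \<in> Obj C" and x: "x \<in> P d" and y: "y \<in> P d" and R: "R \<in> J d"
    and l: "\<And>h. h \<in> R \<Longrightarrow> loc_eq (Dom C h) (r h x) (r h y)"
  shows "loc_eq d x y"
proof -
  have "{h \<in> Arr C. Cod C h = d \<and> r h x = r h y} \<in> J d"
  proof (rule cov_locI[OF d R])
    fix f g assume "f \<in> Arr C" "Cod C f = d" "r f x = r f y" "g \<in> Arr C" "Cod C g = Dom C f"
    then show "r (f \<cdot> g) x = r (f \<cdot> g) y" using psh_Comp[OF P] x y by simp
  next
    fix f assume f: "f \<in> R"
    then obtain S where S: "S \<in> J (Dom C f)" "\<forall>g\<in>S. r g (r f x) = r g (r f y)"
      using l unfolding loc_eq_def by blast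
    have fA: "f \<in> Arr C" "Cod C f = d" using cov_Arr[OF R d f] cov_Cod[OF R d f] by auto
    have "\<forall>g\<in>S. r (f \<cdot> g) x = r (f \<cdot> g) y"
      using S cov_Arr[OF S(1)] cov_Cod[OF S(1)] fA x y Dom_in_Obj psh_Comp[OF P] by simp
    then show "\<exists>R\<in>J (Dom C f). \<forall>g\<in>R. r (f \<cdot> g) x = r (f \<cdot> g) y" using S(1) by blast
  qed
  then show ?thesis unfolding loc_eq_def by (rule bexI[rotated]) simp
qed

lemma loc_eq_refl: "d \<in> Obj C \<Longrightarrow> loc_eq d x x"
  unfolding loc_eq_def using cov_max by blast

lemma loc_eq_sym: "loc_eq d x y \<Longrightarrow> loc_eq d y x"
  unfolding loc_eq_def by metis

lemma loc_eq_trans: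
  assumes "loc_eq d x y" "loc_eq d y z" "d \<in> Obj C" shows "loc_eq d x z"
proof -
  obtain R R' where "R \<in> J d" "\<forall>h\<in>R. r h x = r h y" "R' \<in> J d" "\<forall>h\<in>R'. r h y = r h z"
    using assms unfolding loc_eq_def by blast
  then have "R \<inter> R' \<in> J d" "\<forall>h\<in>R \<inter> R'. r h x = r h z" using cov_inter assms(3) by auto
  then show ?thesis unfolding loc_eq_def by blast
qed

lemma loc_eq_res:
  assumes "loc_eq d x y" "x \<in> P d" "y \<in> P d" "g \<in> Arr C" "Cod C g = d"
  shows "loc_eq (Dom C g) (r g x) (r g y)"
proof -
  obtain R where R: "R \<in> J d" "\<forall>h\<in>R. r h x = r h y" using assms unfolding loc_eq_def by blast
  have "pullback_sieve C g R \<in> J (Dom C g)" using cov_pullback[OF assms(4,5) refl R(1)] .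
  moreover have "\<forall>h\<in>pullback_sieve C g R. r h (r g x) = r h (r g y)"
  proof
    fix h assume "h \<in> pullback_sieve C g R"
    then have h: "h \<in> Arr C" "Cod C h = Dom C g" "g \<cdot> h \<in> R" by (auto simp: pullback_sieve_def)
    show "r h (r g x) = r h (r g y)"
      using bspec[OF R(2) h(3)] psh_Comp[OF P assms(4) h(1,2)] assms by simp
  qed
  ultimately show ?thesis unfolding loc_eq_def by blast
qed

lemma ares_asec:
  assumes s: "s \<in> asec c" and f: "f \<in> Arr C" "Cod C f = c"
  shows "ares f s \<in> asec (Dom C f)"
proof (rule asecI)
  fix g x assume "(g, x) \<in> ares f s"
  then show "g \<in> Arr C \<and> Cod C g = Dom C f \<and> x \<in> P (Dom C g)"
    using asec_mem[OF s, of "f \<cdot> g" x] f by (auto simp: ares_def cat_simps)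
next
  fix g x h assume "(g, x) \<in> ares f s" "h \<in> Arr C" "Cod C h = Dom C g"
  then show "(g \<cdot> h, r h x) \<in> ares f s"
    using asec_res[OF s, of "f \<cdot> g" x h] f by (auto simp: ares_def cat_simps)
next
  fix g x R assume R: "R \<in> J (Dom C g)" and g: "g \<in> Arr C" "Cod C g = Dom C f" and x: "x \<in> P (Dom C g)"
    and h: "\<And>h. h \<in> R \<Longrightarrow> (g \<cdot> h, r h x) \<in> ares f s"
  have "(f \<cdot> g, x) \<in> s"
  proof (rule asec_loc[OF s _ _ _ , where R = R])
    show "\<forall>h\<in>R. (f \<cdot> g \<cdot> h, r h x) \<in> s"
      using h cov_Arr[OF R] cov_Cod[OF R] Dom_in_Obj g f by (auto simp: ares_def cat_simps)
  qed (use f g x R in \<open>auto simp: cat_simps\<close>)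
  then show "(g, x) \<in> ares f s" using g by (simp add: ares_def)
next
  fix g x y assume "(g, x) \<in> ares f s" "(g, y) \<in> ares f s"
  then show "loc_eq (Dom C g) x y"
    using asec_eq[OF s, of "f \<cdot> g" x y] f by (auto simp: ares_def cat_simps)
next
  obtain S where S: "S \<in> J c" "\<forall>g\<in>S. \<exists>x. (g, x) \<in> s" using asec_cov[OF s] by blast
  have "pullback_sieve C f S \<in> J (Dom C f)" using cov_pullback[OF f refl S(1)] .
  moreover have "\<forall>g\<in>pullback_sieve C f S. \<exists>x. (g, x) \<in> ares f s"
    using S(2) by (auto simp: pullback_sieve_def ares_def)
  ultimately show "\<exists>S\<in>J (Dom C f). \<forall>g\<in>S. \<exists>x. (g, x) \<in> ares f s" by blast
qed

lemma asec_psh: "psh asec ares"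
  unfolding psh_def
proof (intro conjI ballI impI)
  fix g s assume "g \<in> Arr C" "s \<in> asec (Cod C g)"
  then show "ares g s \<in> asec (Dom C g)" using ares_asec by blast
next
  fix c s assume c: "c \<in> Obj C" and s: "s \<in> asec c"
  have "(g, x) \<in> ares (Ide C c) s \<longleftrightarrow> (g, x) \<in> s" for g x
    using asec_mem[OF s, of g x] c by (auto simp: ares_def cat_simps)
  then show "ares (Ide C c) s = s" by (simp add: set_eq_iff split_paired_all)
next
  fix f g s assume "f \<in> Arr C" "g \<in> Arr C" "Cod C g = Dom C f" "s \<in> asec (Cod C f)"
  then show "ares (f \<cdot> g) s = ares g (ares f s)"
    by (auto simp: ares_def cat_simps)
qed

lemma asec_small: "c \<in> Obj C \<Longrightarrow> small U (asec c)"
proof -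
  assume c: "c \<in> Obj C"
  have "small U (Arr C)" using small_site unfolding small_category_def by blast
  then have "small U (Pow (Sigma (Arr C) (\<lambda>g. P (Dom C g))))"
    by (intro small_Pow small_Sigma P_small Dom_in_Obj)
  moreover have "asec c \<subseteq> Pow (Sigma (Arr C) (\<lambda>g. P (Dom C g)))"
  proof (rule subsetI, rule PowI, rule subsetI)
    fix s p assume "s \<in> asec c" "p \<in> s"
    then show "p \<in> Sigma (Arr C) (\<lambda>g. P (Dom C g))"
      using asec_mem[of s c "fst p" "snd p"] by (simp add: mem_Sigma_iff split_beta)
        (metis SigmaI prod.collapse)
  qed
  ultimately show ?thesis using small_subset by blast
qed

text \<open>A pair in \<open>s\<close>, restricted to the cover, is visible in the restrictions
  \<open>ares f s\<close> at identity arrows, hence lies in \<open>s'\<close> there; the locality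
  clause for \<open>s'\<close> puts the pair back together.\<close>

lemma asec_sep:
  assumes c: "c \<in> Obj C" and S: "S \<in> J c" and s: "s \<in> asec c" "s' \<in> asec c"
    and eq: "\<And>f. f \<in> S \<Longrightarrow> ares f s = ares f s'"
  shows "s \<subseteq> s'"
proof
  fix p assume "p \<in> s"
  then obtain g x where p: "p = (g, x)" "(g, x) \<in> s" by (cases p) auto
  have g: "g \<in> Arr C" "Cod C g = c" "x \<in> P (Dom C g)" using asec_mem[OF s(1) p(2)] by auto
  have "(g, x) \<in> s'"
  proof (rule asec_loc[OF s(2) g cov_pullback[OF g(1,2) refl S]], rule ballI)
    fix h assume h: "h \<in> pullback_sieve C g S"
    then have h': "h \<in> Arr C" "Cod C h = Dom C g" "g \<cdot> h \<in> S" by (auto simp: pullback_sieve_def)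
    have "(g \<cdot> h, r h x) \<in> s" using asec_res[OF s(1) p(2) h'(1,2)] .
    then have "(Ide C (Dom C h), r h x) \<in> ares (g \<cdot> h) s"
      using g h' by (simp add: ares_def cat_simps)
    then show "(g \<cdot> h, r h x) \<in> s'"
      unfolding eq[OF h'(3)] using g h' by (simp add: ares_def cat_simps)
  qed
  then show "p \<in> s'" using p by simp
qed

lemma asec_shf: "shf asec ares"
  unfolding shf_def
proof (intro conjI ballI allI impI asec_psh)
  fix c S \<sigma> assume c: "c \<in> Obj C" and S: "S \<in> J c" and m: "matching asec ares S \<sigma>"
  note SA = cov_Arr[OF S c] cov_Cod[OF S c] cov_Comp[OF S c]
  have \<sigma>: "\<sigma> f \<in> asec (Dom C f)" if "f \<in> S" for f using m that unfolding matching_def by blast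
  \<comment> \<open>Matching lets membership in \<open>\<sigma> f\<close> at \<open>g\<close> be
    read off from \<open>\<sigma> (f \<cdot> g)\<close> at an identity, so the glued section can be
    described through identities alone.\<close>
  have key: "(Ide C (Dom C g), x) \<in> \<sigma> (f \<cdot> g) \<longleftrightarrow> (g, x) \<in> \<sigma> f"
    if "f \<in> S" "g \<in> Arr C" "Cod C g = Dom C f" for f g x
  proof -
    have "\<sigma> (f \<cdot> g) = ares g (\<sigma> f)" using m that unfolding matching_def by blast
    then show ?thesis using that by (simp add: ares_def cat_simps)
  qed
  \<comment> \<open>The glued section: \<open>x\<close> represents it along \<open>g\<close> when,
    on a cover of the domain of \<open>g\<close>, the restrictions of \<open>x\<close> represent the
    members of the family as whole sections.\<close>
  define s where "s = {(g, x). g \<in> Arr C \<and> Cod C g = c \<and> x \<in> P (Dom C g) \<and>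
    (\<exists>R\<in>J (Dom C g). \<forall>h\<in>R. g \<cdot> h \<in> S \<and> (Ide C (Dom C h), r h x) \<in> \<sigma> (g \<cdot> h))}"
  have sI: "(g, x) \<in> s" if "g \<in> Arr C" "Cod C g = c" "x \<in> P (Dom C g)" "R \<in> J (Dom C g)"
      "\<forall>h\<in>R. g \<cdot> h \<in> S \<and> (Ide C (Dom C h), r h x) \<in> \<sigma> (g \<cdot> h)" for g x R
    unfolding s_def using that by blast
  have s_iff: "(f \<cdot> g, x) \<in> s \<longleftrightarrow> (g, x) \<in> \<sigma> f" if f: "f \<in> S" and g: "g \<in> Arr C" "Cod C g = Dom C f" for f g x
  proof
    note fA = SA(1,2)[OF f]
    assume "(f \<cdot> g, x) \<in> s"
    then obtain R where R: "R \<in> J (Dom C g)" and x: "x \<in> P (Dom C g)"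
      and h: "\<And>h. h \<in> R \<Longrightarrow> (Ide C (Dom C h), r h x) \<in> \<sigma> (f \<cdot> g \<cdot> h)"
      using g fA by (auto simp: s_def cat_simps)
    show "(g, x) \<in> \<sigma> f"
    proof (rule asec_loc[OF \<sigma>[OF f] g x R], rule ballI)
      fix h assume hR: "h \<in> R"
      have hA: "h \<in> Arr C" "Cod C h = Dom C g"
        using cov_Arr[OF R _ hR] cov_Cod[OF R _ hR] Dom_in_Obj g by auto
      have "(Ide C (Dom C (g \<cdot> h)), r h x) \<in> \<sigma> (f \<cdot> (g \<cdot> h))"
        using h[OF hR] fA g hA by (simp add: cat_simps)
      then show "(g \<cdot> h, r h x) \<in> \<sigma> f"
        using key[OF f, of "g \<cdot> h" "r h x"] g hA by (simp add: cat_simps)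
    qed
  next
    note fA = SA(1,2)[OF f]
    assume gx: "(g, x) \<in> \<sigma> f"
    have x: "x \<in> P (Dom C g)" using asec_mem[OF \<sigma>[OF f] gx] by simp
    let ?R = "{h \<in> Arr C. Cod C h = Dom C g}"
    have "?R \<in> J (Dom C g)" using cov_max Dom_in_Obj g by simp
    moreover have "\<forall>h\<in>?R. f \<cdot> g \<cdot> h \<in> S \<and> (Ide C (Dom C h), r h x) \<in> \<sigma> (f \<cdot> g \<cdot> h)"
    proof
      fix h assume "h \<in> ?R"
      then have h: "h \<in> Arr C" "Cod C h = Dom C g" by auto
      have "(g \<cdot> h, r h x) \<in> \<sigma> f" using asec_res[OF \<sigma>[OF f] gx h] .
      then show "f \<cdot> g \<cdot> h \<in> S \<and> (Ide C (Dom C h), r h x) \<in> \<sigma> (f \<cdot> g \<cdot> h)"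
        using key[OF f, of "g \<cdot> h" "r h x"] SA(3)[OF f, of "g \<cdot> h"] fA g h by (simp add: cat_simps)
    qed
    ultimately show "(f \<cdot> g, x) \<in> s"
      using sI[of "f \<cdot> g" x ?R] fA g x by (simp add: Comp_Arr Dom_Comp Cod_Comp)
  qed
  have s: "s \<in> asec c"
  proof (rule asecI)
    fix g x assume "(g, x) \<in> s"
    then show "g \<in> Arr C \<and> Cod C g = c \<and> x \<in> P (Dom C g)" by (simp add: s_def)
  next
    fix g x h assume gx: "(g, x) \<in> s" and h: "h \<in> Arr C" "Cod C h = Dom C g"
    obtain R where R: "R \<in> J (Dom C g)" and k: "\<forall>k\<in>R. g \<cdot> k \<in> S \<and> (Ide C (Dom C k), r k x) \<in> \<sigma> (g \<cdot> k)"
      and g: "g \<in> Arr C" "Cod C g = c" "x \<in> P (Dom C g)"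
      using gx by (auto simp: s_def)
    have "\<forall>k\<in>pullback_sieve C h R. g \<cdot> h \<cdot> k \<in> S \<and> (Ide C (Dom C k), r k (r h x)) \<in> \<sigma> (g \<cdot> h \<cdot> k)"
    proof
      fix k assume "k \<in> pullback_sieve C h R"
      then have kk: "k \<in> Arr C" "Cod C k = Dom C h" "h \<cdot> k \<in> R" by (auto simp: pullback_sieve_def)
      have "r (h \<cdot> k) x = r k (r h x)" using psh_Comp[OF P h(1) kk(1,2)] g(3) h by simp
      then show "g \<cdot> h \<cdot> k \<in> S \<and> (Ide C (Dom C k), r k (r h x)) \<in> \<sigma> (g \<cdot> h \<cdot> k)"
        using bspec[OF k kk(3)] kk h g by (simp add: cat_simps)
    qed
    moreover have "pullback_sieve C h R \<in> J (Dom C h)" using cov_pullback[OF h refl R] .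
    ultimately show "(g \<cdot> h, r h x) \<in> s"
      using sI[of "g \<cdot> h" "r h x" "pullback_sieve C h R"] g h psh_mem[OF P h(1) h(2) g(3) refl]
      by (simp add: Comp_Arr Dom_Comp Cod_Comp)
  next
    fix g x R assume R: "R \<in> J (Dom C g)" and g: "g \<in> Arr C" "Cod C g = c" and x: "x \<in> P (Dom C g)"
      and h: "\<And>h. h \<in> R \<Longrightarrow> (g \<cdot> h, r h x) \<in> s"
    have d: "Dom C g \<in> Obj C" using g Dom_in_Obj by blast
    let ?Q = "\<lambda>k. g \<cdot> k \<in> S \<and> (Ide C (Dom C k), r k x) \<in> \<sigma> (g \<cdot> k)"
    have "{k \<in> Arr C. Cod C k = Dom C g \<and> ?Q k} \<in> J (Dom C g)"
    proof (rule cov_locI[OF d R])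
      fix k l assume k: "k \<in> Arr C" "Cod C k = Dom C g" "?Q k" and l: "l \<in> Arr C" "Cod C l = Dom C k"
      have 1: "g \<cdot> k \<cdot> l \<in> S" using SA(3)[of "g \<cdot> k" l] k l g by (simp add: cat_simps)
      have "(Ide C (Dom C k) \<cdot> l, r l (r k x)) \<in> \<sigma> (g \<cdot> k)"
        using asec_res[OF \<sigma>, of "g \<cdot> k" "Ide C (Dom C k)" "r k x" l] k l by (simp add: cat_simps)
      then have "(l, r (k \<cdot> l) x) \<in> \<sigma> (g \<cdot> k)"
        using psh_Comp[OF P k(1) l] x k l by (simp add: cat_simps)
      then have "(Ide C (Dom C l), r (k \<cdot> l) x) \<in> \<sigma> (g \<cdot> k \<cdot> l)"
        using key[of "g \<cdot> k" l "r (k \<cdot> l) x"] k l g by (simp add: cat_simps)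
      then show "?Q (k \<cdot> l)" using 1 k l g by (simp add: cat_simps)
    next
      fix f assume f: "f \<in> R"
      have fA: "f \<in> Arr C" "Cod C f = Dom C g" using cov_Arr[OF R d f] cov_Cod[OF R d f] by auto
      obtain R' where R': "R' \<in> J (Dom C f)"
          "\<forall>k\<in>R'. g \<cdot> f \<cdot> k \<in> S \<and> (Ide C (Dom C k), r k (r f x)) \<in> \<sigma> (g \<cdot> f \<cdot> k)"
        using h[OF f] g fA by (auto simp: s_def cat_simps)
      have "\<forall>k\<in>R'. ?Q (f \<cdot> k)"
      proof
        fix k assume k: "k \<in> R'"
        have kA: "k \<in> Arr C" "Cod C k = Dom C f"
          using cov_Arr[OF R'(1) _ k] cov_Cod[OF R'(1) _ k] Dom_in_Obj fA by auto
        then show "?Q (f \<cdot> k)"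
          using bspec[OF R'(2) k] psh_Comp[OF P fA(1) kA] fA x g by (simp add: cat_simps)
      qed
      then show "\<exists>R\<in>J (Dom C f). \<forall>k\<in>R. ?Q (f \<cdot> k)" using R'(1) by blast
    qed
    then have "\<exists>R\<in>J (Dom C g). \<forall>k\<in>R. ?Q k" by (rule bexI[rotated]) simp
    then show "(g, x) \<in> s" unfolding s_def using g x by simp
  next
    fix g x y assume "(g, x) \<in> s" "(g, y) \<in> s"
    then obtain R R' where g: "g \<in> Arr C" and x: "x \<in> P (Dom C g)" and y: "y \<in> P (Dom C g)"
      and R: "R \<in> J (Dom C g)" "\<forall>h\<in>R. g \<cdot> h \<in> S \<and> (Ide C (Dom C h), r h x) \<in> \<sigma> (g \<cdot> h)"
      and R': "R' \<in> J (Dom C g)" "\<forall>h\<in>R'. g \<cdot> h \<in> S \<and> (Ide C (Dom C h), r h y) \<in> \<sigma> (g \<cdot> h)"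
      by (auto simp: s_def)
    have d: "Dom C g \<in> Obj C" using g Dom_in_Obj by blast
    show "loc_eq (Dom C g) x y"
    proof (rule loc_eqI[OF d x y cov_inter[OF R(1) R'(1) d]])
      fix h assume h: "h \<in> R \<inter> R'"
      then have "h \<in> Arr C" using cov_Arr[OF R(1) d] by blast
      then show "loc_eq (Dom C h) (r h x) (r h y)"
        using asec_eq[OF \<sigma>, of "g \<cdot> h" "Ide C (Dom C h)" "r h x" "r h y"] R(2) R'(2) h
        by (auto simp: cat_simps)
    qed
  next
    let ?Q = "\<lambda>f. \<exists>x. (f, x) \<in> s"
    have "{f \<in> Arr C. Cod C f = c \<and> ?Q f} \<in> J c"
    proof (rule cov_locI[OF c S])
      fix f g assume f: "f \<in> Arr C" "Cod C f = c" "?Q f" and g: "g \<in> Arr C" "Cod C g = Dom C f"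
      then obtain x R where R: "R \<in> J (Dom C f)" "\<forall>k\<in>R. f \<cdot> k \<in> S \<and> (Ide C (Dom C k), r k x) \<in> \<sigma> (f \<cdot> k)"
        and x: "x \<in> P (Dom C f)"
        by (auto simp: s_def)
      have "\<forall>k\<in>pullback_sieve C g R. f \<cdot> g \<cdot> k \<in> S \<and> (Ide C (Dom C k), r k (r g x)) \<in> \<sigma> (f \<cdot> g \<cdot> k)"
      proof
        fix k assume "k \<in> pullback_sieve C g R"
        then have kk: "k \<in> Arr C" "Cod C k = Dom C g" "g \<cdot> k \<in> R" by (auto simp: pullback_sieve_def)
        have "r (g \<cdot> k) x = r k (r g x)" using psh_Comp[OF P g(1) kk(1,2)] x g by simp
        then show "f \<cdot> g \<cdot> k \<in> S \<and> (Ide C (Dom C k), r k (r g x)) \<in> \<sigma> (f \<cdot> g \<cdot> k)"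
          using bspec[OF R(2) kk(3)] kk f g by (simp add: cat_simps)
      qed
      moreover have "pullback_sieve C g R \<in> J (Dom C g)" using cov_pullback[OF g refl R(1)] .
      ultimately have "(f \<cdot> g, r g x) \<in> s"
        using sI[of "f \<cdot> g" "r g x" "pullback_sieve C g R"] f g psh_mem[OF P g x refl]
        by (simp add: Comp_Arr Dom_Comp Cod_Comp)
      then show "?Q (f \<cdot> g)" by blast
    next
      fix f assume f: "f \<in> S"
      obtain S' where S': "S' \<in> J (Dom C f)" "\<forall>g\<in>S'. \<exists>x. (g, x) \<in> \<sigma> f"
        using asec_cov[OF \<sigma>[OF f]] by blast
      have "\<forall>g\<in>S'. ?Q (f \<cdot> g)"
        using S' s_iff[OF f] asec_mem[OF \<sigma>[OF f]] by metis
      then show "\<exists>R\<in>J (Dom C f). \<forall>g\<in>R. ?Q (f \<cdot> g)" using S'(1) by blast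
    qed
    then show "\<exists>S\<in>J c. \<forall>g\<in>S. \<exists>x. (g, x) \<in> s" by (rule bexI[rotated]) simp
  qed
  have "ares f s = \<sigma> f" if f: "f \<in> S" for f
  proof -
    have "(g, x) \<in> ares f s \<longleftrightarrow> (g, x) \<in> \<sigma> f" for g x
      using s_iff[OF f, of g x] asec_mem[OF \<sigma>[OF f], of g x] by (auto simp: ares_def)
    then show ?thesis by (simp add: set_eq_iff split_paired_all)
  qed
  then have "s \<in> asec c \<and> (\<forall>f\<in>S. ares f s = \<sigma> f)" using s by blast
  moreover have "z = z'" if "z \<in> asec c \<and> (\<forall>f\<in>S. ares f z = \<sigma> f)"
      "z' \<in> asec c \<and> (\<forall>f\<in>S. ares f z' = \<sigma> f)" for z z'
    using asec_sep[OF c S, of z z'] asec_sep[OF c S, of z' z] that by auto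
  ultimately show "\<exists>!y. y \<in> asec c \<and> (\<forall>f\<in>S. ares f y = \<sigma> f)" by blast
qed

definition unit :: "'u \<Rightarrow> 'p \<Rightarrow> ('u \<times> 'p) set" where
  "unit c x = {(g, y). g \<in> Arr C \<and> Cod C g = c \<and> y \<in> P (Dom C g) \<and> loc_eq (Dom C g) y (r g x)}"

lemma unit_asec:
  assumes c: "c \<in> Obj C" and x: "x \<in> P c" shows "unit c x \<in> asec c"
proof (rule asecI)
  fix g y assume "(g, y) \<in> unit c x"
  then show "g \<in> Arr C \<and> Cod C g = c \<and> y \<in> P (Dom C g)" by (simp add: unit_def)
next
  fix g y h assume gy: "(g, y) \<in> unit c x" and h: "h \<in> Arr C" "Cod C h = Dom C g"
  then have g: "g \<in> Arr C" "Cod C g = c" "y \<in> P (Dom C g)" "loc_eq (Dom C g) y (r g x)"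
    by (auto simp: unit_def)
  have "loc_eq (Dom C h) (r h y) (r h (r g x))"
    using loc_eq_res[OF g(4,3) psh_mem[OF P g(1,2) x refl] h] .
  then show "(g \<cdot> h, r h y) \<in> unit c x"
    using g h psh_Comp[OF P g(1) h] x psh_mem[OF P h g(3) refl] by (simp add: unit_def cat_simps)
next
  fix g y R assume R: "R \<in> J (Dom C g)" and g: "g \<in> Arr C" "Cod C g = c" and y: "y \<in> P (Dom C g)"
    and h: "\<And>h. h \<in> R \<Longrightarrow> (g \<cdot> h, r h y) \<in> unit c x"
  have d: "Dom C g \<in> Obj C" using g Dom_in_Obj by blast
  have "loc_eq (Dom C g) y (r g x)"
  proof (rule loc_eqI[OF d y psh_mem[OF P g x refl] R])
    fix k assume k: "k \<in> R"
    have kA: "k \<in> Arr C" "Cod C k = Dom C g" using cov_Arr[OF R d k] cov_Cod[OF R d k] by auto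
    then show "loc_eq (Dom C k) (r k y) (r k (r g x))"
      using h[OF k] g x psh_Comp[OF P g(1) kA] by (simp add: unit_def cat_simps)
  qed
  then show "(g, y) \<in> unit c x" using g y by (simp add: unit_def)
next
  fix g y z assume "(g, y) \<in> unit c x" "(g, z) \<in> unit c x"
  then have "g \<in> Arr C" "loc_eq (Dom C g) y (r g x)" "loc_eq (Dom C g) z (r g x)"
    by (simp_all add: unit_def)
  then show "loc_eq (Dom C g) y z"
    by (meson loc_eq_trans loc_eq_sym Dom_in_Obj)
next
  have "(g, r g x) \<in> unit c x" if "g \<in> Arr C" "Cod C g = c" for g
    using that psh_mem[OF P that x refl] loc_eq_refl Dom_in_Obj by (simp add: unit_def)
  then show "\<exists>S\<in>J c. \<forall>g\<in>S. \<exists>y. (g, y) \<in> unit c x"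
    by (intro bexI[OF _ cov_max[OF c]]) blast
qed

text \<open>Along \<open>g\<close>, both sides collect exactly the elements that are locally equal
  to restrictions of \<open>x\<close>. The consequence is that every section of the associated sheaf
  comes locally from \<open>P\<close>.\<close>

lemma ares_unit:
  assumes s: "s \<in> asec c" and gx: "(g, x) \<in> s"
  shows "ares g s = unit (Dom C g) x"
proof -
  have g: "g \<in> Arr C" "Cod C g = c" "x \<in> P (Dom C g)" using asec_mem[OF s gx] by auto
  have "(g \<cdot> h, y) \<in> s \<longleftrightarrow> y \<in> P (Dom C h) \<and> loc_eq (Dom C h) y (r h x)"
    if h: "h \<in> Arr C" "Cod C h = Dom C g" for h y
  proof
    have gh: "(g \<cdot> h, r h x) \<in> s" using asec_res[OF s gx h] .
    show "(g \<cdot> h, y) \<in> s \<Longrightarrow> y \<in> P (Dom C h) \<and> loc_eq (Dom C h) y (r h x)"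
      using asec_eq[OF s _ gh, of y] asec_mem[OF s, of "g \<cdot> h" y] g h by (simp add: cat_simps)
    assume "y \<in> P (Dom C h) \<and> loc_eq (Dom C h) y (r h x)"
    then obtain R where R: "R \<in> J (Dom C h)" "\<forall>k\<in>R. r k y = r k (r h x)" and y: "y \<in> P (Dom C h)"
      unfolding loc_eq_def by blast
    show "(g \<cdot> h, y) \<in> s"
    proof (rule asec_loc[OF s, where R = R])
      show "\<forall>k\<in>R. (g \<cdot> h \<cdot> k, r k y) \<in> s"
      proof
        fix k assume k: "k \<in> R"
        have kA: "k \<in> Arr C" "Cod C k = Dom C h"
          using cov_Arr[OF R(1) _ k] cov_Cod[OF R(1) _ k] Dom_in_Obj h by auto
        show "(g \<cdot> h \<cdot> k, r k y) \<in> s"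
          using asec_res[OF s gh kA(1)] kA bspec[OF R(2) k] g h by (simp add: Dom_Comp)
      qed
    qed (use g h y R(1) in \<open>simp_all add: cat_simps\<close>)
  qed
  then show ?thesis unfolding ares_def unit_def by auto
qed

lemma unit_ntr: "ntr P r asec ares unit"
  unfolding ntr_def
proof (intro conjI ballI)
  fix c x assume "c \<in> Obj C" "x \<in> P c"
  then show "unit c x \<in> asec c" by (rule unit_asec)
next
  fix g x assume g: "g \<in> Arr C" and x: "x \<in> P (Cod C g)"
  have "(g, r g x) \<in> unit (Cod C g) x"
    using g psh_mem[OF P g refl x refl] loc_eq_refl Dom_in_Obj by (simp add: unit_def)
  then show "unit (Dom C g) (r g x) = ares g (unit (Cod C g) x)"
    using ares_unit[OF unit_asec[OF Cod_in_Obj[OF g] x]] by simp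
qed

text \<open>The values of \<open>t\<close> on representatives form a matching family on the sieve of
  those \<open>g\<close> at which \<open>s\<close> has a representative. Two representatives are
  only locally equal, but \<open>Y\<close> is separated, so \<open>t\<close> does not see the
  choice.\<close>

lemma asec_extend:
  assumes Y: "Y \<in> Obj E" and t: "ntr P r (sec Y) (rs Y) t" and c: "c \<in> Obj C" and s: "s \<in> asec c"
  shows "\<exists>!y. y \<in> sec Y c \<and> (\<forall>g x. (g, x) \<in> s \<longrightarrow> rs Y g y = t (Dom C g) x)"
proof -
  note Ysh = sec_shf[OF Y] and Yp = sec_psh[OF Y]
  define S where "S = {g. \<exists>x. (g, x) \<in> s}"
  define x where "x g = (SOME x. (g, x) \<in> s)" for g
  have x: "(g, x g) \<in> s" if "g \<in> S" for g
    using that unfolding S_def x_def by (auto intro: someI)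
  obtain S0 where S0: "S0 \<in> J c" "\<forall>g\<in>S0. \<exists>x. (g, x) \<in> s" using asec_cov[OF s] by blast
  have "is_sieve C c S"
    unfolding is_sieve_def S_def using asec_mem[OF s] asec_res[OF s] by blast
  then have S: "S \<in> J c" using cov_superset[OF S0(1) c] S0(2) unfolding S_def by blast
  have wd: "t (Dom C g) y = t (Dom C g) z" if gy: "(g, y) \<in> s" and gz: "(g, z) \<in> s" for g y z
  proof -
    note my = asec_mem[OF s gy] and mz = asec_mem[OF s gz]
    have d: "Dom C g \<in> Obj C" using my Dom_in_Obj by blast
    obtain R where R: "R \<in> J (Dom C g)" "\<forall>h\<in>R. r h y = r h z"
      using asec_eq[OF s gy gz] unfolding loc_eq_def by blast
    show ?thesis
    proof (rule shf_sep[OF Ysh d R(1)])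
      show "t (Dom C g) y \<in> sec Y (Dom C g)" "t (Dom C g) z \<in> sec Y (Dom C g)"
        using ntr_mem[OF t d] my mz by auto
      fix h assume h: "h \<in> R"
      note hA = cov_Arr[OF R(1) d h] cov_Cod[OF R(1) d h]
      show "rs Y h (t (Dom C g) y) = rs Y h (t (Dom C g) z)"
        using ntr_nat[OF t hA refl, of y] ntr_nat[OF t hA refl, of z] my mz R(2) h by simp
    qed
  qed
  have "matching (sec Y) (rs Y) S (\<lambda>g. t (Dom C g) (x g))"
    unfolding matching_def
  proof (intro conjI ballI impI)
    fix g assume g: "g \<in> S"
    note mg = asec_mem[OF s x[OF g]]
    show "t (Dom C g) (x g) \<in> sec Y (Dom C g)" using ntr_mem[OF t] mg Dom_in_Obj by blast
    fix h assume h: "h \<in> Arr C" "Cod C h = Dom C g"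
    have gh: "(g \<cdot> h, r h (x g)) \<in> s" using asec_res[OF s x[OF g] h] .
    then have "g \<cdot> h \<in> S" unfolding S_def by blast
    then have "t (Dom C (g \<cdot> h)) (x (g \<cdot> h)) = t (Dom C (g \<cdot> h)) (r h (x g))"
      using wd[OF x gh] by blast
    also have "\<dots> = rs Y h (t (Dom C g) (x g))"
      using ntr_nat[OF t h refl, of "x g"] mg h by (simp add: cat_simps)
    finally show "t (Dom C (g \<cdot> h)) (x (g \<cdot> h)) = rs Y h (t (Dom C g) (x g))" .
  qed
  then obtain y where y: "y \<in> sec Y c" "\<forall>g\<in>S. rs Y g y = t (Dom C g) (x g)"
    using shf_glue[OF Ysh c S] by blast
  show ?thesis
  proof (rule ex1I[of _ y], intro conjI allI impI)
    show "y \<in> sec Y c" by fact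
    fix g z assume gz: "(g, z) \<in> s"
    then have "g \<in> S" unfolding S_def by blast
    then show "rs Y g y = t (Dom C g) z" using y(2) wd[OF x gz] by auto
  next
    fix y' assume y': "y' \<in> sec Y c \<and> (\<forall>g x. (g, x) \<in> s \<longrightarrow> rs Y g y' = t (Dom C g) x)"
    show "y' = y"
      by (rule shf_sep[OF Ysh c S]) (use y y' x in auto)
  qed
qed

text \<open>The second assertion, local surjectivity of the unit, yields the uniqueness part of
  \<open>presents\<close> and will show that coproduct injections are jointly onto.\<close>

theorem sheafify:
  shows "\<exists>X\<in>Obj E. \<exists>\<eta>. presents P r X \<eta> \<and>
    (\<forall>c\<in>Obj C. \<forall>z\<in>sec X c. \<exists>S\<in>J c. \<forall>g\<in>S. \<exists>p\<in>P (Dom C g). rs X g z = \<eta> (Dom C g) p)"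
proof -
  obtain X \<phi> where X: "X \<in> Obj E" and \<phi>: "ntr asec ares (sec X) (rs X) \<phi>"
    and b: "\<And>c. c \<in> Obj C \<Longrightarrow> bij_betw (\<phi> c) (asec c) (sec X c)"
    using make_obj[OF asec_shf asec_small] by metis
  define \<eta> where "\<eta> c x = \<phi> c (unit c x)" for c x
  have \<eta>: "ntr P r (sec X) (rs X) \<eta>" unfolding \<eta>_def using ntr_comp[OF unit_ntr \<phi>] .
  have loc: "\<exists>S\<in>J c. \<forall>g\<in>S. \<exists>p\<in>P (Dom C g). rs X g z = \<eta> (Dom C g) p" if c: "c \<in> Obj C" and z: "z \<in> sec X c" for c z
  proof -
    obtain s where s: "s \<in> asec c" "z = \<phi> c s" using b[OF c] z unfolding bij_betw_def by blast
    obtain S where S: "S \<in> J c" "\<forall>g\<in>S. \<exists>x. (g, x) \<in> s" using asec_cov[OF s(1)] by blast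
    have "\<exists>p\<in>P (Dom C g). rs X g z = \<eta> (Dom C g) p" if g: "g \<in> S" for g
    proof -
      obtain x where x: "(g, x) \<in> s" using S(2) g by blast
      note m = asec_mem[OF s(1) x]
      have "rs X g z = \<phi> (Dom C g) (ares g s)" using ntr_nat[OF \<phi>, of g c "Dom C g" s] m s by simp
      then show ?thesis using ares_unit[OF s(1) x] m unfolding \<eta>_def by auto
    qed
    then show ?thesis using S(1) by blast
  qed
  have "\<exists>!f. f \<in> Hom E X Y \<and> (\<forall>c\<in>Obj C. \<forall>x\<in>P c. ap f c (\<eta> c x) = t c x)"
    if Y: "Y \<in> Obj E" and t: "ntr P r (sec Y) (rs Y) t" for Y t
  proof -
    define n where "n c s = (THE y. y \<in> sec Y c \<and> (\<forall>g x. (g, x) \<in> s \<longrightarrow> rs Y g y = t (Dom C g) x))" for c s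
    have n: "n c s \<in> sec Y c" "\<And>g x. (g, x) \<in> s \<Longrightarrow> rs Y g (n c s) = t (Dom C g) x"
      if "c \<in> Obj C" "s \<in> asec c" for c s
      using theI'[OF asec_extend[OF Y t that]] unfolding n_def by auto
    have nu: "n c s = y" if "c \<in> Obj C" "s \<in> asec c" "y \<in> sec Y c"
      "\<And>g x. (g, x) \<in> s \<Longrightarrow> rs Y g y = t (Dom C g) x" for c s y
      using asec_extend[OF Y t that(1,2)] n[OF that(1,2)] that(3,4) by blast
    have "ntr asec ares (sec Y) (rs Y) n"
      unfolding ntr_def
    proof (intro conjI ballI)
      fix c s assume "c \<in> Obj C" "s \<in> asec c"
      then show "n c s \<in> sec Y c" using n by blast
    next
      fix g s assume g: "g \<in> Arr C" and s: "s \<in> asec (Cod C g)"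
      note c = Cod_in_Obj[OF g] Dom_in_Obj[OF g]
      show "n (Dom C g) (ares g s) = rs Y g (n (Cod C g) s)"
      proof (rule nu[OF c(2) ares_asec[OF s g refl]])
        show "rs Y g (n (Cod C g) s) \<in> sec Y (Dom C g)"
          using psh_mem[OF sec_psh[OF Y] g refl n(1)[OF c(1) s] refl] .
        fix h x assume "(h, x) \<in> ares g s"
        then have h: "h \<in> Arr C" "Cod C h = Dom C g" "(g \<cdot> h, x) \<in> s" by (auto simp: ares_def)
        show "rs Y h (rs Y g (n (Cod C g) s)) = t (Dom C h) x"
          using psh_Comp[OF sec_psh[OF Y] g h(1,2) n(1)[OF c(1) s]] n(2)[OF c(1) s h(3)] g h
          by (simp add: cat_simps)
      qed
    qed
    from ap_full[OF X Y ntr_comp[OF ntr_inv[OF asec_psh \<phi> b] this]]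
    obtain f where f: "f \<in> Hom E X Y"
        "\<And>c x. c \<in> Obj C \<Longrightarrow> x \<in> sec X c \<Longrightarrow> ap f c x = n c (inv_into (asec c) (\<phi> c) x)" by blast
    have "ap f c (\<eta> c x) = t c x" if c: "c \<in> Obj C" and x: "x \<in> P c" for c x
    proof -
      have u: "unit c x \<in> asec c" using unit_asec[OF c x] .
      have "ap f c (\<eta> c x) = n c (inv_into (asec c) (\<phi> c) (\<phi> c (unit c x)))"
        using f(2)[OF c ntr_mem[OF \<eta> c x]] by (simp add: \<eta>_def)
      also have "\<dots> = n c (unit c x)" using b[OF c] u by (simp add: bij_betw_def)
      also have "\<dots> = rs Y (Ide C c) (n c (unit c x))"
        using psh_Ide[OF sec_psh[OF Y] c n(1)[OF c u]] by simp
      also have "\<dots> = t c x"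
      proof -
        have "(Ide C c, x) \<in> unit c x"
          using c x psh_Ide[OF P c x] loc_eq_refl by (simp add: unit_def cat_simps)
        then show ?thesis using n(2)[OF c u] c by (simp add: cat_simps)
      qed
      finally show ?thesis .
    qed
    moreover have "f1 = f2" if f1: "f1 \<in> Hom E X Y \<and> (\<forall>c\<in>Obj C. \<forall>x\<in>P c. ap f1 c (\<eta> c x) = t c x)"
      and f2: "f2 \<in> Hom E X Y \<and> (\<forall>c\<in>Obj C. \<forall>x\<in>P c. ap f2 c (\<eta> c x) = t c x)" for f1 f2
    proof (rule ap_faithful[OF conjunct1[OF f1] conjunct1[OF f2]])
      fix c z assume c: "c \<in> Obj C" and z: "z \<in> sec X c"
      obtain S where S: "S \<in> J c" "\<forall>g\<in>S. \<exists>p\<in>P (Dom C g). rs X g z = \<eta> (Dom C g) p"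
        using loc[OF c z] by blast
      show "ap f1 c z = ap f2 c z"
      proof (rule shf_sep[OF sec_shf[OF Y] c S(1)])
        show "ap f1 c z \<in> sec Y c" "ap f2 c z \<in> sec Y c" using ap_mem f1 f2 c z by blast+
        fix g assume g: "g \<in> S"
        note gA = cov_Arr[OF S(1) c g] cov_Cod[OF S(1) c g]
        obtain p where p: "p \<in> P (Dom C g)" "rs X g z = \<eta> (Dom C g) p" using S(2) g by blast
        show "rs Y g (ap f1 c z) = rs Y g (ap f2 c z)"
          using ap_nat[OF conjunct1[OF f1] gA refl z] ap_nat[OF conjunct1[OF f2] gA refl z]
            p f1 f2 Dom_in_Obj[OF gA(1)] by simp
      qed
    qed
    ultimately show ?thesis using f(1) by blast
  qed
  then have "presents P r X \<eta>" using X \<eta> unfolding presents_def by blast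
  then show ?thesis using X loc by blast
qed

end

section \<open>Generators and right adjoints\<close>

context sheaf_rep
begin

section \<open>Generators of the topos and the Yoneda lemma\<close>

lemma Arr_small: "small U (Arr C)"
  using small_site unfolding small_category_def by blast

definition ysec :: "'u \<Rightarrow> 'u \<Rightarrow> 'u set" where
  "ysec c d = {f \<in> Arr C. Dom C f = d \<and> Cod C f = c}"

definition yres :: "'u \<Rightarrow> 'u \<Rightarrow> 'u" where
  "yres g f = f \<cdot> g"

lemma ysec_psh: "c \<in> Obj C \<Longrightarrow> psh (ysec c) yres"
  unfolding psh_def by (auto simp: ysec_def yres_def cat_simps)

text \<open>The universal section is the image of the identity of \<open>c\<close> in the sheafified
  representable; the Yoneda lemma for presheaves combines with the universal property of
  sheafification.\<close>

lemma yoneda_exists: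
  assumes c: "c \<in> Obj C"
  shows "\<exists>X\<in>Obj E. \<exists>\<gamma>\<in>sec X c. \<forall>Y\<in>Obj E. \<forall>y\<in>sec Y c. \<exists>!f. f \<in> Hom E X Y \<and> ap f c \<gamma> = y"
proof -
  interpret y: sheafification U C J E sec ap rs "ysec c" yres
  proof (unfold_locales, rule ysec_psh[OF c])
    show "small U (ysec c d)" for d
      by (rule small_subset[OF _ Arr_small]) (auto simp: ysec_def)
  qed
  obtain X \<eta> where pres: "presents (ysec c) yres X \<eta>" using y.sheafify by blast
  have X: "X \<in> Obj E" and \<eta>: "ntr (ysec c) yres (sec X) (rs X) \<eta>"
    using pres unfolding presents_def by auto
  have i: "Ide C c \<in> ysec c c" using c by (simp add: ysec_def cat_simps)
  have \<eta>f: "\<eta> d f = rs X f (\<eta> c (Ide C c))" if "f \<in> ysec c d" for d f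
    using ntr_nat[OF \<eta> _ _ _ i, of f d] that by (simp add: ysec_def yres_def cat_simps)
  have "\<exists>!f. f \<in> Hom E X Y \<and> ap f c (\<eta> c (Ide C c)) = y" if Y: "Y \<in> Obj E" and y: "y \<in> sec Y c" for Y y
  proof -
    have "ntr (ysec c) yres (sec Y) (rs Y) (\<lambda>d f. rs Y f y)"
      unfolding ntr_def
      using psh_mem[OF sec_psh[OF Y] _ _ y] psh_Comp[OF sec_psh[OF Y]] y
      by (auto simp: ysec_def yres_def)
    then have u: "\<exists>!f. f \<in> Hom E X Y \<and> (\<forall>d\<in>Obj C. \<forall>g\<in>ysec c d. ap f d (\<eta> d g) = rs Y g y)"
      using pres Y unfolding presents_def by blast
    have "(\<forall>d\<in>Obj C. \<forall>g\<in>ysec c d. ap f d (\<eta> d g) = rs Y g y) \<longleftrightarrow> ap f c (\<eta> c (Ide C c)) = y"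
      if f: "f \<in> Hom E X Y" for f
    proof
      assume "\<forall>d\<in>Obj C. \<forall>g\<in>ysec c d. ap f d (\<eta> d g) = rs Y g y"
      then have "ap f c (\<eta> c (Ide C c)) = rs Y (Ide C c) y" using c i by blast
      then show "ap f c (\<eta> c (Ide C c)) = y" using psh_Ide[OF sec_psh[OF Y] c y] by simp
    next
      assume e: "ap f c (\<eta> c (Ide C c)) = y"
      show "\<forall>d\<in>Obj C. \<forall>g\<in>ysec c d. ap f d (\<eta> d g) = rs Y g y"
      proof (intro ballI)
        fix d g assume "d \<in> Obj C" and g: "g \<in> ysec c d"
        then have "g \<in> Arr C" "Cod C g = c" "Dom C g = d" by (auto simp: ysec_def)
        then show "ap f d (\<eta> d g) = rs Y g y"
          using \<eta>f[OF g] ap_nat[OF f _ _ _ ntr_mem[OF \<eta> c i], of g d] e by simp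
      qed
    qed
    then show ?thesis using u by (metis (no_types, lifting))
  qed
  then show ?thesis using X ntr_mem[OF \<eta> c i] by blast
qed

definition gen :: "'u \<Rightarrow> 'o" where
  "gen c = (SOME X. X \<in> Obj E \<and> (\<exists>\<gamma>\<in>sec X c. \<forall>Y\<in>Obj E. \<forall>y\<in>sec Y c. \<exists>!f. f \<in> Hom E X Y \<and> ap f c \<gamma> = y))"

definition pt :: "'u \<Rightarrow> 'u" where
  "pt c = (SOME \<gamma>. \<gamma> \<in> sec (gen c) c \<and> (\<forall>Y\<in>Obj E. \<forall>y\<in>sec Y c. \<exists>!f. f \<in> Hom E (gen c) Y \<and> ap f c \<gamma> = y))"

text \<open>The map out of the generator that names the section \<open>y\<close>: the Yoneda
  bijection read from sections to maps.\<close>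

definition yo :: "'u \<Rightarrow> 'o \<Rightarrow> 'u \<Rightarrow> 'a" where
  "yo c Y y = (THE f. f \<in> Hom E (gen c) Y \<and> ap f c (pt c) = y)"

lemma gen_pt:
  assumes c: "c \<in> Obj C"
  shows "gen c \<in> Obj E"
    and "pt c \<in> sec (gen c) c \<and> (\<forall>Y\<in>Obj E. \<forall>y\<in>sec Y c. \<exists>!f. f \<in> Hom E (gen c) Y \<and> ap f c (pt c) = y)"
proof -
  have "\<exists>X. X \<in> Obj E \<and> (\<exists>\<gamma>\<in>sec X c. \<forall>Y\<in>Obj E. \<forall>y\<in>sec Y c. \<exists>!f. f \<in> Hom E X Y \<and> ap f c \<gamma> = y)"
    using yoneda_exists[OF c] by blast
  from someI_ex[OF this] have g: "gen c \<in> Obj E"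
      "\<exists>\<gamma>. \<gamma> \<in> sec (gen c) c \<and> (\<forall>Y\<in>Obj E. \<forall>y\<in>sec Y c. \<exists>!f. f \<in> Hom E (gen c) Y \<and> ap f c \<gamma> = y)"
    unfolding gen_def by blast+
  show "gen c \<in> Obj E" by fact
  show "pt c \<in> sec (gen c) c \<and> (\<forall>Y\<in>Obj E. \<forall>y\<in>sec Y c. \<exists>!f. f \<in> Hom E (gen c) Y \<and> ap f c (pt c) = y)"
    using someI_ex[OF g(2)] unfolding pt_def .
qed

lemma pt_mem: "c \<in> Obj C \<Longrightarrow> pt c \<in> sec (gen c) c"
  using gen_pt by blast

lemma yo:
  assumes "c \<in> Obj C" "Y \<in> Obj E" "y \<in> sec Y c"
  shows "yo c Y y \<in> Hom E (gen c) Y" "ap (yo c Y y) c (pt c) = y"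
proof -
  have "\<exists>!f. f \<in> Hom E (gen c) Y \<and> ap f c (pt c) = y" using gen_pt[OF assms(1)] assms by blast
  from theI'[OF this] show "yo c Y y \<in> Hom E (gen c) Y" "ap (yo c Y y) c (pt c) = y"
    unfolding yo_def by auto
qed

lemma yo_unique:
  assumes "c \<in> Obj C" "Y \<in> Obj E" "f \<in> Hom E (gen c) Y" "ap f c (pt c) = y"
  shows "f = yo c Y y"
proof -
  have y: "y \<in> sec Y c" using ap_mem[OF assms(3,1) pt_mem[OF assms(1)]] assms(4) by simp
  have "\<exists>!f. f \<in> Hom E (gen c) Y \<and> ap f c (pt c) = y" using gen_pt[OF assms(1)] assms y by blast
  then show ?thesis using yo[OF assms(1,2) y] assms(3,4) by blast
qed

lemma yo_Comp:
  assumes c: "c \<in> Obj C" and y: "y \<in> sec Y c" and f: "f \<in> Hom E Y Z"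
  shows "f \<cdot>\<^bsub>E\<^esub> yo c Y y = yo c Z (ap f c y)"
proof (rule yo_unique[OF c Hom_Obj(2)[OF f]])
  have Y: "Y \<in> Obj E" using Hom_Obj f by blast
  show "f \<cdot>\<^bsub>E\<^esub> yo c Y y \<in> Hom E (gen c) Z" using E.Comp_in_Hom[OF yo(1)[OF c Y y] f] .
  show "ap (f \<cdot>\<^bsub>E\<^esub> yo c Y y) c (pt c) = ap f c y"
    using ap_Comp[OF yo(1)[OF c Y y] f c pt_mem[OF c]] yo(2)[OF c Y y] by simp
qed

text \<open>The sheafified Yoneda embedding on arrows: the map of generators that names the
  restriction of the universal section along \<open>g\<close>.\<close>

definition gmap :: "'u \<Rightarrow> 'a" where
  "gmap g = yo (Dom C g) (gen (Cod C g)) (rs (gen (Cod C g)) g (pt (Cod C g)))"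

lemma gen_res:
  assumes "g \<in> Arr C" shows "rs (gen (Cod C g)) g (pt (Cod C g)) \<in> sec (gen (Cod C g)) (Dom C g)"
  using psh_mem[OF sec_psh[OF gen_pt(1)[OF Cod_in_Obj[OF assms]]] assms refl pt_mem[OF Cod_in_Obj[OF assms]] refl] .

lemma gmap_Hom: "g \<in> Arr C \<Longrightarrow> gmap g \<in> Hom E (gen (Dom C g)) (gen (Cod C g))"
  unfolding gmap_def using yo(1)[OF Dom_in_Obj gen_pt(1)[OF Cod_in_Obj] gen_res] by blast

lemma yo_gmap:
  assumes g: "g \<in> Arr C" and c: "Cod C g = c" and Y: "Y \<in> Obj E" and y: "y \<in> sec Y c"
  shows "yo c Y y \<cdot>\<^bsub>E\<^esub> gmap g = yo (Dom C g) Y (rs Y g y)"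
proof -
  have cO: "c \<in> Obj C" using g c Cod_in_Obj by blast
  have "yo c Y y \<cdot>\<^bsub>E\<^esub> gmap g = yo (Dom C g) Y (ap (yo c Y y) (Dom C g) (rs (gen c) g (pt c)))"
    unfolding gmap_def using yo_Comp[OF Dom_in_Obj[OF g] gen_res[OF g]] yo(1)[OF cO Y y] c by blast
  also have "ap (yo c Y y) (Dom C g) (rs (gen c) g (pt c)) = rs Y g y"
    using ap_nat[OF yo(1)[OF cO Y y] g c refl pt_mem[OF cO]] yo(2)[OF cO Y y] by simp
  finally show ?thesis .
qed

lemma gmap_Comp:
  assumes "f \<in> Arr C" "g \<in> Arr C" "Cod C g = Dom C f"
  shows "gmap (f \<cdot> g) = gmap f \<cdot>\<^bsub>E\<^esub> gmap g"
proof -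
  have c: "Cod C f \<in> Obj C" using assms Cod_in_Obj by blast
  have "gmap f \<cdot>\<^bsub>E\<^esub> gmap g = yo (Dom C g) (gen (Cod C f)) (rs (gen (Cod C f)) g (rs (gen (Cod C f)) f (pt (Cod C f))))"
    unfolding gmap_def[of f] using yo_gmap[OF assms(2,3) gen_pt(1)[OF c] gen_res[OF assms(1)]] .
  also have "\<dots> = gmap (f \<cdot> g)"
    using assms psh_Comp[OF sec_psh[OF gen_pt(1)[OF c]] assms pt_mem[OF c]]
    by (simp add: gmap_def Dom_Comp Cod_Comp)
  finally show ?thesis by simp
qed

lemma gmap_Ide: "c \<in> Obj C \<Longrightarrow> gmap (Ide C c) = Ide E (gen c)"
proof -
  assume c: "c \<in> Obj C"
  have "Ide E (gen c) = yo c (gen c) (pt c)"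
    using yo_unique[OF c gen_pt(1)[OF c] E.Ide_in_Hom[OF gen_pt(1)[OF c]]]
      ap_Ide[OF gen_pt(1)[OF c] c pt_mem[OF c]] by blast
  then show ?thesis
    using c psh_Ide[OF sec_psh[OF gen_pt(1)[OF c]] c pt_mem[OF c]] by (simp add: gmap_def cat_simps)
qed

lemma presents_self: "X \<in> Obj E \<Longrightarrow> presents (sec X) (rs X) X (\<lambda>c x. x)"
  unfolding presents_def
proof (intro conjI ballI allI impI)
  assume X: "X \<in> Obj E"
  then show "ntr (sec X) (rs X) (sec X) (rs X) (\<lambda>c x. x)" unfolding ntr_def by blast
  fix Y t assume "Y \<in> Obj E" "ntr (sec X) (rs X) (sec Y) (rs Y) t"
  then obtain f where f: "f \<in> Hom E X Y" "\<forall>c\<in>Obj C. \<forall>x\<in>sec X c. ap f c x = t c x"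
    using ap_full X by blast
  show "\<exists>!f. f \<in> Hom E X Y \<and> (\<forall>c\<in>Obj C. \<forall>x\<in>sec X c. ap f c x = t c x)"
  proof (rule ex1I[of _ f])
    show "f \<in> Hom E X Y \<and> (\<forall>c\<in>Obj C. \<forall>x\<in>sec X c. ap f c x = t c x)" using f by blast
    fix g assume "g \<in> Hom E X Y \<and> (\<forall>c\<in>Obj C. \<forall>x\<in>sec X c. ap g c x = t c x)"
    then show "g = f" using ap_faithful[of g X Y f] f by simp
  qed
qed

text \<open>The sheaf condition read as a universal property: a covering sieve has the same
  associated sheaf as the representable it covers. Through this lemma, the sheaf condition for hom
  sets out of \<open>L (gen c)\<close> becomes preservation of a colimit by
  \<open>L\<close>.\<close>

lemma presents_sieve:
  assumes c: "c \<in> Obj C" and S: "S \<in> J c"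
  shows "psh (\<lambda>d. {f \<in> S. Dom C f = d}) yres"
    and "presents (\<lambda>d. {f \<in> S. Dom C f = d}) yres (gen c) (\<lambda>d f. rs (gen c) f (pt c))"
proof -
  let ?P = "\<lambda>d. {f \<in> S. Dom C f = d}"
  note SA = cov_Arr[OF S c] cov_Cod[OF S c] cov_Comp[OF S c]
  note G = gen_pt(1)[OF c]
  show "psh ?P yres"
    unfolding psh_def using SA by (auto simp: yres_def cat_simps)
  show "presents ?P yres (gen c) (\<lambda>d f. rs (gen c) f (pt c))"
    unfolding presents_def
  proof (intro conjI ballI allI impI G)
    show "ntr ?P yres (sec (gen c)) (rs (gen c)) (\<lambda>d f. rs (gen c) f (pt c))"
      unfolding ntr_def
    proof (intro conjI ballI)
      fix d f assume "d \<in> Obj C" "f \<in> ?P d"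
      then show "rs (gen c) f (pt c) \<in> sec (gen c) d"
        using psh_mem[OF sec_psh[OF G] _ _ pt_mem[OF c], of f d] SA by simp
    next
      fix g f assume "g \<in> Arr C" "f \<in> ?P (Cod C g)"
      then show "rs (gen c) (yres g f) (pt c) = rs (gen c) g (rs (gen c) f (pt c))"
        using psh_Comp[OF sec_psh[OF G], of f g "pt c"] SA pt_mem[OF c] by (simp add: yres_def)
    qed
    fix Y t assume Y: "Y \<in> Obj E" and t: "ntr ?P yres (sec Y) (rs Y) t"
    have "matching (sec Y) (rs Y) S (\<lambda>f. t (Dom C f) f)"
      unfolding matching_def
    proof (intro conjI ballI impI)
      fix f assume f: "f \<in> S"
      then show "t (Dom C f) f \<in> sec Y (Dom C f)" using ntr_mem[OF t Dom_in_Obj[OF SA(1)]] by simp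
      fix g assume g: "g \<in> Arr C" "Cod C g = Dom C f"
      then show "t (Dom C (f \<cdot> g)) (f \<cdot> g) = rs Y g (t (Dom C f) f)"
        using ntr_nat[OF t g refl, of f] f SA by (simp add: yres_def Dom_Comp)
    qed
    then obtain y where y: "y \<in> sec Y c" "\<forall>f\<in>S. rs Y f y = t (Dom C f) f"
      using shf_glue[OF sec_shf[OF Y] c S] by blast
    have apf: "ap f d (rs (gen c) g (pt c)) = rs Y g (ap f c (pt c))"
      if "f \<in> Hom E (gen c) Y" "g \<in> S" "Dom C g = d" for f d g
      using ap_nat[OF that(1) SA(1)[OF that(2)] SA(2)[OF that(2)] that(3) pt_mem[OF c]] .
    show "\<exists>!f. f \<in> Hom E (gen c) Y \<and> (\<forall>d\<in>Obj C. \<forall>g\<in>?P d. ap f d (rs (gen c) g (pt c)) = t d g)"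
    proof (rule ex1I[of _ "yo c Y y"])
      show "yo c Y y \<in> Hom E (gen c) Y \<and> (\<forall>d\<in>Obj C. \<forall>g\<in>?P d. ap (yo c Y y) d (rs (gen c) g (pt c)) = t d g)"
        using yo[OF c Y y(1)] y(2) apf by auto
      fix f assume f: "f \<in> Hom E (gen c) Y \<and> (\<forall>d\<in>Obj C. \<forall>g\<in>?P d. ap f d (rs (gen c) g (pt c)) = t d g)"
      have "ap f c (pt c) = y"
      proof (rule shf_sep[OF sec_shf[OF Y] c S ap_mem[OF conjunct1[OF f] c pt_mem[OF c]] y(1)])
        fix g assume g: "g \<in> S"
        then show "rs Y g (ap f c (pt c)) = rs Y g y"
          using apf[OF conjunct1[OF f] g refl] f y(2) Dom_in_Obj[OF SA(1)[OF g]] by auto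
      qed
      then show "f = yo c Y y" using yo_unique[OF c Y conjunct1[OF f]] by blast
    qed
  qed
qed

text \<open>A cocone with vertex \<open>T\<close> on the objects \<open>L (gen c)\<close>, indexed
  by the category of elements of \<open>P\<close>, spelled out without that category.\<close>

definition cone_family :: "('u \<Rightarrow> 'u set) \<Rightarrow> ('u \<Rightarrow> 'u \<Rightarrow> 'u) \<Rightarrow> ('o, 'a, 'o, 'a) fctr \<Rightarrow> 'o \<Rightarrow>
    ('u \<Rightarrow> 'u \<Rightarrow> 'a) \<Rightarrow> bool" where
  "cone_family P r L T \<psi> \<longleftrightarrow>
     (\<forall>c\<in>Obj C. \<forall>p\<in>P c. \<psi> c p \<in> Hom E (OMap L (gen c)) T) \<and>
     (\<forall>g\<in>Arr C. \<forall>p\<in>P (Cod C g). \<psi> (Dom C g) (r g p) = \<psi> (Cod C g) p \<cdot>\<^bsub>E\<^esub> AMap L (gmap g))"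

text \<open>
  A presented object is the colimit of the generators over the category of elements of the
  presenting presheaf; that category is coded in the universe by the pairing \<open>pr\<close>.
\<close>

lemma presented_colimit:
  fixes P :: "'u \<Rightarrow> 'u set"
  assumes psh: "psh P r" and P_small: "\<And>c. c \<in> Obj C \<Longrightarrow> small U (P c)"
    and pres: "presents P r X \<eta>"
    and L: "preserves_colimits U E E L"
    and fam: "cone_family P r L T \<psi>" and T: "T \<in> Obj E"
  shows "\<exists>!h. h \<in> Hom E (OMap L X) T \<and>
    (\<forall>c\<in>Obj C. \<forall>p\<in>P c. h \<cdot>\<^bsub>E\<^esub> AMap L (yo c X (\<eta> c p)) = \<psi> c p)"
proof -
  have X: "X \<in> Obj E" and \<eta>: "ntr P r (sec X) (rs X) \<eta>" using pres unfolding presents_def by auto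
  define p1 where "p1 z = fst (inv pr z)" for z :: 'u
  define p2 where "p2 z = snd (inv pr z)" for z :: 'u
  have p12 [simp]: "p1 (pr (a, b)) = a" "p2 (pr (a, b)) = b" for a b
    using inj_pr by (simp_all add: p1_def p2_def)
  \<comment> \<open>An arrow of the category of elements is stored as its codomain together with its
    arrow in the site; the element over its domain is then forced to be the restriction.\<close>
  define K :: "('u, 'u) cat" where "K = \<lparr>Obj = {pr (c, p) |c p. c \<in> Obj C \<and> p \<in> P c},
    Arr = {pr (pr (Cod C g, p), g) |g p. g \<in> Arr C \<and> p \<in> P (Cod C g)},
    Dom = (\<lambda>a. pr (Dom C (p2 a), r (p2 a) (p2 (p1 a)))), Cod = p1,
    Ide = (\<lambda>q. pr (q, Ide C (p1 q))), Comp = (\<lambda>b a. pr (p1 b, p2 b \<cdot> p2 a))\<rparr>"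
  have K [simp]: "Obj K = {pr (c, p) |c p. c \<in> Obj C \<and> p \<in> P c}"
    "Arr K = {pr (pr (Cod C g, p), g) |g p. g \<in> Arr C \<and> p \<in> P (Cod C g)}"
    "Dom K (pr (pr (c, p), g)) = pr (Dom C g, r g p)" "Cod K (pr (q, g)) = q"
    "Ide K q = pr (q, Ide C (p1 q))" "Comp K (pr (q, g)) (pr (q', h)) = pr (q, g \<cdot> h)" for c p g q q' h
    by (simp_all add: K_def)
  have pr_eq [simp]: "pr (a, b) = pr (a', b') \<longleftrightarrow> a = a' \<and> b = b'" for a b a' b'
    using injD[OF inj_pr] by blast
  have catK: "category K"
  proof
    fix f assume "f \<in> Arr K"
    then obtain g p where f: "f = pr (pr (Cod C g, p), g)" "g \<in> Arr C" "p \<in> P (Cod C g)" by auto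
    then show "Dom K f \<in> Obj K" "Cod K f \<in> Obj K"
      using Dom_in_Obj Cod_in_Obj psh_mem[OF psh f(2) refl f(3) refl] by auto
  next
    fix q assume "q \<in> Obj K"
    then show "Ide K q \<in> Hom K q q" using psh_Ide[OF psh] by (auto simp: Hom_def cat_simps intro!: exI)
  next
    fix f x y g z assume "f \<in> Hom K x y" "g \<in> Hom K y z"
    then show "Comp K g f \<in> Hom K x z"
      using psh_Comp[OF psh] by (auto simp: Hom_def cat_simps)
  next
    fix f x y assume "f \<in> Hom K x y"
    then show "Comp K f (Ide K x) = f" "Comp K (Ide K y) f = f" by (auto simp: Hom_def cat_simps)
  next
    fix f x y g z h w assume "f \<in> Hom K x y" "g \<in> Hom K y z" "h \<in> Hom K z w"
    then show "Comp K h (Comp K g f) = Comp K (Comp K h g) f" by (auto simp: Hom_def cat_simps)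
  qed
  have smK: "small_category U K"
    unfolding small_category_def
  proof (intro conjI catK)
    have CO: "small U (Obj C)" using small_site unfolding small_category_def by blast
    have "Obj K = pr ` Sigma (Obj C) P" by auto
    then show "small U (Obj K)" by (simp only: small_image[OF small_Sigma[OF CO P_small]])
    have "Arr K = (\<lambda>(g, p). pr (pr (Cod C g, p), g)) ` Sigma (Arr C) (\<lambda>g. P (Cod C g))" by auto
    moreover have "small U (Sigma (Arr C) (\<lambda>g. P (Cod C g)))"
      by (rule small_Sigma[OF Arr_small], rule P_small, rule Cod_in_Obj)
    ultimately show "small U (Arr K)" by (simp only: small_image)
  qed
  define D :: "('u, 'u, 'o, 'a) fctr" where
    "D = \<lparr>OMap = (\<lambda>q. gen (p1 q)), AMap = (\<lambda>a. gmap (p2 a))\<rparr>"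
  define k where "k q = yo (p1 q) X (\<eta> (p1 q) (p2 q))" for q
  have D: "is_functor K E D"
    unfolding is_functor_def
    using gen_pt(1) gmap_Hom gmap_Ide gmap_Comp by (auto simp: D_def)
  have kH: "yo c X (\<eta> c p) \<in> Hom E (gen c) X" if "c \<in> Obj C" "p \<in> P c" for c p
    using yo(1)[OF that(1) X ntr_mem[OF \<eta> that]] .
  have ylift: "yo (Cod C g) X (\<eta> (Cod C g) p) \<cdot>\<^bsub>E\<^esub> gmap g = yo (Dom C g) X (\<eta> (Dom C g) (r g p))"
    if "g \<in> Arr C" "p \<in> P (Cod C g)" for g p
    using yo_gmap[OF that(1) refl X ntr_mem[OF \<eta> Cod_in_Obj[OF that(1)] that(2)]]
      ntr_nat[OF \<eta> that(1) refl refl that(2)] by simp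
  have colim: "is_colimit E K D X k"
    unfolding is_colimit_def
  proof (intro conjI allI impI)
    show "is_cocone E K D X k"
      unfolding is_cocone_def using X kH ylift by (auto simp: D_def k_def)
    fix Y l assume "is_cocone E K D Y l"
    then have Y: "Y \<in> Obj E"
      and l: "\<And>c p. c \<in> Obj C \<Longrightarrow> p \<in> P c \<Longrightarrow> l (pr (c, p)) \<in> Hom E (gen c) Y"
      and ln: "\<And>g p. g \<in> Arr C \<Longrightarrow> p \<in> P (Cod C g) \<Longrightarrow>
        l (pr (Cod C g, p)) \<cdot>\<^bsub>E\<^esub> gmap g = l (pr (Dom C g, r g p))"
      unfolding is_cocone_def by (auto 4 4 simp: D_def)
    \<comment> \<open>By Yoneda a cocone leg out of a generator is a section of \<open>Y\<close>,
      and compatibility of the legs is naturality of \<open>t\<close>, so the presentation of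
      \<open>X\<close> supplies the mediating map.\<close>
    define t where "t c p = ap (l (pr (c, p))) c (pt c)" for c p
    have t: "t c p \<in> sec Y c" if "c \<in> Obj C" "p \<in> P c" for c p
      unfolding t_def using ap_mem[OF l[OF that] that(1) pt_mem[OF that(1)]] .
    have lt: "l (pr (c, p)) = yo c Y (t c p)" if "c \<in> Obj C" "p \<in> P c" for c p
      unfolding t_def using yo_unique[OF that(1) Y l[OF that] refl] .
    have "ntr P r (sec Y) (rs Y) t"
      unfolding ntr_def
    proof (intro conjI ballI)
      fix g p assume g: "g \<in> Arr C" and p: "p \<in> P (Cod C g)"
      note c = Cod_in_Obj[OF g] Dom_in_Obj[OF g]
      have rp: "r g p \<in> P (Dom C g)" using psh_mem[OF psh g refl p refl] .
      have "yo (Dom C g) Y (t (Dom C g) (r g p)) = yo (Dom C g) Y (rs Y g (t (Cod C g) p))"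
        using ln[OF g p] lt[OF c(1) p] lt[OF c(2) rp] yo_gmap[OF g refl Y t[OF c(1) p]] by simp
      then show "t (Dom C g) (r g p) = rs Y g (t (Cod C g) p)"
        using yo(2)[OF c(2) Y t[OF c(2) rp]]
          yo(2)[OF c(2) Y psh_mem[OF sec_psh[OF Y] g refl t[OF c(1) p] refl]] by metis
    qed (use t in blast)
    then have u: "\<exists>!f. f \<in> Hom E X Y \<and> (\<forall>c\<in>Obj C. \<forall>p\<in>P c. ap f c (\<eta> c p) = t c p)"
      using pres Y unfolding presents_def by blast
    have iff: "(\<forall>q\<in>Obj K. f \<cdot>\<^bsub>E\<^esub> k q = l q) \<longleftrightarrow> (\<forall>c\<in>Obj C. \<forall>p\<in>P c. ap f c (\<eta> c p) = t c p)"
      if f: "f \<in> Hom E X Y" for f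
    proof -
      have "f \<cdot>\<^bsub>E\<^esub> k (pr (c, p)) = l (pr (c, p)) \<longleftrightarrow> ap f c (\<eta> c p) = t c p"
        if c: "c \<in> Obj C" and p: "p \<in> P c" for c p
      proof -
        have "f \<cdot>\<^bsub>E\<^esub> k (pr (c, p)) = yo c Y (ap f c (\<eta> c p))"
          unfolding k_def using yo_Comp[OF c ntr_mem[OF \<eta> c p] f] by simp
        then show ?thesis
          using lt[OF c p] yo(2)[OF c Y t[OF c p]] yo(2)[OF c Y ap_mem[OF f c ntr_mem[OF \<eta> c p]]]
          by metis
      qed
      then show ?thesis by auto
    qed
    show "\<exists>!w. w \<in> Hom E X Y \<and> (\<forall>q\<in>Obj K. w \<cdot>\<^bsub>E\<^esub> k q = l q)"
      using u iff by (metis (no_types, lifting))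
  qed
  have "is_colimit E K (comp_fctr L D) (OMap L X) (\<lambda>q. AMap L (k q))"
    using L smK D colim unfolding preserves_colimits_def by blast
  moreover have "is_cocone E K (comp_fctr L D) T (\<lambda>q. \<psi> (p1 q) (p2 q))"
    unfolding is_cocone_def using T fam unfolding cone_family_def by (auto simp: comp_fctr_def D_def)
  ultimately have u: "\<exists>!w. w \<in> Hom E (OMap L X) T \<and>
      (\<forall>q\<in>Obj K. w \<cdot>\<^bsub>E\<^esub> AMap L (k q) = \<psi> (p1 q) (p2 q))"
    unfolding is_colimit_def by blast
  have "(\<forall>q\<in>Obj K. w \<cdot>\<^bsub>E\<^esub> AMap L (k q) = \<psi> (p1 q) (p2 q)) \<longleftrightarrow>
      (\<forall>c\<in>Obj C. \<forall>p\<in>P c. w \<cdot>\<^bsub>E\<^esub> AMap L (yo c X (\<eta> c p)) = \<psi> c p)" for w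
  proof -
    have "(\<forall>q\<in>Obj K. Q q) \<longleftrightarrow> (\<forall>c\<in>Obj C. \<forall>p\<in>P c. Q (pr (c, p)))" for Q
      by auto
    then show ?thesis by (simp add: k_def del: K)
  qed
  then show ?thesis using u by simp
qed

text \<open>An arrow is determined by the graph of its action on sections, a subset of a small set.
  Smallness matters because hom sets will be the sections of the right adjoint.\<close>

lemma Hom_small:
  assumes "X \<in> Obj E" "Y \<in> Obj E" shows "small U (Hom E X Y)"
proof -
  let ?B = "Sigma (Obj C) (\<lambda>c. sec X c \<times> sec Y c)"
  let ?k = "\<lambda>f. {(c, x, ap f c x) |c x. c \<in> Obj C \<and> x \<in> sec X c}"
  have "small U (Obj C)" using small_site unfolding small_category_def by blast
  then have "small U (Pow ?B)"
    using assms by (intro small_Pow small_Sigma small_Times sec_small)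
  moreover have "?k ` Hom E X Y \<subseteq> Pow ?B" using ap_mem by auto
  moreover have "inj_on ?k (Hom E X Y)"
  proof (rule inj_onI)
    fix f g assume fg: "f \<in> Hom E X Y" "g \<in> Hom E X Y" and eq: "?k f = ?k g"
    show "f = g"
    proof (rule ap_faithful[OF fg])
      fix c x assume "c \<in> Obj C" "x \<in> sec X c"
      then have "(c, x, ap f c x) \<in> ?k g" unfolding eq[symmetric] by blast
      then show "ap f c x = ap g c x" by auto
    qed
  qed
  ultimately show ?thesis using small_inj_on by blast
qed

theorem right_adjoint_object:
  assumes F: "is_functor E E L" and L: "preserves_colimits U E E L" and Y: "Y \<in> Obj E"
  shows "\<exists>R\<in>Obj E. \<exists>ev\<in>Hom E (OMap L R) Y. \<forall>X\<in>Obj E. \<forall>h\<in>Hom E (OMap L X) Y.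
    \<exists>!f. f \<in> Hom E X R \<and> ev \<cdot>\<^bsub>E\<^esub> AMap L f = h"
proof -
  have LO: "OMap L X \<in> Obj E" if "X \<in> Obj E" for X using F that unfolding is_functor_def by blast
  have LA: "AMap L f \<in> Hom E (OMap L X) (OMap L Z)" if "f \<in> Hom E X Z" for f X Z
    using F that unfolding is_functor_def Hom_def by blast
  have LC: "AMap L (g \<cdot>\<^bsub>E\<^esub> f) = AMap L g \<cdot>\<^bsub>E\<^esub> AMap L f" if "f \<in> Hom E X Z" "g \<in> Hom E Z W" for f g X Z W
    using F that unfolding is_functor_def Hom_def by auto
  have LI: "AMap L (Ide E X) = Ide E (OMap L X)" if "X \<in> Obj E" for X
    using F that unfolding is_functor_def by blast
  define Q where "Q c = Hom E (OMap L (gen c)) Y" for c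
  define q where "q g h = h \<cdot>\<^bsub>E\<^esub> AMap L (gmap g)" for g h
  note G = gen_pt(1)
  have gL: "AMap L (gmap g) \<in> Hom E (OMap L (gen (Dom C g))) (OMap L (gen (Cod C g)))" if "g \<in> Arr C" for g
    using LA[OF gmap_Hom[OF that]] .
  have Qp: "psh Q q"
    unfolding psh_def
  proof (intro conjI ballI impI)
    fix g h assume "g \<in> Arr C" "h \<in> Q (Cod C g)"
    then show "q g h \<in> Q (Dom C g)" unfolding Q_def q_def using E.Comp_in_Hom gL by blast
  next
    fix c h assume c: "c \<in> Obj C" and h: "h \<in> Q c"
    then show "q (Ide C c) h = h"
      unfolding Q_def q_def gmap_Ide[OF c] LI[OF G[OF c]] using E.Comp_Ide by blast
  next
    fix f g h assume fg: "f \<in> Arr C" "g \<in> Arr C" "Cod C g = Dom C f" and h: "h \<in> Q (Cod C f)"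
    have "AMap L (gmap (f \<cdot> g)) = AMap L (gmap f) \<cdot>\<^bsub>E\<^esub> AMap L (gmap g)"
      using LC[OF _ gmap_Hom[OF fg(1)]] gmap_Hom[OF fg(2)] gmap_Comp[OF fg] fg(3) by simp
    then show "q (f \<cdot> g) h = q g (q f h)"
      using E.Comp_assoc[OF _ gL[OF fg(1)]] gL[OF fg(2)] h fg(3) unfolding Q_def q_def by simp
  qed
  have Qs: "shf Q q"
    unfolding shf_def
  proof (intro conjI ballI allI impI Qp)
    fix c S x assume c: "c \<in> Obj C" and S: "S \<in> J c" and m: "matching Q q S x"
    note SA = cov_Arr[OF S c] cov_Cod[OF S c]
    note pS = presents_sieve[OF c S]
    have sm: "small U {f \<in> S. Dom C f = d}" for d
      using small_subset[OF _ Arr_small] SA(1) by (metis (no_types, lifting) mem_Collect_eq subsetI)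
    \<comment> \<open>The sieve \<open>S\<close> presents \<open>gen c\<close> and \<open>L\<close>
      preserves the resulting colimit, so a matching family on \<open>S\<close> is a cocone under
      \<open>L (gen c)\<close> and glues to a unique map.\<close>
    have "cone_family (\<lambda>d. {f \<in> S. Dom C f = d}) yres L Y (\<lambda>d f. x f)"
      using m unfolding cone_family_def matching_def by (auto simp: Q_def q_def yres_def)
    from presented_colimit[OF pS(1) sm pS(2) L this Y]
    have u: "\<exists>!h. h \<in> Hom E (OMap L (gen c)) Y \<and> (\<forall>d\<in>Obj C. \<forall>p\<in>{f \<in> S. Dom C f = d}.
        h \<cdot>\<^bsub>E\<^esub> AMap L (yo d (gen c) (rs (gen c) p (pt c))) = x p)" .
    have "(\<forall>d\<in>Obj C. \<forall>p\<in>{f \<in> S. Dom C f = d}.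
        h \<cdot>\<^bsub>E\<^esub> AMap L (yo d (gen c) (rs (gen c) p (pt c))) = x p) \<longleftrightarrow> (\<forall>f\<in>S. q f h = x f)" for h
      using SA Dom_in_Obj by (auto simp: q_def gmap_def)
    then show "\<exists>!y. y \<in> Q c \<and> (\<forall>f\<in>S. q f y = x f)" using u by (simp add: Q_def)
  qed
  obtain R \<phi> where R: "R \<in> Obj E" and \<phi>: "ntr Q q (sec R) (rs R) \<phi>"
    and b: "\<And>c. c \<in> Obj C \<Longrightarrow> bij_betw (\<phi> c) (Q c) (sec R c)"
    using make_obj[OF Qs] Hom_small[OF LO[OF G] Y] unfolding Q_def by metis
  define i where "i c = inv_into (Q c) (\<phi> c)" for c
  have in_: "ntr (sec R) (rs R) Q q i" unfolding i_def using ntr_inv[OF Qp \<phi> b] .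
  have i\<phi>: "i c (\<phi> c h) = h" if "c \<in> Obj C" "h \<in> Q c" for c h
    using b[OF that(1)] that(2) unfolding i_def by (simp add: bij_betw_def)
  have \<phi>i: "\<phi> c (i c r) = r" if "c \<in> Obj C" "r \<in> sec R c" for c r
    using b[OF that(1)] that(2) unfolding i_def by (simp add: bij_betw_def f_inv_into_f)
  \<comment> \<open>The counit: \<open>R\<close> is the colimit of the generators over its own
    sections, and each section is, through \<open>i\<close>, a map from \<open>L (gen c)\<close> to
    \<open>Y\<close>.\<close>
  have "cone_family (sec R) (rs R) L Y i"
    using in_ unfolding cone_family_def ntr_def by (auto simp: Q_def q_def)
  from presented_colimit[OF sec_psh[OF R] sec_small[OF R] presents_self[OF R] L this Y]
  obtain ev where ev: "ev \<in> Hom E (OMap L R) Y"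
      "\<And>c r. c \<in> Obj C \<Longrightarrow> r \<in> sec R c \<Longrightarrow> ev \<cdot>\<^bsub>E\<^esub> AMap L (yo c R r) = i c r" by blast
  have key: "(ev \<cdot>\<^bsub>E\<^esub> AMap L f) \<cdot>\<^bsub>E\<^esub> AMap L (yo c X x) = i c (ap f c x)"
    if f: "f \<in> Hom E X R" and c: "c \<in> Obj C" and x: "x \<in> sec X c" for f X c x
  proof -
    have yx: "yo c X x \<in> Hom E (gen c) X" using yo(1)[OF c Hom_Obj(1)[OF f] x] .
    have "(ev \<cdot>\<^bsub>E\<^esub> AMap L f) \<cdot>\<^bsub>E\<^esub> AMap L (yo c X x) = ev \<cdot>\<^bsub>E\<^esub> (AMap L f \<cdot>\<^bsub>E\<^esub> AMap L (yo c X x))"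
      using E.Comp_assoc[OF LA[OF yx] LA[OF f] ev(1)] by simp
    also have "\<dots> = ev \<cdot>\<^bsub>E\<^esub> AMap L (yo c R (ap f c x))"
      using LC[OF yx f] yo_Comp[OF c x f] by simp
    also have "\<dots> = i c (ap f c x)" using ev(2)[OF c ap_mem[OF f c x]] .
    finally show ?thesis .
  qed
  have "\<exists>!f. f \<in> Hom E X R \<and> ev \<cdot>\<^bsub>E\<^esub> AMap L f = h" if X: "X \<in> Obj E" and h: "h \<in> Hom E (OMap L X) Y" for X h
  proof -
    \<comment> \<open>The transpose of \<open>h\<close> on sections: a section of \<open>X\<close>
      names a map out of a generator, and \<open>h\<close> after the image of that map under
      \<open>L\<close> is an element of \<open>Q\<close>.\<close>
    define t where "t c x = h \<cdot>\<^bsub>E\<^esub> AMap L (yo c X x)" for c x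
    have tQ: "t c x \<in> Q c" if "c \<in> Obj C" "x \<in> sec X c" for c x
      unfolding t_def Q_def using E.Comp_in_Hom[OF LA[OF yo(1)[OF that(1) X that(2)]] h] .
    have tn: "ntr (sec X) (rs X) Q q t"
      unfolding ntr_def
    proof (intro conjI ballI)
      fix g x assume g: "g \<in> Arr C" and x: "x \<in> sec X (Cod C g)"
      have yx: "yo (Cod C g) X x \<in> Hom E (gen (Cod C g)) X" using yo(1)[OF Cod_in_Obj[OF g] X x] .
      have "AMap L (yo (Dom C g) X (rs X g x)) = AMap L (yo (Cod C g) X x) \<cdot>\<^bsub>E\<^esub> AMap L (gmap g)"
        using LC[OF gmap_Hom[OF g] yx] yo_gmap[OF g refl X x] by simp
      then show "t (Dom C g) (rs X g x) = q g (t (Cod C g) x)"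
        unfolding t_def q_def using E.Comp_assoc[OF gL[OF g] LA[OF yx] h] by simp
    qed (use tQ in blast)
    obtain f where f: "f \<in> Hom E X R" "\<forall>c\<in>Obj C. \<forall>x\<in>sec X c. ap f c x = \<phi> c (t c x)"
      using ap_full[OF X R ntr_comp[OF tn \<phi>]] by blast
    have tfam: "cone_family (sec X) (rs X) L Y t"
      using tn unfolding cone_family_def ntr_def by (auto simp: Q_def q_def)
    note u = presented_colimit[OF sec_psh[OF X] sec_small[OF X] presents_self[OF X] L tfam Y]
    have evf: "ev \<cdot>\<^bsub>E\<^esub> AMap L f \<in> Hom E (OMap L X) Y" using E.Comp_in_Hom[OF LA[OF f(1)] ev(1)] .
    have "ev \<cdot>\<^bsub>E\<^esub> AMap L f = h"
    proof (rule ex1E[OF u])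
      fix w assume w: "\<forall>y. y \<in> Hom E (OMap L X) Y \<and> (\<forall>c\<in>Obj C. \<forall>p\<in>sec X c. y \<cdot>\<^bsub>E\<^esub> AMap L (yo c X p) = t c p) \<longrightarrow> y = w"
      have "h = w" using w h by (auto simp: t_def)
      moreover have "ev \<cdot>\<^bsub>E\<^esub> AMap L f = w"
        using w evf key[OF f(1)] f(2) i\<phi> tQ by auto
      ultimately show ?thesis by simp
    qed
    moreover have "f' = f" if f': "f' \<in> Hom E X R" "ev \<cdot>\<^bsub>E\<^esub> AMap L f' = h" for f'
    proof (rule ap_faithful[OF f'(1) f(1)])
      fix c x assume c: "c \<in> Obj C" and x: "x \<in> sec X c"
      have "i c (ap f' c x) = t c x" using key[OF f'(1) c x] f'(2) by (simp add: t_def)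
      then show "ap f' c x = ap f c x"
        using \<phi>i[OF c ap_mem[OF f'(1) c x]] f(2) c x by simp
    qed
    ultimately show ?thesis using f(1) by blast
  qed
  then show ?thesis using R ev(1) by blast
qed

end

section \<open>Exactness properties\<close>

context category
begin

lemma mono_Comp_right: "is_mono C (g \<cdot> f) \<Longrightarrow> f \<in> Arr C \<Longrightarrow> g \<in> Arr C \<Longrightarrow> Cod C f = Dom C g \<Longrightarrow> is_mono C f"
  unfolding is_mono_def by (metis assoc Dom_Comp)

lemma mono_cancel:
  "is_mono C m \<Longrightarrow> m \<cdot> f = m \<cdot> g \<Longrightarrow> f \<in> Hom C X (Dom C m) \<Longrightarrow> g \<in> Hom C X (Dom C m) \<Longrightarrow> f = g"
  unfolding is_mono_def Hom_def by simp

lemma mono_Arr: "is_mono C m \<Longrightarrow> m \<in> Arr C"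
  unfolding is_mono_def by simp

lemma mono_Comp:
  assumes f: "is_mono C f" and g: "is_mono C g" and fg: "Cod C f = Dom C g"
  shows "is_mono C (g \<cdot> f)"
  unfolding is_mono_def
proof (intro conjI ballI impI)
  note A = mono_Arr[OF f] mono_Arr[OF g]
  show "g \<cdot> f \<in> Arr C" using A fg Comp_Arr by blast
  fix x y assume xy: "x \<in> Arr C" "y \<in> Arr C" "Dom C x = Dom C y" "Cod C x = Dom C (g \<cdot> f)"
    "Cod C y = Dom C (g \<cdot> f)" and eq: "g \<cdot> f \<cdot> x = g \<cdot> f \<cdot> y"
  have c: "Cod C x = Dom C f" "Cod C y = Dom C f" using xy A fg by (simp_all add: Dom_Comp)
  have "g \<cdot> (f \<cdot> x) = g \<cdot> (f \<cdot> y)" using eq assoc A xy(1,2) c fg by simp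
  then have "f \<cdot> x = f \<cdot> y"
    using mono_cancel[OF g, of "f \<cdot> x" "f \<cdot> y" "Dom C x"] A xy c fg by (simp add: Hom_def cat_simps)
  then show "x = y" using mono_cancel[OF f, of x y "Dom C x"] xy c by (simp add: Hom_def)
qed

lemma split_mono: "r \<cdot> m = Ide C (Dom C m) \<Longrightarrow> m \<in> Arr C \<Longrightarrow> r \<in> Hom C (Cod C m) (Dom C m) \<Longrightarrow> is_mono C m"
  unfolding is_mono_def Hom_def by (auto) (metis assoc Ide_Comp')

end

context sheaf_rep
begin

text \<open>Sections over \<open>c\<close> are the maps out of \<open>gen c\<close>, and on these a
  mono can be cancelled.\<close>

lemma ap_inj_if_mono:
  assumes m: "is_mono E m" and mH: "m \<in> Hom E X Y" and c: "c \<in> Obj C"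
  shows "inj_on (ap m c) (sec X c)"
proof (rule inj_onI)
  fix x y assume x: "x \<in> sec X c" and y: "y \<in> sec X c" and eq: "ap m c x = ap m c y"
  note X = Hom_Obj(1)[OF mH]
  have e: "m \<cdot>\<^bsub>E\<^esub> yo c X x = m \<cdot>\<^bsub>E\<^esub> yo c X y"
    unfolding yo_Comp[OF c x mH] yo_Comp[OF c y mH] eq ..
  have d: "Dom E m = X" using mH by (simp add: Hom_def)
  have "yo c X x = yo c X y"
    by (rule E.mono_cancel[OF m e, unfolded d, OF yo(1)[OF c X x] yo(1)[OF c X y]])
  then show "x = y" using yo(2)[OF c X x] yo(2)[OF c X y] by metis
qed

text \<open>Where the empty sieve covers, every sheaf has exactly one section; the sections over
  such objects therefore form an initial object. Cutting it out of \<open>X\<close> gives the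
  monicity of its map to \<open>X\<close> at the same time.\<close>

lemma initial_exists:
  assumes X: "X \<in> Obj E"
  shows "\<exists>z. is_mono E z \<and> Cod E z = X \<and> (\<forall>Y\<in>Obj E. \<exists>!f. f \<in> Hom E (Dom E z) Y)"
proof -
  let ?A = "\<lambda>c. {x \<in> sec X c. {} \<in> J c}"
  have "\<exists>Y m. m \<in> Hom E Y X \<and> is_mono E m \<and> (\<forall>c\<in>Obj C. bij_betw (ap m c) (sec Y c) (?A c))"
  proof (rule subobject[OF X])
    fix g x assume g: "g \<in> Arr C" and x: "x \<in> ?A (Cod C g)"
    have "pullback_sieve C g {} = {}" unfolding pullback_sieve_def by simp
    then have "{} \<in> J (Dom C g)" using cov_pullback[OF g refl refl, of "{}"] x by simp
    then show "rs X g x \<in> ?A (Dom C g)" using psh_mem[OF sec_psh[OF X] g refl _ refl] x by simp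
  next
    fix c S x assume c: "c \<in> Obj C" and S: "S \<in> J c" and x: "x \<in> sec X c"
      and f: "\<And>f. f \<in> S \<Longrightarrow> rs X f x \<in> ?A (Dom C f)"
    have "{} \<in> J c"
    proof (rule cov_trans[OF c S])
      show "is_sieve C c {}" unfolding is_sieve_def by simp
      show "pullback_sieve C h {} \<in> J (Dom C h)" if "h \<in> S" for h
        using f[OF that] by (simp add: pullback_sieve_def)
    qed
    then show "x \<in> ?A c" using x by simp
  qed auto
  then obtain Z z where z: "z \<in> Hom E Z X" "is_mono E z" "\<And>c. c \<in> Obj C \<Longrightarrow> bij_betw (ap z c) (sec Z c) (?A c)"
    by blast
  have em: "{} \<in> J c" if "c \<in> Obj C" "x \<in> sec Z c" for c x
    using z(3)[OF that(1)] that(2) unfolding bij_betw_def by blast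
  have sing: "\<exists>!y. y \<in> sec Y c" if "Y \<in> Obj E" "c \<in> Obj C" "{} \<in> J c" for Y c
  proof -
    have "matching (sec Y) (rs Y) {} id" unfolding matching_def by simp
    then show ?thesis using sec_shf[OF that(1)] that(2,3) unfolding shf_def by fastforce
  qed
  have "\<exists>!f. f \<in> Hom E Z Y" if Y: "Y \<in> Obj E" for Y
  proof -
    have "ntr (sec Z) (rs Z) (sec Y) (rs Y) (\<lambda>c x. THE y. y \<in> sec Y c)"
      unfolding ntr_def
    proof (intro conjI ballI)
      fix c x assume "c \<in> Obj C" "x \<in> sec Z c"
      then show "(THE y. y \<in> sec Y c) \<in> sec Y c" using theI'[OF sing[OF Y]] em by blast
    next
      fix g x assume g: "g \<in> Arr C" and x: "x \<in> sec Z (Cod C g)"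
      note c = Cod_in_Obj[OF g] Dom_in_Obj[OF g]
      have x': "rs Z g x \<in> sec Z (Dom C g)"
        using psh_mem[OF sec_psh[OF Hom_Obj(1)[OF z(1)]] g refl x refl] .
      have "(THE y. y \<in> sec Y (Cod C g)) \<in> sec Y (Cod C g)"
        using theI'[OF sing[OF Y c(1) em[OF c(1) x]]] .
      then have "rs Y g (THE y. y \<in> sec Y (Cod C g)) \<in> sec Y (Dom C g)"
        using psh_mem[OF sec_psh[OF Y] g refl _ refl] by blast
      then show "(THE y. y \<in> sec Y (Dom C g)) = rs Y g (THE y. y \<in> sec Y (Cod C g))"
        using sing[OF Y c(2) em[OF c(2) x']] by (metis the1_equality)
    qed
    from ap_full[OF Hom_Obj(1)[OF z(1)] Y this] obtain f where f: "f \<in> Hom E Z Y" by blast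
    show ?thesis
    proof (rule ex1I[of _ f], rule f)
      fix f' assume f': "f' \<in> Hom E Z Y"
      show "f' = f"
      proof (rule ap_faithful[OF f' f])
        fix c x assume "c \<in> Obj C" "x \<in> sec Z c"
        then show "ap f' c x = ap f c x"
          using sing[OF Y _ em] ap_mem[OF f'] ap_mem[OF f] by blast
      qed
    qed
  qed
  then show ?thesis using z(1,2) unfolding Hom_def by blast
qed

definition jointly_onto :: "'a \<Rightarrow> 'a \<Rightarrow> bool" where
  "jointly_onto i j \<longleftrightarrow> (\<forall>c\<in>Obj C. \<forall>z\<in>sec (Cod E i) c. \<exists>S\<in>J c. \<forall>g\<in>S.
     (\<exists>x\<in>sec (Dom E i) (Dom C g). rs (Cod E i) g z = ap i (Dom C g) x) \<or>
     (\<exists>x\<in>sec (Dom E j) (Dom C g). rs (Cod E i) g z = ap j (Dom C g) x))"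

text \<open>The sheafified disjoint union, with summands tagged by booleans. Local surjectivity of
  the unit says that each section lies locally in one summand.\<close>

lemma coproduct_onto_exists:
  assumes X: "X \<in> Obj E" and Y: "Y \<in> Obj E"
  shows "\<exists>i j. is_coproduct E i j \<and> Dom E i = X \<and> Dom E j = Y \<and> jointly_onto i j"
proof -
  let ?X = "\<lambda>b. if b then X else Y"
  define P where "P c = Sigma UNIV (\<lambda>b. sec (?X b) c)" for c
  define r where "r g p = (fst p, rs (?X (fst p)) g (snd p))" for g and p :: "bool \<times> 'u"
  have XO: "?X b \<in> Obj E" for b using X Y by simp
  note xp = sec_psh[OF XO]
  interpret s: sheafification U C J E sec ap rs P r
  proof
    show "psh P r"
      unfolding psh_def
    proof (intro conjI ballI impI)
      fix g x assume g: "g \<in> Arr C" and x: "x \<in> P (Cod C g)"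
      then show "r g x \<in> P (Dom C g)"
        using psh_mem[OF xp[of "fst x"] g refl _ refl, of "snd x"] by (auto simp: P_def r_def)
    next
      fix c x assume c: "c \<in> Obj C" and x: "x \<in> P c"
      then show "r (Ide C c) x = x"
        using psh_Ide[OF xp[of "fst x"] c, of "snd x"] by (auto simp: P_def r_def)
    next
      fix f g x assume fg: "f \<in> Arr C" "g \<in> Arr C" "Cod C g = Dom C f" and x: "x \<in> P (Cod C f)"
      then show "r (f \<cdot> g) x = r g (r f x)"
        using psh_Comp[OF xp[of "fst x"] fg, of "snd x"] by (auto simp: P_def r_def)
    qed
    fix c assume c: "c \<in> Obj C"
    show "small U (P c)"
      unfolding P_def by (rule small_Sigma[OF small_finite[OF finite] sec_small[OF XO c]])
  qed
  obtain Z \<eta> where pres: "presents P r Z \<eta>"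
    and onto: "\<And>c z. c \<in> Obj C \<Longrightarrow> z \<in> sec Z c \<Longrightarrow> \<exists>S\<in>J c. \<forall>g\<in>S. \<exists>p\<in>P (Dom C g). rs Z g z = \<eta> (Dom C g) p"
    using s.sheafify by blast
  have Z: "Z \<in> Obj E" and \<eta>: "ntr P r (sec Z) (rs Z) \<eta>" using pres unfolding presents_def by auto
  have in_: "\<exists>f\<in>Hom E (?X b) Z. \<forall>c\<in>Obj C. \<forall>x\<in>sec (?X b) c. ap f c x = \<eta> c (b, x)" for b
  proof (rule ap_full[OF XO Z])
    show "ntr (sec (?X b)) (rs (?X b)) (sec Z) (rs Z) (\<lambda>c x. \<eta> c (b, x))"
      unfolding ntr_def
    proof (intro conjI ballI)
      fix c x assume "c \<in> Obj C" "x \<in> sec (?X b) c"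
      then show "\<eta> c (b, x) \<in> sec Z c" using ntr_mem[OF \<eta>, of c "(b, x)"] by (simp add: P_def)
    next
      fix g x assume "g \<in> Arr C" "x \<in> sec (?X b) (Cod C g)"
      then show "\<eta> (Dom C g) (b, rs (?X b) g x) = rs Z g (\<eta> (Cod C g) (b, x))"
        using ntr_nat[OF \<eta>, of g "Cod C g" "Dom C g" "(b, x)"] by (simp add: P_def r_def)
    qed
  qed
  obtain i where i: "i \<in> Hom E X Z" "\<And>c x. c \<in> Obj C \<Longrightarrow> x \<in> sec X c \<Longrightarrow> ap i c x = \<eta> c (True, x)"
    using in_[of True] by auto
  obtain j where j: "j \<in> Hom E Y Z" "\<And>c x. c \<in> Obj C \<Longrightarrow> x \<in> sec Y c \<Longrightarrow> ap j c x = \<eta> c (False, x)"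
    using in_[of False] by auto
  have ij: "i \<in> Arr E" "Dom E i = X" "Cod E i = Z" "j \<in> Arr E" "Dom E j = Y" "Cod E j = Z"
    using i(1) j(1) by (auto simp: Hom_def)
  have "is_coproduct E i j"
    unfolding is_coproduct_def
  proof (intro conjI ballI impI)
    fix f g assume "f \<in> Arr E" "g \<in> Arr E" "Dom E f = Dom E i" "Dom E g = Dom E j" "Cod E f = Cod E g"
    then obtain T where fg: "f \<in> Hom E X T" "g \<in> Hom E Y T" "Cod E f = T"
      using ij by (auto simp: Hom_def)
    define t where "t c p = ap (if fst p then f else g) c (snd p)" for c and p :: "bool \<times> 'u"
    have "ntr P r (sec T) (rs T) t"
      unfolding ntr_def
    proof (intro conjI ballI)
      fix c p assume "c \<in> Obj C" "p \<in> P c"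
      then show "t c p \<in> sec T c" using ap_mem[OF fg(1)] ap_mem[OF fg(2)] by (auto simp: P_def t_def)
    next
      fix h p assume "h \<in> Arr C" "p \<in> P (Cod C h)"
      then show "t (Dom C h) (r h p) = rs T h (t (Cod C h) p)"
        using ap_nat[OF fg(1)] ap_nat[OF fg(2)] by (auto simp: P_def t_def r_def)
    qed
    then have u: "\<exists>!w. w \<in> Hom E Z T \<and> (\<forall>c\<in>Obj C. \<forall>p\<in>P c. ap w c (\<eta> c p) = t c p)"
      using pres Hom_Obj(2)[OF fg(1)] unfolding presents_def by blast
    have "(\<forall>c\<in>Obj C. \<forall>p\<in>P c. ap w c (\<eta> c p) = t c p) \<longleftrightarrow> w \<cdot>\<^bsub>E\<^esub> i = f \<and> w \<cdot>\<^bsub>E\<^esub> j = g"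
      if w: "w \<in> Hom E Z T" for w
    proof
      assume a: "\<forall>c\<in>Obj C. \<forall>p\<in>P c. ap w c (\<eta> c p) = t c p"
      have "w \<cdot>\<^bsub>E\<^esub> i = f"
      proof (rule ap_faithful[OF E.Comp_in_Hom[OF i(1) w] fg(1)])
        fix c x assume "c \<in> Obj C" "x \<in> sec X c"
        then show "ap (w \<cdot>\<^bsub>E\<^esub> i) c x = ap f c x"
          using ap_Comp[OF i(1) w] i(2) a by (auto simp: P_def t_def)
      qed
      moreover have "w \<cdot>\<^bsub>E\<^esub> j = g"
      proof (rule ap_faithful[OF E.Comp_in_Hom[OF j(1) w] fg(2)])
        fix c x assume "c \<in> Obj C" "x \<in> sec Y c"
        then show "ap (w \<cdot>\<^bsub>E\<^esub> j) c x = ap g c x"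
          using ap_Comp[OF j(1) w] j(2) a by (auto simp: P_def t_def)
      qed
      ultimately show "w \<cdot>\<^bsub>E\<^esub> i = f \<and> w \<cdot>\<^bsub>E\<^esub> j = g" by blast
    next
      assume a: "w \<cdot>\<^bsub>E\<^esub> i = f \<and> w \<cdot>\<^bsub>E\<^esub> j = g"
      show "\<forall>c\<in>Obj C. \<forall>p\<in>P c. ap w c (\<eta> c p) = t c p"
      proof (intro ballI)
        fix c p assume c: "c \<in> Obj C" and p: "p \<in> P c"
        obtain b x where bx: "p = (b, x)" by (cases p)
        show "ap w c (\<eta> c p) = t c p"
        proof (cases b)
          case True
          then have "x \<in> sec X c" using p bx by (simp add: P_def)
          then show ?thesis using ap_Comp[OF i(1) w c] i(2)[OF c] a bx True by (simp add: t_def)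
        next
          case False
          then have "x \<in> sec Y c" using p bx by (simp add: P_def)
          then show ?thesis using ap_Comp[OF j(1) w c] j(2)[OF c] a bx False by (simp add: t_def)
        qed
      qed
    qed
    then show "\<exists>!w. w \<in> Hom E (Cod E i) (Cod E f) \<and> w \<cdot>\<^bsub>E\<^esub> i = f \<and> w \<cdot>\<^bsub>E\<^esub> j = g"
      using u ij(3) fg(3) by (metis (no_types, lifting))
  qed (use ij in auto)
  moreover have "jointly_onto i j"
    unfolding jointly_onto_def ij
  proof (intro ballI)
    fix c z assume c: "c \<in> Obj C" and z: "z \<in> sec Z c"
    obtain S where S: "S \<in> J c" "\<forall>g\<in>S. \<exists>p\<in>P (Dom C g). rs Z g z = \<eta> (Dom C g) p"
      using onto[OF c z] by blast
    have "(\<exists>x\<in>sec X (Dom C g). rs Z g z = ap i (Dom C g) x) \<or>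
        (\<exists>x\<in>sec Y (Dom C g). rs Z g z = ap j (Dom C g) x)" if g: "g \<in> S" for g
    proof -
      obtain b x where p: "(b, x) \<in> P (Dom C g)" "rs Z g z = \<eta> (Dom C g) (b, x)"
        using S(2) g by (metis surj_pair)
      have d: "Dom C g \<in> Obj C" using cov_Arr[OF S(1) c g] Dom_in_Obj by blast
      show ?thesis using p i(2)[OF d] j(2)[OF d] by (cases b) (auto simp: P_def)
    qed
    then show "\<exists>S\<in>J c. \<forall>g\<in>S. (\<exists>x\<in>sec X (Dom C g). rs Z g z = ap i (Dom C g) x) \<or>
        (\<exists>x\<in>sec Y (Dom C g). rs Z g z = ap j (Dom C g) x)" using S(1) by blast
  qed
  ultimately show ?thesis using ij by blast
qed

text \<open>Copairings refer to arbitrary coproducts, so local surjectivity is carried from the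
  constructed one along the canonical comparison maps \<open>v\<close> and \<open>w\<close>.\<close>

lemma coproduct_onto:
  assumes ij: "is_coproduct E i j"
  shows "jointly_onto i j"
proof -
  have A: "i \<in> Arr E" "j \<in> Arr E" "Cod E i = Cod E j" using ij unfolding is_coproduct_def by auto
  obtain i' j' where c': "is_coproduct E i' j'" "Dom E i' = Dom E i" "Dom E j' = Dom E j" "jointly_onto i' j'"
    using coproduct_onto_exists[of "Dom E i" "Dom E j"] A E.Dom_in_Obj by blast
  have A': "i' \<in> Arr E" "j' \<in> Arr E" "Cod E i' = Cod E j'" using c'(1) unfolding is_coproduct_def by auto
  have univ: "\<exists>!w. w \<in> Hom E (Cod E i) (Cod E f) \<and> w \<cdot>\<^bsub>E\<^esub> i = f \<and> w \<cdot>\<^bsub>E\<^esub> j = g"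
    if "f \<in> Arr E" "g \<in> Arr E" "Dom E f = Dom E i" "Dom E g = Dom E j" "Cod E f = Cod E g" for f g
    using ij that unfolding is_coproduct_def by blast
  have univ': "\<exists>!w. w \<in> Hom E (Cod E i') (Cod E f) \<and> w \<cdot>\<^bsub>E\<^esub> i' = f \<and> w \<cdot>\<^bsub>E\<^esub> j' = g"
    if "f \<in> Arr E" "g \<in> Arr E" "Dom E f = Dom E i'" "Dom E g = Dom E j'" "Cod E f = Cod E g" for f g
    using c'(1) that unfolding is_coproduct_def by blast
  obtain w where w: "w \<in> Hom E (Cod E i') (Cod E i)" "w \<cdot>\<^bsub>E\<^esub> i' = i" "w \<cdot>\<^bsub>E\<^esub> j' = j"
    using univ'[of i j] A A' c' by auto
  obtain v where v: "v \<in> Hom E (Cod E i) (Cod E i')" "v \<cdot>\<^bsub>E\<^esub> i = i'" "v \<cdot>\<^bsub>E\<^esub> j = j'"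
    using univ[of i' j'] A A' c' by auto
  have iH: "i \<in> Hom E (Dom E i) (Cod E i)" "j \<in> Hom E (Dom E j) (Cod E i)"
    "i' \<in> Hom E (Dom E i) (Cod E i')" "j' \<in> Hom E (Dom E j) (Cod E i')"
    using A A' c' by (auto simp: Hom_def)
  have wv: "w \<cdot>\<^bsub>E\<^esub> v = Ide E (Cod E i)"
  proof -
    have "w \<cdot>\<^bsub>E\<^esub> v \<in> Hom E (Cod E i) (Cod E i) \<and> w \<cdot>\<^bsub>E\<^esub> v \<cdot>\<^bsub>E\<^esub> i = i \<and> w \<cdot>\<^bsub>E\<^esub> v \<cdot>\<^bsub>E\<^esub> j = j"
      using E.Comp_in_Hom[OF v(1) w(1)] E.Comp_assoc[OF iH(1) v(1) w(1)] E.Comp_assoc[OF iH(2) v(1) w(1)] v w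
      by simp
    moreover have "Ide E (Cod E i) \<in> Hom E (Cod E i) (Cod E i) \<and> Ide E (Cod E i) \<cdot>\<^bsub>E\<^esub> i = i \<and> Ide E (Cod E i) \<cdot>\<^bsub>E\<^esub> j = j"
      using E.Ide_in_Hom E.Cod_in_Obj[OF A(1)] E.Ide_Comp iH by blast
    ultimately show ?thesis using univ[of i j] A by blast
  qed
  show ?thesis
    unfolding jointly_onto_def
  proof (intro ballI)
    fix c z assume c: "c \<in> Obj C" and z: "z \<in> sec (Cod E i) c"
    have vz: "ap v c z \<in> sec (Cod E i') c" using ap_mem[OF v(1) c z] .
    obtain S where S: "S \<in> J c" "\<And>g. g \<in> S \<Longrightarrow>
        (\<exists>x\<in>sec (Dom E i) (Dom C g). rs (Cod E i') g (ap v c z) = ap i' (Dom C g) x) \<or>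
        (\<exists>x\<in>sec (Dom E j) (Dom C g). rs (Cod E i') g (ap v c z) = ap j' (Dom C g) x)"
      using c'(4) c vz unfolding jointly_onto_def c'(2,3) by blast
    have "(\<exists>x\<in>sec (Dom E i) (Dom C g). rs (Cod E i) g z = ap i (Dom C g) x) \<or>
        (\<exists>x\<in>sec (Dom E j) (Dom C g). rs (Cod E i) g z = ap j (Dom C g) x)" if g: "g \<in> S" for g
    proof -
      have gA: "g \<in> Arr C" "Cod C g = c" "Dom C g \<in> Obj C"
        using cov_Arr[OF S(1) c g] cov_Cod[OF S(1) c g] Dom_in_Obj by auto
      have "ap w c (ap v c z) = z"
        using ap_Comp[OF v(1) w(1) c z] ap_Ide[OF Hom_Obj(1)[OF v(1)] c z] wv by simp
      then have e: "rs (Cod E i) g z = ap w (Dom C g) (rs (Cod E i') g (ap v c z))"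
        using ap_nat[OF w(1) gA(1,2) refl vz] by simp
      show ?thesis
        unfolding e
        using S(2)[OF g] ap_Comp[OF iH(3) w(1) gA(3)] ap_Comp[OF iH(4) w(1) gA(3)] w(2,3)
        by (metis (no_types))
    qed
    then show "\<exists>S\<in>J c. \<forall>g\<in>S.
        (\<exists>x\<in>sec (Dom E i) (Dom C g). rs (Cod E i) g z = ap i (Dom C g) x) \<or>
        (\<exists>x\<in>sec (Dom E j) (Dom C g). rs (Cod E i) g z = ap j (Dom C g) x)" using S(1) by blast
  qed
qed

text \<open>Limits of sheaves are computed on sections: compatible pairs glue componentwise, and
  separatedness of \<open>D\<close> preserves their compatibility.\<close>

lemma pullback_exists:
  assumes f: "f \<in> Hom E X D" and g: "g \<in> Hom E Y D"
  shows "\<exists>p q. is_pullback E f g p q"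
proof -
  define P where "P c = {(x, y). x \<in> sec X c \<and> y \<in> sec Y c \<and> ap f c x = ap g c y}" for c
  define r where "r h p = (rs X h (fst p), rs Y h (snd p))" for h and p :: "'u \<times> 'u"
  note O = Hom_Obj(1)[OF f] Hom_Obj(1)[OF g] Hom_Obj(2)[OF f]
  note Xp = sec_psh[OF O(1)] and Yp = sec_psh[OF O(2)]
  have Pp: "psh P r"
    unfolding psh_def
  proof (intro conjI ballI impI)
    fix h p assume h: "h \<in> Arr C" and p: "p \<in> P (Cod C h)"
    then show "r h p \<in> P (Dom C h)"
      using ap_nat[OF f h refl refl] ap_nat[OF g h refl refl] psh_mem[OF Xp h refl _ refl]
        psh_mem[OF Yp h refl _ refl] by (auto simp: P_def r_def)
  next
    fix c p assume "c \<in> Obj C" "p \<in> P c"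
    then show "r (Ide C c) p = p" using psh_Ide[OF Xp] psh_Ide[OF Yp] by (auto simp: P_def r_def)
  next
    fix h k p assume hk: "h \<in> Arr C" "k \<in> Arr C" "Cod C k = Dom C h" and p: "p \<in> P (Cod C h)"
    then show "r (h \<cdot> k) p = r k (r h p)"
      using psh_Comp[OF Xp hk] psh_Comp[OF Yp hk] by (auto simp: P_def r_def)
  qed
  have Ps: "shf P r"
    unfolding shf_def
  proof (intro conjI ballI allI impI Pp)
    fix c S x assume c: "c \<in> Obj C" and S: "S \<in> J c" and m: "matching P r S x"
    note SA = cov_Arr[OF S c] cov_Cod[OF S c]
    have xP: "fst (x h) \<in> sec X (Dom C h)" "snd (x h) \<in> sec Y (Dom C h)"
      "ap f (Dom C h) (fst (x h)) = ap g (Dom C h) (snd (x h))" if "h \<in> S" for h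
      using m that unfolding matching_def P_def by auto
    have mX: "matching (sec X) (rs X) S (\<lambda>h. fst (x h))" and mY: "matching (sec Y) (rs Y) S (\<lambda>h. snd (x h))"
      using m xP unfolding matching_def by (auto simp: r_def)
    obtain a where a: "a \<in> sec X c" "\<forall>h\<in>S. rs X h a = fst (x h)"
      using shf_glue[OF sec_shf[OF O(1)] c S mX] by blast
    obtain b where b: "b \<in> sec Y c" "\<forall>h\<in>S. rs Y h b = snd (x h)"
      using shf_glue[OF sec_shf[OF O(2)] c S mY] by blast
    have "ap f c a = ap g c b"
    proof (rule shf_sep[OF sec_shf[OF O(3)] c S ap_mem[OF f c a(1)] ap_mem[OF g c b(1)]])
      fix h assume h: "h \<in> S"
      show "rs D h (ap f c a) = rs D h (ap g c b)"
        using ap_nat[OF f SA(1)[OF h] SA(2)[OF h] refl a(1)] ap_nat[OF g SA(1)[OF h] SA(2)[OF h] refl b(1)]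
          a(2) b(2) h xP(3)[OF h] by simp
    qed
    then have ab: "(a, b) \<in> P c \<and> (\<forall>h\<in>S. r h (a, b) = x h)" using a b by (simp add: P_def r_def)
    moreover have "y = (a, b)" if y: "y \<in> P c \<and> (\<forall>h\<in>S. r h y = x h)" for y
    proof -
      have 1: "fst y = a"
      proof (rule shf_sep[OF sec_shf[OF O(1)] c S _ a(1)])
        show "fst y \<in> sec X c" using y by (auto simp: P_def)
        show "rs X h (fst y) = rs X h a" if "h \<in> S" for h
          using y a(2) that by (metis fst_conv r_def)
      qed
      have 2: "snd y = b"
      proof (rule shf_sep[OF sec_shf[OF O(2)] c S _ b(1)])
        show "snd y \<in> sec Y c" using y by (auto simp: P_def)
        show "rs Y h (snd y) = rs Y h b" if "h \<in> S" for h
          using y b(2) that by (metis snd_conv r_def)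
      qed
      from 1 2 show ?thesis by (metis prod.collapse)
    qed
    ultimately show "\<exists>!y. y \<in> P c \<and> (\<forall>h\<in>S. r h y = x h)" by (rule ex1I)
  qed
  have "small U (P c)" if "c \<in> Obj C" for c
    by (rule small_subset[OF _ small_Times[OF sec_small[OF O(1) that] sec_small[OF O(2) that]]])
      (auto simp: P_def)
  from make_obj[OF Ps this] obtain R \<phi> where R: "R \<in> Obj E" and \<phi>: "ntr P r (sec R) (rs R) \<phi>"
    and b: "\<And>c. c \<in> Obj C \<Longrightarrow> bij_betw (\<phi> c) (P c) (sec R c)" by blast
  define \<psi> where "\<psi> c = inv_into (P c) (\<phi> c)" for c
  have \<psi>: "ntr (sec R) (rs R) P r \<psi>" unfolding \<psi>_def using ntr_inv[OF Pp \<phi> b] .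
  have \<psi>\<phi>: "\<psi> c (\<phi> c p) = p" if "c \<in> Obj C" "p \<in> P c" for c p
    using b[OF that(1)] that(2) unfolding \<psi>_def by (simp add: bij_betw_def)
  have \<phi>\<psi>: "\<phi> c (\<psi> c z) = z" if "c \<in> Obj C" "z \<in> sec R c" for c z
    using b[OF that(1)] that(2) unfolding \<psi>_def by (simp add: bij_betw_def f_inv_into_f)
  have \<psi>P: "fst (\<psi> c z) \<in> sec X c" "snd (\<psi> c z) \<in> sec Y c" "ap f c (fst (\<psi> c z)) = ap g c (snd (\<psi> c z))"
    if "c \<in> Obj C" "z \<in> sec R c" for c z
    using ntr_mem[OF \<psi> that] by (auto simp: P_def)
  have "ntr P r (sec X) (rs X) (\<lambda>c p. fst p)" "ntr P r (sec Y) (rs Y) (\<lambda>c p. snd p)"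
    unfolding ntr_def by (auto simp: P_def r_def)
  from ap_full[OF R O(1) ntr_comp[OF \<psi> this(1)]] ap_full[OF R O(2) ntr_comp[OF \<psi> this(2)]]
  obtain p q where p: "p \<in> Hom E R X" "\<forall>c\<in>Obj C. \<forall>z\<in>sec R c. ap p c z = fst (\<psi> c z)"
    and q: "q \<in> Hom E R Y" "\<forall>c\<in>Obj C. \<forall>z\<in>sec R c. ap q c z = snd (\<psi> c z)" by blast
  have dom: "f \<in> Arr E" "Dom E f = X" "Cod E f = D" "g \<in> Arr E" "Dom E g = Y" "Cod E g = D"
    "p \<in> Arr E" "Dom E p = R" "Cod E p = X" "q \<in> Arr E" "Dom E q = R" "Cod E q = Y"
    using f g p(1) q(1) by (auto simp: Hom_def)
  have "is_pullback E f g p q"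
    unfolding is_pullback_def dom
  proof (intro conjI ballI impI)
    show "f \<cdot>\<^bsub>E\<^esub> p = g \<cdot>\<^bsub>E\<^esub> q"
      by (rule ap_faithful[OF E.Comp_in_Hom[OF p(1) f] E.Comp_in_Hom[OF q(1) g]])
        (simp add: ap_Comp[OF p(1) f] ap_Comp[OF q(1) g] p(2) q(2) \<psi>P)
    fix u v assume "u \<in> Arr E" "v \<in> Arr E" "Dom E u = Dom E v" "Cod E u = X" "Cod E v = Y"
      and eq: "f \<cdot>\<^bsub>E\<^esub> u = g \<cdot>\<^bsub>E\<^esub> v"
    then obtain W where u: "u \<in> Hom E W X" and v: "v \<in> Hom E W Y" and W: "Dom E u = W"
      by (auto simp: Hom_def)
    have uv: "(ap u c z, ap v c z) \<in> P c" if "c \<in> Obj C" "z \<in> sec W c" for c z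
      using ap_mem[OF u that] ap_mem[OF v that] ap_Comp[OF u f that] ap_Comp[OF v g that] eq
      by (simp add: P_def)
    have "ntr (sec W) (rs W) P r (\<lambda>c z. (ap u c z, ap v c z))"
      unfolding ntr_def using uv ap_nat[OF u _ refl refl] ap_nat[OF v _ refl refl] by (simp add: r_def)
    from ap_full[OF Hom_Obj(1)[OF u] R ntr_comp[OF this \<phi>]] obtain w where w: "w \<in> Hom E W R"
        "\<forall>c\<in>Obj C. \<forall>z\<in>sec W c. ap w c z = \<phi> c (ap u c z, ap v c z)" by blast
    have "p \<cdot>\<^bsub>E\<^esub> w = u"
      by (rule ap_faithful[OF E.Comp_in_Hom[OF w(1) p(1)] u])
        (use ap_Comp[OF w(1) p(1)] p(2) ap_mem[OF w(1)] w(2) \<psi>\<phi> uv in simp)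
    moreover have "q \<cdot>\<^bsub>E\<^esub> w = v"
      by (rule ap_faithful[OF E.Comp_in_Hom[OF w(1) q(1)] v])
        (use ap_Comp[OF w(1) q(1)] q(2) ap_mem[OF w(1)] w(2) \<psi>\<phi> uv in simp)
    moreover have "w' = w" if w': "w' \<in> Hom E W R" "p \<cdot>\<^bsub>E\<^esub> w' = u" "q \<cdot>\<^bsub>E\<^esub> w' = v" for w'
    proof (rule ap_faithful[OF w'(1) w(1)])
      fix c z assume c: "c \<in> Obj C" and z: "z \<in> sec W c"
      have m: "ap w' c z \<in> sec R c" using ap_mem[OF w'(1) c z] .
      have "\<psi> c (ap w' c z) = (ap u c z, ap v c z)"
        using ap_Comp[OF w'(1) p(1) c z] ap_Comp[OF w'(1) q(1) c z] p(2) q(2) w'(2,3) c m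
        by (metis prod.collapse)
      then show "ap w' c z = ap w c z" using \<phi>\<psi>[OF c m] w(2) c z by simp
    qed
    ultimately show "\<exists>!w. w \<in> Hom E (Dom E u) R \<and> p \<cdot>\<^bsub>E\<^esub> w = u \<and> q \<cdot>\<^bsub>E\<^esub> w = v"
      using w(1) W by blast
  qed (use dom in auto)
  then show ?thesis by blast
qed

text \<open>A compatible pair of sections is a cone with vertex \<open>gen c\<close>; the mediating
  map names the wanted section.\<close>

lemma pullback_sec:
  assumes pb: "is_pullback E f g p q" and c: "c \<in> Obj C" and x: "x \<in> sec (Dom E f) c" and y: "y \<in> sec (Dom E g) c"
    and eq: "ap f c x = ap g c y"
  shows "\<exists>z\<in>sec (Dom E p) c. ap p c z = x \<and> ap q c z = y"
proof -
  have A: "f \<in> Arr E" "g \<in> Arr E" "Cod E f = Cod E g" "p \<in> Arr E" "q \<in> Arr E" "Dom E p = Dom E q"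
      "Cod E p = Dom E f" "Cod E q = Dom E g"
    and univ: "\<And>u v. u \<in> Arr E \<Longrightarrow> v \<in> Arr E \<Longrightarrow> Dom E u = Dom E v \<Longrightarrow> Cod E u = Dom E f \<Longrightarrow>
      Cod E v = Dom E g \<Longrightarrow> f \<cdot>\<^bsub>E\<^esub> u = g \<cdot>\<^bsub>E\<^esub> v \<Longrightarrow>
      \<exists>!w. w \<in> Hom E (Dom E u) (Dom E p) \<and> p \<cdot>\<^bsub>E\<^esub> w = u \<and> q \<cdot>\<^bsub>E\<^esub> w = v"
    using pb unfolding is_pullback_def by blast+
  have H: "f \<in> Hom E (Dom E f) (Cod E f)" "g \<in> Hom E (Dom E g) (Cod E f)"
    "p \<in> Hom E (Dom E p) (Dom E f)" "q \<in> Hom E (Dom E p) (Dom E g)"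
    using A by (auto simp: Hom_def)
  note O = Hom_Obj(1)[OF H(1)] Hom_Obj(1)[OF H(2)]
  note yx = yo(1)[OF c O(1) x] and yy = yo(1)[OF c O(2) y]
  have "f \<cdot>\<^bsub>E\<^esub> yo c (Dom E f) x = g \<cdot>\<^bsub>E\<^esub> yo c (Dom E g) y"
    using yo_Comp[OF c x H(1)] yo_Comp[OF c y H(2)] eq by simp
  then obtain w where w: "w \<in> Hom E (gen c) (Dom E p)" "p \<cdot>\<^bsub>E\<^esub> w = yo c (Dom E f) x"
      "q \<cdot>\<^bsub>E\<^esub> w = yo c (Dom E g) y"
    using univ[of "yo c (Dom E f) x" "yo c (Dom E g) y"] yx yy by (auto simp: Hom_def)
  have "ap p c (ap w c (pt c)) = x" "ap q c (ap w c (pt c)) = y"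
    using ap_Comp[OF w(1) H(3) c pt_mem[OF c]] ap_Comp[OF w(1) H(4) c pt_mem[OF c]] w(2,3)
      yo(2)[OF c O(1) x] yo(2)[OF c O(2) y] by simp_all
  then show ?thesis using ap_mem[OF w(1) c pt_mem[OF c]] by blast
qed

text \<open>Descent for maps: \<open>\<rho>\<close> prescribes values wherever it is defined, and it
  is defined locally everywhere, so the prescribed values glue in \<open>T\<close>. The case in view
  is a union of subobjects, whose sections lie only locally in one of the parts.\<close>

lemma glue_local_map:
  assumes W: "W \<in> Obj E" and T: "T \<in> Obj E"
    and \<rho>: "\<And>c d y. c \<in> Obj C \<Longrightarrow> \<rho> c d y \<Longrightarrow> d \<in> sec W c \<and> y \<in> sec T c"
    and st: "\<And>h d y. h \<in> Arr C \<Longrightarrow> \<rho> (Cod C h) d y \<Longrightarrow> \<rho> (Dom C h) (rs W h d) (rs T h y)"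
    and functional: "\<And>c d y y'. c \<in> Obj C \<Longrightarrow> \<rho> c d y \<Longrightarrow> \<rho> c d y' \<Longrightarrow> y = y'"
    and tot: "\<And>c d. c \<in> Obj C \<Longrightarrow> d \<in> sec W c \<Longrightarrow> \<exists>S\<in>J c. \<forall>h\<in>S. \<exists>y. \<rho> (Dom C h) (rs W h d) y"
  shows "\<exists>w\<in>Hom E W T. \<forall>c\<in>Obj C. \<forall>d y. \<rho> c d y \<longrightarrow> ap w c d = y"
proof -
  note Wp = sec_psh[OF W] and Tp = sec_psh[OF T]
  have ex: "\<exists>!y. y \<in> sec T c \<and> (\<forall>h y'. h \<in> Arr C \<longrightarrow> Cod C h = c \<longrightarrow> \<rho> (Dom C h) (rs W h d) y' \<longrightarrow> rs T h y = y')"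
    if c: "c \<in> Obj C" and d: "d \<in> sec W c" for c d
  proof -
    obtain S where S: "S \<in> J c" "\<forall>h\<in>S. \<exists>y. \<rho> (Dom C h) (rs W h d) y" using tot[OF c d] by blast
    then obtain x where x: "\<And>h. h \<in> S \<Longrightarrow> \<rho> (Dom C h) (rs W h d) (x h)" by metis
    note SA = cov_Arr[OF S(1) c] cov_Cod[OF S(1) c] cov_Comp[OF S(1) c]
    have "matching (sec T) (rs T) S x"
      unfolding matching_def
    proof (intro conjI ballI impI)
      fix f assume f: "f \<in> S"
      show "x f \<in> sec T (Dom C f)" using \<rho>[OF Dom_in_Obj[OF SA(1)[OF f]] x[OF f]] by blast
      fix g assume g: "g \<in> Arr C" "Cod C g = Dom C f"
      have "\<rho> (Dom C g) (rs W g (rs W f d)) (rs T g (x f))" using st[OF g(1)] x[OF f] g(2) by simp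
      moreover have "rs W g (rs W f d) = rs W (f \<cdot> g) d"
        using psh_Comp[OF Wp SA(1)[OF f] g] d SA(2)[OF f] by simp
      moreover have "\<rho> (Dom C g) (rs W (f \<cdot> g) d) (x (f \<cdot> g))"
        using x[OF SA(3)[OF f g]] g SA(1)[OF f] by (simp add: Dom_Comp)
      ultimately show "x (f \<cdot> g) = rs T g (x f)" using functional[OF Dom_in_Obj[OF g(1)]] by metis
    qed
    then obtain y where y: "y \<in> sec T c" "\<forall>f\<in>S. rs T f y = x f"
      using shf_glue[OF sec_shf[OF T] c S(1)] by blast
    show ?thesis
    proof (rule ex1I[of _ y], intro conjI allI impI y(1))
      fix h y' assume h: "h \<in> Arr C" "Cod C h = c" and y': "\<rho> (Dom C h) (rs W h d) y'"
      note dO = Dom_in_Obj[OF h(1)]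
      show "rs T h y = y'"
      proof (rule shf_sep[OF sec_shf[OF T] dO cov_pullback[OF h refl S(1)]])
        show "rs T h y \<in> sec T (Dom C h)" using psh_mem[OF Tp h y(1) refl] .
        show "y' \<in> sec T (Dom C h)" using \<rho>[OF dO y'] by blast
        fix k assume "k \<in> pullback_sieve C h S"
        then have k: "k \<in> Arr C" "Cod C k = Dom C h" "h \<cdot> k \<in> S" by (auto simp: pullback_sieve_def)
        have "\<rho> (Dom C k) (rs W k (rs W h d)) (rs T k y')" using st[OF k(1)] y' k(2) by simp
        moreover have "rs W k (rs W h d) = rs W (h \<cdot> k) d" using psh_Comp[OF Wp h(1) k(1,2)] d h by simp
        moreover have "\<rho> (Dom C k) (rs W (h \<cdot> k) d) (x (h \<cdot> k))"
          using x[OF k(3)] k h by (simp add: Dom_Comp)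
        ultimately have "rs T k y' = x (h \<cdot> k)" using functional[OF Dom_in_Obj[OF k(1)]] by metis
        moreover have "rs T k (rs T h y) = rs T (h \<cdot> k) y"
          using psh_Comp[OF Tp h(1) k(1,2)] y(1) h(2) by simp
        ultimately show "rs T k (rs T h y) = rs T k y'" using y(2) k(3) by simp
      qed
    next
      fix z assume z: "z \<in> sec T c \<and> (\<forall>h y'. h \<in> Arr C \<longrightarrow> Cod C h = c \<longrightarrow> \<rho> (Dom C h) (rs W h d) y' \<longrightarrow> rs T h z = y')"
      show "z = y"
        by (rule shf_sep[OF sec_shf[OF T] c S(1)]) (use z y x SA in auto)
    qed
  qed
  define t where "t c d = (THE y. y \<in> sec T c \<and>
    (\<forall>h y'. h \<in> Arr C \<longrightarrow> Cod C h = c \<longrightarrow> \<rho> (Dom C h) (rs W h d) y' \<longrightarrow> rs T h y = y'))" for c d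
  have t: "t c d \<in> sec T c"
    "\<And>h y'. h \<in> Arr C \<Longrightarrow> Cod C h = c \<Longrightarrow> \<rho> (Dom C h) (rs W h d) y' \<Longrightarrow> rs T h (t c d) = y'"
    if "c \<in> Obj C" "d \<in> sec W c" for c d
    using theI'[OF ex[OF that]] unfolding t_def by blast+
  have tu: "t c d = y" if "c \<in> Obj C" "d \<in> sec W c" "y \<in> sec T c"
    "\<And>h y'. h \<in> Arr C \<Longrightarrow> Cod C h = c \<Longrightarrow> \<rho> (Dom C h) (rs W h d) y' \<Longrightarrow> rs T h y = y'" for c d y
    using ex[OF that(1,2)] t[OF that(1,2)] that(3,4) by blast
  have "ntr (sec W) (rs W) (sec T) (rs T) t"
    unfolding ntr_def
  proof (intro conjI ballI)
    fix g d assume g: "g \<in> Arr C" and d: "d \<in> sec W (Cod C g)"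
    note c = Cod_in_Obj[OF g] Dom_in_Obj[OF g]
    show "t (Dom C g) (rs W g d) = rs T g (t (Cod C g) d)"
    proof (rule tu[OF c(2) psh_mem[OF Wp g refl d refl] psh_mem[OF Tp g refl t(1)[OF c(1) d] refl]])
      fix h y' assume h: "h \<in> Arr C" "Cod C h = Dom C g" and y': "\<rho> (Dom C h) (rs W h (rs W g d)) y'"
      have "\<rho> (Dom C (g \<cdot> h)) (rs W (g \<cdot> h) d) y'"
        using y' psh_Comp[OF Wp g h d] g h by (simp add: Dom_Comp)
      then have "rs T (g \<cdot> h) (t (Cod C g) d) = y'"
        using t(2)[OF c(1) d, of "g \<cdot> h"] g h by (simp add: Comp_Arr Cod_Comp)
      then show "rs T h (rs T g (t (Cod C g) d)) = y'"
        using psh_Comp[OF Tp g h t(1)[OF c(1) d]] by simp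
    qed
  qed (use t(1) in blast)
  from ap_full[OF W T this] obtain w where w: "w \<in> Hom E W T" "\<forall>c\<in>Obj C. \<forall>d\<in>sec W c. ap w c d = t c d" by blast
  have "ap w c d = y" if c: "c \<in> Obj C" and y: "\<rho> c d y" for c d y
  proof -
    have d: "d \<in> sec W c" "y \<in> sec T c" using \<rho>[OF c y] by auto
    have "rs T (Ide C c) (t c d) = y"
      using t(2)[OF c d(1), of "Ide C c" y] y c psh_Ide[OF Wp c d(1)] by (simp add: cat_simps)
    then show ?thesis using psh_Ide[OF Tp c t(1)[OF c d(1)]] w(2) c d(1) by simp
  qed
  then show ?thesis using w(1) by blast
qed

end

section \<open>Unions of subobjects and maps out of them\<close>

context sheaf_rep
begin

definition locally_in :: "'a \<Rightarrow> 'a \<Rightarrow> 'u \<Rightarrow> 'u \<Rightarrow> bool" where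
  "locally_in f g c d \<longleftrightarrow> {h \<in> Arr C. Cod C h = c \<and>
     (rs (Cod E f) h d \<in> ap f (Dom C h) ` sec (Dom E f) (Dom C h) \<or>
      rs (Cod E f) h d \<in> ap g (Dom C h) ` sec (Dom E g) (Dom C h))} \<in> J c"

text \<open>Preimages under a mono are unique, so local preimages match and glue.\<close>

lemma mono_image_local:
  assumes m: "is_mono E m" and mH: "m \<in> Hom E V D" and c: "c \<in> Obj C" and d: "d \<in> sec D c" and S: "S \<in> J c"
    and im: "\<And>h. h \<in> S \<Longrightarrow> rs D h d \<in> ap m (Dom C h) ` sec V (Dom C h)"
  shows "d \<in> ap m c ` sec V c"
proof -
  note SA = cov_Arr[OF S c] cov_Cod[OF S c] cov_Comp[OF S c]
  note O = Hom_Obj[OF mH]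
  have "\<forall>h\<in>S. \<exists>y. y \<in> sec V (Dom C h) \<and> ap m (Dom C h) y = rs D h d"
    by (rule ballI, drule im) (auto simp: image_iff)
  from bchoice[OF this] obtain x
    where x: "\<And>h. h \<in> S \<Longrightarrow> x h \<in> sec V (Dom C h) \<and> ap m (Dom C h) (x h) = rs D h d" by blast
  have "matching (sec V) (rs V) S x"
    unfolding matching_def
  proof (intro conjI ballI impI)
    fix f assume f: "f \<in> S"
    show "x f \<in> sec V (Dom C f)" using x[OF f] by blast
    fix g assume g: "g \<in> Arr C" "Cod C g = Dom C f"
    have "ap m (Dom C g) (rs V g (x f)) = rs D g (rs D f d)"
      using ap_nat[OF mH g refl] x[OF f] by metis
    also have "\<dots> = ap m (Dom C g) (x (f \<cdot> g))"
      using x[OF SA(3)[OF f g]] psh_Comp[OF sec_psh[OF O(2)] SA(1)[OF f] g] d SA[OF f] g by (simp add: Dom_Comp)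
    finally have e: "ap m (Dom C g) (rs V g (x f)) = ap m (Dom C g) (x (f \<cdot> g))" .
    have "x (f \<cdot> g) \<in> sec V (Dom C g)"
      using x[OF SA(3)[OF f g]] g SA(1)[OF f] by (simp add: Dom_Comp)
    moreover have "rs V g (x f) \<in> sec V (Dom C g)"
      using psh_mem[OF sec_psh[OF O(1)] g _ refl] x[OF f] by blast
    ultimately show "x (f \<cdot> g) = rs V g (x f)"
      using inj_onD[OF ap_inj_if_mono[OF m mH Dom_in_Obj[OF g(1)]] e] by metis
  qed
  then obtain y where y: "y \<in> sec V c" "\<forall>h\<in>S. rs V h y = x h" using shf_glue[OF sec_shf[OF O(1)] c S] by blast
  have "ap m c y = d"
  proof (rule shf_sep[OF sec_shf[OF O(2)] c S ap_mem[OF mH c y(1)] d])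
    fix h assume h: "h \<in> S"
    show "rs D h (ap m c y) = rs D h d"
      using ap_nat[OF mH SA(1)[OF h] SA(2)[OF h] refl y(1)] y(2) x[OF h] h by simp
  qed
  then show ?thesis using y(1) by blast
qed

text \<open>The pointwise union of two subsheaves need not be a sheaf; the sections lying locally in
  one of them do form one. It is the least upper bound because images of monos are closed under
  local membership.\<close>

lemma union_exists_local:
  assumes f: "is_mono E f" and g: "is_mono E g" and fg: "Cod E f = Cod E g"
  shows "\<exists>u. is_union E f g u \<and> (\<forall>c\<in>Obj C. \<forall>x\<in>sec (Dom E u) c. locally_in f g c (ap u c x))"
proof -
  define D where "D = Cod E f"
  have H: "f \<in> Hom E (Dom E f) D" "g \<in> Hom E (Dom E g) D"
    using E.mono_Arr f g fg by (auto simp: Hom_def D_def)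
  note O = Hom_Obj[OF H(1)] Hom_Obj[OF H(2)]
  let ?Q = "\<lambda>d h. rs D h d \<in> ap f (Dom C h) ` sec (Dom E f) (Dom C h) \<or>
      rs D h d \<in> ap g (Dom C h) ` sec (Dom E g) (Dom C h)"
  have L: "locally_in f g c d \<longleftrightarrow> {h \<in> Arr C. Cod C h = c \<and> ?Q d h} \<in> J c" for c d
    unfolding locally_in_def D_def by simp
  have stable: "?Q d (h \<cdot> k)" if "h \<in> Arr C" "k \<in> Arr C" "Cod C k = Dom C h" "d \<in> sec D (Cod C h)" "?Q d h" for d h k
  proof -
    have e: "rs D (h \<cdot> k) d = rs D k (rs D h d)" using psh_Comp[OF sec_psh[OF O(2)] that(1-4)] .
    have "rs D k (ap f (Dom C h) x) \<in> ap f (Dom C k) ` sec (Dom E f) (Dom C k)" if "x \<in> sec (Dom E f) (Dom C h)" for x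
      using ap_nat[OF H(1) \<open>k \<in> Arr C\<close> \<open>Cod C k = Dom C h\<close> refl that]
        psh_mem[OF sec_psh[OF O(1)] \<open>k \<in> Arr C\<close> \<open>Cod C k = Dom C h\<close> that refl] by (metis imageI)
    moreover have "rs D k (ap g (Dom C h) x) \<in> ap g (Dom C k) ` sec (Dom E g) (Dom C k)" if "x \<in> sec (Dom E g) (Dom C h)" for x
      using ap_nat[OF H(2) \<open>k \<in> Arr C\<close> \<open>Cod C k = Dom C h\<close> refl that]
        psh_mem[OF sec_psh[OF O(3)] \<open>k \<in> Arr C\<close> \<open>Cod C k = Dom C h\<close> that refl] by (metis imageI)
    ultimately show ?thesis using that(2,5) \<open>h \<in> Arr C\<close> e \<open>Cod C k = Dom C h\<close>
      by (auto simp: Dom_Comp)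
  qed
  have "\<exists>W u. u \<in> Hom E W D \<and> is_mono E u \<and>
      (\<forall>c\<in>Obj C. bij_betw (ap u c) (sec W c) {d \<in> sec D c. locally_in f g c d})"
  proof (rule subobject[OF O(2)])
    fix k d assume k: "k \<in> Arr C" and "d \<in> {d \<in> sec D (Cod C k). locally_in f g (Cod C k) d}"
    then have d: "d \<in> sec D (Cod C k)" and cov: "{h \<in> Arr C. Cod C h = Cod C k \<and> ?Q d h} \<in> J (Cod C k)"
      using L by auto
    have "{h \<in> Arr C. Cod C h = Dom C k \<and> ?Q d (k \<cdot> h)} \<in> J (Dom C k)"
      using cov_pullbackI[OF k cov] .
    moreover have "?Q d (k \<cdot> h) \<longleftrightarrow> ?Q (rs D k d) h" if "h \<in> Arr C" "Cod C h = Dom C k" for h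
      using psh_Comp[OF sec_psh[OF O(2)] k that d] that k by (simp add: Dom_Comp)
    ultimately have "{h \<in> Arr C. Cod C h = Dom C k \<and> ?Q (rs D k d) h} \<in> J (Dom C k)"
      by (simp cong: conj_cong)
    then show "rs D k d \<in> {d \<in> sec D (Dom C k). locally_in f g (Dom C k) d}"
      using L psh_mem[OF sec_psh[OF O(2)] k refl d refl] by simp
  next
    fix c S d assume c: "c \<in> Obj C" and S: "S \<in> J c" and d: "d \<in> sec D c"
      and l: "\<And>k. k \<in> S \<Longrightarrow> rs D k d \<in> {d \<in> sec D (Dom C k). locally_in f g (Dom C k) d}"
    have "{h \<in> Arr C. Cod C h = c \<and> ?Q d h} \<in> J c"
    proof (rule cov_locI[OF c S])
      fix h k assume "h \<in> Arr C" "Cod C h = c" "?Q d h" "k \<in> Arr C" "Cod C k = Dom C h"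
      then show "?Q d (h \<cdot> k)" using stable[of h k d] d by blast
    next
      fix k assume k: "k \<in> S"
      have kA: "k \<in> Arr C" "Cod C k = c" using cov_Arr[OF S c k] cov_Cod[OF S c k] by auto
      have R: "{h \<in> Arr C. Cod C h = Dom C k \<and> ?Q (rs D k d) h} \<in> J (Dom C k)" (is "?R \<in> _") using l[OF k] L by simp
      have "\<forall>h\<in>?R. ?Q d (k \<cdot> h)"
        using psh_Comp[OF sec_psh[OF O(2)] kA(1)] d kA by (simp add: Dom_Comp)
      then show "\<exists>R\<in>J (Dom C k). \<forall>h\<in>R. ?Q d (k \<cdot> h)" using R by blast
    qed
    then show "d \<in> {d \<in> sec D c. locally_in f g c d}" using L d by simp
  qed auto
  then obtain W u where u: "u \<in> Hom E W D" "is_mono E u"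
    and b: "\<And>c. c \<in> Obj C \<Longrightarrow> bij_betw (ap u c) (sec W c) {d \<in> sec D c. locally_in f g c d}" by blast
  have W: "Dom E u = W" "Cod E u = D" using u by (auto simp: Hom_def)
  have fg_in: "locally_in f g c (ap m c x)" if m: "m = f \<or> m = g" and c: "c \<in> Obj C" and x: "x \<in> sec (Dom E m) c" for m c x
  proof -
    have mH: "m \<in> Hom E (Dom E m) D" using m H by auto
    have "?Q (ap m c x) h" if h: "h \<in> Arr C" "Cod C h = c" for h
    proof -
      have "rs D h (ap m c x) \<in> ap m (Dom C h) ` sec (Dom E m) (Dom C h)"
        using ap_nat[OF mH h refl x] psh_mem[OF sec_psh[OF Hom_Obj(1)[OF mH]] h x refl] by (metis imageI)
      then show ?thesis using m by auto
    qed
    then have "{h \<in> Arr C. Cod C h = c \<and> ?Q (ap m c x) h} = {h \<in> Arr C. Cod C h = c}" by blast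
    then show ?thesis using L cov_max[OF c] by simp
  qed
  have le: "subobj_le E m u" if m: "m = f \<or> m = g" for m
  proof -
    have mH: "m \<in> Hom E (Dom E m) D" using m H by auto
    have "\<exists>w\<in>Hom E (Dom E m) W. u \<cdot>\<^bsub>E\<^esub> w = m"
    proof (rule factor[OF u(1) ap_inj_if_mono[OF u(2,1)] mH])
      fix c z assume c: "c \<in> Obj C" and z: "z \<in> sec (Dom E m) c"
      then show "ap m c z \<in> ap u c ` sec W c"
        using b[OF c] fg_in[OF m c z] ap_mem[OF mH c z] unfolding bij_betw_def by simp
    qed
    then show ?thesis using mH W by (auto simp: subobj_le_def Hom_def)
  qed
  have "subobj_le E u v" if v: "is_mono E v" "subobj_le E f v" "subobj_le E g v" for v
  proof -
    have vH: "v \<in> Hom E (Dom E v) D" using E.mono_Arr[OF v(1)] v(2) by (auto simp: Hom_def subobj_le_def D_def)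
    have im: "ap m c x \<in> ap v c ` sec (Dom E v) c"
      if m: "m = f \<or> m = g" and c: "c \<in> Obj C" and x: "x \<in> sec (Dom E m) c" for m c x
    proof -
      obtain w where w: "w \<in> Hom E (Dom E m) (Dom E v)" "v \<cdot>\<^bsub>E\<^esub> w = m"
        using m v(2,3) unfolding subobj_le_def by blast
      then show ?thesis using ap_Comp[OF w(1) vH c x] ap_mem[OF w(1) c x] by simp
    qed
    have "\<exists>w\<in>Hom E W (Dom E v). v \<cdot>\<^bsub>E\<^esub> w = u"
    proof (rule factor[OF vH ap_inj_if_mono[OF v(1) vH] u(1)])
      fix c z assume c: "c \<in> Obj C" and z: "z \<in> sec W c"
      have d: "ap u c z \<in> sec D c" "locally_in f g c (ap u c z)"
        using b[OF c] z unfolding bij_betw_def by auto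
      show "ap u c z \<in> ap v c ` sec (Dom E v) c"
      proof (rule mono_image_local[OF v(1) vH c d(1) d(2)[unfolded L]])
        fix h assume "h \<in> {h \<in> Arr C. Cod C h = c \<and> ?Q (ap u c z) h}"
        then show "rs D h (ap u c z) \<in> ap v (Dom C h) ` sec (Dom E v) (Dom C h)"
          using im[of f "Dom C h"] im[of g "Dom C h"] Dom_in_Obj by auto
      qed
    qed
    then show ?thesis using u vH by (auto simp: subobj_le_def Hom_def)
  qed
  then have "is_union E f g u"
    unfolding is_union_def using f g u(2) le by blast
  moreover have "locally_in f g c (ap u c x)" if "c \<in> Obj C" "x \<in> sec (Dom E u) c" for c x
    using b[OF that(1)] that(2) W unfolding bij_betw_def by auto
  ultimately show ?thesis by blast
qed

text \<open>Any union is contained in the constructed one, being least, and inherits the local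
  description from it.\<close>

lemma union_local:
  assumes u: "is_union E f g u" and c: "c \<in> Obj C" and x: "x \<in> sec (Dom E u) c"
  shows "locally_in f g c (ap u c x)"
proof -
  have m: "is_mono E f" "is_mono E g" "is_mono E u" "subobj_le E f u" "subobj_le E g u"
    using u unfolding is_union_def by auto
  have fg: "Cod E f = Cod E g" using m(4,5) unfolding subobj_le_def by simp
  obtain u0 where u0: "is_union E f g u0" "\<forall>c\<in>Obj C. \<forall>x\<in>sec (Dom E u0) c. locally_in f g c (ap u0 c x)"
    using union_exists_local[OF m(1,2) fg] by blast
  have "subobj_le E u u0"
    using u u0(1) unfolding is_union_def by blast
  then obtain w where w: "w \<in> Hom E (Dom E u) (Dom E u0)" "u0 \<cdot>\<^bsub>E\<^esub> w = u"
    unfolding subobj_le_def by blast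
  have "u0 \<in> Hom E (Dom E u0) (Cod E u0)"
    using u0(1) E.mono_Arr unfolding is_union_def Hom_def by auto
  from ap_Comp[OF w(1) this c x] show ?thesis using u0(2) c ap_mem[OF w(1) c x] w(2) by simp
qed

lemma union_parts:
  assumes u: "is_union E f g u"
  obtains f' g' where "f' \<in> Hom E (Dom E f) (Dom E u)" "u \<cdot>\<^bsub>E\<^esub> f' = f"
    "g' \<in> Hom E (Dom E g) (Dom E u)" "u \<cdot>\<^bsub>E\<^esub> g' = g" "u \<in> Hom E (Dom E u) (Cod E u)"
    "f \<in> Hom E (Dom E f) (Cod E u)" "g \<in> Hom E (Dom E g) (Cod E u)"
    "\<And>c x. c \<in> Obj C \<Longrightarrow> x \<in> sec (Dom E u) c \<Longrightarrow> \<exists>S\<in>J c. \<forall>h\<in>S.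
       rs (Dom E u) h x \<in> ap f' (Dom C h) ` sec (Dom E f) (Dom C h) \<or>
       rs (Dom E u) h x \<in> ap g' (Dom C h) ` sec (Dom E g) (Dom C h)"
proof -
  have m: "is_mono E f" "is_mono E g" "is_mono E u" "subobj_le E f u" "subobj_le E g u"
    using u unfolding is_union_def by auto
  have uH: "u \<in> Hom E (Dom E u) (Cod E u)" using E.mono_Arr[OF m(3)] by (simp add: Hom_def)
  have fH: "f \<in> Hom E (Dom E f) (Cod E u)" "g \<in> Hom E (Dom E g) (Cod E u)"
    using E.mono_Arr m unfolding subobj_le_def Hom_def by auto
  obtain f' g' where f': "f' \<in> Hom E (Dom E f) (Dom E u)" "u \<cdot>\<^bsub>E\<^esub> f' = f"
    and g': "g' \<in> Hom E (Dom E g) (Dom E u)" "u \<cdot>\<^bsub>E\<^esub> g' = g"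
    using m(4,5) unfolding subobj_le_def by blast
  have "\<exists>S\<in>J c. \<forall>h\<in>S.
       rs (Dom E u) h x \<in> ap f' (Dom C h) ` sec (Dom E f) (Dom C h) \<or>
       rs (Dom E u) h x \<in> ap g' (Dom C h) ` sec (Dom E g) (Dom C h)"
    if c: "c \<in> Obj C" and x: "x \<in> sec (Dom E u) c" for c x
  proof -
    let ?Q = "\<lambda>h. rs (Cod E u) h (ap u c x) \<in> ap f (Dom C h) ` sec (Dom E f) (Dom C h) \<or>
      rs (Cod E u) h (ap u c x) \<in> ap g (Dom C h) ` sec (Dom E g) (Dom C h)"
    have S: "{h \<in> Arr C. Cod C h = c \<and> ?Q h} \<in> J c"
      using union_local[OF u c x] fH(1) unfolding locally_in_def Hom_def by simp
    have part: "rs (Dom E u) h x \<in> ap m' (Dom C h) ` sec (Dom E m) (Dom C h)"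
      if h: "h \<in> Arr C" "Cod C h = c" and m': "m' \<in> Hom E (Dom E m) (Dom E u)" "u \<cdot>\<^bsub>E\<^esub> m' = m"
        and y: "rs (Cod E u) h (ap u c x) \<in> ap m (Dom C h) ` sec (Dom E m) (Dom C h)" for h m m'
    proof -
      note d = Dom_in_Obj[OF h(1)]
      obtain y where y: "y \<in> sec (Dom E m) (Dom C h)" "rs (Cod E u) h (ap u c x) = ap m (Dom C h) y" using y by blast
      have "ap u (Dom C h) (rs (Dom E u) h x) = ap u (Dom C h) (ap m' (Dom C h) y)"
        using ap_nat[OF uH h refl x] y(2) ap_Comp[OF m'(1) uH d y(1)] m'(2) by simp
      then have "rs (Dom E u) h x = ap m' (Dom C h) y"
        using inj_onD[OF ap_inj_if_mono[OF m(3) uH d]] psh_mem[OF sec_psh[OF Hom_Obj(1)[OF uH]] h x refl]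
          ap_mem[OF m'(1) d y(1)] by blast
      then show ?thesis using y(1) by blast
    qed
    show ?thesis
      by (rule bexI[OF _ S]) (use part f' g' in blast)
  qed
  then show ?thesis using that[OF f' g' uH fH] by blast
qed

text \<open>Each section of the union comes locally from one of the parts, and \<open>T\<close> is
  separated; so the inclusions of the parts are jointly epic.\<close>

lemma union_epi:
  assumes u: "is_union E f g u" and w: "w \<in> Hom E (Dom E u) T" "w' \<in> Hom E (Dom E u) T"
    and f: "\<And>x. x \<in> Hom E (Dom E f) (Dom E u) \<Longrightarrow> u \<cdot>\<^bsub>E\<^esub> x = f \<Longrightarrow> w \<cdot>\<^bsub>E\<^esub> x = w' \<cdot>\<^bsub>E\<^esub> x"
    and g: "\<And>x. x \<in> Hom E (Dom E g) (Dom E u) \<Longrightarrow> u \<cdot>\<^bsub>E\<^esub> x = g \<Longrightarrow> w \<cdot>\<^bsub>E\<^esub> x = w' \<cdot>\<^bsub>E\<^esub> x"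
  shows "w = w'"
proof (rule union_parts[OF u])
  fix f' g'
  assume f': "f' \<in> Hom E (Dom E f) (Dom E u)" "u \<cdot>\<^bsub>E\<^esub> f' = f"
    and g': "g' \<in> Hom E (Dom E g) (Dom E u)" "u \<cdot>\<^bsub>E\<^esub> g' = g"
    and loc: "\<And>c x. c \<in> Obj C \<Longrightarrow> x \<in> sec (Dom E u) c \<Longrightarrow> \<exists>S\<in>J c. \<forall>h\<in>S.
       rs (Dom E u) h x \<in> ap f' (Dom C h) ` sec (Dom E f) (Dom C h) \<or>
       rs (Dom E u) h x \<in> ap g' (Dom C h) ` sec (Dom E g) (Dom C h)"
  have eqf: "ap w c (ap f' c y) = ap w' c (ap f' c y)" if "c \<in> Obj C" "y \<in> sec (Dom E f) c" for c y
    using ap_Comp[OF f'(1) w(1) that] ap_Comp[OF f'(1) w(2) that] f[OF f'] by simp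
  have eqg: "ap w c (ap g' c y) = ap w' c (ap g' c y)" if "c \<in> Obj C" "y \<in> sec (Dom E g) c" for c y
    using ap_Comp[OF g'(1) w(1) that] ap_Comp[OF g'(1) w(2) that] g[OF g'] by simp
  show "w = w'"
  proof (rule ap_faithful[OF w])
    fix c x assume c: "c \<in> Obj C" and x: "x \<in> sec (Dom E u) c"
    obtain S where S: "S \<in> J c" "\<And>h. h \<in> S \<Longrightarrow>
       rs (Dom E u) h x \<in> ap f' (Dom C h) ` sec (Dom E f) (Dom C h) \<or>
       rs (Dom E u) h x \<in> ap g' (Dom C h) ` sec (Dom E g) (Dom C h)" using loc[OF c x] by blast
    show "ap w c x = ap w' c x"
    proof (rule shf_sep[OF sec_shf[OF Hom_Obj(2)[OF w(1)]] c S(1) ap_mem[OF w(1) c x] ap_mem[OF w(2) c x]])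
      fix h assume h: "h \<in> S"
      have hA: "h \<in> Arr C" "Cod C h = c" "Dom C h \<in> Obj C"
        using cov_Arr[OF S(1) c h] cov_Cod[OF S(1) c h] Dom_in_Obj by auto
      show "rs T h (ap w c x) = rs T h (ap w' c x)"
        using ap_nat[OF w(1) hA(1,2) refl x] ap_nat[OF w(2) hA(1,2) refl x] S(2)[OF h]
          eqf[OF hA(3)] eqg[OF hA(3)] by auto
    qed
  qed
qed

text \<open>A union is the pushout of its parts over their intersection. The relation
  \<open>\<rho>\<close> is the union of the graphs of \<open>a\<close> and \<open>b\<close>; it is
  functional on each part because the inclusions are injective, and across the parts by
  \<open>compat\<close>.\<close>

lemma union_glue_sec:
  assumes u: "is_union E f g u" and a: "a \<in> Hom E (Dom E f) T" and b: "b \<in> Hom E (Dom E g) T"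
    and compat: "\<And>c x y. c \<in> Obj C \<Longrightarrow> x \<in> sec (Dom E f) c \<Longrightarrow> y \<in> sec (Dom E g) c \<Longrightarrow>
      ap f c x = ap g c y \<Longrightarrow> ap a c x = ap b c y"
  shows "\<exists>w\<in>Hom E (Dom E u) T.
    (\<forall>x\<in>Hom E (Dom E f) (Dom E u). u \<cdot>\<^bsub>E\<^esub> x = f \<longrightarrow> w \<cdot>\<^bsub>E\<^esub> x = a) \<and>
    (\<forall>x\<in>Hom E (Dom E g) (Dom E u). u \<cdot>\<^bsub>E\<^esub> x = g \<longrightarrow> w \<cdot>\<^bsub>E\<^esub> x = b)"
proof (rule union_parts[OF u])
  fix f' g'
  assume f': "f' \<in> Hom E (Dom E f) (Dom E u)" "u \<cdot>\<^bsub>E\<^esub> f' = f"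
    and g': "g' \<in> Hom E (Dom E g) (Dom E u)" "u \<cdot>\<^bsub>E\<^esub> g' = g" and uH: "u \<in> Hom E (Dom E u) (Cod E u)"
    and loc: "\<And>c x. c \<in> Obj C \<Longrightarrow> x \<in> sec (Dom E u) c \<Longrightarrow> \<exists>S\<in>J c. \<forall>h\<in>S.
       rs (Dom E u) h x \<in> ap f' (Dom C h) ` sec (Dom E f) (Dom C h) \<or>
       rs (Dom E u) h x \<in> ap g' (Dom C h) ` sec (Dom E g) (Dom C h)"
  let ?W = "Dom E u"
  have mono: "is_mono E f" "is_mono E g" "is_mono E u" using u unfolding is_union_def by auto
  have fH: "f \<in> Hom E (Dom E f) (Cod E u)" "g \<in> Hom E (Dom E g) (Cod E u)"
    using E.Comp_in_Hom[OF f'(1) uH] E.Comp_in_Hom[OF g'(1) uH] f'(2) g'(2) by auto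
  have uf: "ap u c (ap f' c x) = ap f c x" if "c \<in> Obj C" "x \<in> sec (Dom E f) c" for c x
    using ap_Comp[OF f'(1) uH that] f'(2) by simp
  have ug: "ap u c (ap g' c x) = ap g c x" if "c \<in> Obj C" "x \<in> sec (Dom E g) c" for c x
    using ap_Comp[OF g'(1) uH that] g'(2) by simp
  define \<rho> where "\<rho> c d y \<longleftrightarrow> (\<exists>x\<in>sec (Dom E f) c. d = ap f' c x \<and> y = ap a c x) \<or>
      (\<exists>x\<in>sec (Dom E g) c. d = ap g' c x \<and> y = ap b c x)" for c d y
  have "\<exists>w\<in>Hom E ?W T. \<forall>c\<in>Obj C. \<forall>d y. \<rho> c d y \<longrightarrow> ap w c d = y"
  proof (rule glue_local_map[OF Hom_Obj(1)[OF uH] Hom_Obj(2)[OF a]])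
    fix c d y assume "c \<in> Obj C" "\<rho> c d y"
    then show "d \<in> sec ?W c \<and> y \<in> sec T c"
      unfolding \<rho>_def using ap_mem[OF f'(1)] ap_mem[OF g'(1)] ap_mem[OF a] ap_mem[OF b] by auto
  next
    fix h d y assume h: "h \<in> Arr C" and \<rho>: "\<rho> (Cod C h) d y"
    have "\<rho> (Dom C h) (rs ?W h (ap f' (Cod C h) x)) (rs T h (ap a (Cod C h) x))" if x: "x \<in> sec (Dom E f) (Cod C h)" for x
    proof -
      have "rs (Dom E f) h x \<in> sec (Dom E f) (Dom C h)" using psh_mem[OF sec_psh[OF Hom_Obj(1)[OF a]] h refl x refl] .
      then show ?thesis unfolding \<rho>_def
        using ap_nat[OF f'(1) h refl refl x] ap_nat[OF a h refl refl x] by metis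
    qed
    moreover have "\<rho> (Dom C h) (rs ?W h (ap g' (Cod C h) x)) (rs T h (ap b (Cod C h) x))" if x: "x \<in> sec (Dom E g) (Cod C h)" for x
    proof -
      have "rs (Dom E g) h x \<in> sec (Dom E g) (Dom C h)" using psh_mem[OF sec_psh[OF Hom_Obj(1)[OF b]] h refl x refl] .
      then show ?thesis unfolding \<rho>_def
        using ap_nat[OF g'(1) h refl refl x] ap_nat[OF b h refl refl x] by metis
    qed
    ultimately show "\<rho> (Dom C h) (rs ?W h d) (rs T h y)" using \<rho> unfolding \<rho>_def[of "Cod C h"] by auto
  next
    fix c d y y' assume c: "c \<in> Obj C" and y: "\<rho> c d y" and y': "\<rho> c d y'"
    have ff: "x = x'" if "x \<in> sec (Dom E f) c" "x' \<in> sec (Dom E f) c" "ap f' c x = ap f' c x'" for x x'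
      using uf[OF c that(1)] uf[OF c that(2)] that inj_onD[OF ap_inj_if_mono[OF mono(1) fH(1) c]] by simp
    have gg: "x = x'" if "x \<in> sec (Dom E g) c" "x' \<in> sec (Dom E g) c" "ap g' c x = ap g' c x'" for x x'
      using ug[OF c that(1)] ug[OF c that(2)] that inj_onD[OF ap_inj_if_mono[OF mono(2) fH(2) c]] by simp
    have fg: "ap a c x = ap b c x'" if "x \<in> sec (Dom E f) c" "x' \<in> sec (Dom E g) c" "ap f' c x = ap g' c x'" for x x'
      using compat[OF c that(1,2)] uf[OF c that(1)] ug[OF c that(2)] that(3) by simp
    show "y = y'" using y y' ff gg fg unfolding \<rho>_def by metis
  next
    fix c d assume "c \<in> Obj C" "d \<in> sec ?W c"
    then obtain S where S: "S \<in> J c" "\<forall>h\<in>S. rs ?W h d \<in> ap f' (Dom C h) ` sec (Dom E f) (Dom C h) \<or>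
       rs ?W h d \<in> ap g' (Dom C h) ` sec (Dom E g) (Dom C h)" using loc by blast
    have "\<forall>h\<in>S. \<exists>y. \<rho> (Dom C h) (rs ?W h d) y" using S(2) unfolding \<rho>_def by blast
    then show "\<exists>S\<in>J c. \<forall>h\<in>S. \<exists>y. \<rho> (Dom C h) (rs ?W h d) y" using S(1) by blast
  qed
  then obtain w where w: "w \<in> Hom E ?W T" "\<And>c d y. c \<in> Obj C \<Longrightarrow> \<rho> c d y \<Longrightarrow> ap w c d = y" by blast
  have "w \<cdot>\<^bsub>E\<^esub> x = a" if x: "x \<in> Hom E (Dom E f) ?W" "u \<cdot>\<^bsub>E\<^esub> x = f" for x
  proof -
    have xf: "x = f'" by (rule E.mono_cancel[OF mono(3) _ x(1) f'(1)]) (simp add: x(2) f'(2))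
    show ?thesis
      unfolding xf
    proof (rule ap_faithful[OF E.Comp_in_Hom[OF f'(1) w(1)] a])
      fix c z assume cz: "c \<in> Obj C" "z \<in> sec (Dom E f) c"
      then have "\<rho> c (ap f' c z) (ap a c z)" unfolding \<rho>_def by blast
      then show "ap (w \<cdot>\<^bsub>E\<^esub> f') c z = ap a c z" using w(2) cz ap_Comp[OF f'(1) w(1) cz] by simp
    qed
  qed
  moreover have "w \<cdot>\<^bsub>E\<^esub> x = b" if x: "x \<in> Hom E (Dom E g) ?W" "u \<cdot>\<^bsub>E\<^esub> x = g" for x
  proof -
    have xg: "x = g'" by (rule E.mono_cancel[OF mono(3) _ x(1) g'(1)]) (simp add: x(2) g'(2))
    show ?thesis
      unfolding xg
    proof (rule ap_faithful[OF E.Comp_in_Hom[OF g'(1) w(1)] b])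
      fix c z assume cz: "c \<in> Obj C" "z \<in> sec (Dom E g) c"
      then have "\<rho> c (ap g' c z) (ap b c z)" unfolding \<rho>_def by blast
      then show "ap (w \<cdot>\<^bsub>E\<^esub> g') c z = ap b c z" using w(2) cz ap_Comp[OF g'(1) w(1) cz] by simp
    qed
  qed
  ultimately show ?thesis using w(1) by blast
qed

lemma pullback_compat:
  assumes pb: "is_pullback E f g p q" and a: "a \<in> Hom E (Dom E f) T" and b: "b \<in> Hom E (Dom E g) T"
    and eq: "a \<cdot>\<^bsub>E\<^esub> p = b \<cdot>\<^bsub>E\<^esub> q"
    and c: "c \<in> Obj C" and x: "x \<in> sec (Dom E f) c" and y: "y \<in> sec (Dom E g) c" and xy: "ap f c x = ap g c y"
  shows "ap a c x = ap b c y"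
proof -
  have H: "p \<in> Hom E (Dom E p) (Dom E f)" "q \<in> Hom E (Dom E p) (Dom E g)"
    using pb unfolding is_pullback_def Hom_def by auto
  obtain z where z: "z \<in> sec (Dom E p) c" "ap p c z = x" "ap q c z = y" using pullback_sec[OF pb c x y xy] by blast
  show ?thesis using ap_Comp[OF H(1) a c z(1)] ap_Comp[OF H(2) b c z(1)] z eq by simp
qed

lemma union_glue:
  assumes u: "is_union E f g u" and pb: "is_pullback E f g p q"
    and a: "a \<in> Hom E (Dom E f) T" and b: "b \<in> Hom E (Dom E g) T" and eq: "a \<cdot>\<^bsub>E\<^esub> p = b \<cdot>\<^bsub>E\<^esub> q"
  shows "\<exists>w\<in>Hom E (Dom E u) T.
    (\<forall>x\<in>Hom E (Dom E f) (Dom E u). u \<cdot>\<^bsub>E\<^esub> x = f \<longrightarrow> w \<cdot>\<^bsub>E\<^esub> x = a) \<and>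
    (\<forall>x\<in>Hom E (Dom E g) (Dom E u). u \<cdot>\<^bsub>E\<^esub> x = g \<longrightarrow> w \<cdot>\<^bsub>E\<^esub> x = b)"
  using union_glue_sec[OF u a b] pullback_compat[OF pb a b eq] by blast

text \<open>The overlap of \<open>f\<close> with a copairing is tested on one summand at a time: a
  section of the coproduct lies locally in a summand, and there the corresponding pullback square
  decides.\<close>

lemma union_glue_copairing:
  assumes u: "is_union E f k u" and ij: "is_coproduct E i j" and k: "k \<in> Hom E (Cod E i) (Cod E f)"
    and pb0: "is_pullback E f (k \<cdot>\<^bsub>E\<^esub> i) p0 q0" and pb1: "is_pullback E f (k \<cdot>\<^bsub>E\<^esub> j) p1 q1"
    and a: "a \<in> Hom E (Dom E f) T" and b: "b \<in> Hom E (Cod E i) T"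
    and eq0: "a \<cdot>\<^bsub>E\<^esub> p0 = b \<cdot>\<^bsub>E\<^esub> i \<cdot>\<^bsub>E\<^esub> q0" and eq1: "a \<cdot>\<^bsub>E\<^esub> p1 = b \<cdot>\<^bsub>E\<^esub> j \<cdot>\<^bsub>E\<^esub> q1"
  shows "\<exists>w\<in>Hom E (Dom E u) T.
    (\<forall>x\<in>Hom E (Dom E f) (Dom E u). u \<cdot>\<^bsub>E\<^esub> x = f \<longrightarrow> w \<cdot>\<^bsub>E\<^esub> x = a) \<and>
    (\<forall>x\<in>Hom E (Dom E k) (Dom E u). u \<cdot>\<^bsub>E\<^esub> x = k \<longrightarrow> w \<cdot>\<^bsub>E\<^esub> x = b)"
proof (rule union_glue_sec[OF u a])
  have dk: "Dom E k = Cod E i" using k by (simp add: Hom_def)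
  then show "b \<in> Hom E (Dom E k) T" using b by simp
  have iH: "i \<in> Hom E (Dom E i) (Cod E i)" "j \<in> Hom E (Dom E j) (Cod E i)"
    using ij unfolding is_coproduct_def Hom_def by auto
  have fH: "f \<in> Hom E (Dom E f) (Cod E f)" using pb0 unfolding is_pullback_def Hom_def by auto
  note O = Hom_Obj[OF fH] Hom_Obj(1)[OF k] Hom_Obj(2)[OF b]
  have D: "Dom E (k \<cdot>\<^bsub>E\<^esub> i) = Dom E i" "Dom E (k \<cdot>\<^bsub>E\<^esub> j) = Dom E j"
    using E.Comp_in_Hom[OF iH(1) k] E.Comp_in_Hom[OF iH(2) k] by (auto simp: Hom_def)
  have bi: "b \<cdot>\<^bsub>E\<^esub> i \<in> Hom E (Dom E (k \<cdot>\<^bsub>E\<^esub> i)) T" "b \<cdot>\<^bsub>E\<^esub> j \<in> Hom E (Dom E (k \<cdot>\<^bsub>E\<^esub> j)) T"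
    unfolding D using E.Comp_in_Hom[OF iH(1) b] E.Comp_in_Hom[OF iH(2) b] .
  fix c x y assume c: "c \<in> Obj C" and x: "x \<in> sec (Dom E f) c" and y: "y \<in> sec (Dom E k) c"
    and xy: "ap f c x = ap k c y"
  have y: "y \<in> sec (Cod E i) c" using y dk by simp
  obtain S where S: "S \<in> J c" "\<And>g. g \<in> S \<Longrightarrow>
     (\<exists>z\<in>sec (Dom E i) (Dom C g). rs (Cod E i) g y = ap i (Dom C g) z) \<or>
     (\<exists>z\<in>sec (Dom E j) (Dom C g). rs (Cod E i) g y = ap j (Dom C g) z)"
    using coproduct_onto[OF ij] c y unfolding jointly_onto_def by blast
  show "ap a c x = ap b c y"
  proof (rule shf_sep[OF sec_shf[OF O(4)] c S(1) ap_mem[OF a c x] ap_mem[OF b c y]])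
    fix g assume g: "g \<in> S"
    have gA: "g \<in> Arr C" "Cod C g = c" and d: "Dom C g \<in> Obj C"
      using cov_Arr[OF S(1) c g] cov_Cod[OF S(1) c g] Dom_in_Obj by auto
    have x': "rs (Dom E f) g x \<in> sec (Dom E f) (Dom C g)" using psh_mem[OF sec_psh[OF O(1)] gA x refl] .
    have fx: "ap f (Dom C g) (rs (Dom E f) g x) = ap k (Dom C g) (rs (Cod E i) g y)"
      using ap_nat[OF fH gA refl x] ap_nat[OF k gA refl y] xy by simp
    have "ap a (Dom C g) (rs (Dom E f) g x) = ap b (Dom C g) (rs (Cod E i) g y)"
      using S(2)[OF g]
    proof
      assume "\<exists>z\<in>sec (Dom E i) (Dom C g). rs (Cod E i) g y = ap i (Dom C g) z"
      then obtain z where z: "z \<in> sec (Dom E i) (Dom C g)" "rs (Cod E i) g y = ap i (Dom C g) z" by blast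
      have "ap a (Dom C g) (rs (Dom E f) g x) = ap (b \<cdot>\<^bsub>E\<^esub> i) (Dom C g) z"
        using pullback_compat[OF pb0 a bi(1) eq0 d x', of z] z fx D ap_Comp[OF iH(1) k d z(1)] by simp
      then show ?thesis using ap_Comp[OF iH(1) b d z(1)] z by simp
    next
      assume "\<exists>z\<in>sec (Dom E j) (Dom C g). rs (Cod E i) g y = ap j (Dom C g) z"
      then obtain z where z: "z \<in> sec (Dom E j) (Dom C g)" "rs (Cod E i) g y = ap j (Dom C g) z" by blast
      have "ap a (Dom C g) (rs (Dom E f) g x) = ap (b \<cdot>\<^bsub>E\<^esub> j) (Dom C g) z"
        using pullback_compat[OF pb1 a bi(2) eq1 d x', of z] z fx D ap_Comp[OF iH(2) k d z(1)] by simp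
      then show ?thesis using ap_Comp[OF iH(2) b d z(1)] z by simp
    qed
    then show "rs T g (ap a c x) = rs T g (ap b c y)"
      using ap_nat[OF a gA refl x] ap_nat[OF b gA refl y] by simp
  qed
qed

end

section \<open>Intervals\<close>

text \<open>The interface between sheaves and homotopy theory. Unions appear as pushouts, once over
  the intersection of two subobjects and once for a copairing; the universe enters through the
  colimits that a left adjoint has to preserve.\<close>

locale topos_like = category E
  for E :: "('o, 'a) cat" (structure) +
  fixes U :: "'u itself"
  assumes initial: "X \<in> Obj E \<Longrightarrow>
      \<exists>z. is_mono E z \<and> Cod E z = X \<and> (\<forall>Y\<in>Obj E. \<exists>!f. f \<in> Hom E (Dom E z) Y)"
    and coproduct: "X \<in> Obj E \<Longrightarrow> Y \<in> Obj E \<Longrightarrow> \<exists>i j. is_coproduct E i j \<and> Dom E i = X \<and> Dom E j = Y"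
    and pullback: "f \<in> Hom E X D \<Longrightarrow> g \<in> Hom E Y D \<Longrightarrow> \<exists>p q. is_pullback E f g p q"
    and union_exists: "is_mono E f \<Longrightarrow> is_mono E g \<Longrightarrow> Cod E f = Cod E g \<Longrightarrow> \<exists>u. is_union E f g u"
    and union_epi: "is_union E f g u \<Longrightarrow> w \<in> Hom E (Dom E u) T \<Longrightarrow> w' \<in> Hom E (Dom E u) T \<Longrightarrow>
      (\<And>x. x \<in> Hom E (Dom E f) (Dom E u) \<Longrightarrow> u \<cdot> x = f \<Longrightarrow> w \<cdot> x = w' \<cdot> x) \<Longrightarrow>
      (\<And>x. x \<in> Hom E (Dom E g) (Dom E u) \<Longrightarrow> u \<cdot> x = g \<Longrightarrow> w \<cdot> x = w' \<cdot> x) \<Longrightarrow> w = w'"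
    and union_glue: "is_union E f g u \<Longrightarrow> is_pullback E f g p q \<Longrightarrow> a \<in> Hom E (Dom E f) T \<Longrightarrow>
      b \<in> Hom E (Dom E g) T \<Longrightarrow> a \<cdot> p = b \<cdot> q \<Longrightarrow> \<exists>w\<in>Hom E (Dom E u) T.
        (\<forall>x\<in>Hom E (Dom E f) (Dom E u). u \<cdot> x = f \<longrightarrow> w \<cdot> x = a) \<and>
        (\<forall>x\<in>Hom E (Dom E g) (Dom E u). u \<cdot> x = g \<longrightarrow> w \<cdot> x = b)"
    and union_glue_copairing: "is_union E f k u \<Longrightarrow> is_coproduct E i j \<Longrightarrow> k \<in> Hom E (Cod E i) (Cod E f) \<Longrightarrow>
      is_pullback E f (k \<cdot> i) p0 q0 \<Longrightarrow> is_pullback E f (k \<cdot> j) p1 q1 \<Longrightarrow>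
      a \<in> Hom E (Dom E f) T \<Longrightarrow> b \<in> Hom E (Cod E i) T \<Longrightarrow>
      a \<cdot> p0 = b \<cdot> i \<cdot> q0 \<Longrightarrow> a \<cdot> p1 = b \<cdot> j \<cdot> q1 \<Longrightarrow> \<exists>w\<in>Hom E (Dom E u) T.
        (\<forall>x\<in>Hom E (Dom E f) (Dom E u). u \<cdot> x = f \<longrightarrow> w \<cdot> x = a) \<and>
        (\<forall>x\<in>Hom E (Dom E k) (Dom E u). u \<cdot> x = k \<longrightarrow> w \<cdot> x = b)"
    and right_adjoint: "is_functor E E L \<Longrightarrow> preserves_colimits U E E L \<Longrightarrow> Y \<in> Obj E \<Longrightarrow>
      \<exists>R\<in>Obj E. \<exists>ev\<in>Hom E (OMap L R) Y. \<forall>X\<in>Obj E. \<forall>h\<in>Hom E (OMap L X) Y.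
        \<exists>!f. f \<in> Hom E X R \<and> ev \<cdot> AMap L f = h"

theorem grothendieck_topos_like:
  assumes "universe (U :: 'u itself)" and "grothendieck_topos U E"
  shows "topos_like E U"
proof (rule sheaf_rep_exists[OF assms])
  fix C :: "('u, 'u) cat" and J sec ap rs
  assume "sheaf_rep U C J E sec ap rs"
  then interpret sheaf_rep U C J E sec ap rs .
  show ?thesis
  proof
    show "\<exists>p q. is_pullback E f g p q" if "f \<in> Hom E X D" "g \<in> Hom E Y D" for f X D g Y
      using pullback_exists[OF that] .
    show "\<exists>i j. is_coproduct E i j \<and> Dom E i = X \<and> Dom E j = Y" if "X \<in> Obj E" "Y \<in> Obj E" for X Y
      using coproduct_onto_exists[OF that] by blast
    show "\<exists>u. is_union E f g u" if "is_mono E f" "is_mono E g" "Cod E f = Cod E g" for f g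
      using union_exists_local[OF that] by blast
  qed (fact initial_exists union_epi union_glue union_glue_copairing right_adjoint_object)+
qed

context category
begin

lemma HomD: "f \<in> Hom C X Y \<Longrightarrow> f \<in> Arr C" "f \<in> Hom C X Y \<Longrightarrow> Dom C f = X"
    "f \<in> Hom C X Y \<Longrightarrow> Cod C f = Y" "f \<in> Hom C X Y \<Longrightarrow> X \<in> Obj C" "f \<in> Hom C X Y \<Longrightarrow> Y \<in> Obj C"
  using Dom_in_Obj Cod_in_Obj by (auto simp: Hom_def)

lemma Hom_iff: "f \<in> Hom C X Y \<longleftrightarrow> f \<in> Arr C \<and> Dom C f = X \<and> Cod C f = Y"
  by (auto simp: Hom_def)

lemma pullback_sym: "is_pullback C f g p q \<Longrightarrow> is_pullback C g f q p"
  unfolding is_pullback_def by (metis (no_types, opaque_lifting))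

lemma pullbackE:
  assumes "is_pullback C f g p q" "f \<in> Hom C X D" "g \<in> Hom C Y D"
  obtains Q where "p \<in> Hom C Q X" "q \<in> Hom C Q Y" "f \<cdot> p = g \<cdot> q"
    "\<And>W u v. u \<in> Hom C W X \<Longrightarrow> v \<in> Hom C W Y \<Longrightarrow> f \<cdot> u = g \<cdot> v \<Longrightarrow> \<exists>w\<in>Hom C W Q. p \<cdot> w = u \<and> q \<cdot> w = v"
    "\<And>W w w'. w \<in> Hom C W Q \<Longrightarrow> w' \<in> Hom C W Q \<Longrightarrow> p \<cdot> w = p \<cdot> w' \<Longrightarrow> q \<cdot> w = q \<cdot> w' \<Longrightarrow> w = w'"
proof -
  define Q where "Q = Dom C p"
  have A: "f \<in> Arr C" "g \<in> Arr C" "Cod C f = Cod C g" "p \<in> Arr C" "q \<in> Arr C" "Dom C p = Dom C q"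
      "Cod C p = Dom C f" "Cod C q = Dom C g" "f \<cdot> p = g \<cdot> q"
    and univ: "\<And>u v. u \<in> Arr C \<Longrightarrow> v \<in> Arr C \<Longrightarrow> Dom C u = Dom C v \<Longrightarrow> Cod C u = Dom C f \<Longrightarrow>
      Cod C v = Dom C g \<Longrightarrow> f \<cdot> u = g \<cdot> v \<Longrightarrow>
      \<exists>!w. w \<in> Hom C (Dom C u) (Dom C p) \<and> p \<cdot> w = u \<and> q \<cdot> w = v"
    using assms(1) unfolding is_pullback_def by blast+
  have H: "p \<in> Hom C Q X" "q \<in> Hom C Q Y"
    using A assms(2,3) by (auto simp: Hom_def Q_def)
  show ?thesis
  proof
    show "p \<in> Hom C Q X" "q \<in> Hom C Q Y" "f \<cdot> p = g \<cdot> q" using H A by auto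
    fix W u v assume "u \<in> Hom C W X" "v \<in> Hom C W Y" "f \<cdot> u = g \<cdot> v"
    then show "\<exists>w\<in>Hom C W Q. p \<cdot> w = u \<and> q \<cdot> w = v"
      using univ[of u v] assms(2,3) unfolding Q_def Hom_def by auto
  next
    fix W w w' assume w: "w \<in> Hom C W Q" "w' \<in> Hom C W Q" "p \<cdot> w = p \<cdot> w'" "q \<cdot> w = q \<cdot> w'"
    have "f \<cdot> (p \<cdot> w) = g \<cdot> (q \<cdot> w)"
      using Comp_assoc[OF w(1) H(1) assms(2)] Comp_assoc[OF w(1) H(2) assms(3)] A(9) by simp
    moreover have "p \<cdot> w \<in> Hom C W X" "q \<cdot> w \<in> Hom C W Y"
      using Comp_in_Hom[OF w(1) H(1)] Comp_in_Hom[OF w(1) H(2)] by auto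
    ultimately have "\<exists>!x. x \<in> Hom C W Q \<and> p \<cdot> x = p \<cdot> w \<and> q \<cdot> x = q \<cdot> w"
      using univ[of "p \<cdot> w" "q \<cdot> w"] assms(2,3) unfolding Q_def Hom_def by auto
    then show "w = w'" using w by metis
  qed
qed

lemma has_liftingD:
  assumes "has_lifting C i p" "i \<in> Hom C A B" "p \<in> Hom C Y Z" "u \<in> Hom C A Y" "v \<in> Hom C B Z" "p \<cdot> u = v \<cdot> i"
  shows "\<exists>w\<in>Hom C B Y. w \<cdot> i = u \<and> p \<cdot> w = v"
proof -
  have "Dom C i = A" "Cod C i = B" "Dom C p = Y" "Cod C p = Z" using assms(2,3) by (auto simp: Hom_def)
  then show ?thesis using assms unfolding has_lifting_def by blast
qed

lemma has_liftingI:
  assumes "i \<in> Hom C A B" "p \<in> Hom C Y Z"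
    and "\<And>u v. u \<in> Hom C A Y \<Longrightarrow> v \<in> Hom C B Z \<Longrightarrow> p \<cdot> u = v \<cdot> i \<Longrightarrow> \<exists>w\<in>Hom C B Y. w \<cdot> i = u \<and> p \<cdot> w = v"
  shows "has_lifting C i p"
proof -
  have "Dom C i = A" "Cod C i = B" "Dom C p = Y" "Cod C p = Z" using assms(1,2) by (auto simp: Hom_def)
  then show ?thesis using assms(3) unfolding has_lifting_def by blast
qed

lemma unionD:
  assumes "is_union C f g u" "f \<in> Hom C X D" "g \<in> Hom C Y D"
  obtains W f' g' where "u \<in> Hom C W D" "is_mono C u" "f' \<in> Hom C X W" "u \<cdot> f' = f" "g' \<in> Hom C Y W" "u \<cdot> g' = g"
proof -
  have m: "is_mono C u" "subobj_le C f u" "subobj_le C g u" using assms(1) unfolding is_union_def by auto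
  then show ?thesis
    using that[of "Dom C u"] assms(2,3) mono_Arr[OF m(1)] unfolding subobj_le_def Hom_def by auto
qed

end

locale topos_interval = topos_like E U
  for E :: "('o, 'a) cat" (structure) and U :: "'u itself" +
  fixes I :: "('o, 'a) cyl"
  assumes interval: "interval U E I"
begin

abbreviation L where "L X \<equiv> OMap (Cyl I) X"
abbreviation LA where "LA f \<equiv> AMap (Cyl I) f"
abbreviation s where "s X \<equiv> proj I X"

text \<open>Booleans index the two ends, \<open>False\<close> for 0 and \<open>True\<close> for 1,
  so that a statement about all ends is an unrestricted quantification.\<close>

definition d :: "bool \<Rightarrow> 'o \<Rightarrow> 'a" where
  "d e X = bd I (if e then 1 else 0) X"

lemma cyl: "cylinder E I"
  using interval unfolding interval_def cartesian_cylinder_def by blast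

lemma L_functor: "is_functor E E (Cyl I)"
  using cyl unfolding cylinder_def by blast

lemma L_Obj: "X \<in> Obj E \<Longrightarrow> L X \<in> Obj E"
  using L_functor unfolding is_functor_def by blast

lemma LA_Hom: "f \<in> Hom E X Y \<Longrightarrow> LA f \<in> Hom E (L X) (L Y)"
  using L_functor unfolding is_functor_def Hom_def by blast

lemma LA_simps: "f \<in> Arr E \<Longrightarrow> LA f \<in> Arr E" "f \<in> Arr E \<Longrightarrow> Dom E (LA f) = L (Dom E f)"
    "f \<in> Arr E \<Longrightarrow> Cod E (LA f) = L (Cod E f)"
  using LA_Hom[of f "Dom E f" "Cod E f"] by (auto simp: Hom_def)

lemma LA_Comp: "f \<in> Arr E \<Longrightarrow> g \<in> Arr E \<Longrightarrow> Cod E f = Dom E g \<Longrightarrow> LA (g \<cdot> f) = LA g \<cdot> LA f"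
  using L_functor unfolding is_functor_def by blast

lemma LA_Ide: "X \<in> Obj E \<Longrightarrow> LA (Ide E X) = Ide E (L X)"
  using L_functor unfolding is_functor_def by blast

lemma d_Hom: "X \<in> Obj E \<Longrightarrow> d e X \<in> Hom E X (L X)"
  and s_Hom: "X \<in> Obj E \<Longrightarrow> s X \<in> Hom E (L X) X"
  using cyl unfolding cylinder_def nat_trans_def d_def by (auto simp: id_fctr_def)

lemma d_simps: "X \<in> Obj E \<Longrightarrow> d e X \<in> Arr E" "X \<in> Obj E \<Longrightarrow> Dom E (d e X) = X"
    "X \<in> Obj E \<Longrightarrow> Cod E (d e X) = L X"
  using d_Hom[of X e] by (auto simp: Hom_def)

lemma s_simps: "X \<in> Obj E \<Longrightarrow> s X \<in> Arr E" "X \<in> Obj E \<Longrightarrow> Dom E (s X) = L X"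
    "X \<in> Obj E \<Longrightarrow> Cod E (s X) = X"
  using s_Hom[of X] by (auto simp: Hom_def)

lemma d_nat: "f \<in> Arr E \<Longrightarrow> Cod E f = Y \<Longrightarrow> d e Y \<cdot> f = LA f \<cdot> d e (Dom E f)"
  using cyl unfolding cylinder_def nat_trans_def d_def by (auto simp: id_fctr_def)

lemma s_nat: "f \<in> Arr E \<Longrightarrow> Cod E f = Y \<Longrightarrow> s Y \<cdot> LA f = f \<cdot> s (Dom E f)"
  using cyl unfolding cylinder_def nat_trans_def by (auto simp: id_fctr_def)

text \<open>The simplifier moves ends and projections towards the source. For ends
  \<open>d_nat\<close> already matches any composite that follows, whereas \<open>s_nat\<close>
  expects a bare \<open>LA f\<close> and has to be restated for longer composites.\<close>

lemma s_nat': "f \<in> Arr E \<Longrightarrow> Cod E f = Y \<Longrightarrow> x \<in> Arr E \<Longrightarrow> Cod E x = L (Dom E f) \<Longrightarrow>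
    s Y \<cdot> (LA f \<cdot> x) = f \<cdot> (s (Dom E f) \<cdot> x)"
  using post[OF s_nat[of f Y], of x] Cod_in_Obj[of f]
  by (simp add: LA_simps s_simps Dom_in_Obj assoc)

lemma s_d: "X \<in> Obj E \<Longrightarrow> s X \<cdot> d e X = Ide E X"
  using cyl unfolding cylinder_def d_def by auto

lemma LA_s_d: "X \<in> Obj E \<Longrightarrow> LA (s X) \<cdot> LA (d e X) = Ide E (L X)"
  using LA_Comp[of "d e X" "s X"] by (simp add: s_d LA_Ide s_simps d_simps)

lemma LA_s_d': "X \<in> Obj E \<Longrightarrow> x \<in> Arr E \<Longrightarrow> Cod E x = L X \<Longrightarrow> LA (s X) \<cdot> (LA (d e X) \<cdot> x) = x"
  using post[OF LA_s_d[of X e], of x] by (simp add: LA_simps s_simps d_simps L_Obj Ide_Comp')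

lemmas isimps = cat_simps L_Obj LA_simps LA_Comp LA_Ide d_simps s_simps d_nat s_nat s_nat' s_d LA_s_d LA_s_d'

lemma LA_mono: "is_mono E m \<Longrightarrow> is_mono E (LA m)"
  using interval unfolding interval_def preserves_monos_def by blast

lemma d_mono: "X \<in> Obj E \<Longrightarrow> is_mono E (d e X)"
  by (rule split_mono[of "s X"]) (simp_all add: isimps Hom_iff)

lemma cart_pullback: "is_mono E j \<Longrightarrow> is_pullback E (LA j) (d e (Cod E j)) (d e (Dom E j)) j"
  using interval pullback_sym unfolding interval_def cartesian_cylinder_def d_def by auto

lemma copairing_exists:
  assumes X: "X \<in> Obj E"
  obtains i j k where "is_coproduct E i j" "i \<in> Hom E X (Cod E i)" "j \<in> Hom E X (Cod E i)"
    "k \<in> Hom E (Cod E i) (L X)" "k \<cdot> i = d False X" "k \<cdot> j = d True X" "is_mono E k"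
    "is_copairing E (bd I 0 X) (bd I 1 X) k"
proof -
  obtain i j where ij: "is_coproduct E i j" "Dom E i = X" "Dom E j = X" using coproduct[OF X X] by blast
  have H: "i \<in> Hom E X (Cod E i)" "j \<in> Hom E X (Cod E i)" using ij unfolding is_coproduct_def Hom_def by auto
  obtain k where k: "k \<in> Hom E (Cod E i) (L X)" "k \<cdot> i = d False X" "k \<cdot> j = d True X"
    using ij d_simps[OF X] unfolding is_coproduct_def by metis
  have c: "is_copairing E (bd I 0 X) (bd I 1 X) k"
    unfolding is_copairing_def
    using ij k d_simps[OF X, of False] d_simps[OF X, of True] by (auto simp: Hom_def d_def)
  then have "is_mono E k" using interval X unfolding interval_def by blast
  then show ?thesis using that ij H k c by blast
qed

lemma coproduct_univ:
  assumes "is_coproduct E i j" "f \<in> Hom E (Dom E i) T" "g \<in> Hom E (Dom E j) T"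
  shows "\<exists>!w. w \<in> Hom E (Cod E i) T \<and> w \<cdot> i = f \<and> w \<cdot> j = g"
proof -
  have univ: "\<forall>f\<in>Arr E. \<forall>g\<in>Arr E. Dom E f = Dom E i \<longrightarrow> Dom E g = Dom E j \<longrightarrow> Cod E f = Cod E g \<longrightarrow>
        (\<exists>!w. w \<in> Hom E (Cod E i) (Cod E f) \<and> w \<cdot> i = f \<and> w \<cdot> j = g)"
    using assms(1) unfolding is_coproduct_def by (elim conjE)
  show ?thesis
    using univ[rule_format, OF HomD(1)[OF assms(2)] HomD(1)[OF assms(3)]] HomD[OF assms(2)] HomD[OF assms(3)]
    by simp
qed

lemma coproductE:
  assumes "is_coproduct E i j" "f \<in> Hom E (Dom E i) T" "g \<in> Hom E (Dom E j) T"
  shows "\<exists>w\<in>Hom E (Cod E i) T. w \<cdot> i = f \<and> w \<cdot> j = g"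
  using ex1_implies_ex[OF coproduct_univ[OF assms]] by blast

lemma coproduct_epi:
  assumes "is_coproduct E i j" "w \<in> Hom E (Cod E i) T" "w' \<in> Hom E (Cod E i) T"
    "w \<cdot> i = w' \<cdot> i" "w \<cdot> j = w' \<cdot> j"
  shows "w = w'"
proof -
  have A: "i \<in> Arr E" "j \<in> Arr E" "Cod E i = Cod E j" using assms(1) unfolding is_coproduct_def by auto
  have "w \<cdot> i \<in> Hom E (Dom E i) T" "w \<cdot> j \<in> Hom E (Dom E j) T"
    using A HomD[OF assms(2)] by (simp_all add: Hom_iff cat_simps)
  from coproduct_univ[OF assms(1) this] show ?thesis using assms(2-5) by (metis (no_types))
qed

text \<open>The cylinder is cartesian, so \<open>LA m\<close> and \<open>d e B\<close> intersect
  exactly in \<open>A\<close>; the union is then the pushout of \<open>L A\<close> and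
  \<open>B\<close> over \<open>A\<close>.\<close>

lemma horn_union:
  assumes m: "is_mono E m" and mH: "m \<in> Hom E A B" and u: "is_union E (LA m) (d e B) u"
  obtains W f g where "u \<in> Hom E W (L B)" "is_mono E u" "f \<in> Hom E (L A) W" "u \<cdot> f = LA m"
    "g \<in> Hom E B W" "u \<cdot> g = d e B"
    "\<And>T a b. a \<in> Hom E (L A) T \<Longrightarrow> b \<in> Hom E B T \<Longrightarrow> a \<cdot> d e A = b \<cdot> m \<Longrightarrow>
       \<exists>w\<in>Hom E W T. w \<cdot> f = a \<and> w \<cdot> g = b"
    "\<And>T w w'. w \<in> Hom E W T \<Longrightarrow> w' \<in> Hom E W T \<Longrightarrow> w \<cdot> f = w' \<cdot> f \<Longrightarrow> w \<cdot> g = w' \<cdot> g \<Longrightarrow> w = w'"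
proof -
  note [simp] = HomD[OF mH]
  have dH: "d e B \<in> Hom E B (L B)" using d_Hom by simp
  obtain W f g where W: "u \<in> Hom E W (L B)" "is_mono E u" "f \<in> Hom E (L A) W" "u \<cdot> f = LA m"
    "g \<in> Hom E B W" "u \<cdot> g = d e B"
    using unionD[OF u LA_Hom[OF mH] dH] .
  note [simp] = HomD[OF W(1)] LA_simps d_simps
  have pb: "is_pullback E (LA m) (d e B) (d e A) m" using cart_pullback[OF m] by simp
  show ?thesis
  proof (rule that[OF W])
    fix T a b assume "a \<in> Hom E (L A) T" "b \<in> Hom E B T" "a \<cdot> d e A = b \<cdot> m"
    then show "\<exists>w\<in>Hom E W T. w \<cdot> f = a \<and> w \<cdot> g = b"
      using union_glue[OF u pb, of a T b] W by simp blast
  next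
    fix T w w' assume w: "w \<in> Hom E W T" "w' \<in> Hom E W T" "w \<cdot> f = w' \<cdot> f" "w \<cdot> g = w' \<cdot> g"
    have x: "x = f" if "x \<in> Hom E (L A) W" "u \<cdot> x = LA m" for x
      by (rule mono_cancel[OF W(2)]) (use that W in auto)
    have y: "x = g" if "x \<in> Hom E B W" "u \<cdot> x = d e B" for x
      by (rule mono_cancel[OF W(2)]) (use that W in auto)
    show "w = w'"
    proof (rule union_epi[OF u])
      show "w \<in> Hom E (Dom E u) T" "w' \<in> Hom E (Dom E u) T" using w by auto
      show "w \<cdot> z = w' \<cdot> z" if "z \<in> Hom E (Dom E (LA m)) (Dom E u)" "u \<cdot> z = LA m" for z
        using x[of z] that w(3) by simp
      show "w \<cdot> z = w' \<cdot> z" if "z \<in> Hom E (Dom E (d e B)) (Dom E u)" "u \<cdot> z = d e B" for z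
        using y[of z] that w(4) by simp
    qed
  qed
qed

text \<open>The analogue with both ends: \<open>L A\<close> and two copies of \<open>B\<close>,
  glued along two copies of \<open>A\<close>. The copairing is replaced by the family
  \<open>g\<close>, so that the coproduct disappears from later arguments.\<close>

lemma sat_union:
  assumes m: "is_mono E m" and mH: "m \<in> Hom E A B" and k: "is_copairing E (bd I 0 B) (bd I 1 B) k"
    and u: "is_union E (LA m) k u"
  obtains W f g where "u \<in> Hom E W (L B)" "is_mono E u" "f \<in> Hom E (L A) W" "u \<cdot> f = LA m"
    "\<And>e. g e \<in> Hom E B W" "\<And>e. u \<cdot> g e = d e B"
    "\<And>T a b. a \<in> Hom E (L A) T \<Longrightarrow> (\<And>e. b e \<in> Hom E B T) \<Longrightarrow> (\<And>e. a \<cdot> d e A = b e \<cdot> m) \<Longrightarrow>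
       \<exists>w\<in>Hom E W T. w \<cdot> f = a \<and> (\<forall>e. w \<cdot> g e = b e)"
    "\<And>T w w'. w \<in> Hom E W T \<Longrightarrow> w' \<in> Hom E W T \<Longrightarrow> w \<cdot> f = w' \<cdot> f \<Longrightarrow>
       (\<And>e. w \<cdot> g e = w' \<cdot> g e) \<Longrightarrow> w = w'"
proof -
  note [simp] = HomD[OF mH]
  obtain i j where ij: "is_coproduct E i j" "Dom E k = Cod E i" "Dom E i = B" "Dom E j = B"
      and kk: "k \<cdot> i = d False B" "k \<cdot> j = d True B" "k \<in> Arr E"
    using k d_simps[of B False] d_simps[of B True] unfolding is_copairing_def d_def by auto
  have H: "i \<in> Hom E B (Cod E i)" "j \<in> Hom E B (Cod E i)" using ij unfolding is_coproduct_def Hom_def by auto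
  have kH: "k \<in> Hom E (Cod E i) (L B)"
  proof -
    have "Cod E (k \<cdot> i) = Cod E k" using Cod_Comp[of i k] HomD[OF H(1)] ij(2) kk(3) by simp
    then show ?thesis using kk ij d_simps by (simp add: Hom_iff)
  qed
  note [simp] = HomD[OF kH] HomD(1,2)[OF H(1)] HomD(1,2,3)[OF H(2)]
  obtain W f g where W: "u \<in> Hom E W (L B)" "is_mono E u" "f \<in> Hom E (L A) W" "u \<cdot> f = LA m"
    "g \<in> Hom E (Cod E i) W" "u \<cdot> g = k"
    using unionD[OF u LA_Hom[OF mH] kH] .
  note [simp] = HomD[OF W(1)] HomD[OF W(3)] HomD[OF W(5)] isimps
  have pb: "is_pullback E (LA m) (d e B) (d e A) m" for e using cart_pullback[OF m] by simp
  define g' where "g' e = (if e then g \<cdot> j else g \<cdot> i)" for e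
  show ?thesis
  proof (rule that[OF W(1-4)])
    show "g' e \<in> Hom E B W" for e by (simp add: g'_def Hom_iff)
    show "u \<cdot> g' e = d e B" for e
      using post[OF W(6), of i] post[OF W(6), of j] kk by (cases e) (simp_all add: g'_def)
    fix T a and b :: "bool \<Rightarrow> 'a"
    assume a: "a \<in> Hom E (L A) T" and b: "\<And>e. b e \<in> Hom E B T" and ab: "\<And>e. a \<cdot> d e A = b e \<cdot> m"
    obtain c where c: "c \<in> Hom E (Cod E i) T" "c \<cdot> i = b False" "c \<cdot> j = b True"
      using coproductE[OF ij(1), of "b False" T "b True"] b ij by auto
    have "\<exists>w\<in>Hom E (Dom E u) T.
        (\<forall>x\<in>Hom E (Dom E (LA m)) (Dom E u). u \<cdot> x = LA m \<longrightarrow> w \<cdot> x = a) \<and>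
        (\<forall>x\<in>Hom E (Dom E k) (Dom E u). u \<cdot> x = k \<longrightarrow> w \<cdot> x = c)"
      by (rule union_glue_copairing[OF u ij(1) _ pb[of False, folded kk(1)] pb[of True, folded kk(2)]])
        (use a c ab kH in auto)
    then obtain w where w: "w \<in> Hom E W T" "w \<cdot> f = a" "w \<cdot> g = c" using W by auto
    note [simp] = HomD[OF w(1)]
    have "w \<cdot> g' e = b e" for e
      using post[OF w(3), of i] post[OF w(3), of j] c by (cases e) (simp_all add: g'_def)
    then show "\<exists>w\<in>Hom E W T. w \<cdot> f = a \<and> (\<forall>e. w \<cdot> g' e = b e)" using w by blast
  next
    fix T w w' assume w: "w \<in> Hom E W T" "w' \<in> Hom E W T" "w \<cdot> f = w' \<cdot> f" and wg: "\<And>e. w \<cdot> g' e = w' \<cdot> g' e"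
    note [simp] = HomD[OF w(1)] HomD[OF w(2)]
    have wg: "w \<cdot> g = w' \<cdot> g"
    proof (rule coproduct_epi[OF ij(1)])
      show "w \<cdot> g \<in> Hom E (Cod E i) T" "w' \<cdot> g \<in> Hom E (Cod E i) T" by (simp_all add: Hom_iff)
      show "w \<cdot> g \<cdot> i = w' \<cdot> g \<cdot> i" "w \<cdot> g \<cdot> j = w' \<cdot> g \<cdot> j"
        using wg[of False] wg[of True] by (simp_all add: g'_def)
    qed
    have x: "x = f" if "x \<in> Hom E (L A) W" "u \<cdot> x = LA m" for x
      by (rule mono_cancel[OF W(2)]) (use that W in auto)
    have y: "x = g" if "x \<in> Hom E (Cod E i) W" "u \<cdot> x = k" for x
      by (rule mono_cancel[OF W(2)]) (use that W in auto)
    show "w = w'"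
    proof (rule union_epi[OF u])
      show "w \<in> Hom E (Dom E u) T" "w' \<in> Hom E (Dom E u) T" using w by auto
      show "w \<cdot> z = w' \<cdot> z" if "z \<in> Hom E (Dom E (LA m)) (Dom E u)" "u \<cdot> z = LA m" for z
        using x[of z] that w(3) by simp
      show "w \<cdot> z = w' \<cdot> z" if "z \<in> Hom E (Dom E k) (Dom E u)" "u \<cdot> z = k" for z
        using y[of z] that wg by simp
    qed
  qed
qed

lemma sat_union_exists:
  assumes m: "is_mono E m" and mH: "m \<in> Hom E A B"
  shows "\<exists>k u. is_copairing E (bd I 0 B) (bd I 1 B) k \<and> is_union E (LA m) k u"
proof -
  obtain i j k where k: "k \<in> Hom E (Cod E i) (L B)" "is_mono E k" "is_copairing E (bd I 0 B) (bd I 1 B) k"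
    using copairing_exists[OF HomD(5)[OF mH]] by metis
  then show ?thesis
    using union_exists[OF LA_mono[OF m] k(2)] HomD[OF k(1)] HomD[OF LA_Hom[OF mH]] by metis
qed

subsection \<open>Path objects\<close>

lemma path_exists:
  assumes "Y \<in> Obj E"
  shows "\<exists>R ev. R \<in> Obj E \<and> ev \<in> Hom E (L R) Y \<and> (\<forall>X\<in>Obj E. \<forall>h\<in>Hom E (L X) Y.
    \<exists>!f. f \<in> Hom E X R \<and> ev \<cdot> LA f = h)"
proof -
  have "preserves_colimits U E E (Cyl I)" using interval unfolding interval_def by blast
  then show ?thesis using right_adjoint[OF L_functor _ assms] by blast
qed

definition path :: "'o \<Rightarrow> 'o" where
  "path Y = (SOME R. R \<in> Obj E \<and> (\<exists>ev. ev \<in> Hom E (L R) Y \<and> (\<forall>X\<in>Obj E. \<forall>h\<in>Hom E (L X) Y.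
    \<exists>!f. f \<in> Hom E X R \<and> ev \<cdot> LA f = h)))"

definition ev :: "'o \<Rightarrow> 'a" where
  "ev Y = (SOME ev. ev \<in> Hom E (L (path Y)) Y \<and> (\<forall>X\<in>Obj E. \<forall>h\<in>Hom E (L X) Y.
    \<exists>!f. f \<in> Hom E X (path Y) \<and> ev \<cdot> LA f = h))"

lemma path_ev:
  assumes "Y \<in> Obj E"
  shows "path Y \<in> Obj E" and "ev Y \<in> Hom E (L (path Y)) Y"
    and "X \<in> Obj E \<Longrightarrow> h \<in> Hom E (L X) Y \<Longrightarrow> \<exists>!f. f \<in> Hom E X (path Y) \<and> ev Y \<cdot> LA f = h"
proof -
  have "\<exists>R. R \<in> Obj E \<and> (\<exists>ev. ev \<in> Hom E (L R) Y \<and> (\<forall>X\<in>Obj E. \<forall>h\<in>Hom E (L X) Y.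
      \<exists>!f. f \<in> Hom E X R \<and> ev \<cdot> LA f = h))"
    using path_exists[OF assms] by blast
  from someI_ex[OF this] have p: "path Y \<in> Obj E" "\<exists>ev. ev \<in> Hom E (L (path Y)) Y \<and>
      (\<forall>X\<in>Obj E. \<forall>h\<in>Hom E (L X) Y. \<exists>!f. f \<in> Hom E X (path Y) \<and> ev \<cdot> LA f = h)"
    unfolding path_def by blast+
  show "path Y \<in> Obj E" by fact
  note e = someI_ex[OF p(2), folded ev_def]
  show "ev Y \<in> Hom E (L (path Y)) Y" using e by blast
  show "X \<in> Obj E \<Longrightarrow> h \<in> Hom E (L X) Y \<Longrightarrow> \<exists>!f. f \<in> Hom E X (path Y) \<and> ev Y \<cdot> LA f = h" using e by blast
qed

lemma tr_exists:
  assumes "X \<in> Obj E" "h \<in> Hom E (L X) Y"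
  shows "\<exists>f\<in>Hom E X (path Y). ev Y \<cdot> LA f = h"
  using path_ev(3)[OF HomD(5)[OF assms(2)] assms] by blast

lemma ev_cancel:
  assumes f: "f \<in> Hom E X (path Y)" "g \<in> Hom E X (path Y)" and Y: "Y \<in> Obj E" and eq: "ev Y \<cdot> LA f = ev Y \<cdot> LA g"
  shows "f = g"
proof -
  have X: "X \<in> Obj E" using HomD f by blast
  have "ev Y \<cdot> LA f \<in> Hom E (L X) Y" using Comp_in_Hom[OF LA_Hom[OF f(1)] path_ev(2)[OF Y]] .
  then show ?thesis using path_ev(3)[OF Y X] f eq by metis
qed

subsection \<open>Box lifting\<close>

text \<open>
  \<open>box Es i p\<close> is the lifting property of the union of \<open>I(i)\<close> and the ends \<open>\<partial>\<^sup>e\<close>, \<open>e \<in> Es\<close>, against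
  \<open>p\<close>, with the data spelled out: \<open>Es = {e}\<close> for \<open>I(i) \<or> \<partial>\<^sup>e\<close>, \<open>Es = UNIV\<close> for \<open>I(i) \<or> [\<partial>\<^sup>0, \<partial>\<^sup>1]\<close>.
\<close>

definition box :: "bool set \<Rightarrow> 'a \<Rightarrow> 'a \<Rightarrow> bool" where
  "box Es i p \<longleftrightarrow> (\<forall>h\<in>Hom E (L (Dom E i)) (Dom E p). \<forall>v. \<forall>z\<in>Hom E (L (Cod E i)) (Cod E p).
     (\<forall>e\<in>Es. v e \<in> Hom E (Cod E i) (Dom E p) \<and> h \<cdot> d e (Dom E i) = v e \<cdot> i \<and> p \<cdot> v e = z \<cdot> d e (Cod E i)) \<longrightarrow>
     p \<cdot> h = z \<cdot> LA i \<longrightarrow>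
     (\<exists>H\<in>Hom E (L (Cod E i)) (Dom E p). H \<cdot> LA i = h \<and> p \<cdot> H = z \<and> (\<forall>e\<in>Es. H \<cdot> d e (Cod E i) = v e)))"

lemma boxD:
  assumes "box Es i p" "i \<in> Hom E A B" "p \<in> Hom E Y Z" "h \<in> Hom E (L A) Y" "z \<in> Hom E (L B) Z"
    "\<And>e. e \<in> Es \<Longrightarrow> v e \<in> Hom E B Y" "\<And>e. e \<in> Es \<Longrightarrow> h \<cdot> d e A = v e \<cdot> i"
    "\<And>e. e \<in> Es \<Longrightarrow> p \<cdot> v e = z \<cdot> d e B" "p \<cdot> h = z \<cdot> LA i"
  shows "\<exists>H\<in>Hom E (L B) Y. H \<cdot> LA i = h \<and> p \<cdot> H = z \<and> (\<forall>e\<in>Es. H \<cdot> d e B = v e)"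
proof -
  have "Dom E i = A" "Cod E i = B" "Dom E p = Y" "Cod E p = Z" using assms(2,3) by (auto simp: Hom_def)
  then show ?thesis using assms unfolding box_def by blast
qed

lemma boxI:
  assumes "i \<in> Hom E A B" "p \<in> Hom E Y Z"
    and "\<And>h z v. h \<in> Hom E (L A) Y \<Longrightarrow> z \<in> Hom E (L B) Z \<Longrightarrow> (\<And>e. e \<in> Es \<Longrightarrow> v e \<in> Hom E B Y) \<Longrightarrow>
      (\<And>e. e \<in> Es \<Longrightarrow> h \<cdot> d e A = v e \<cdot> i) \<Longrightarrow> (\<And>e. e \<in> Es \<Longrightarrow> p \<cdot> v e = z \<cdot> d e B) \<Longrightarrow> p \<cdot> h = z \<cdot> LA i \<Longrightarrow>
      \<exists>H\<in>Hom E (L B) Y. H \<cdot> LA i = h \<and> p \<cdot> H = z \<and> (\<forall>e\<in>Es. H \<cdot> d e B = v e)"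
  shows "box Es i p"
proof -
  have "Dom E i = A" "Cod E i = B" "Dom E p = Y" "Cod E p = Z" using assms(1,2) by (auto simp: Hom_def)
  then show ?thesis using assms(3) unfolding box_def by blast
qed

text \<open>\<open>Q\<close> is the pullback of the path object of the codomain of \<open>p\<close> and one copy of its domain per end.\<close>

definition box_limit :: "bool set \<Rightarrow> 'a \<Rightarrow> 'o \<Rightarrow> 'a \<Rightarrow> (bool \<Rightarrow> 'a) \<Rightarrow> bool" where
  "box_limit Es p Q a b \<longleftrightarrow>
     a \<in> Hom E Q (path (Cod E p)) \<and>
     (\<forall>e\<in>Es. b e \<in> Hom E Q (Dom E p) \<and> ev (Cod E p) \<cdot> d e (path (Cod E p)) \<cdot> a = p \<cdot> b e) \<and>
     (\<forall>X z v. z \<in> Hom E X (path (Cod E p)) \<longrightarrow>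
        (\<forall>e\<in>Es. v e \<in> Hom E X (Dom E p) \<and> ev (Cod E p) \<cdot> d e (path (Cod E p)) \<cdot> z = p \<cdot> v e) \<longrightarrow>
        (\<exists>w\<in>Hom E X Q. a \<cdot> w = z \<and> (\<forall>e\<in>Es. b e \<cdot> w = v e))) \<and>
     (\<forall>X w w'. w \<in> Hom E X Q \<longrightarrow> w' \<in> Hom E X Q \<longrightarrow> a \<cdot> w = a \<cdot> w' \<longrightarrow> (\<forall>e\<in>Es. b e \<cdot> w = b e \<cdot> w') \<longrightarrow> w = w')"

lemma box_limit_single:
  assumes p: "p \<in> Hom E Y Z" shows "\<exists>Q a b. box_limit {e} p Q a b"
proof -
  have [simp]: "Dom E p = Y" "Cod E p = Z" and Z: "Z \<in> Obj E" using HomD[OF p] by auto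
  note P = path_ev(1,2)[OF Z]
  have \<pi>: "ev Z \<cdot> d e (path Z) \<in> Hom E (path Z) Z" using Comp_in_Hom[OF d_Hom[OF P(1)] P(2)] .
  obtain a b where ab: "is_pullback E (ev Z \<cdot> d e (path Z)) p a b" using pullback[OF \<pi> p] by blast
  show ?thesis
  proof (rule pullbackE[OF ab \<pi> p])
    fix Q assume "a \<in> Hom E Q (path Z)" "b \<in> Hom E Q Y" "ev Z \<cdot> d e (path Z) \<cdot> a = p \<cdot> b"
      "\<And>W u v. u \<in> Hom E W (path Z) \<Longrightarrow> v \<in> Hom E W Y \<Longrightarrow> ev Z \<cdot> d e (path Z) \<cdot> u = p \<cdot> v \<Longrightarrow>
         \<exists>w\<in>Hom E W Q. a \<cdot> w = u \<and> b \<cdot> w = v"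
      "\<And>W w w'. w \<in> Hom E W Q \<Longrightarrow> w' \<in> Hom E W Q \<Longrightarrow> a \<cdot> w = a \<cdot> w' \<Longrightarrow> b \<cdot> w = b \<cdot> w' \<Longrightarrow> w = w'"
    then have "box_limit {e} p Q a (\<lambda>_. b)" unfolding box_limit_def by simp
    then show ?thesis by blast
  qed
qed

text \<open>An iterated pullback: first the path object is pulled back over the end
  \<open>False\<close>, then the result over the end \<open>True\<close>.\<close>

lemma box_limit_both:
  assumes p: "p \<in> Hom E Y Z" shows "\<exists>Q a b. box_limit UNIV p Q a b"
proof -
  note [simp] = HomD[OF p]
  have Z: "Z \<in> Obj E" by simp
  note P = path_ev(1,2)[OF Z]
  let ?\<pi> = "\<lambda>e. ev Z \<cdot> d e (path Z)"
  have \<pi>: "?\<pi> e \<in> Hom E (path Z) Z" for e using Comp_in_Hom[OF d_Hom[OF P(1)] P(2)] .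
  obtain a1 b1 where ab1: "is_pullback E (?\<pi> False) p a1 b1" using pullback[OF \<pi> p] by blast
  show ?thesis
  proof (rule pullbackE[OF ab1 \<pi> p])
    fix Q1 assume Q1: "a1 \<in> Hom E Q1 (path Z)" "b1 \<in> Hom E Q1 Y" "?\<pi> False \<cdot> a1 = p \<cdot> b1"
      and Q1e: "\<And>W u v. u \<in> Hom E W (path Z) \<Longrightarrow> v \<in> Hom E W Y \<Longrightarrow> ?\<pi> False \<cdot> u = p \<cdot> v \<Longrightarrow>
         \<exists>w\<in>Hom E W Q1. a1 \<cdot> w = u \<and> b1 \<cdot> w = v"
      and Q1u: "\<And>W w w'. w \<in> Hom E W Q1 \<Longrightarrow> w' \<in> Hom E W Q1 \<Longrightarrow> a1 \<cdot> w = a1 \<cdot> w' \<Longrightarrow> b1 \<cdot> w = b1 \<cdot> w' \<Longrightarrow> w = w'"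
    have \<pi>a: "?\<pi> True \<cdot> a1 \<in> Hom E Q1 Z" using Comp_in_Hom[OF Q1(1) \<pi>] .
    obtain a2 b2 where ab2: "is_pullback E (?\<pi> True \<cdot> a1) p a2 b2" using pullback[OF \<pi>a p] by blast
    show ?thesis
    proof (rule pullbackE[OF ab2 \<pi>a p])
      fix Q assume Q: "a2 \<in> Hom E Q Q1" "b2 \<in> Hom E Q Y" "?\<pi> True \<cdot> a1 \<cdot> a2 = p \<cdot> b2"
        and Qe: "\<And>W u v. u \<in> Hom E W Q1 \<Longrightarrow> v \<in> Hom E W Y \<Longrightarrow> ?\<pi> True \<cdot> a1 \<cdot> u = p \<cdot> v \<Longrightarrow>
           \<exists>w\<in>Hom E W Q. a2 \<cdot> w = u \<and> b2 \<cdot> w = v"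
        and Qu: "\<And>W w w'. w \<in> Hom E W Q \<Longrightarrow> w' \<in> Hom E W Q \<Longrightarrow> a2 \<cdot> w = a2 \<cdot> w' \<Longrightarrow> b2 \<cdot> w = b2 \<cdot> w' \<Longrightarrow> w = w'"
      note H [simp] = HomD[OF Q1(1)] HomD[OF Q1(2)] HomD[OF Q(1)] HomD[OF Q(2)] HomD[OF \<pi>]
      define b where "b e = (if e then b2 else b1 \<cdot> a2)" for e
      have "box_limit UNIV p Q (a1 \<cdot> a2) b"
        unfolding box_limit_def HomD(2,3)[OF p]
      proof (intro conjI allI ballI impI)
        show "a1 \<cdot> a2 \<in> Hom E Q (path Z)" using Comp_in_Hom[OF Q(1) Q1(1)] .
        show "b e \<in> Hom E Q Y" for e using Q Comp_in_Hom[OF Q(1) Q1(2)] by (simp add: b_def)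
        show "?\<pi> e \<cdot> (a1 \<cdot> a2) = p \<cdot> b e" for e
        proof (cases e)
          case True
          then show ?thesis using Q(3) Comp_assoc[OF Q(1) Q1(1) \<pi>] by (simp add: b_def)
        next
          case False
          then show ?thesis
            using Q1(3) Comp_assoc[OF Q(1) Q1(1) \<pi>] Comp_assoc[OF Q(1) Q1(2) p] by (simp add: b_def)
        qed
        fix X z and v :: "bool \<Rightarrow> 'a"
        assume z: "z \<in> Hom E X (path Z)" and v: "\<forall>e\<in>UNIV. v e \<in> Hom E X Y \<and> ?\<pi> e \<cdot> z = p \<cdot> v e"
        then obtain w1 where w1: "w1 \<in> Hom E X Q1" "a1 \<cdot> w1 = z" "b1 \<cdot> w1 = v False" using Q1e by blast
        have "?\<pi> True \<cdot> a1 \<cdot> w1 = p \<cdot> v True" using Comp_assoc[OF w1(1) Q1(1) \<pi>] w1(2) v by simp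
        then obtain w where w: "w \<in> Hom E X Q" "a2 \<cdot> w = w1" "b2 \<cdot> w = v True" using Qe[OF w1(1)] v by blast
        have "b e \<cdot> w = v e" for e
          using w w1 Comp_assoc[OF w(1) Q(1) Q1(2)] by (cases e) (simp_all add: b_def)
        moreover have "a1 \<cdot> a2 \<cdot> w = z" using w w1 Comp_assoc[OF w(1) Q(1) Q1(1)] by simp
        ultimately show "\<exists>w\<in>Hom E X Q. a1 \<cdot> a2 \<cdot> w = z \<and> (\<forall>e\<in>UNIV. b e \<cdot> w = v e)" using w(1) by blast
      next
        fix X w w'
        assume w: "w \<in> Hom E X Q" and w': "w' \<in> Hom E X Q" and a: "a1 \<cdot> a2 \<cdot> w = a1 \<cdot> a2 \<cdot> w'"
          and b: "\<forall>e\<in>UNIV. b e \<cdot> w = b e \<cdot> w'"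
        show "w = w'"
        proof (rule Qu[OF w w'])
          show "b2 \<cdot> w = b2 \<cdot> w'" using b[rule_format, of True] by (simp add: b_def)
          show "a2 \<cdot> w = a2 \<cdot> w'"
          proof (rule Q1u[OF Comp_in_Hom[OF w Q(1)] Comp_in_Hom[OF w' Q(1)]])
            show "a1 \<cdot> (a2 \<cdot> w) = a1 \<cdot> (a2 \<cdot> w')"
              using a Comp_assoc[OF w Q(1) Q1(1)] Comp_assoc[OF w' Q(1) Q1(1)] by simp
            show "b1 \<cdot> (a2 \<cdot> w) = b1 \<cdot> (a2 \<cdot> w')"
              using b[rule_format, of False] Comp_assoc[OF w Q(1) Q1(2)] Comp_assoc[OF w' Q(1) Q1(2)]
              by (simp add: b_def)
          qed
        qed
      qed
      then show ?thesis by blast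
    qed
  qed
qed

text \<open>Adjunction between adding ends to \<open>I(i)\<close> and the map \<open>q\<close> from
  paths in \<open>Y\<close> to paths in \<open>Z\<close> with lifted ends. The map \<open>q\<close>
  does not depend on \<open>i\<close>; that is why box lifting passes from a set \<open>S\<close> of
  arrows to the whole class \<open>cof_class E S\<close>.\<close>

lemma box_rep:
  assumes p: "p \<in> Hom E Y Z" and lim: "box_limit Es p Q a b"
  shows "\<exists>q\<in>Hom E (path Y) Q. \<forall>i\<in>Arr E. box Es i p \<longleftrightarrow> has_lifting E i q"
proof -
  note [simp] = HomD[OF p]
  have Y: "Y \<in> Obj E" and Z: "Z \<in> Obj E" by auto
  note PY = path_ev(1,2)[OF Y] and PZ = path_ev(1,2)[OF Z]
  let ?\<pi> = "\<lambda>e. ev Z \<cdot> d e (path Z)"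
  note lim' = lim[unfolded box_limit_def HomD(2,3)[OF p]]
  note a = conjunct1[OF lim'] and b0 = conjunct1[OF conjunct2[OF lim']]
    and ex0 = conjunct1[OF conjunct2[OF conjunct2[OF lim']]]
    and uni0 = conjunct2[OF conjunct2[OF conjunct2[OF lim']]]
  have b: "b e \<in> Hom E Q Y" and ab: "?\<pi> e \<cdot> a = p \<cdot> b e" if "e \<in> Es" for e
    using b0 that by blast+
  have ex: "\<exists>w\<in>Hom E X Q. a \<cdot> w = z \<and> (\<forall>e\<in>Es. b e \<cdot> w = v e)"
    if "z \<in> Hom E X (path Z)" "\<And>e. e \<in> Es \<Longrightarrow> v e \<in> Hom E X Y" "\<And>e. e \<in> Es \<Longrightarrow> ?\<pi> e \<cdot> z = p \<cdot> v e" for X z v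
    by (rule ex0[rule_format, OF that(1)]) (use that(2,3) in simp)
  have uni: "w = w'" if "w \<in> Hom E X Q" "w' \<in> Hom E X Q" "a \<cdot> w = a \<cdot> w'" "\<And>e. e \<in> Es \<Longrightarrow> b e \<cdot> w = b e \<cdot> w'" for X w w'
    by (rule uni0[rule_format, OF that(1-3)]) (use that(4) in simp)
  note [simp] = PY(1) PZ(1) HomD(1-3)[OF PY(2)] HomD(1-3)[OF PZ(2)] HomD[OF a] isimps
  have bs: "b e \<in> Arr E" "Dom E (b e) = Q" "Cod E (b e) = Y" if "e \<in> Es" for e using HomD[OF b[OF that]] by auto
  \<comment> \<open>\<open>t\<close> is the action of \<open>p\<close> on path objects, obtained as
    the transpose of \<open>p \<cdot> ev Y\<close>.\<close>
  obtain t where t: "t \<in> Hom E (path Y) (path Z)" "ev Z \<cdot> LA t = p \<cdot> ev Y"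
    using tr_exists[OF PY(1), of "p \<cdot> ev Y" Z] by (auto simp: Hom_iff)
  note [simp] = HomD(1-3)[OF t(1)]
  have "?\<pi> e \<cdot> t = p \<cdot> (ev Y \<cdot> d e (path Y))" for e
    using post[OF t(2), of "d e (path Y)"] by simp
  then obtain q where q: "q \<in> Hom E (path Y) Q" "a \<cdot> q = t" and bq: "\<And>e. e \<in> Es \<Longrightarrow> b e \<cdot> q = ev Y \<cdot> d e (path Y)"
    using ex[OF t(1), of "\<lambda>e. ev Y \<cdot> d e (path Y)"] by (auto simp: Hom_iff)
  note [simp] = HomD(1-3)[OF q(1)]
  have key: "p \<cdot> (ev Y \<cdot> LA x) = ev Z \<cdot> LA (a \<cdot> (q \<cdot> x))" if "x \<in> Hom E X (path Y)" for x X
    using post[OF t(2), of "LA x"] post[OF q(2), of x] HomD[OF that] by simp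
  have key2: "b e \<cdot> (q \<cdot> x) = ev Y \<cdot> (LA x \<cdot> d e X)" if "x \<in> Hom E X (path Y)" "e \<in> Es" for x X e
    using post[OF bq[OF that(2)], of x] HomD[OF that(1)] bs[OF that(2)] by simp
  have "box Es i p \<longleftrightarrow> has_lifting E i q" if i: "i \<in> Arr E" for i
  proof -
    define A B where "A = Dom E i" and "B = Cod E i"
    have iH: "i \<in> Hom E A B" using i by (simp add: Hom_def A_def B_def)
    note [simp] = HomD[OF iH]
    show ?thesis
    proof
      assume bx: "box Es i p"
      show "has_lifting E i q"
      proof (rule has_liftingI[OF iH q(1)])
        fix u w assume u: "u \<in> Hom E A (path Y)" and w: "w \<in> Hom E B Q" and sq: "q \<cdot> u = w \<cdot> i"
        note [simp] = HomD[OF u] HomD[OF w]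
        have h: "ev Y \<cdot> LA u \<in> Hom E (L A) Y" and z: "ev Z \<cdot> LA (a \<cdot> w) \<in> Hom E (L B) Z"
          by (simp_all add: Hom_iff)
        have "\<exists>H\<in>Hom E (L B) Y. H \<cdot> LA i = ev Y \<cdot> LA u \<and> p \<cdot> H = ev Z \<cdot> LA (a \<cdot> w) \<and> (\<forall>e\<in>Es. H \<cdot> d e B = b e \<cdot> w)"
        proof (rule boxD[OF bx iH p h z])
          fix e assume e: "e \<in> Es"
          note [simp] = bs[OF e]
          show "b e \<cdot> w \<in> Hom E B Y" by (simp add: Hom_iff)
          show "ev Y \<cdot> LA u \<cdot> d e A = b e \<cdot> w \<cdot> i" using key2[OF u e] sq by simp
          show "p \<cdot> (b e \<cdot> w) = ev Z \<cdot> LA (a \<cdot> w) \<cdot> d e B" using post[OF ab[OF e], of w] by simp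
        next
          show "p \<cdot> (ev Y \<cdot> LA u) = ev Z \<cdot> LA (a \<cdot> w) \<cdot> LA i" using key[OF u] sq by simp
        qed
        then obtain H where H: "H \<in> Hom E (L B) Y" "H \<cdot> LA i = ev Y \<cdot> LA u" "p \<cdot> H = ev Z \<cdot> LA (a \<cdot> w)"
          "\<And>e. e \<in> Es \<Longrightarrow> H \<cdot> d e B = b e \<cdot> w" by blast
        obtain l where l: "l \<in> Hom E B (path Y)" "ev Y \<cdot> LA l = H" using tr_exists[OF _ H(1)] by auto
        note [simp] = HomD[OF l(1)] HomD(1-3)[OF H(1)]
        have "l \<cdot> i = u"
        proof (rule ev_cancel[OF _ u Y])
          show "l \<cdot> i \<in> Hom E A (path Y)" by (simp add: Hom_iff)
          show "ev Y \<cdot> LA (l \<cdot> i) = ev Y \<cdot> LA u" using post[OF l(2), of "LA i"] H(2) by simp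
        qed
        moreover have "q \<cdot> l = w"
        proof (rule uni[OF _ w])
          show "q \<cdot> l \<in> Hom E B Q" by (simp add: Hom_iff)
          show "a \<cdot> (q \<cdot> l) = a \<cdot> w"
          proof (rule ev_cancel[OF _ _ Z])
            show "a \<cdot> (q \<cdot> l) \<in> Hom E B (path Z)" "a \<cdot> w \<in> Hom E B (path Z)" by (simp_all add: Hom_iff)
            show "ev Z \<cdot> LA (a \<cdot> (q \<cdot> l)) = ev Z \<cdot> LA (a \<cdot> w)" using key[OF l(1)] l(2) H(3) by simp
          qed
          show "b e \<cdot> (q \<cdot> l) = b e \<cdot> w" if e: "e \<in> Es" for e
            using key2[OF l(1) e] H(4)[OF e] post[OF l(2), of "d e B"] by simp
        qed
        ultimately show "\<exists>w'\<in>Hom E B (path Y). w' \<cdot> i = u \<and> q \<cdot> w' = w" using l(1) by blast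
      qed
    next
      assume lift: "has_lifting E i q"
      show "box Es i p"
      proof (rule boxI[OF iH p])
        fix h z and v :: "bool \<Rightarrow> 'a"
        assume h: "h \<in> Hom E (L A) Y" and z: "z \<in> Hom E (L B) Z" and v: "\<And>e. e \<in> Es \<Longrightarrow> v e \<in> Hom E B Y"
          and hv: "\<And>e. e \<in> Es \<Longrightarrow> h \<cdot> d e A = v e \<cdot> i" and pv: "\<And>e. e \<in> Es \<Longrightarrow> p \<cdot> v e = z \<cdot> d e B"
          and ph: "p \<cdot> h = z \<cdot> LA i"
        obtain u where u: "u \<in> Hom E A (path Y)" "ev Y \<cdot> LA u = h" using tr_exists[OF _ h] by auto
        obtain z' where z': "z' \<in> Hom E B (path Z)" "ev Z \<cdot> LA z' = z" using tr_exists[OF _ z] by auto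
        note [simp] = HomD(1-3)[OF h] HomD(1-3)[OF z] HomD[OF u(1)] HomD[OF z'(1)]
        have vs: "v e \<in> Arr E" "Dom E (v e) = B" "Cod E (v e) = Y" if "e \<in> Es" for e using HomD[OF v[OF that]] by auto
        have "?\<pi> e \<cdot> z' = p \<cdot> v e" if e: "e \<in> Es" for e
          using post[OF z'(2), of "d e B"] pv[OF e] by simp
        from ex[where v = v, OF z'(1) v this]
        obtain w where w: "w \<in> Hom E B Q" "a \<cdot> w = z'" "\<And>e. e \<in> Es \<Longrightarrow> b e \<cdot> w = v e"
          by blast
        note [simp] = HomD[OF w(1)]
        have "q \<cdot> u = w \<cdot> i"
        proof (rule uni)
          show "q \<cdot> u \<in> Hom E A Q" "w \<cdot> i \<in> Hom E A Q" by (simp_all add: Hom_iff)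
          show "a \<cdot> (q \<cdot> u) = a \<cdot> (w \<cdot> i)"
          proof (rule ev_cancel[OF _ _ Z])
            show "a \<cdot> (q \<cdot> u) \<in> Hom E A (path Z)" "a \<cdot> (w \<cdot> i) \<in> Hom E A (path Z)" by (simp_all add: Hom_iff)
            have "ev Z \<cdot> LA (a \<cdot> (w \<cdot> i)) = z \<cdot> LA i"
              using post[OF w(2), of i] post[OF z'(2), of "LA i"] by simp
            then show "ev Z \<cdot> LA (a \<cdot> (q \<cdot> u)) = ev Z \<cdot> LA (a \<cdot> (w \<cdot> i))" using key[OF u(1)] u(2) ph by simp
          qed
          fix e assume e: "e \<in> Es"
          note [simp] = bs[OF e] vs[OF e]
          show "b e \<cdot> (q \<cdot> u) = b e \<cdot> (w \<cdot> i)"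
            using key2[OF u(1) e] post[OF u(2), of "d e A"] post[OF w(3)[OF e], of i] hv[OF e] by simp
        qed
        from has_liftingD[OF lift iH q(1) u(1) w(1) this]
        obtain l where l: "l \<in> Hom E B (path Y)" "l \<cdot> i = u" "q \<cdot> l = w" by blast
        note [simp] = HomD[OF l(1)]
        have "ev Y \<cdot> LA l \<in> Hom E (L B) Y" by (simp add: Hom_iff)
        moreover have "ev Y \<cdot> LA l \<cdot> LA i = h" using arg_cong[OF l(2), of LA] u(2) by simp
        moreover have "p \<cdot> (ev Y \<cdot> LA l) = z" using key[OF l(1)] l(3) w(2) z'(2) by simp
        moreover have "ev Y \<cdot> LA l \<cdot> d e B = v e" if e: "e \<in> Es" for e
          using key2[OF l(1) e] l(3) w(3)[OF e] by simp
        ultimately show "\<exists>H\<in>Hom E (L B) Y. H \<cdot> LA i = h \<and> p \<cdot> H = z \<and> (\<forall>e\<in>Es. H \<cdot> d e B = v e)" by blast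
      qed
    qed
  qed
  then show ?thesis using q(1) by blast
qed

lemma box_cof:
  assumes p: "p \<in> Hom E Y Z" and lim: "box_limit Es p Q a b"
    and S: "S \<subseteq> Arr E" "\<And>m. m \<in> S \<Longrightarrow> box Es m p" and i: "i \<in> cof_class E S"
  shows "box Es i p"
proof -
  obtain q where q: "q \<in> Hom E (path Y) Q" "\<forall>i\<in>Arr E. box Es i p \<longleftrightarrow> has_lifting E i q"
    using box_rep[OF p lim] by blast
  have "q \<in> inj_class E S" unfolding inj_class_def using q S HomD(1)[OF q(1)] by blast
  then show ?thesis using i q(2) unfolding cof_class_def by blast
qed

text \<open>The pushout property of the union turns box data into a map out of \<open>W\<close>, and
  joint epicness of the parts checks the square; restricting the lift to the parts gives the box
  filler.\<close>

lemma box_single_if_union: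
  assumes m: "is_mono E m" and mH: "m \<in> Hom E A B" and p: "p \<in> Hom E Y Z"
    and u: "is_union E (LA m) (d e B) u" and lift: "has_lifting E u p"
  shows "box {e} m p"
proof (rule horn_union[OF m mH u])
  fix W f g assume W: "u \<in> Hom E W (L B)" and f: "f \<in> Hom E (L A) W" "u \<cdot> f = LA m"
    and g: "g \<in> Hom E B W" "u \<cdot> g = d e B"
    and glue: "\<And>T a b. a \<in> Hom E (L A) T \<Longrightarrow> b \<in> Hom E B T \<Longrightarrow> a \<cdot> d e A = b \<cdot> m \<Longrightarrow>
       \<exists>w\<in>Hom E W T. w \<cdot> f = a \<and> w \<cdot> g = b"
    and epi: "\<And>T w w'. w \<in> Hom E W T \<Longrightarrow> w' \<in> Hom E W T \<Longrightarrow> w \<cdot> f = w' \<cdot> f \<Longrightarrow> w \<cdot> g = w' \<cdot> g \<Longrightarrow> w = w'"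
  note [simp] = HomD[OF mH] HomD[OF p] HomD[OF W] HomD[OF f(1)] HomD[OF g(1)] isimps
  show "box {e} m p"
  proof (rule boxI[OF mH p])
    fix h z and v :: "bool \<Rightarrow> 'a"
    assume h: "h \<in> Hom E (L A) Y" and z: "z \<in> Hom E (L B) Z" and v: "\<And>e'. e' \<in> {e} \<Longrightarrow> v e' \<in> Hom E B Y"
      and hv: "\<And>e'. e' \<in> {e} \<Longrightarrow> h \<cdot> d e' A = v e' \<cdot> m" and pv: "\<And>e'. e' \<in> {e} \<Longrightarrow> p \<cdot> v e' = z \<cdot> d e' B"
      and ph: "p \<cdot> h = z \<cdot> LA m"
    have ve: "v e \<in> Hom E B Y" using v by simp
    note [simp] = HomD[OF h] HomD[OF z] HomD[OF ve]
    obtain w where w: "w \<in> Hom E W Y" "w \<cdot> f = h" "w \<cdot> g = v e" using glue[OF h ve] hv by auto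
    note [simp] = HomD[OF w(1)]
    have "p \<cdot> w = z \<cdot> u"
      by (rule epi) (use w f g ph pv in \<open>simp_all add: Hom_iff\<close>)
    from has_liftingD[OF lift W p w(1) z this] obtain H where H: "H \<in> Hom E (L B) Y" "H \<cdot> u = w" "p \<cdot> H = z" by blast
    note [simp] = HomD[OF H(1)]
    have "H \<cdot> LA m = h" "H \<cdot> d e B = v e"
      using post[OF H(2), of f] post[OF H(2), of g] w f g by simp_all
    then show "\<exists>H\<in>Hom E (L B) Y. H \<cdot> LA m = h \<and> p \<cdot> H = z \<and> (\<forall>e'\<in>{e}. H \<cdot> d e' B = v e')"
      using H by blast
  qed
qed

lemma box_both_if_union:
  assumes m: "is_mono E m" and mH: "m \<in> Hom E A B" and p: "p \<in> Hom E Y Z"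
    and k: "is_copairing E (bd I 0 B) (bd I 1 B) k"
    and u: "is_union E (LA m) k u" and lift: "has_lifting E u p"
  shows "box UNIV m p"
proof (rule sat_union[OF m mH k u])
  fix W f and g :: "bool \<Rightarrow> 'a"
  assume W: "u \<in> Hom E W (L B)" and f: "f \<in> Hom E (L A) W" "u \<cdot> f = LA m"
    and g: "\<And>e. g e \<in> Hom E B W" "\<And>e. u \<cdot> g e = d e B"
    and glue: "\<And>T a b. a \<in> Hom E (L A) T \<Longrightarrow> (\<And>e. b e \<in> Hom E B T) \<Longrightarrow> (\<And>e. a \<cdot> d e A = b e \<cdot> m) \<Longrightarrow>
       \<exists>w\<in>Hom E W T. w \<cdot> f = a \<and> (\<forall>e. w \<cdot> g e = b e)"
    and epi: "\<And>T w w'. w \<in> Hom E W T \<Longrightarrow> w' \<in> Hom E W T \<Longrightarrow> w \<cdot> f = w' \<cdot> f \<Longrightarrow>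
       (\<And>e. w \<cdot> g e = w' \<cdot> g e) \<Longrightarrow> w = w'"
  note [simp] = HomD[OF mH] HomD[OF p] HomD[OF W] HomD[OF f(1)] HomD[OF g(1)] isimps
  show "box UNIV m p"
  proof (rule boxI[OF mH p])
    fix h z and v :: "bool \<Rightarrow> 'a"
    assume h: "h \<in> Hom E (L A) Y" and z: "z \<in> Hom E (L B) Z" and v: "\<And>e. e \<in> UNIV \<Longrightarrow> v e \<in> Hom E B Y"
      and hv: "\<And>e. e \<in> UNIV \<Longrightarrow> h \<cdot> d e A = v e \<cdot> m" and pv: "\<And>e. e \<in> UNIV \<Longrightarrow> p \<cdot> v e = z \<cdot> d e B"
      and ph: "p \<cdot> h = z \<cdot> LA m"
    note [simp] = HomD[OF h] HomD[OF z] HomD[OF v[OF UNIV_I]]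
    obtain w where w: "w \<in> Hom E W Y" "w \<cdot> f = h" "\<And>e. w \<cdot> g e = v e" using glue[OF h, of v] hv v by auto
    note [simp] = HomD[OF w(1)]
    have "p \<cdot> w = z \<cdot> u"
      by (rule epi) (use w f g ph pv in \<open>simp_all add: Hom_iff\<close>)
    from has_liftingD[OF lift W p w(1) z this] obtain H where H: "H \<in> Hom E (L B) Y" "H \<cdot> u = w" "p \<cdot> H = z" by blast
    note [simp] = HomD[OF H(1)]
    have "H \<cdot> LA m = h" "H \<cdot> d e B = v e" for e
      using post[OF H(2), of f] post[OF H(2), of "g e"] w f g by simp_all
    then show "\<exists>H\<in>Hom E (L B) Y. H \<cdot> LA m = h \<and> p \<cdot> H = z \<and> (\<forall>e\<in>UNIV. H \<cdot> d e B = v e)"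
      using H by blast
  qed
qed

end

section \<open>Naively fibrant objects and homotopy\<close>

locale model_setting = topos_interval E U I
  for E :: "('o, 'a) cat" (structure) and U :: "'u itself" and I :: "('o, 'a) cyl" +
  fixes M :: "'a set"
  assumes cellular: "cellular_model U E M"
begin

abbreviation "fib \<equiv> inj_class E (Lambda E M I)"
abbreviation "nf \<equiv> naively_fibrant E M I"
abbreviation "hrel \<equiv> homotopy_rel E I"

lemma mono_iff_cof: "is_mono E i \<longleftrightarrow> i \<in> cof_class E M"
  using cellular unfolding cellular_model_def by blast

lemma M_mono: "m \<in> M \<Longrightarrow> is_mono E m"
  using cellular unfolding cellular_model_def by blast

lemma Lambda_mono: "l \<in> Lambda E M I \<Longrightarrow> is_mono E l"
proof -
  assume "l \<in> Lambda E M I"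
  then obtain n where "l \<in> Lambda_stage E M I n" unfolding Lambda_def by blast
  then show ?thesis by (cases n) (auto simp: sat_def is_union_def)
qed

lemma fibD: "p \<in> fib \<Longrightarrow> p \<in> Hom E (Dom E p) (Cod E p)" "p \<in> fib \<Longrightarrow> l \<in> Lambda E M I \<Longrightarrow> has_lifting E l p"
  unfolding inj_class_def Hom_def by auto

text \<open>The unions for the monos in \<open>M\<close> make up stage 0 of \<open>Lambda\<close>,
  so members of \<open>M\<close> lift boxes. Every mono is in \<open>cof_class E M\<close>, and box
  lifting extends to that class by transposition.\<close>

lemma box_single:
  assumes p: "p \<in> fib" and i: "is_mono E i"
  shows "box {e} i p"
proof -
  note pH = fibD(1)[OF p]
  obtain Q a b where lim: "box_limit {e} p Q a b" using box_limit_single[OF pH] by blast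
  show ?thesis
  proof (rule box_cof[OF pH lim])
    show "M \<subseteq> Arr E" using M_mono mono_Arr by blast
    show "i \<in> cof_class E M" using i mono_iff_cof by blast
    fix m assume mM: "m \<in> M"
    have m: "is_mono E m" and mH: "m \<in> Hom E (Dom E m) (Cod E m)"
      using M_mono[OF mM] mono_Arr unfolding Hom_def by auto
    obtain u where u: "is_union E (LA m) (d e (Cod E m)) u"
      using union_exists[OF LA_mono[OF m] d_mono[OF HomD(5)[OF mH], of e]] HomD[OF mH]
      by (auto simp: isimps)
    have "u \<in> Lambda_stage E M I 0"
      using mM u by (cases e) (auto simp: d_def)
    then have "u \<in> Lambda E M I" unfolding Lambda_def by blast
    then show "box {e} m p" using box_single_if_union[OF m mH pH u] fibD(2)[OF p] by blast
  qed
qed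

text \<open>The same passage, now starting from \<open>Lambda\<close> itself: it is closed under
  \<open>sat\<close>, so each of its members lifts boxes with both ends.\<close>

lemma box_both:
  assumes p: "p \<in> fib" and l: "l \<in> cof_class E (Lambda E M I)"
  shows "box UNIV l p"
proof -
  note pH = fibD(1)[OF p]
  obtain Q a b where lim: "box_limit UNIV p Q a b" using box_limit_both[OF pH] by blast
  show ?thesis
  proof (rule box_cof[OF pH lim _ _ l])
    show "Lambda E M I \<subseteq> Arr E" using Lambda_mono mono_Arr by blast
    fix m assume mM: "m \<in> Lambda E M I"
    have m: "is_mono E m" and mH: "m \<in> Hom E (Dom E m) (Cod E m)"
      using Lambda_mono[OF mM] mono_Arr unfolding Hom_def by auto
    obtain k u where k: "is_copairing E (bd I 0 (Cod E m)) (bd I 1 (Cod E m)) k"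
      and u: "is_union E (LA m) k u" using sat_union_exists[OF m mH] by blast
    obtain n where "m \<in> Lambda_stage E M I n" using mM unfolding Lambda_def by blast
    then have "u \<in> Lambda_stage E M I (Suc n)" using k u by (auto simp: sat_def)
    then have "u \<in> Lambda E M I" unfolding Lambda_def by blast
    then show "box UNIV m p" using box_both_if_union[OF m mH pH k u] fibD(2)[OF p] by blast
  qed
qed

text \<open>A box over the mono from the initial object has no content on its sides, so filling it
  is lifting against the end \<open>d e X\<close> alone.\<close>

lemma d_cof:
  assumes X: "X \<in> Obj E"
  shows "d e X \<in> cof_class E (Lambda E M I)"
  unfolding cof_class_def
proof (intro CollectI conjI ballI)
  show "d e X \<in> Arr E" using d_simps X by blast
  fix p assume p: "p \<in> fib"
  define Y Z where "Y = Dom E p" and "Z = Cod E p"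
  have pH: "p \<in> Hom E Y Z" using fibD(1)[OF p] unfolding Y_def Z_def .
  obtain z where z: "is_mono E z" "Cod E z = X" and z0: "\<And>Y. Y \<in> Obj E \<Longrightarrow> \<exists>!f. f \<in> Hom E (Dom E z) Y"
    using initial[OF X] by blast
  define Z0 where "Z0 = Dom E z"
  have zH: "z \<in> Hom E Z0 X" using z mono_Arr unfolding Z0_def Hom_def by auto
  note [simp] = HomD[OF zH] isimps HomD[OF pH]
  have z0': "f = g" if "f \<in> Hom E Z0 Y" "g \<in> Hom E Z0 Y" for f g Y
    using z0[OF HomD(5)[OF that(1)]] that unfolding Z0_def by blast
  \<comment> \<open>The cylinder on an initial object again has at most one map to each object:
    transpose to maps into the path object.\<close>
  have L0: "f = g" if fg: "f \<in> Hom E (L Z0) Y" "g \<in> Hom E (L Z0) Y" for f g Y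
  proof -
    obtain f' g' where f': "f' \<in> Hom E Z0 (path Y)" "ev Y \<cdot> LA f' = f" and g': "g' \<in> Hom E Z0 (path Y)" "ev Y \<cdot> LA g' = g"
      using tr_exists[OF HomD(4)[OF zH]] fg by blast
    then show ?thesis using z0'[OF f'(1) g'(1)] by simp
  qed
  show "has_lifting E (d e X) p"
  proof (rule has_liftingI[OF d_Hom[OF X] pH])
    fix u v assume u: "u \<in> Hom E X Y" and v: "v \<in> Hom E (L X) Z" and sq: "p \<cdot> u = v \<cdot> d e X"
    note [simp] = HomD[OF u] HomD[OF v]
    have h: "u \<cdot> z \<cdot> s Z0 \<in> Hom E (L Z0) Y" by (simp add: Hom_iff)
    have "\<exists>H\<in>Hom E (L X) Y. H \<cdot> LA z = u \<cdot> z \<cdot> s Z0 \<and> p \<cdot> H = v \<and> (\<forall>e'\<in>{e}. H \<cdot> d e' X = u)"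
    proof (rule boxD[OF box_single[OF p z(1)] zH pH h v])
      show "p \<cdot> (u \<cdot> z \<cdot> s Z0) = v \<cdot> LA z" by (rule L0) (simp_all add: Hom_iff)
    qed (use u sq in auto)
    then show "\<exists>w\<in>Hom E (L X) Y. w \<cdot> d e X = u \<and> p \<cdot> w = v" by blast
  qed
qed

lemma nfE:
  assumes "nf T"
  obtains t where "t \<in> fib" "t \<in> Hom E T (Cod E t)" "T \<in> Obj E" "Cod E t \<in> Obj E" "is_terminal E (Cod E t)"
    "\<And>X f g. f \<in> Hom E X (Cod E t) \<Longrightarrow> g \<in> Hom E X (Cod E t) \<Longrightarrow> f = g"
    "\<And>X. X \<in> Obj E \<Longrightarrow> \<exists>f. f \<in> Hom E X (Cod E t)"
proof -
  obtain t where t: "T \<in> Obj E" "t \<in> fib" "Dom E t = T" "is_terminal E (Cod E t)"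
    using assms unfolding naively_fibrant_def by blast
  have "t \<in> Hom E T (Cod E t)" using fibD(1)[OF t(2)] t(3) by simp
  moreover have "f = g" if "f \<in> Hom E X (Cod E t)" "g \<in> Hom E X (Cod E t)" for X f g
    using t(4) that HomD(4)[OF that(1)] unfolding is_terminal_def by blast
  moreover have "\<exists>f. f \<in> Hom E X (Cod E t)" if "X \<in> Obj E" for X
    using t(4) that unfolding is_terminal_def by blast
  ultimately show ?thesis using that t unfolding is_terminal_def by blast
qed

lemma nf_lift:
  assumes T: "nf T" and l: "l \<in> Lambda E M I" and lH: "l \<in> Hom E A B" and u: "u \<in> Hom E A T"
  shows "\<exists>w\<in>Hom E B T. w \<cdot> l = u"
proof (rule nfE[OF T])
  fix t assume t: "t \<in> fib" "t \<in> Hom E T (Cod E t)"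
    and un: "\<And>X f g. f \<in> Hom E X (Cod E t) \<Longrightarrow> g \<in> Hom E X (Cod E t) \<Longrightarrow> f = g"
    and ex: "\<And>X. X \<in> Obj E \<Longrightarrow> \<exists>f. f \<in> Hom E X (Cod E t)"
  obtain v where v: "v \<in> Hom E B (Cod E t)" using ex[OF HomD(5)[OF lH]] by blast
  have "t \<cdot> u = v \<cdot> l" using un[OF Comp_in_Hom[OF u t(2)] Comp_in_Hom[OF lH v]] .
  from has_liftingD[OF fibD(2)[OF t(1) l] lH t(2) u v this] show ?thesis by blast
qed

lemma nf_box_single:
  assumes T: "nf T" and i: "is_mono E i" and iH: "i \<in> Hom E A B" and h: "h \<in> Hom E (L A) T"
    and v: "v \<in> Hom E B T" and hv: "h \<cdot> d e A = v \<cdot> i"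
  shows "\<exists>H\<in>Hom E (L B) T. H \<cdot> LA i = h \<and> H \<cdot> d e B = v"
proof (rule nfE[OF T])
  fix t assume t: "t \<in> fib" "t \<in> Hom E T (Cod E t)"
    and un: "\<And>X f g. f \<in> Hom E X (Cod E t) \<Longrightarrow> g \<in> Hom E X (Cod E t) \<Longrightarrow> f = g"
    and ex: "\<And>X. X \<in> Obj E \<Longrightarrow> \<exists>f. f \<in> Hom E X (Cod E t)"
  note B = HomD(5)[OF iH]
  obtain z where z: "z \<in> Hom E (L B) (Cod E t)" using ex[OF L_Obj[OF B]] by blast
  have "\<exists>H\<in>Hom E (L B) T. H \<cdot> LA i = h \<and> t \<cdot> H = z \<and> (\<forall>e'\<in>{e}. H \<cdot> d e' B = v)"
  proof (rule boxD[OF box_single[OF t(1) i] iH t(2) h z])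
    show "t \<cdot> h = z \<cdot> LA i" using un[OF Comp_in_Hom[OF h t(2)] Comp_in_Hom[OF LA_Hom[OF iH] z]] .
    show "t \<cdot> v = z \<cdot> d e' B" for e'
      using un[OF Comp_in_Hom[OF v t(2)] Comp_in_Hom[OF d_Hom[OF B] z]] .
  qed (use v hv in auto)
  then show ?thesis by blast
qed

lemma nf_box_both:
  assumes T: "nf T" and i: "i \<in> cof_class E (Lambda E M I)" and iH: "i \<in> Hom E A B" and h: "h \<in> Hom E (L A) T"
    and v: "\<And>e. v e \<in> Hom E B T" and hv: "\<And>e. h \<cdot> d e A = v e \<cdot> i"
  shows "\<exists>H\<in>Hom E (L B) T. H \<cdot> LA i = h \<and> (\<forall>e. H \<cdot> d e B = v e)"
proof (rule nfE[OF T])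
  fix t assume t: "t \<in> fib" "t \<in> Hom E T (Cod E t)"
    and un: "\<And>X f g. f \<in> Hom E X (Cod E t) \<Longrightarrow> g \<in> Hom E X (Cod E t) \<Longrightarrow> f = g"
    and ex: "\<And>X. X \<in> Obj E \<Longrightarrow> \<exists>f. f \<in> Hom E X (Cod E t)"
  note B = HomD(5)[OF iH]
  obtain z where z: "z \<in> Hom E (L B) (Cod E t)" using ex[OF L_Obj[OF B]] by blast
  have "\<exists>H\<in>Hom E (L B) T. H \<cdot> LA i = h \<and> t \<cdot> H = z \<and> (\<forall>e\<in>UNIV. H \<cdot> d e B = v e)"
  proof (rule boxD[OF box_both[OF t(1) i] iH t(2) h z])
    show "t \<cdot> h = z \<cdot> LA i" using un[OF Comp_in_Hom[OF h t(2)] Comp_in_Hom[OF LA_Hom[OF iH] z]] .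
    show "t \<cdot> v e = z \<cdot> d e B" for e
      using un[OF Comp_in_Hom[OF v t(2)] Comp_in_Hom[OF d_Hom[OF B] z]] .
  qed (use v hv in auto)
  then show ?thesis by blast
qed

section \<open>Homotopy of maps into a naively fibrant object\<close>

lemma hrel_iff: "(f, g) \<in> hrel X T \<longleftrightarrow> f \<in> Hom E X T \<and> g \<in> Hom E X T \<and>
    (\<exists>h\<in>Hom E (L X) T. h \<cdot> d False X = f \<and> h \<cdot> d True X = g)"
  unfolding homotopy_rel_def d_def by simp

lemma hrelD: "(f, g) \<in> hrel X T \<Longrightarrow> f \<in> Hom E X T" "(f, g) \<in> hrel X T \<Longrightarrow> g \<in> Hom E X T"
  "(f, g) \<in> hrel X T \<Longrightarrow> \<exists>h\<in>Hom E (L X) T. h \<cdot> d False X = f \<and> h \<cdot> d True X = g"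
  unfolding hrel_iff by auto

lemma hrelI: "h \<in> Hom E (L X) T \<Longrightarrow> X \<in> Obj E \<Longrightarrow> (h \<cdot> d False X, h \<cdot> d True X) \<in> hrel X T"
  unfolding hrel_iff using Comp_in_Hom[OF d_Hom] by blast

lemma hrel_refl: "f \<in> Hom E X T \<Longrightarrow> (f, f) \<in> hrel X T"
proof -
  assume f: "f \<in> Hom E X T"
  note [simp] = HomD[OF f] isimps
  have "f \<cdot> s X \<in> Hom E (L X) T" by (simp add: Hom_iff)
  from hrelI[OF this] show ?thesis by simp
qed

lemma hrel_Comp:
  assumes fg: "(f, g) \<in> hrel X T" and w: "w \<in> Hom E W X"
  shows "(f \<cdot> w, g \<cdot> w) \<in> hrel W T"
proof -
  obtain h where h: "h \<in> Hom E (L X) T" "h \<cdot> d False X = f" "h \<cdot> d True X = g" using hrelD(3)[OF fg] by blast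
  note [simp] = HomD[OF w] HomD[OF h(1)] isimps
  have "h \<cdot> LA w \<in> Hom E (L W) T" by (simp add: Hom_iff)
  from hrelI[OF this] show ?thesis
    using post[OF h(2), of w] post[OF h(3), of w] by simp
qed

text \<open>Fill a box over \<open>q\<close>, the copairing of the ends of \<open>X\<close>: the two
  homotopies stand over the two ends, the constant homotopy at \<open>f\<close> is the bottom, and
  the opposite face joins \<open>g\<close> to \<open>k\<close>. With reflexivity this form gives
  symmetry and transitivity together.\<close>

lemma hrel_euclid:
  assumes T: "nf T" and fg: "(f, g) \<in> hrel X T" and fk: "(f, k) \<in> hrel X T"
  shows "(g, k) \<in> hrel X T"
proof -
  note f = hrelD(1)[OF fg]
  have X: "X \<in> Obj E" using HomD f by blast
  obtain h h' where h: "h \<in> Hom E (L X) T" "h \<cdot> d False X = f" "h \<cdot> d True X = g"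
    and h': "h' \<in> Hom E (L X) T" "h' \<cdot> d False X = f" "h' \<cdot> d True X = k"
    using hrelD(3)[OF fg] hrelD(3)[OF fk] by blast
  show ?thesis
  proof (rule copairing_exists[OF X])
    fix i j q assume ij: "is_coproduct E i j" and i: "i \<in> Hom E X (Cod E i)" and j: "j \<in> Hom E X (Cod E i)"
      and q: "q \<in> Hom E (Cod E i) (L X)" "q \<cdot> i = d False X" "q \<cdot> j = d True X" "is_mono E q"
    define S where "S = Cod E i"
    have i: "i \<in> Hom E X S" and j: "j \<in> Hom E X S" and qH: "q \<in> Hom E S (L X)" using i j q(1) S_def by auto
    note [simp] = HomD[OF i] HomD[OF j] HomD[OF qH] HomD[OF f] HomD[OF h(1)] HomD[OF h'(1)] isimps
    have TO: "T \<in> Obj E" by simp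
    obtain a a' where a: "a \<in> Hom E X (path T)" "ev T \<cdot> LA a = h" and a': "a' \<in> Hom E X (path T)" "ev T \<cdot> LA a' = h'"
      using tr_exists[OF X] h(1) h'(1) by blast
    obtain b where b: "b \<in> Hom E S (path T)" "b \<cdot> i = a" "b \<cdot> j = a'"
      using coproductE[OF ij, of a "path T" a'] a(1) a'(1) by auto
    note evH = path_ev(1,2)[OF TO]
    note [simp] = HomD[OF evH(2)] evH(1) HomD[OF b(1)] HomD[OF a(1)] HomD[OF a'(1)]
    \<comment> \<open>The two homotopies are combined over the cylinder of the coproduct; gluing
      their transposes into \<open>path T\<close> replaces an appeal to preservation of coproducts
      by \<open>L\<close>.\<close>
    define w where "w = ev T \<cdot> LA b"
    have w: "w \<in> Hom E (L S) T" unfolding w_def by (simp add: Hom_iff)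
    have wi: "w \<cdot> LA i = h" "w \<cdot> LA j = h'"
      unfolding w_def using arg_cong[OF b(2), of LA] arg_cong[OF b(3), of LA] a(2) a'(2) by simp_all
    note [simp] = HomD[OF w]
    have fs: "f \<cdot> s X \<in> Hom E (L X) T" by (simp add: Hom_iff)
    have "w \<cdot> d False S = f \<cdot> s X \<cdot> q"
    proof (rule coproduct_epi[OF ij, folded S_def])
      show "w \<cdot> d False S \<in> Hom E S T" "f \<cdot> s X \<cdot> q \<in> Hom E S T" by (simp_all add: Hom_iff)
      show "w \<cdot> d False S \<cdot> i = f \<cdot> s X \<cdot> q \<cdot> i" "w \<cdot> d False S \<cdot> j = f \<cdot> s X \<cdot> q \<cdot> j"
        using post[OF wi(1), of "d False X"] post[OF wi(2), of "d False X"] h(2) h'(2) q(2,3) by simp_all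
    qed
    from nf_box_single[OF T q(4) qH w fs this]
    obtain H where H: "H \<in> Hom E (L (L X)) T" "H \<cdot> LA q = w" "H \<cdot> d False (L X) = f \<cdot> s X" by blast
    note [simp] = HomD[OF H(1)]
    have r: "H \<cdot> d True (L X) \<in> Hom E (L X) T" by (simp add: Hom_iff)
    have "(H \<cdot> d True (L X)) \<cdot> d False X = g"
    proof -
      have "(H \<cdot> d True (L X)) \<cdot> d False X = H \<cdot> d True (L X) \<cdot> (q \<cdot> i)" using q(2) by simp
      also have "\<dots> = w \<cdot> (LA i \<cdot> d True X)" using post[OF H(2), of "LA i \<cdot> d True X"] by simp
      also have "\<dots> = g" using post[OF wi(1), of "d True X"] h(3) by simp
      finally show ?thesis .
    qed
    moreover have "(H \<cdot> d True (L X)) \<cdot> d True X = k"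
    proof -
      have "(H \<cdot> d True (L X)) \<cdot> d True X = H \<cdot> d True (L X) \<cdot> (q \<cdot> j)" using q(3) by simp
      also have "\<dots> = w \<cdot> (LA j \<cdot> d True X)" using post[OF H(2), of "LA j \<cdot> d True X"] by simp
      also have "\<dots> = k" using post[OF wi(2), of "d True X"] h'(3) by simp
      finally show ?thesis .
    qed
    ultimately show ?thesis using hrelI[OF r X] by simp
  qed
qed

lemma hrel_sym: "nf T \<Longrightarrow> (f, g) \<in> hrel X T \<Longrightarrow> (g, f) \<in> hrel X T"
  using hrel_euclid hrel_refl hrelD(1) by blast

lemma hrel_trans: "nf T \<Longrightarrow> (f, g) \<in> hrel X T \<Longrightarrow> (g, k) \<in> hrel X T \<Longrightarrow> (f, k) \<in> hrel X T"
  using hrel_euclid hrel_sym by blast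

lemma hrel_equiv:
  assumes "nf T" shows "equiv (Hom E X T) (hrel X T)"
proof (rule equivI)
  show "hrel X T \<subseteq> Hom E X T \<times> Hom E X T" using hrelD by auto
  show "refl_on (Hom E X T) (hrel X T)" using hrel_refl by (auto simp: refl_on_def)
  show "sym (hrel X T)" using hrel_sym[OF assms] by (auto simp: sym_def)
  show "trans (hrel X T)" using hrel_trans[OF assms] by (auto simp: trans_def)
qed

text \<open>\<open>d_cof\<close> allows a box with both ends over the mono \<open>d e X\<close>: the
  given homotopy is its side, and \<open>f\<close> and \<open>g\<close> are its ends. The filler is
  a homotopy between \<open>f\<close> and \<open>g\<close>.\<close>

lemma d_injective:
  assumes T: "nf T" and X: "X \<in> Obj E" and f: "f \<in> Hom E (L X) T" and g: "g \<in> Hom E (L X) T"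
    and eq: "(f \<cdot> d e X, g \<cdot> d e X) \<in> hrel X T"
  shows "(f, g) \<in> hrel (L X) T"
proof -
  obtain h where h: "h \<in> Hom E (L X) T" "h \<cdot> d False X = f \<cdot> d e X" "h \<cdot> d True X = g \<cdot> d e X"
    using hrelD(3)[OF eq] by blast
  have v: "(if e' then g else f) \<in> Hom E (L X) T" for e' using f g by simp
  have "h \<cdot> d e' X = (if e' then g else f) \<cdot> d e X" for e' using h by (cases e') simp_all
  from nf_box_both[where v = "\<lambda>e'. if e' then g else f", OF T d_cof[OF X] d_Hom[OF X] h(1) v this]
  obtain H where H: "H \<in> Hom E (L (L X)) T" "\<And>e'. H \<cdot> d e' (L X) = (if e' then g else f)"
    by blast
  from hrelI[OF H(1) L_Obj[OF X]] show ?thesis unfolding H(2) by simp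
qed

lemma weak_equivalence_quot:
  assumes \<phi>: "\<phi> \<in> weak_equivalences E M I" and \<phi>H: "\<phi> \<in> Hom E X Y" and T: "nf T"
  shows "a \<in> Hom E X T \<Longrightarrow> \<exists>b\<in>Hom E Y T. (b \<cdot> \<phi>, a) \<in> hrel X T"
    and "b \<in> Hom E Y T \<Longrightarrow> b' \<in> Hom E Y T \<Longrightarrow> (b \<cdot> \<phi>, b' \<cdot> \<phi>) \<in> hrel X T \<Longrightarrow> (b, b') \<in> hrel Y T"
proof -
  have D: "Dom E \<phi> = X" "Cod E \<phi> = Y" using \<phi>H by (auto simp: Hom_def)
  have bij: "bij_betw (precomp_classes E I \<phi> T) (Hom E Y T // hrel Y T) (Hom E X T // hrel X T)"
    using \<phi> T D unfolding weak_equivalences_def homotopy_classes_def by auto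
  note eX = hrel_equiv[OF T, of X] and eY = hrel_equiv[OF T, of Y]
  have pre: "precomp_classes E I \<phi> T (hrel Y T `` {b}) = hrel X T `` {b \<cdot> \<phi>}" if b: "b \<in> Hom E Y T" for b
  proof
    show "precomp_classes E I \<phi> T (hrel Y T `` {b}) \<subseteq> hrel X T `` {b \<cdot> \<phi>}"
      unfolding precomp_classes_def D
      using hrel_Comp[OF _ \<phi>H] hrel_trans[OF T] by blast
    have "b \<in> hrel Y T `` {b}" using hrel_refl[OF b] by blast
    then show "hrel X T `` {b \<cdot> \<phi>} \<subseteq> precomp_classes E I \<phi> T (hrel Y T `` {b})"
      unfolding precomp_classes_def D by blast
  qed
  show "\<exists>b\<in>Hom E Y T. (b \<cdot> \<phi>, a) \<in> hrel X T" if a: "a \<in> Hom E X T"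
  proof -
    have "hrel X T `` {a} \<in> Hom E X T // hrel X T" using a by (rule quotientI)
    then obtain c where c: "c \<in> Hom E Y T // hrel Y T" "precomp_classes E I \<phi> T c = hrel X T `` {a}"
      using bij unfolding bij_betw_def by (metis imageE)
    obtain b where b: "b \<in> Hom E Y T" "c = hrel Y T `` {b}" using c(1) by (rule quotientE)
    have "hrel X T `` {b \<cdot> \<phi>} = hrel X T `` {a}" using pre[OF b(1)] c(2) b(2) by simp
    then have "(b \<cdot> \<phi>, a) \<in> hrel X T" using eq_equiv_class[OF _ eX] a by blast
    then show ?thesis using b(1) by blast
  qed
  assume b: "b \<in> Hom E Y T" "b' \<in> Hom E Y T" and e: "(b \<cdot> \<phi>, b' \<cdot> \<phi>) \<in> hrel X T"
  have "hrel X T `` {b \<cdot> \<phi>} = hrel X T `` {b' \<cdot> \<phi>}" using equiv_class_eq[OF eX e] .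
  then have "precomp_classes E I \<phi> T (hrel Y T `` {b}) = precomp_classes E I \<phi> T (hrel Y T `` {b'})"
    using pre b by simp
  then have "hrel Y T `` {b} = hrel Y T `` {b'}"
    using bij quotientI[OF b(1), of "hrel Y T"] quotientI[OF b(2), of "hrel Y T"]
    unfolding bij_betw_def by (meson inj_onD)
  then show "(b, b') \<in> hrel Y T" using eq_equiv_class[OF _ eY] b(2) by blast
qed

section \<open>Monos lifting against fibrations with naively fibrant codomain\<close>

text \<open>
  The retraction turns any homotopy between the two maps into one that is constant on \<open>A\<close>:
  its restriction to \<open>A\<close> is a loop, and that loop is cancelled along its own pullback by \<open>r\<close>.
\<close>

lemma relative_homotopy:
  assumes T: "nf T" and l: "is_mono E l" and lH: "l \<in> Hom E A B" and rH: "r \<in> Hom E B A" and rl: "r \<cdot> l = Ide E A"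
    and inj: "\<And>f g. f \<in> Hom E B T \<Longrightarrow> g \<in> Hom E B T \<Longrightarrow> f \<cdot> l = g \<cdot> l \<Longrightarrow> (f, g) \<in> hrel B T"
    and f: "f \<in> Hom E B T"
  shows "\<exists>K\<in>Hom E (L B) T. K \<cdot> d False B = f \<cdot> (l \<cdot> r) \<and> K \<cdot> d True B = f \<and> K \<cdot> LA l = f \<cdot> (l \<cdot> s A)"
proof -
  note [simp] = HomD[OF lH] HomD[OF rH] HomD[OF f] isimps
  have rl': "r \<cdot> (l \<cdot> x) = x" if "x \<in> Arr E" "Cod E x = A" for x using post[OF rl, of x] that by simp
  have LArl: "LA r \<cdot> LA l = Ide E (L A)" using arg_cong[OF rl, of LA] by simp
  note [simp] = rl rl'
  have TO: "T \<in> Obj E" and B: "B \<in> Obj E" and A: "A \<in> Obj E" by auto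
  have "f \<cdot> (l \<cdot> r) \<in> Hom E B T" by (simp add: Hom_iff)
  \<comment> \<open>Both maps agree after \<open>l\<close> because \<open>r \<cdot> l\<close> is the
    identity. Over \<open>A\<close> the homotopy \<open>c\<close> is therefore a loop at
    \<open>f \<cdot> l\<close>, in general not a constant one.\<close>
  from inj[OF this f] obtain c where c: "c \<in> Hom E (L B) T" "c \<cdot> d False B = f \<cdot> (l \<cdot> r)" "c \<cdot> d True B = f"
    unfolding hrel_iff by auto
  note [simp] = HomD[OF c(1)]
  have cA: "c \<cdot> (LA l \<cdot> d e A) = f \<cdot> l" for e
    using post[OF c(2), of l] post[OF c(3), of l] by (cases e) simp_all
  obtain k u where k: "is_copairing E (bd I 0 B) (bd I 1 B) k" and u: "is_union E (LA l) k u"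
    using sat_union_exists[OF l lH] by blast
  show ?thesis
  proof (rule sat_union[OF l lH k u])
    fix W j and g :: "bool \<Rightarrow> 'a"
    assume W: "u \<in> Hom E W (L B)" "is_mono E u" and j: "j \<in> Hom E (L A) W" "u \<cdot> j = LA l"
      and g: "\<And>e. g e \<in> Hom E B W" "\<And>e. u \<cdot> g e = d e B"
      and glue: "\<And>T a b. a \<in> Hom E (L A) T \<Longrightarrow> (\<And>e. b e \<in> Hom E B T) \<Longrightarrow> (\<And>e. a \<cdot> d e A = b e \<cdot> l) \<Longrightarrow>
         \<exists>w\<in>Hom E W T. w \<cdot> j = a \<and> (\<forall>e. w \<cdot> g e = b e)"
      and epi: "\<And>T w w'. w \<in> Hom E W T \<Longrightarrow> w' \<in> Hom E W T \<Longrightarrow> w \<cdot> j = w' \<cdot> j \<Longrightarrow>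
         (\<And>e. w \<cdot> g e = w' \<cdot> g e) \<Longrightarrow> w = w'"
    note [simp] = HomD[OF W(1)] HomD[OF j(1)] HomD[OF g(1)]
    note evH = path_ev(1,2)[OF TO]
    note [simp] = HomD[OF evH(2)] evH(1)
    \<comment> \<open>The sides of a box over the boundary \<open>W\<close> of \<open>L B\<close>:
      above the end \<open>True\<close> the homotopy \<open>c\<close>, above the end
      \<open>False\<close> the loop pulled back by \<open>r\<close>, and above \<open>L A\<close>
      the loop itself, constant in the direction of that cylinder. They agree over \<open>A\<close>
      since \<open>r\<close> retracts onto it.\<close>
    have h0: "c \<cdot> (LA l \<cdot> LA (s A)) \<in> Hom E (L (L A)) T" and h1: "c \<cdot> (LA l \<cdot> LA r) \<in> Hom E (L B) T"
      by (simp_all add: Hom_iff)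
    obtain a where a: "a \<in> Hom E (L A) (path T)" "ev T \<cdot> LA a = c \<cdot> (LA l \<cdot> LA (s A))"
      using tr_exists[OF L_Obj[OF A] h0] by blast
    obtain b0 where b0: "b0 \<in> Hom E B (path T)" "ev T \<cdot> LA b0 = c \<cdot> (LA l \<cdot> LA r)"
      using tr_exists[OF B h1] by blast
    obtain b1 where b1: "b1 \<in> Hom E B (path T)" "ev T \<cdot> LA b1 = c" using tr_exists[OF B c(1)] by blast
    note [simp] = HomD[OF a(1)] HomD[OF b0(1)] HomD[OF b1(1)]
    define b where "b e = (if e then b1 else b0)" for e
    have bH: "b e \<in> Hom E B (path T)" for e using b0(1) b1(1) by (simp add: b_def)
    note [simp] = HomD[OF bH]
    have bl: "ev T \<cdot> LA (b e) = (if e then c else c \<cdot> (LA l \<cdot> LA r))" for e using b0(2) b1(2) by (simp add: b_def)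
    have "a \<cdot> d e A = b e \<cdot> l" for e
    proof (rule ev_cancel[OF _ _ TO])
      show "a \<cdot> d e A \<in> Hom E A (path T)" "b e \<cdot> l \<in> Hom E A (path T)" by (simp_all add: Hom_iff)
      show "ev T \<cdot> LA (a \<cdot> d e A) = ev T \<cdot> LA (b e \<cdot> l)"
        using post[OF a(2), of "LA (d e A)"] post[OF bl[of e], of "LA l"] LArl by (cases e) simp_all
    qed
    from glue[OF a(1) bH this] obtain w where w: "w \<in> Hom E W (path T)" "w \<cdot> j = a" "\<And>e. w \<cdot> g e = b e" by blast
    note [simp] = HomD[OF w(1)]
    define h where "h = ev T \<cdot> LA w"
    have h: "h \<in> Hom E (L W) T" unfolding h_def by (simp add: Hom_iff)
    note [simp] = HomD[OF h]
    have hj: "h \<cdot> LA j = c \<cdot> (LA l \<cdot> LA (s A))"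
      unfolding h_def using arg_cong[OF w(2), of LA] a(2) by simp
    have hg: "h \<cdot> LA (g e) = (if e then c else c \<cdot> (LA l \<cdot> LA r))" for e
      unfolding h_def using arg_cong[OF w(3), of LA e] bl[of e] by simp
    have v: "f \<cdot> (l \<cdot> (r \<cdot> s B)) \<in> Hom E (L B) T" by (simp add: Hom_iff)
    \<comment> \<open>At their starting face all sides are given by
      \<open>f \<cdot> (l \<cdot> r)\<close>, so the bottom of the box can be the constant homotopy
      there.\<close>
    have "h \<cdot> d False W = f \<cdot> (l \<cdot> (r \<cdot> s B)) \<cdot> u"
    proof (rule epi)
      show "h \<cdot> d False W \<in> Hom E W T" "f \<cdot> (l \<cdot> (r \<cdot> s B)) \<cdot> u \<in> Hom E W T" by (simp_all add: Hom_iff)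
      have "h \<cdot> d False W \<cdot> j = c \<cdot> (LA l \<cdot> LA (s A)) \<cdot> d False (L A)"
        using post[OF hj, of "d False (L A)"] by simp
      also have "\<dots> = c \<cdot> (LA l \<cdot> d False A) \<cdot> s A" using d_nat[of "s A" A False] by simp
      also have "\<dots> = f \<cdot> (l \<cdot> s A)" using post[OF cA[of False], of "s A"] by simp
      also have "\<dots> = f \<cdot> (l \<cdot> (r \<cdot> s B)) \<cdot> u \<cdot> j" using j(2) by simp
      finally show "h \<cdot> d False W \<cdot> j = f \<cdot> (l \<cdot> (r \<cdot> s B)) \<cdot> u \<cdot> j" .
      fix e
      have "h \<cdot> d False W \<cdot> g e = (h \<cdot> LA (g e)) \<cdot> d False B" by simp
      also have "\<dots> = f \<cdot> (l \<cdot> r)"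
      proof (cases e)
        case True then show ?thesis using hg[of e] c(2) by simp
      next
        case False
        have "(c \<cdot> (LA l \<cdot> LA r)) \<cdot> d False B = c \<cdot> (LA l \<cdot> d False A) \<cdot> r" by simp
        then show ?thesis using False hg[of e] post[OF cA[of False], of r] by simp
      qed
      also have "\<dots> = f \<cdot> (l \<cdot> (r \<cdot> s B)) \<cdot> u \<cdot> g e" using g(2)[of e] by simp
      finally show "h \<cdot> d False W \<cdot> g e = f \<cdot> (l \<cdot> (r \<cdot> s B)) \<cdot> u \<cdot> g e" .
    qed
    from nf_box_single[OF T W(2,1) h v this]
    obtain H where H: "H \<in> Hom E (L (L B)) T" "H \<cdot> LA u = h" by blast
    note [simp] = HomD[OF H(1)]
    \<comment> \<open>The opposite face. Over \<open>A\<close> the sides end at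
      \<open>f \<cdot> l\<close> independently of the cylinder coordinate, so this homotopy is
      constant on \<open>A\<close>.\<close>
    define K where "K = H \<cdot> d True (L B)"
    have K: "K \<in> Hom E (L B) T" unfolding K_def by (simp add: Hom_iff)
    have Kx: "K \<cdot> (u \<cdot> x) = h \<cdot> (LA x \<cdot> d True (Dom E x))" if "x \<in> Arr E" "Cod E x = W" for x
      unfolding K_def using that post[OF H(2), of "LA x \<cdot> d True (Dom E x)"] by simp
    have Kd: "K \<cdot> d e B = (if e then f else f \<cdot> (l \<cdot> r))" for e
    proof -
      have "K \<cdot> d e B = h \<cdot> (LA (g e) \<cdot> d True B)" using Kx[of "g e"] g(2)[of e] by simp
      also have "\<dots> = (if e then c else c \<cdot> (LA l \<cdot> LA r)) \<cdot> d True B"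
        using post[OF hg[of e], of "d True B"] by simp
      also have "\<dots> = (if e then f else f \<cdot> (l \<cdot> r))"
      proof (cases e)
        case True then show ?thesis using c(3) by simp
      next
        case False
        have "(c \<cdot> (LA l \<cdot> LA r)) \<cdot> d True B = c \<cdot> (LA l \<cdot> d True A) \<cdot> r" by simp
        then show ?thesis using False post[OF cA[of True], of r] by simp
      qed
      finally show ?thesis .
    qed
    have "K \<cdot> LA l = h \<cdot> (LA j \<cdot> d True (L A))" using Kx[of j] j(2) by simp
    also have "\<dots> = c \<cdot> (LA l \<cdot> LA (s A)) \<cdot> d True (L A)" using post[OF hj, of "d True (L A)"] by simp
    also have "\<dots> = c \<cdot> (LA l \<cdot> d True A) \<cdot> s A" using d_nat[of "s A" A True] by simp
    also have "\<dots> = f \<cdot> (l \<cdot> s A)" using post[OF cA[of True], of "s A"] by simp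
    finally show ?thesis using K Kd[of True] Kd[of False] by auto
  qed
qed

definition nfib :: "'a set" where
  "nfib = {p \<in> fib. nf (Cod E p)}"

text \<open>A stand-in for the trivial cofibrations. Pushouts and composites stay inside because
  membership is a lifting property.\<close>

definition nfcof :: "'a set" where
  "nfcof = {i. is_mono E i \<and> (\<forall>p\<in>nfib. has_lifting E i p)}"

lemma nfibD: "p \<in> nfib \<Longrightarrow> p \<in> fib" "p \<in> nfib \<Longrightarrow> nf (Cod E p)" "p \<in> nfib \<Longrightarrow> p \<in> Hom E (Dom E p) (Cod E p)"
  unfolding nfib_def using fibD(1) by auto

lemma nfcof_lift:
  assumes "i \<in> nfcof" "p \<in> nfib" "i \<in> Hom E A B" "p \<in> Hom E Y Z" "u \<in> Hom E A Y" "v \<in> Hom E B Z" "p \<cdot> u = v \<cdot> i"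
  shows "\<exists>w\<in>Hom E B Y. w \<cdot> i = u \<and> p \<cdot> w = v"
  using assms has_liftingD[OF _ assms(3-7)] unfolding nfcof_def by blast

lemma nfcofI:
  assumes i: "is_mono E i" "i \<in> Hom E A B"
    and lift: "\<And>p Y Z u v. p \<in> nfib \<Longrightarrow> p \<in> Hom E Y Z \<Longrightarrow> u \<in> Hom E A Y \<Longrightarrow> v \<in> Hom E B Z \<Longrightarrow> p \<cdot> u = v \<cdot> i \<Longrightarrow>
      \<exists>w\<in>Hom E B Y. w \<cdot> i = u \<and> p \<cdot> w = v"
  shows "i \<in> nfcof"
  unfolding nfcof_def using i has_liftingI[OF i(2) nfibD(3)] lift nfibD(3) by blast

text \<open>The map \<open>u \<cdot> r\<close> solves the lifting problem with
  \<open>z \<cdot> (l \<cdot> r)\<close> in place of \<open>z\<close>. The homotopy \<open>K\<close>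
  from that map to \<open>z\<close> is constant on \<open>A\<close>; lifting it through
  \<open>p\<close> with the start at \<open>u \<cdot> r\<close> and constant on \<open>A\<close>
  ends at a solution for \<open>z\<close>.\<close>

lemma retract_nfcof:
  assumes l: "is_mono E l" and lH: "l \<in> Hom E A B" and rH: "r \<in> Hom E B A" and rl: "r \<cdot> l = Ide E A"
    and inj: "\<And>T f g. nf T \<Longrightarrow> f \<in> Hom E B T \<Longrightarrow> g \<in> Hom E B T \<Longrightarrow> f \<cdot> l = g \<cdot> l \<Longrightarrow> (f, g) \<in> hrel B T"
  shows "l \<in> nfcof"
proof (rule nfcofI[OF l lH])
  fix p Y Z u z assume p: "p \<in> nfib" and pH: "p \<in> Hom E Y Z" and u: "u \<in> Hom E A Y" and z: "z \<in> Hom E B Z"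
    and sq: "p \<cdot> u = z \<cdot> l"
  note [simp] = HomD[OF lH] HomD[OF rH] HomD[OF pH] HomD[OF u] HomD[OF z] isimps
  have Z: "nf Z" using nfibD(2)[OF p] by simp
  obtain K where K: "K \<in> Hom E (L B) Z" "K \<cdot> d False B = z \<cdot> (l \<cdot> r)" "K \<cdot> d True B = z" "K \<cdot> LA l = z \<cdot> (l \<cdot> s A)"
    using relative_homotopy[OF Z l lH rH rl inj[OF Z] z] by blast
  note [simp] = HomD[OF K(1)]
  have h: "u \<cdot> s A \<in> Hom E (L A) Y" and v: "u \<cdot> r \<in> Hom E B Y" by (simp_all add: Hom_iff)
  have "\<exists>H\<in>Hom E (L B) Y. H \<cdot> LA l = u \<cdot> s A \<and> p \<cdot> H = K \<and> (\<forall>e\<in>{False}. H \<cdot> d e B = u \<cdot> r)"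
  proof (rule boxD[OF box_single[OF nfibD(1)[OF p] l] lH pH h K(1)])
    fix e assume e: "e \<in> {False}"
    show "u \<cdot> r \<in> Hom E B Y" by fact
    show "u \<cdot> s A \<cdot> d e A = u \<cdot> r \<cdot> l" using rl by simp
    show "p \<cdot> (u \<cdot> r) = K \<cdot> d e B" using e K(2) post[OF sq, of r] by simp
  next
    show "p \<cdot> (u \<cdot> s A) = K \<cdot> LA l" using K(4) post[OF sq, of "s A"] by simp
  qed
  then obtain H where H: "H \<in> Hom E (L B) Y" "H \<cdot> LA l = u \<cdot> s A" "p \<cdot> H = K" by blast
  note [simp] = HomD[OF H(1)]
  have "H \<cdot> d True B \<in> Hom E B Y" by (simp add: Hom_iff)
  moreover have "H \<cdot> d True B \<cdot> l = u" using post[OF H(2), of "d True A"] by simp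
  moreover have "p \<cdot> (H \<cdot> d True B) = z" using post[OF H(3), of "d True B"] K(3) by simp
  ultimately show "\<exists>w\<in>Hom E B Y. w \<cdot> l = u \<and> p \<cdot> w = z" by blast
qed

lemma nfcof_Comp:
  assumes j: "j \<in> nfcof" "j \<in> Hom E A X" and i: "i \<in> nfcof" "i \<in> Hom E X B"
  shows "i \<cdot> j \<in> nfcof"
proof (rule nfcofI)
  note [simp] = HomD[OF j(2)] HomD[OF i(2)] cat_simps
  show "is_mono E (i \<cdot> j)" using mono_Comp[of j i] i(1) j(1) unfolding nfcof_def by simp
  show "i \<cdot> j \<in> Hom E A B" by (simp add: Hom_iff)
  fix p Y Z u v assume p: "p \<in> nfib" and pH: "p \<in> Hom E Y Z" and u: "u \<in> Hom E A Y" and v: "v \<in> Hom E B Z"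
    and sq: "p \<cdot> u = v \<cdot> (i \<cdot> j)"
  note [simp] = HomD[OF pH] HomD[OF u] HomD[OF v]
  have "v \<cdot> i \<in> Hom E X Z" "p \<cdot> u = v \<cdot> i \<cdot> j" using sq by (simp_all add: Hom_iff)
  from nfcof_lift[OF j(1) p j(2) pH u this] obtain w where w: "w \<in> Hom E X Y" "w \<cdot> j = u" "p \<cdot> w = v \<cdot> i" by blast
  from nfcof_lift[OF i(1) p i(2) pH w(1) v w(3)] obtain w' where w': "w' \<in> Hom E B Y" "w' \<cdot> i = w" "p \<cdot> w' = v" by blast
  note [simp] = HomD[OF w'(1)]
  have "w' \<cdot> (i \<cdot> j) = u" using post[OF w'(2), of j] w(2) by simp
  then show "\<exists>w\<in>Hom E B Y. w \<cdot> (i \<cdot> j) = u \<and> p \<cdot> w = v" using w' by blast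
qed

text \<open>The fibration dual to \<open>sat\<close> stays in the class, so cofibrations in \<open>nfcof\<close> also lift boxes.\<close>

lemma nfcof_box_both:
  assumes j: "j \<in> nfcof" and p: "p \<in> nfib"
  shows "box UNIV j p"
proof -
  note pH = nfibD(3)[OF p]
  have jA: "j \<in> Arr E" using j mono_Arr unfolding nfcof_def by blast
  obtain Q a b where lim: "box_limit UNIV p Q a b" using box_limit_both[OF pH] by blast
  obtain q where q: "q \<in> Hom E (path (Dom E p)) Q" and rep: "\<forall>i\<in>Arr E. box UNIV i p \<longleftrightarrow> has_lifting E i q"
    using box_rep[OF pH lim] by blast
  define Y Z where "Y = Dom E p" and "Z = Cod E p"
  have pH: "p \<in> Hom E Y Z" using pH by (simp add: Y_def Z_def)
  note [simp] = HomD[OF pH] isimps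
  have ZO: "Z \<in> Obj E" by simp
  note lim' = lim[unfolded box_limit_def HomD(2,3)[OF pH]]
  note aH = conjunct1[OF lim'] and b0 = conjunct1[OF conjunct2[OF lim']]
    and ex0 = conjunct1[OF conjunct2[OF conjunct2[OF lim']]]
    and uni0 = conjunct2[OF conjunct2[OF conjunct2[OF lim']]]
  let ?\<pi> = "\<lambda>e. ev Z \<cdot> d e (path Z)"
  have bH: "b e \<in> Hom E Q Y" and ab: "?\<pi> e \<cdot> a = p \<cdot> b e" for e using b0 by blast+
  note evH = path_ev(1,2)[OF ZO]
  note [simp] = HomD[OF evH(2)] evH(1) HomD[OF aH] HomD[OF bH]
  have Z: "nf Z" using nfibD(2)[OF p] by simp
  have qfib: "q \<in> fib"
    unfolding inj_class_def
  proof (intro CollectI conjI ballI)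
    show "q \<in> Arr E" using HomD(1)[OF q] .
    fix l assume l: "l \<in> Lambda E M I"
    then have "l \<in> cof_class E (Lambda E M I)"
      using mono_Arr[OF Lambda_mono[OF l]] fibD(2) unfolding cof_class_def by blast
    then show "has_lifting E l q" using box_both[OF nfibD(1)[OF p]] rep mono_Arr[OF Lambda_mono[OF l]] by blast
  qed
  \<comment> \<open>Naive fibrancy of \<open>Z\<close> and the fibration \<open>p\<close> pass to
    the object of paths in \<open>Z\<close> with lifted ends.\<close>
  have "nf Q"
  proof (rule nfE[OF Z])
    fix t assume t: "is_terminal E (Cod E t)" "t \<in> Hom E Z (Cod E t)"
      and un: "\<And>X f g. f \<in> Hom E X (Cod E t) \<Longrightarrow> g \<in> Hom E X (Cod E t) \<Longrightarrow> f = g"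
      and ex: "\<And>X. X \<in> Obj E \<Longrightarrow> \<exists>f. f \<in> Hom E X (Cod E t)"
    have Q: "Q \<in> Obj E" by simp
    obtain t' where t': "t' \<in> Hom E Q (Cod E t)" using ex[OF Q] by blast
    have "t' \<in> fib"
      unfolding inj_class_def
    proof (intro CollectI conjI ballI)
      show "t' \<in> Arr E" using HomD(1)[OF t'] .
      fix l assume l: "l \<in> Lambda E M I"
      define A B where "A = Dom E l" and "B = Cod E l"
      have lH: "l \<in> Hom E A B" using mono_Arr[OF Lambda_mono[OF l]] by (simp add: A_def B_def Hom_def)
      note [simp] = HomD[OF lH]
      have lc: "l \<in> cof_class E (Lambda E M I)" using l fibD(2) unfolding cof_class_def by auto
      show "has_lifting E l t'"
      proof (rule has_liftingI[OF lH t'])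
        fix x v assume x: "x \<in> Hom E A Q" and v: "v \<in> Hom E B (Cod E t)"
        note [simp] = HomD[OF x]
        \<comment> \<open>The ends are extended before the path: extend in \<open>Z\<close> by
          fibrancy, then lift the extension through \<open>p\<close>. The path follows by filling a
          box in \<open>Z\<close> between the ends found.\<close>
        have "\<exists>y\<in>Hom E B Y. y \<cdot> l = b e \<cdot> x" for e
        proof -
          have "b e \<cdot> x \<in> Hom E A Y" "p \<cdot> (b e \<cdot> x) \<in> Hom E A Z" by (simp_all add: Hom_iff)
          moreover from nf_lift[OF Z l lH this(2)] obtain z where z: "z \<in> Hom E B Z" "z \<cdot> l = p \<cdot> (b e \<cdot> x)" by blast
          ultimately show ?thesis
            using has_liftingD[OF fibD(2)[OF nfibD(1)[OF p] l] lH pH _ z(1)] z(2) by auto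
        qed
        then obtain y where y: "\<And>e. y e \<in> Hom E B Y" "\<And>e. y e \<cdot> l = b e \<cdot> x" by metis
        note [simp] = HomD[OF y(1)]
        have h: "ev Z \<cdot> LA (a \<cdot> x) \<in> Hom E (L A) Z" by (simp add: Hom_iff)
        have py: "p \<cdot> y e \<in> Hom E B Z" for e by (simp add: Hom_iff)
        have "ev Z \<cdot> LA (a \<cdot> x) \<cdot> d e A = p \<cdot> y e \<cdot> l" for e
          using post[OF ab[of e], of x] y(2)[of e] by simp
        from nf_box_both[OF Z lc lH h py this]
        obtain H where H: "H \<in> Hom E (L B) Z" "H \<cdot> LA l = ev Z \<cdot> LA (a \<cdot> x)" "\<And>e. H \<cdot> d e B = p \<cdot> y e" by blast
        obtain z where z: "z \<in> Hom E B (path Z)" "ev Z \<cdot> LA z = H" using tr_exists[OF _ H(1)] by auto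
        note [simp] = HomD[OF z(1)] HomD(1-3)[OF H(1)]
        have "?\<pi> e \<cdot> z = p \<cdot> y e" for e using post[OF z(2), of "d e B"] H(3)[of e] by simp
        then obtain w where w: "w \<in> Hom E B Q" "a \<cdot> w = z" "\<And>e. b e \<cdot> w = y e"
          using ex0[rule_format, OF z(1), of y] y(1) by auto
        note [simp] = HomD[OF w(1)]
        have "w \<cdot> l = x"
        proof (rule uni0[rule_format])
          show "w \<cdot> l \<in> Hom E A Q" by (simp add: Hom_iff)
          show "x \<in> Hom E A Q" by fact
          show "b e \<cdot> (w \<cdot> l) = b e \<cdot> x" for e using post[OF w(3)[of e], of l] y(2)[of e] by simp
          show "a \<cdot> (w \<cdot> l) = a \<cdot> x"
          proof (rule ev_cancel[OF _ _ ZO])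
            show "a \<cdot> (w \<cdot> l) \<in> Hom E A (path Z)" "a \<cdot> x \<in> Hom E A (path Z)" by (simp_all add: Hom_iff)
            show "ev Z \<cdot> LA (a \<cdot> (w \<cdot> l)) = ev Z \<cdot> LA (a \<cdot> x)"
              using post[OF w(2), of l] post[OF z(2), of "LA l"] H(2) by simp
          qed
        qed
        moreover have "t' \<cdot> w = v" using un[OF Comp_in_Hom[OF w(1) t'] v] .
        ultimately show "\<exists>w\<in>Hom E B Q. w \<cdot> l = x \<and> t' \<cdot> w = v" using w(1) by blast
      qed
    qed
    then show "nf Q" unfolding naively_fibrant_def using Q t(1) HomD(2,3)[OF t'] by auto
  qed
  then have "q \<in> nfib" unfolding nfib_def using qfib HomD(3)[OF q] by simp
  then show ?thesis using rep jA j unfolding nfcof_def by blast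
qed

text \<open>The lift \<open>w\<close> for \<open>u \<cdot> j\<close> agrees with
  \<open>\<phi>\<close> on \<open>A\<close> only. Box lifting along \<open>j\<close> produces a
  homotopy over \<open>Z\<close>, relative to \<open>A\<close>, from \<open>w \<cdot> u\<close> to
  \<open>\<phi>\<close>; extending it along \<open>u\<close> from \<open>w\<close> and taking the
  other end corrects \<open>w\<close> on all of \<open>X\<close>.\<close>

lemma nfcof_cancel:
  assumes j: "j \<in> nfcof" "j \<in> Hom E A X" and u: "is_mono E u" "u \<in> Hom E X B" and uj: "u \<cdot> j \<in> nfcof"
  shows "u \<in> nfcof"
proof (rule nfcofI[OF u])
  fix p Y Z \<phi> z assume p: "p \<in> nfib" and pH: "p \<in> Hom E Y Z" and \<phi>: "\<phi> \<in> Hom E X Y" and z: "z \<in> Hom E B Z"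
    and sq: "p \<cdot> \<phi> = z \<cdot> u"
  note [simp] = HomD[OF j(2)] HomD[OF u(2)] HomD[OF pH] HomD[OF \<phi>] HomD[OF z] isimps
  have ujH: "u \<cdot> j \<in> Hom E A B" and \<phi>j: "\<phi> \<cdot> j \<in> Hom E A Y" by (simp_all add: Hom_iff)
  have "p \<cdot> (\<phi> \<cdot> j) = z \<cdot> (u \<cdot> j)" using post[OF sq, of j] by simp
  from nfcof_lift[OF uj p ujH pH \<phi>j z this]
  obtain w where w: "w \<in> Hom E B Y" "w \<cdot> (u \<cdot> j) = \<phi> \<cdot> j" "p \<cdot> w = z" by blast
  note [simp] = HomD[OF w(1)]
  define v where "v e = (if e then \<phi> else w \<cdot> u)" for e
  have v: "v e \<in> Hom E X Y" for e using \<phi> by (simp add: v_def Hom_iff)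
  have h: "\<phi> \<cdot> (j \<cdot> s A) \<in> Hom E (L A) Y" and zz: "z \<cdot> (u \<cdot> s X) \<in> Hom E (L X) Z" by (simp_all add: Hom_iff)
  have "\<exists>H\<in>Hom E (L X) Y. H \<cdot> LA j = \<phi> \<cdot> (j \<cdot> s A) \<and> p \<cdot> H = z \<cdot> (u \<cdot> s X) \<and> (\<forall>e\<in>UNIV. H \<cdot> d e X = v e)"
  proof (rule boxD[OF nfcof_box_both[OF j(1) p] j(2) pH h zz v])
    show "\<phi> \<cdot> (j \<cdot> s A) \<cdot> d e A = v e \<cdot> j" for e using w(2) by (simp add: v_def)
    show "p \<cdot> v e = z \<cdot> (u \<cdot> s X) \<cdot> d e X" for e using sq post[OF w(3), of u] by (simp add: v_def)
    show "p \<cdot> (\<phi> \<cdot> (j \<cdot> s A)) = z \<cdot> (u \<cdot> s X) \<cdot> LA j" using post[OF sq, of "j \<cdot> s A"] by simp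
  qed
  then obtain k where k: "k \<in> Hom E (L X) Y" "p \<cdot> k = z \<cdot> (u \<cdot> s X)" and kd: "\<And>e. k \<cdot> d e X = v e" by blast
  note [simp] = HomD[OF k(1)]
  have zs: "z \<cdot> s B \<in> Hom E (L B) Z" by (simp add: Hom_iff)
  have "\<exists>H\<in>Hom E (L B) Y. H \<cdot> LA u = k \<and> p \<cdot> H = z \<cdot> s B \<and> (\<forall>e\<in>{False}. H \<cdot> d e B = w)"
  proof (rule boxD[OF box_single[OF nfibD(1)[OF p] u(1)] u(2) pH k(1) zs w(1)])
    show "k \<cdot> d e X = w \<cdot> u" if "e \<in> {False}" for e using kd[of False] that by (simp add: v_def)
    show "p \<cdot> w = z \<cdot> s B \<cdot> d e B" for e using w(3) by simp
    show "p \<cdot> k = z \<cdot> s B \<cdot> LA u" using k(2) by simp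
  qed
  then obtain H where H: "H \<in> Hom E (L B) Y" "H \<cdot> LA u = k" "p \<cdot> H = z \<cdot> s B" by blast
  note [simp] = HomD[OF H(1)]
  have "H \<cdot> d True B \<in> Hom E B Y" by (simp add: Hom_iff)
  moreover have "H \<cdot> d True B \<cdot> u = \<phi>" using post[OF H(2), of "d True X"] kd[of True] by (simp add: v_def)
  moreover have "p \<cdot> (H \<cdot> d True B) = z" using post[OF H(3), of "d True B"] by simp
  ultimately show "\<exists>w\<in>Hom E B Y. w \<cdot> u = \<phi> \<and> p \<cdot> w = z" by blast
qed

end

section \<open>Comparison of two intervals\<close>

text \<open>\<open>I\<close> is the interval whose weak equivalences are tested and \<open>K\<close>
  the other one. The assumption is what remains of the ends of \<open>K\<close> being
  \<open>I\<close>-weak equivalences: injectivity of restriction to an end, up to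
  \<open>I\<close>-homotopy.\<close>

locale two_intervals = model_setting E U I M + K: topos_interval E U K
  for E :: "('o, 'a) cat" (structure) and U :: "'u itself" and I :: "('o, 'a) cyl" and M
    and K :: "('o, 'a) cyl" +
  assumes K_d_injective: "nf T \<Longrightarrow> X \<in> Obj E \<Longrightarrow> f \<in> Hom E (K.L X) T \<Longrightarrow> g \<in> Hom E (K.L X) T \<Longrightarrow>
      f \<cdot> K.d e X = g \<cdot> K.d e X \<Longrightarrow> (f, g) \<in> hrel (K.L X) T"
begin

lemma K_d_nfcof: "X \<in> Obj E \<Longrightarrow> K.d e X \<in> nfcof"
  by (rule retract_nfcof[OF K.d_mono K.d_Hom K.s_Hom K.s_d K_d_injective])

text \<open>\<open>g\<close> is a pushout of the end of \<open>A\<close>, hence in the class, and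
  \<open>u \<cdot> g\<close> is the end of \<open>B\<close>; cancellation leaves
  \<open>u\<close>.\<close>

lemma K_horn_nfcof:
  assumes m: "is_mono E m" and mH: "m \<in> Hom E A B" and u: "is_union E (K.LA m) (K.d e B) u"
  shows "u \<in> nfcof"
proof (rule K.horn_union[OF m mH u])
  fix W f g assume uH: "u \<in> Hom E W (K.L B)" and um: "is_mono E u" and f: "f \<in> Hom E (K.L A) W" "u \<cdot> f = K.LA m"
    and g: "g \<in> Hom E B W" "u \<cdot> g = K.d e B"
    and glue: "\<And>T a b. a \<in> Hom E (K.L A) T \<Longrightarrow> b \<in> Hom E B T \<Longrightarrow> a \<cdot> K.d e A = b \<cdot> m \<Longrightarrow>
       \<exists>w\<in>Hom E W T. w \<cdot> f = a \<and> w \<cdot> g = b"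
    and epi: "\<And>T w w'. w \<in> Hom E W T \<Longrightarrow> w' \<in> Hom E W T \<Longrightarrow> w \<cdot> f = w' \<cdot> f \<Longrightarrow> w \<cdot> g = w' \<cdot> g \<Longrightarrow> w = w'"
  note [simp] = HomD[OF mH] HomD[OF uH] HomD[OF f(1)] HomD[OF g(1)] K.isimps
  have B: "B \<in> Obj E" and A: "A \<in> Obj E" by auto
  have fg: "f \<cdot> K.d e A = g \<cdot> m"
  proof (rule mono_cancel[OF um])
    show "u \<cdot> (f \<cdot> K.d e A) = u \<cdot> (g \<cdot> m)" using post[OF f(2), of "K.d e A"] post[OF g(2), of m] by simp
    show "f \<cdot> K.d e A \<in> Hom E A (Dom E u)" "g \<cdot> m \<in> Hom E A (Dom E u)" by (simp_all add: Hom_iff)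
  qed
  have "g \<in> nfcof"
  proof (rule nfcofI[OF _ g(1)])
    show "is_mono E g" using mono_Comp_right[of u g] K.d_mono[OF B, of e] g(2) by simp
    fix p Y Z \<phi> z assume p: "p \<in> nfib" and pH: "p \<in> Hom E Y Z" and \<phi>: "\<phi> \<in> Hom E B Y" and z: "z \<in> Hom E W Z"
      and sq: "p \<cdot> \<phi> = z \<cdot> g"
    note [simp] = HomD[OF pH] HomD[OF \<phi>] HomD[OF z]
    have "\<phi> \<cdot> m \<in> Hom E A Y" "z \<cdot> f \<in> Hom E (K.L A) Z" by (simp_all add: Hom_iff)
    moreover have "p \<cdot> (\<phi> \<cdot> m) = z \<cdot> f \<cdot> K.d e A" using post[OF sq, of m] fg by simp
    ultimately obtain h where h: "h \<in> Hom E (K.L A) Y" "h \<cdot> K.d e A = \<phi> \<cdot> m" "p \<cdot> h = z \<cdot> f"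
      using nfcof_lift[OF K_d_nfcof[OF A] p K.d_Hom[OF A] pH] by blast
    obtain w where w: "w \<in> Hom E W Y" "w \<cdot> f = h" "w \<cdot> g = \<phi>" using glue[OF h(1) \<phi> h(2)] by blast
    note [simp] = HomD[OF w(1)]
    have "p \<cdot> w = z"
      by (rule epi) (use w h sq z in \<open>simp_all add: Hom_iff\<close>)
    then show "\<exists>w\<in>Hom E W Y. w \<cdot> g = \<phi> \<and> p \<cdot> w = z" using w by blast
  qed
  then show "u \<in> nfcof"
    using nfcof_cancel[OF _ g(1) um uH] K_d_nfcof[OF B] g(2) by simp
qed

text \<open>Cancellation is applied twice. Naturality of an end writes \<open>K.LA l\<close> after
  the end of \<open>A\<close> as the end of \<open>B\<close> after \<open>l\<close>, so
  \<open>K.LA l\<close> is in the class. The map \<open>f\<close> is a pushout of two copies of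
  \<open>l\<close>, and \<open>u \<cdot> f\<close> is \<open>K.LA l\<close>, so \<open>u\<close>
  follows.\<close>

lemma K_sat_nfcof:
  assumes l: "l \<in> nfcof" and lH: "l \<in> Hom E A B" and k: "is_copairing E (bd K 0 B) (bd K 1 B) k"
    and u: "is_union E (K.LA l) k u"
  shows "u \<in> nfcof"
proof -
  have lm: "is_mono E l" using l unfolding nfcof_def by blast
  show ?thesis
  proof (rule K.sat_union[OF lm lH k u])
    fix W f and g :: "bool \<Rightarrow> 'a"
    assume uH: "u \<in> Hom E W (K.L B)" and um: "is_mono E u" and f: "f \<in> Hom E (K.L A) W" "u \<cdot> f = K.LA l"
      and g: "\<And>e. g e \<in> Hom E B W" "\<And>e. u \<cdot> g e = K.d e B"
      and glue: "\<And>T a b. a \<in> Hom E (K.L A) T \<Longrightarrow> (\<And>e. b e \<in> Hom E B T) \<Longrightarrow> (\<And>e. a \<cdot> K.d e A = b e \<cdot> l) \<Longrightarrow>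
         \<exists>w\<in>Hom E W T. w \<cdot> f = a \<and> (\<forall>e. w \<cdot> g e = b e)"
      and epi: "\<And>T w w'. w \<in> Hom E W T \<Longrightarrow> w' \<in> Hom E W T \<Longrightarrow> w \<cdot> f = w' \<cdot> f \<Longrightarrow>
         (\<And>e. w \<cdot> g e = w' \<cdot> g e) \<Longrightarrow> w = w'"
    note [simp] = HomD[OF lH] HomD[OF uH] HomD[OF f(1)] HomD[OF g(1)] K.isimps
    have B: "B \<in> Obj E" and A: "A \<in> Obj E" by auto
    have fg: "f \<cdot> K.d e A = g e \<cdot> l" for e
    proof (rule mono_cancel[OF um])
      show "u \<cdot> (f \<cdot> K.d e A) = u \<cdot> (g e \<cdot> l)"
        using post[OF f(2), of "K.d e A"] post[OF g(2)[of e], of l] by simp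
      show "f \<cdot> K.d e A \<in> Hom E A (Dom E u)" "g e \<cdot> l \<in> Hom E A (Dom E u)" by (simp_all add: Hom_iff)
    qed
    have "K.d False B \<cdot> l \<in> nfcof" using nfcof_Comp[OF l lH K_d_nfcof[OF B] K.d_Hom[OF B]] .
    then have Ll: "K.LA l \<in> nfcof"
      using nfcof_cancel[OF K_d_nfcof[OF A] K.d_Hom[OF A] K.LA_mono[OF lm] K.LA_Hom[OF lH], of False] by simp
    have "f \<in> nfcof"
    proof (rule nfcofI[OF _ f(1)])
      show "is_mono E f" using mono_Comp_right[of u f] K.LA_mono[OF lm] f(2) by simp
      fix p Y Z \<phi> z assume p: "p \<in> nfib" and pH: "p \<in> Hom E Y Z" and \<phi>: "\<phi> \<in> Hom E (K.L A) Y"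
        and z: "z \<in> Hom E W Z" and sq: "p \<cdot> \<phi> = z \<cdot> f"
      note [simp] = HomD[OF pH] HomD[OF \<phi>] HomD[OF z]
      have "\<exists>y\<in>Hom E B Y. y \<cdot> l = \<phi> \<cdot> K.d e A \<and> p \<cdot> y = z \<cdot> g e" for e
      proof (rule nfcof_lift[OF l p lH pH])
        show "\<phi> \<cdot> K.d e A \<in> Hom E A Y" "z \<cdot> g e \<in> Hom E B Z" by (simp_all add: Hom_iff)
        show "p \<cdot> (\<phi> \<cdot> K.d e A) = z \<cdot> g e \<cdot> l" using post[OF sq, of "K.d e A"] fg[of e] by simp
      qed
      then obtain y where y: "\<And>e. y e \<in> Hom E B Y" "\<And>e. y e \<cdot> l = \<phi> \<cdot> K.d e A" "\<And>e. p \<cdot> y e = z \<cdot> g e"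
        by metis
      obtain w where w: "w \<in> Hom E W Y" "w \<cdot> f = \<phi>" "\<And>e. w \<cdot> g e = y e" using glue[where b = y, OF \<phi> y(1)] y(2) by auto
      note [simp] = HomD[OF w(1)]
      have "p \<cdot> w = z"
        by (rule epi) (use w y sq z in \<open>simp_all add: Hom_iff\<close>)
      then show "\<exists>w\<in>Hom E W Y. w \<cdot> f = \<phi> \<and> p \<cdot> w = z" using w by blast
    qed
    then show "u \<in> nfcof" using nfcof_cancel[OF _ f(1) um uH] Ll f(2) by simp
  qed
qed

lemma Lambda_nfcof: "Lambda E M K \<subseteq> nfcof"
proof -
  have "Lambda_stage E M K n \<subseteq> nfcof" for n
  proof (induction n)
    case 0
    show ?case
    proof
      fix u assume "u \<in> Lambda_stage E M K 0"
      then obtain m e where m: "m \<in> M" "e = 0 \<or> e = Suc 0" "is_union E (K.LA m) (bd K e (Cod E m)) u" by auto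
      note mm = M_mono[OF m(1)]
      have mH: "m \<in> Hom E (Dom E m) (Cod E m)" using mono_Arr[OF mm] by (simp add: Hom_def)
      have "bd K e (Cod E m) = K.d (e = 1) (Cod E m)" using m(2) by (auto simp: K.d_def)
      then show "u \<in> nfcof" using K_horn_nfcof[OF mm mH] m(3) by simp
    qed
  next
    case (Suc n)
    show ?case
    proof
      fix u assume "u \<in> Lambda_stage E M K (Suc n)"
      then obtain l k where l: "l \<in> Lambda_stage E M K n" and k: "is_copairing E (bd K 0 (Cod E l)) (bd K 1 (Cod E l)) k"
        and u: "is_union E (K.LA l) k u" by (auto simp: sat_def)
      have ln: "l \<in> nfcof" using Suc l by blast
      then have "l \<in> Hom E (Dom E l) (Cod E l)" using mono_Arr unfolding nfcof_def Hom_def by auto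
      from K_sat_nfcof[OF ln this k u] show "u \<in> nfcof" .
    qed
  qed
  then show ?thesis unfolding Lambda_def by blast
qed

text \<open>The terminal object is itself naively fibrant, by its identity, so the map from
  \<open>T\<close> to it belongs to \<open>nfib\<close> and lifts against \<open>Lambda\<close> of
  \<open>K\<close>.\<close>

lemma nf_K:
  assumes T: "nf T" shows "naively_fibrant E M K T"
proof (rule nfE[OF T])
  fix t assume t: "t \<in> fib" "t \<in> Hom E T (Cod E t)" "T \<in> Obj E" "Cod E t \<in> Obj E" "is_terminal E (Cod E t)"
  have i: "Ide E (Cod E t) \<in> Hom E (Cod E t) (Cod E t)" using Ide_in_Hom[OF t(4)] .
  have "Ide E (Cod E t) \<in> fib"
    unfolding inj_class_def
  proof (intro CollectI conjI ballI)
    show "Ide E (Cod E t) \<in> Arr E" using HomD(1)[OF i] .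
    fix l assume l: "l \<in> Lambda E M I"
    have lH: "l \<in> Hom E (Dom E l) (Cod E l)" using mono_Arr[OF Lambda_mono[OF l]] by (simp add: Hom_def)
    show "has_lifting E l (Ide E (Cod E t))"
    proof (rule has_liftingI[OF lH i])
      fix u v assume u: "u \<in> Hom E (Dom E l) (Cod E t)" and v: "v \<in> Hom E (Cod E l) (Cod E t)"
        and eq: "Ide E (Cod E t) \<cdot> u = v \<cdot> l"
      have "v \<cdot> l = u" using eq Ide_Comp[OF u] by simp
      then show "\<exists>w\<in>Hom E (Cod E l) (Cod E t). w \<cdot> l = u \<and> Ide E (Cod E t) \<cdot> w = v"
        using v Ide_Comp[OF v] by blast
    qed
  qed
  then have "nf (Cod E t)"
    unfolding naively_fibrant_def using t(4,5) HomD(2,3)[OF i] by auto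
  then have "t \<in> nfib" using t(1) unfolding nfib_def by blast
  then have "t \<in> inj_class E (Lambda E M K)"
    using Lambda_nfcof HomD(1)[OF t(2)] unfolding inj_class_def nfcof_def by blast
  then show ?thesis unfolding naively_fibrant_def using t(3,5) HomD(2)[OF t(2)] by blast
qed

lemma weak_equivalences_subset:
  assumes "\<And>X T. nf T \<Longrightarrow> X \<in> Obj E \<Longrightarrow> homotopy_rel E K X T = hrel X T"
  shows "weak_equivalences E M K \<subseteq> weak_equivalences E M I"
proof
  fix f assume f: "f \<in> weak_equivalences E M K"
  then have fA: "f \<in> Arr E" unfolding weak_equivalences_def by blast
  note XY = Dom_in_Obj[OF fA] Cod_in_Obj[OF fA]
  have "bij_betw (precomp_classes E I f T) (homotopy_classes E I (Cod E f) T) (homotopy_classes E I (Dom E f) T)"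
    if T: "nf T" for T
  proof -
    have "bij_betw (precomp_classes E K f T) (homotopy_classes E K (Cod E f) T) (homotopy_classes E K (Dom E f) T)"
      using f nf_K[OF T] unfolding weak_equivalences_def by blast
    moreover have "precomp_classes E K f T = precomp_classes E I f T"
      unfolding precomp_classes_def assms[OF T XY(1)] ..
    ultimately show ?thesis
      unfolding homotopy_classes_def assms[OF T XY(1)] assms[OF T XY(2)] by simp
  qed
  then show "f \<in> weak_equivalences E M I" unfolding weak_equivalences_def using fA by blast
qed

end

text \<open>A \<open>B\<close>-homotopy becomes an \<open>A\<close>-homotopy by precomposing with
  \<open>\<iota> X\<close>. Conversely, surjectivity on \<open>I\<close>-homotopy classes factors an
  \<open>A\<close>-homotopy through \<open>\<iota> X\<close> only up to an
  \<open>I\<close>-homotopy, which spoils its end points; homotopy extension along the ends of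
  \<open>B\<close> restores them.\<close>

lemma (in model_setting) homotopy_rel_eq:
  assumes A: "topos_interval E U A" and B: "topos_interval E U B"
    and \<iota>: "interval_morphism E A B \<iota>" and W: "sectionwise E (weak_equivalences E M I) \<iota>"
    and T: "nf T" and X: "X \<in> Obj E"
  shows "homotopy_rel E A X T = homotopy_rel E B X T"
proof -
  interpret A: topos_interval E U A by fact
  interpret B: topos_interval E U B by fact
  have \<iota>H: "\<iota> X \<in> Hom E (A.L X) (B.L X)"
    using \<iota> X unfolding interval_morphism_def nat_trans_def by blast
  have \<iota>d: "\<iota> X \<cdot> A.d e X = B.d e X" for e
    using \<iota> X unfolding interval_morphism_def A.d_def B.d_def by simp
  have \<iota>W: "\<iota> X \<in> weak_equivalences E M I" using W X unfolding sectionwise_def by blast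
  note [simp] = HomD[OF \<iota>H] A.isimps B.isimps isimps
  have iff: "(f, g) \<in> homotopy_rel E A X T \<longleftrightarrow> f \<in> Hom E X T \<and> g \<in> Hom E X T \<and>
      (\<exists>h\<in>Hom E (A.L X) T. h \<cdot> A.d False X = f \<and> h \<cdot> A.d True X = g)"
    "(f, g) \<in> homotopy_rel E B X T \<longleftrightarrow> f \<in> Hom E X T \<and> g \<in> Hom E X T \<and>
      (\<exists>h\<in>Hom E (B.L X) T. h \<cdot> B.d False X = f \<and> h \<cdot> B.d True X = g)" for f g
    unfolding homotopy_rel_def A.d_def B.d_def by simp_all
  have "\<exists>h\<in>Hom E (A.L X) T. \<forall>e. h \<cdot> A.d e X = k \<cdot> B.d e X" if k: "k \<in> Hom E (B.L X) T" for k
  proof -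
    note [simp] = HomD[OF k]
    have "k \<cdot> \<iota> X \<in> Hom E (A.L X) T" by (simp add: Hom_iff)
    moreover have "k \<cdot> \<iota> X \<cdot> A.d e X = k \<cdot> B.d e X" for e using \<iota>d X by simp
    ultimately show ?thesis by blast
  qed
  moreover have "\<exists>k\<in>Hom E (B.L X) T. \<forall>e. k \<cdot> B.d e X = h \<cdot> A.d e X" if h: "h \<in> Hom E (A.L X) T" for h
  proof -
    obtain h' where h': "h' \<in> Hom E (B.L X) T" and rel: "(h' \<cdot> \<iota> X, h) \<in> hrel (A.L X) T"
      using weak_equivalence_quot(1)[OF \<iota>W \<iota>H T h] by blast
    obtain k where k: "k \<in> Hom E (L (A.L X)) T" "k \<cdot> d False (A.L X) = h' \<cdot> \<iota> X" "k \<cdot> d True (A.L X) = h"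
      using hrelD(3)[OF rel] by blast
    show ?thesis
    proof (rule B.copairing_exists[OF X])
      fix i j q assume ij: "is_coproduct E i j" and i0: "i \<in> Hom E X (Cod E i)" and j0: "j \<in> Hom E X (Cod E i)"
        and q0: "q \<in> Hom E (Cod E i) (B.L X)" and q: "q \<cdot> i = B.d False X" "q \<cdot> j = B.d True X" "is_mono E q"
      define S where "S = Cod E i"
      have iH: "i \<in> Hom E X S" and jH: "j \<in> Hom E X S" and qH: "q \<in> Hom E S (B.L X)" using i0 j0 q0 S_def by auto
      note [simp] = HomD[OF iH] HomD[OF jH] HomD[OF qH] HomD[OF h] HomD[OF h'] HomD[OF k(1)]
      obtain r where r: "r \<in> Hom E S (A.L X)" "r \<cdot> i = A.d False X" "r \<cdot> j = A.d True X"
        using coproductE[OF ij, of "A.d False X" "A.L X" "A.d True X"] A.d_Hom[OF X] by auto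
      note [simp] = HomD[OF r(1)]
      have \<iota>r: "\<iota> X \<cdot> r = q"
      proof (rule coproduct_epi[OF ij, folded S_def])
        show "\<iota> X \<cdot> r \<in> Hom E S (B.L X)" "q \<in> Hom E S (B.L X)" using qH by (simp_all add: Hom_iff)
        show "\<iota> X \<cdot> r \<cdot> i = q \<cdot> i" "\<iota> X \<cdot> r \<cdot> j = q \<cdot> j" using r(2,3) q(1,2) \<iota>d by simp_all
      qed
      have kr: "k \<cdot> LA r \<in> Hom E (L S) T" by (simp add: Hom_iff)
      have "k \<cdot> LA r \<cdot> d False S = h' \<cdot> q" using post[OF k(2), of r] \<iota>r by simp
      \<comment> \<open>The \<open>I\<close>-homotopy \<open>k\<close>, restricted to the two ends,
        is extended from \<open>h'\<close> to all of \<open>B.L X\<close>; at its other face the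
        ends of the result are those of \<open>h\<close>.\<close>
      from nf_box_single[OF T q(3) qH kr h' this]
      obtain H where H: "H \<in> Hom E (L (B.L X)) T" "H \<cdot> LA q = k \<cdot> LA r" by blast
      note [simp] = HomD[OF H(1)]
      have HH: "H \<cdot> d True (B.L X) \<in> Hom E (B.L X) T" by (simp add: Hom_iff)
      have Hq: "H \<cdot> d True (B.L X) \<cdot> q = h \<cdot> r"
        using post[OF H(2), of "d True S"] post[OF k(3), of r] by simp
      have "H \<cdot> d True (B.L X) \<cdot> B.d e X = h \<cdot> A.d e X" for e
      proof -
        define x where "x = (if e then j else i)"
        have xH: "x \<in> Hom E X S" using iH jH by (simp add: x_def)
        note [simp] = HomD[OF xH]
        have "q \<cdot> x = B.d e X" "r \<cdot> x = A.d e X" using q(1,2) r(2,3) by (simp_all add: x_def)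
        then show ?thesis using Comp_assoc[OF xH qH HH] Comp_assoc[OF xH r(1) h] Hq by simp
      qed
      then show ?thesis using HH by blast
    qed
  qed
  ultimately show ?thesis by (intro set_eqI) (simp add: split_paired_all iff, metis)
qed

theorem mainTheorem3:
  fixes E :: "('o, 'a) cat" and M :: "'a set"
    and I I' :: "('o, 'a) cyl" and \<iota> :: "'o \<Rightarrow> 'a"
  assumes "universe TYPE('u)"
    and "grothendieck_topos TYPE('u) E"
    and "cellular_model TYPE('u) E M"
    and "interval TYPE('u) E I"
    and "interval TYPE('u) E I'"
    and "interval_morphism E I I' \<iota>"
  shows "(sectionwise E (weak_equivalences E M I) \<iota> \<longrightarrow>
            weak_equivalences E M I' \<subseteq> weak_equivalences E M I) \<and>
         (sectionwise E (weak_equivalences E M I') \<iota> \<longrightarrow>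
            weak_equivalences E M I \<subseteq> weak_equivalences E M I')"
proof -
  interpret topos_like E "TYPE('u)" using grothendieck_topos_like[OF assms(1,2)] .
  have ti: "topos_interval E TYPE('u) I" "topos_interval E TYPE('u) I'"
    using topos_like_axioms assms(4,5) by (auto simp: topos_interval_def topos_interval_axioms_def)
  interpret I: model_setting E "TYPE('u)" I M
    using ti(1) assms(3) by (simp add: model_setting_def model_setting_axioms_def)
  interpret I': model_setting E "TYPE('u)" I' M
    using ti(2) assms(3) by (simp add: model_setting_def model_setting_axioms_def)
  have \<iota>H: "\<iota> X \<in> Hom E (I.L X) (I'.L X)" if "X \<in> Obj E" for X
    using assms(6) that unfolding interval_morphism_def nat_trans_def by blast
  have \<iota>d: "\<iota> X \<cdot>\<^bsub>E\<^esub> I.d e X = I'.d e X" if "X \<in> Obj E" for X e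
    using assms(6) that unfolding interval_morphism_def I.d_def I'.d_def by simp
  have fd: "f \<cdot>\<^bsub>E\<^esub> \<iota> X \<cdot>\<^bsub>E\<^esub> I.d e X = f \<cdot>\<^bsub>E\<^esub> I'.d e X" if "X \<in> Obj E" "f \<in> Hom E (I'.L X) T" for X e f T
    using Comp_assoc[OF I.d_Hom[OF that(1)] \<iota>H[OF that(1)] that(2)] \<iota>d[OF that(1)] by simp
  have "weak_equivalences E M I' \<subseteq> weak_equivalences E M I" if W: "sectionwise E (weak_equivalences E M I) \<iota>"
  proof -
    have \<iota>W: "\<iota> X \<in> weak_equivalences E M I" if "X \<in> Obj E" for X using W that unfolding sectionwise_def by blast
    \<comment> \<open>Here \<iota> goes from \<open>I\<close> to the second interval
      \<open>I'\<close>: precomposing with it leads to the ends of \<open>I\<close>, where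
      \<open>d_injective\<close> applies, and injectivity on classes leads back.\<close>
    interpret two_intervals E "TYPE('u)" I M I'
    proof
      fix T X f g e assume T: "I.nf T" and X: "X \<in> Obj E" and f: "f \<in> Hom E (I'.L X) T" and g: "g \<in> Hom E (I'.L X) T"
        and eq: "f \<cdot>\<^bsub>E\<^esub> I'.d e X = g \<cdot>\<^bsub>E\<^esub> I'.d e X"
      note fi = Comp_in_Hom[OF \<iota>H[OF X] f] and gi = Comp_in_Hom[OF \<iota>H[OF X] g]
      have "(f \<cdot>\<^bsub>E\<^esub> \<iota> X \<cdot>\<^bsub>E\<^esub> I.d e X, g \<cdot>\<^bsub>E\<^esub> \<iota> X \<cdot>\<^bsub>E\<^esub> I.d e X) \<in> I.hrel X T"
        unfolding fd[OF X f] fd[OF X g] eq using I.hrel_refl[OF Comp_in_Hom[OF I'.d_Hom[OF X] g]] .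
      then have "(f \<cdot>\<^bsub>E\<^esub> \<iota> X, g \<cdot>\<^bsub>E\<^esub> \<iota> X) \<in> I.hrel (I.L X) T"
        using I.d_injective[OF T X fi gi] by blast
      then show "(f, g) \<in> I.hrel (I'.L X) T"
        using I.weak_equivalence_quot(2)[OF \<iota>W[OF X] \<iota>H[OF X] T f g] by blast
    qed
    show ?thesis
      by (rule weak_equivalences_subset) (rule I.homotopy_rel_eq[OF ti assms(6) W, symmetric])
  qed
  moreover have "weak_equivalences E M I \<subseteq> weak_equivalences E M I'" if W: "sectionwise E (weak_equivalences E M I') \<iota>"
  proof -
    have \<iota>W: "\<iota> X \<in> weak_equivalences E M I'" if "X \<in> Obj E" for X using W that unfolding sectionwise_def by blast
    \<comment> \<open>Here \<iota> starts at the second interval, so \<open>f\<close> and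
      \<open>g\<close> are first replaced, up to homotopy, by maps \<open>f'\<close> and
      \<open>g'\<close> that factor through it; these agree up to homotopy at an end of
      \<open>I'\<close>, where \<open>d_injective\<close> applies.\<close>
    interpret two_intervals E "TYPE('u)" I' M I
    proof
      fix T X f g e assume T: "I'.nf T" and X: "X \<in> Obj E" and f: "f \<in> Hom E (I.L X) T" and g: "g \<in> Hom E (I.L X) T"
        and eq: "f \<cdot>\<^bsub>E\<^esub> I.d e X = g \<cdot>\<^bsub>E\<^esub> I.d e X"
      obtain f' where f': "f' \<in> Hom E (I'.L X) T" "(f' \<cdot>\<^bsub>E\<^esub> \<iota> X, f) \<in> I'.hrel (I.L X) T"
        using I'.weak_equivalence_quot(1)[OF \<iota>W[OF X] \<iota>H[OF X] T f] by blast
      obtain g' where g': "g' \<in> Hom E (I'.L X) T" "(g' \<cdot>\<^bsub>E\<^esub> \<iota> X, g) \<in> I'.hrel (I.L X) T"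
        using I'.weak_equivalence_quot(1)[OF \<iota>W[OF X] \<iota>H[OF X] T g] by blast
      have "(f' \<cdot>\<^bsub>E\<^esub> I'.d e X, f \<cdot>\<^bsub>E\<^esub> I.d e X) \<in> I'.hrel X T" "(g' \<cdot>\<^bsub>E\<^esub> I'.d e X, f \<cdot>\<^bsub>E\<^esub> I.d e X) \<in> I'.hrel X T"
        using I'.hrel_Comp[OF f'(2) I.d_Hom[OF X, of e]] I'.hrel_Comp[OF g'(2) I.d_Hom[OF X, of e]]
          fd[OF X f'(1), of e] fd[OF X g'(1), of e] eq
        by simp_all
      then have "(f' \<cdot>\<^bsub>E\<^esub> I'.d e X, g' \<cdot>\<^bsub>E\<^esub> I'.d e X) \<in> I'.hrel X T"
        using I'.hrel_trans[OF T] I'.hrel_sym[OF T] by blast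
      then have "(f', g') \<in> I'.hrel (I'.L X) T" using I'.d_injective[OF T X f'(1) g'(1)] by blast
      then have "(f' \<cdot>\<^bsub>E\<^esub> \<iota> X, g' \<cdot>\<^bsub>E\<^esub> \<iota> X) \<in> I'.hrel (I.L X) T" using I'.hrel_Comp \<iota>H[OF X] by blast
      then show "(f, g) \<in> I'.hrel (I.L X) T"
        using f'(2) g'(2) I'.hrel_trans[OF T] I'.hrel_sym[OF T] by blast
    qed
    show ?thesis
      by (rule weak_equivalences_subset) (rule I'.homotopy_rel_eq[OF ti assms(6) W])
  qed
  ultimately show ?thesis by blast
qed

end
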